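(* Let $M$ and $\tilde M$ be smooth oriented $n$-dimensional Riemannian manifolds, let $1\le k\le n$, let $1\le p\le\tilde p<\infty$, and let $f:M\to\tilde M$ be a diffeomorphism of class $\mathrm{BD}^k_{(\tilde p,t)}(M,\tilde M)$, where $t=\frac{p}{\tilde p-p}$ ($t=\infty$ if $p=\tilde p$). Then the following hold. (A) $f^*:L^{\tilde p}(\tilde M,\Lambda^k)\to L^p(M,\Lambda^k)$ is a bounded operator and $f^*(Z^k_{\tilde p}(\tilde M))\subset Z^k_p(M)$. (B) If $1<\tilde q\le q<\infty$ and in addition $f\in \mathrm{BD}^{n-k+1}_{(\tilde q',r)}(M,\tilde M)$ with $\tilde q'=\frac{\tilde q}{\tilde q-1}$ and $r=\frac{q(\tilde q-1)}{q-\tilde q}$ ($r=\infty$ if $q=\tilde q$), then for every $\omega\in Z^k_{\tilde p}(\tilde M)$: $[f^*\omega]=0$ in $H^k_{q,p}(M)$ implies $[\omega]=0$ in $H^k_{\tilde q,\tilde p}(\tilde M)$. In particular, $H^k_{q,p}(M)=0$ implies $H^k_{\tilde q,\tilde p}(\tilde M)=0$. (C) If $1\le q\le\tilde q<\infty$ and in addition $f\in \mathrm{BD}^{k-1}_{(\tilde q,u)}(M,\tilde M)$ with $u=\frac{q}{\tilde q-q}$ ($u=\infty$ if $q=\tilde q$), then (a) $f^*:\Omega^{k-1}_{\tilde q,\tilde p}(\tilde M)\to\Omega^{k-1}_{q,p}(M)$ is a bounded operator; (b) $f^*:H^k_{\tilde q,\tilde p}(\tilde M)\to H^k_{q,p}(M)$,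 $[\omega]\mapsto[f^*\omega]$, is a well defined linear map; (c) $f^*:\overline H^k_{\tilde q,\tilde p}(\tilde M)\to\overline H^k_{q,p}(M)$, $[\omega]\mapsto[f^*\omega]$, is a (well defined) bounded operator.
   Context: Differential forms: $L^1_{loc}(M,\Lambda^k)$ is the space of $k$-forms with locally integrable coefficients. For $\phi\in L^1_{loc}(M,\Lambda^{k-1})$ and $\theta\in L^1_{loc}(M,\Lambda^k)$ one writes $d\phi=\theta$ (weak exterior differential) if $\int_M\theta\wedge\omega=(-1)^k\int_M\phi\wedge d\omega$ for all smooth compactly supported $(n-k)$-forms $\omega$. $L^p(M,\Lambda^k)$ is the Banach space of $k$-forms $\theta$ with $\|\theta\|_p=(\int_M|\theta|^p\,dx)^{1/p}<\infty$, where $|\theta|$ is the pointwise norm induced by the metric and $dx$ the Riemannian volume. Cohomology: $Z^k_p(M)=L^p(M,\Lambda^k)\cap\ker d$; $B^k_{q,p}(M)=d(L^q(M,\Lambda^{k-1}))\cap L^p(M,\Lambda^k)$ (the forms in $L^p$ that are weak differentials of a form in $L^q$); $\overline B^k_{q,p}(M)$ is its closure in $L^p(M,\Lambda^k)$. $H^k_{q,p}(M)=Z^k_p(M)/B^k_{q,p}(M)$ and $\overline H^k_{q,p}(M)=Z^k_p(M)/\overline B^k_{q,p}(M)$ (a Banach space with the quotient norm). $\Omega^{k-1}_{q,p}(M)$ is the space of $\omega\in L^q(M,\Lambda^{k-1})$ with $d\omega\in L^p(M,\Lambda^k)$, normed by $\|\omega\|_q+\|d\omega\|_p$. Distortion: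 for a diffeomorphism $f:M\to\tilde M$ and $x\in M$, let $\lambda_1(x),\dots,\lambda_n(x)>0$ be the singular values of $df_x$ (square roots of the eigenvalues of $(df_x)^*df_x$). Put $\sigma_0(f,x)=1$, $\sigma_m(f,x)=\sum_{i_1<\dots<i_m}\lambda_{i_1}(x)\cdots\lambda_{i_m}(x)$, and $J_f(x)=\sigma_n(f,x)=\lambda_1(x)\cdots\lambda_n(x)$. For $1\le s<\infty$, $0<\tau\le\infty$, $f\in \mathrm{BD}^m_{(s,\tau)}(M,\tilde M)$ means that $f$ is a diffeomorphism with $(\sigma_m(f))^sJ_f^{-1}\in L^\tau(M)$ (for $\tau<\infty$: $\int_M((\sigma_m(f))^sJ_f^{-1})^\tau dx<\infty$; for $\tau=\infty$: essentially bounded). *)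

theory Defs
  imports
    "HOL-Analysis.Analysis"
    "HOL-Combinatorics.Combinatorics"
    "HOL-Library.Function_Algebras"
begin

section \<open>Smooth maps between open subsets of Euclidean spaces\<close>

fun Ck_on :: "nat \<Rightarrow> 'a::real_normed_vector set \<Rightarrow> ('a \<Rightarrow> 'b::real_normed_vector) \<Rightarrow> bool" where
  "Ck_on 0 S f \<longleftrightarrow> continuous_on S f"
| "Ck_on (Suc k) S f \<longleftrightarrow> (\<forall>x\<in>S. f differentiable (at x)) \<and>
     (\<forall>v. Ck_on k S (\<lambda>x. frechet_derivative f (at x) v))"

text \<open>Only meaningful for open \<open>S\<close>, and only used for such \<open>S\<close>.\<close>

definition smooth_on :: "'a::real_normed_vector set \<Rightarrow> ('a \<Rightarrow> 'b::real_normed_vector) \<Rightarrow> bool" where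
  "smooth_on S f \<longleftrightarrow> (\<forall>k. Ck_on k S f)"


section \<open>Oriented Riemannian manifolds\<close>

text \<open>
  The points of a manifold are the elements of a type \<open>'a\<close>, whose topology is Hausdorff and
  second countable by class constraints in the final statement. The dimension is \<open>CARD('n)\<close>.
  A chart is a domain together with a coordinate map.

  The tangent space at \<open>x\<close> is modelled by \<open>real^'n\<close>, a vector being given by its components in
  one chart \<open>chart_at M x\<close> around \<open>x\<close> that is chosen once and for all. The metric at \<open>x\<close> is a
  bilinear form on this copy of \<open>real^'n\<close>. Smoothness, measurability and the like are always
  expressed in all charts of the atlas, after transforming components by \<open>coord_to_tan\<close>.
\<close>

type_synonym ('a, 'n) chart = "'a set \<times> ('a \<Rightarrow> real^'n)"

record ('a, 'n::finite) mfd =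
  atlas :: "('a, 'n) chart set"
  metric :: "'a \<Rightarrow> real^'n \<Rightarrow> real^'n \<Rightarrow> real"

abbreviation cdom :: "('a, 'n) chart \<Rightarrow> 'a set" where "cdom \<equiv> fst"
abbreviation cmap :: "('a, 'n) chart \<Rightarrow> 'a \<Rightarrow> real^'n" where "cmap \<equiv> snd"

definition cinv :: "('a, 'n) chart \<Rightarrow> real^'n \<Rightarrow> 'a" where
  "cinv c = inv_into (cdom c) (cmap c)"

definition cimg :: "('a, 'n) chart \<Rightarrow> (real^'n) set" where
  "cimg c = cmap c ` cdom c"

definition is_chart :: "('a::topological_space, 'n::finite) chart \<Rightarrow> bool" where
  "is_chart c \<longleftrightarrow> open (cdom c) \<and> open (cimg c) \<and>
     homeomorphism (cdom c) (cimg c) (cmap c) (cinv c)"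

text \<open>The orientation is the one for which all charts of the atlas are positively oriented.\<close>

definition oriented_smooth_atlas :: "('a::topological_space, 'n::finite) chart set \<Rightarrow> bool" where
  "oriented_smooth_atlas A \<longleftrightarrow>
     (\<forall>c\<in>A. is_chart c) \<and> (\<Union>c\<in>A. cdom c) = UNIV \<and>
     (\<forall>c\<in>A. \<forall>d\<in>A. smooth_on (cmap c ` (cdom c \<inter> cdom d)) (cmap d \<circ> cinv c) \<and>
        (\<forall>y\<in>cmap c ` (cdom c \<inter> cdom d).
           0 < det (matrix (frechet_derivative (cmap d \<circ> cinv c) (at y)))))"

definition chart_at :: "('a, 'n::finite) mfd \<Rightarrow> 'a \<Rightarrow> ('a, 'n) chart" where
  "chart_at M x = (SOME c. c \<in> atlas M \<and> x \<in> cdom c)"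

text \<open>Maps components with respect to the chart \<open>c\<close> of a vector tangent at \<open>x\<close> to the vector
  itself; \<open>coord_to_tan M c x (axis i 1)\<close> is the \<open>i\<close>-th coordinate vector field of \<open>c\<close> at \<open>x\<close>.\<close>

definition coord_to_tan :: "('a, 'n::finite) mfd \<Rightarrow> ('a, 'n) chart \<Rightarrow> 'a \<Rightarrow> real^'n \<Rightarrow> real^'n" where
  "coord_to_tan M c x = frechet_derivative (cmap (chart_at M x) \<circ> cinv c) (at (cmap c x))"

definition oriented_riemannian_mfd :: "('a::topological_space, 'n::finite) mfd \<Rightarrow> bool" where
  "oriented_riemannian_mfd M \<longleftrightarrow>
     oriented_smooth_atlas (atlas M) \<and>
     (\<forall>x. bilinear (metric M x) \<and> (\<forall>u v. metric M x u v = metric M x v u) \<and>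
          (\<forall>v. v \<noteq> 0 \<longrightarrow> 0 < metric M x v v)) \<and>
     (\<forall>c\<in>atlas M. \<forall>u v. smooth_on (cimg c)
        (\<lambda>y. metric M (cinv c y) (coord_to_tan M c (cinv c y) u) (coord_to_tan M c (cinv c y) v)))"

definition gram :: "(real^'n \<Rightarrow> real^'n \<Rightarrow> real) \<Rightarrow> ('n \<Rightarrow> real^'n) \<Rightarrow> real^'n^'n" where
  "gram G E = (\<chi> i j. G (E i) (E j))"

text \<open>The Riemannian volume is the unique Borel measure which in every chart has density
  \<open>sqrt (det g\<^sub>i\<^sub>j)\<close> with respect to Lebesgue measure.\<close>

definition riem_vol :: "('a::topological_space, 'n::finite) mfd \<Rightarrow> 'a measure" where
  "riem_vol M = (THE \<mu>. sets \<mu> = sets borel \<and>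
     (\<forall>c\<in>atlas M. \<forall>A\<in>sets borel. A \<subseteq> cdom c \<longrightarrow>
        emeasure \<mu> A =
          (\<integral>\<^sup>+y. ennreal (sqrt (det (gram (metric M (cinv c y))
                 (\<lambda>i. coord_to_tan M c (cinv c y) (axis i 1))))) * indicator (cmap c ` A) y \<partial>lborel)))"


section \<open>Differential forms\<close>

text \<open>A \<open>k\<close>-form on \<open>real^'n\<close> is a function of lists of vectors, multilinear and alternating on
  lists of length \<open>k\<close> and zero on all other lists. A (rough) \<open>k\<close>-form on \<open>M\<close> assigns to each
  point a \<open>k\<close>-form on the tangent space.\<close>

type_synonym 'n altform = "(real^'n) list \<Rightarrow> real"
type_synonym ('a, 'n) dform = "'a \<Rightarrow> 'n altform"

definition alternating :: "nat \<Rightarrow> 'n::finite altform \<Rightarrow> bool" where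
  "alternating k \<alpha> \<longleftrightarrow>
     (\<forall>vs. length vs \<noteq> k \<longrightarrow> \<alpha> vs = 0) \<and>
     (\<forall>vs i. length vs = k \<longrightarrow> i < k \<longrightarrow> linear (\<lambda>v. \<alpha> (vs[i := v]))) \<and>
     (\<forall>vs i j. length vs = k \<longrightarrow> i < j \<longrightarrow> j < k \<longrightarrow> vs ! i = vs ! j \<longrightarrow> \<alpha> vs = 0)"

definition wedge :: "nat \<Rightarrow> nat \<Rightarrow> 'n::finite altform \<Rightarrow> 'n altform \<Rightarrow> 'n altform" where
  "wedge k l \<alpha> \<beta> vs = (if length vs = k + l then
     (\<Sum>\<pi> | \<pi> permutes {..<k + l}. of_int (sign \<pi>) *
        \<alpha> (take k (permute_list \<pi> vs)) * \<beta> (drop k (permute_list \<pi> vs))) / (fact k * fact l)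
     else 0)"

definition form_scale :: "real \<Rightarrow> ('a, 'n) dform \<Rightarrow> ('a, 'n) dform" where
  "form_scale r \<omega> = (\<lambda>x vs. r * \<omega> x vs)"

text \<open>Representation of a form in the coordinates given by the chart \<open>c\<close>. Its coefficients
  are the functions \<open>\<lambda>y. local_form M c \<omega> y vs\<close> where \<open>vs\<close> are lists of standard basis vectors;
  by multilinearity one may as well take arbitrary constant vectors \<open>vs\<close>.\<close>

definition local_form ::
  "('a, 'n::finite) mfd \<Rightarrow> ('a, 'n) chart \<Rightarrow> ('a, 'n) dform \<Rightarrow> real^'n \<Rightarrow> 'n altform" where
  "local_form M c \<omega> y vs = \<omega> (cinv c y) (map (coord_to_tan M c (cinv c y)) vs)"

definition smooth_form :: "('a, 'n::finite) mfd \<Rightarrow> nat \<Rightarrow> ('a, 'n) dform \<Rightarrow> bool" where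
  "smooth_form M k \<omega> \<longleftrightarrow> (\<forall>x. alternating k (\<omega> x)) \<and>
     (\<forall>c\<in>atlas M. \<forall>vs. length vs = k \<longrightarrow> smooth_on (cimg c) (\<lambda>y. local_form M c \<omega> y vs))"

definition compactly_supported :: "('a::topological_space, 'n) dform \<Rightarrow> bool" where
  "compactly_supported \<omega> \<longleftrightarrow> compact (closure {x. \<exists>vs. \<omega> x vs \<noteq> 0})"

text \<open>Exterior derivative of a smooth \<open>k\<close>-form. At \<open>x\<close> it is computed in the chart
  \<open>chart_at M x\<close>, with respect to which tangent vectors at \<open>x\<close> are represented.\<close>

definition ext_d :: "('a, 'n::finite) mfd \<Rightarrow> nat \<Rightarrow> ('a, 'n) dform \<Rightarrow> ('a, 'n) dform" where
  "ext_d M k \<omega> x vs = (if length vs = Suc k then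
     (\<Sum>i\<le>k. (- 1) ^ i *
        frechet_derivative (\<lambda>y. local_form M (chart_at M x) \<omega> y (take i vs @ drop (Suc i) vs))
          (at (cmap (chart_at M x) x)) (vs ! i))
     else 0)"

text \<open>Integral of an \<open>n\<close>-form \<open>\<eta>\<close>: with \<open>\<eta> = h vol\<close>, where \<open>vol\<close> is the Riemannian volume form of the
  oriented manifold, it is the integral of \<open>h\<close> with respect to the volume measure. The well-order
  on \<open>'n\<close> orders the coordinates.\<close>

definition form_integral ::
  "('a::topological_space, 'n::{finite,wellorder}) mfd \<Rightarrow> ('a, 'n) dform \<Rightarrow> real" where
  "form_integral M \<eta> =
     (\<integral>x. \<eta> x (map (\<lambda>i. axis i 1) (sorted_list_of_set UNIV)) /
          sqrt (det (gram (metric M x) (\<lambda>i. axis i 1))) \<partial>(riem_vol M))"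

definition orthonormal_frame :: "(real^'n \<Rightarrow> real^'n \<Rightarrow> real) \<Rightarrow> ('n \<Rightarrow> real^'n) \<Rightarrow> bool" where
  "orthonormal_frame G E \<longleftrightarrow> (\<forall>i j. G (E i) (E j) = (if i = j then 1 else 0))"

text \<open>Euclidean norm on \<open>k\<close>-forms induced by the inner product \<open>G\<close>, i.e. the one for which
  the \<open>e\<^sub>I\<close>, for the \<open>k\<close>-subsets \<open>I\<close> of an orthonormal coframe, are orthonormal. The sum below
  runs over all \<open>k\<close>-tuples of indices, so every \<open>k\<close>-subset is counted \<open>k!\<close> times.\<close>

definition alt_norm :: "(real^'n \<Rightarrow> real^'n \<Rightarrow> real) \<Rightarrow> nat \<Rightarrow> 'n::finite altform \<Rightarrow> real" where
  "alt_norm G k \<alpha> = (let E = SOME E. orthonormal_frame G E in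
     sqrt ((\<Sum>js\<in>{js. length js = k}. (\<alpha> (map E js))\<^sup>2) / fact k))"


section \<open>Spaces of forms and the weak exterior differential\<close>

text \<open>Elements of the spaces below are forms defined everywhere, with Borel measurable
  coefficients. Forms that agree almost everywhere are identified by passing to quotients.\<close>

definition measurable_form ::
  "('a::topological_space, 'n::finite) mfd \<Rightarrow> nat \<Rightarrow> ('a, 'n) dform \<Rightarrow> bool" where
  "measurable_form M k \<omega> \<longleftrightarrow> (\<forall>x. alternating k (\<omega> x)) \<and>
     (\<forall>c\<in>atlas M. \<forall>vs. length vs = k \<longrightarrow>
        set_borel_measurable borel (cimg c) (\<lambda>y. local_form M c \<omega> y vs))"

definition L1loc_form ::
  "('a::topological_space, 'n::finite) mfd \<Rightarrow> nat \<Rightarrow> ('a, 'n) dform \<Rightarrow> bool" where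
  "L1loc_form M k \<omega> \<longleftrightarrow> measurable_form M k \<omega> \<and>
     (\<forall>c\<in>atlas M. \<forall>K vs. compact K \<longrightarrow> K \<subseteq> cimg c \<longrightarrow> length vs = k \<longrightarrow>
        set_integrable lborel K (\<lambda>y. local_form M c \<omega> y vs))"

text \<open>\<open>weak_d M k \<phi> \<theta>\<close> says that \<open>d \<phi> = \<theta>\<close> weakly, for a \<open>k\<close>-form \<open>\<phi>\<close> and a \<open>(k+1)\<close>-form \<open>\<theta>\<close>.
  The test forms have degree \<open>n - (k+1)\<close>; for \<open>k = n\<close> there are none, and \<open>\<theta> = 0\<close> anyway.\<close>

definition weak_d ::
  "('a::topological_space, 'n::{finite,wellorder}) mfd \<Rightarrow> nat \<Rightarrow> ('a, 'n) dform \<Rightarrow> ('a, 'n) dform \<Rightarrow> bool"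
  where
  "weak_d M k \<phi> \<theta> \<longleftrightarrow> L1loc_form M k \<phi> \<and> L1loc_form M (Suc k) \<theta> \<and>
     (\<forall>m \<omega>. Suc k + m = CARD('n) \<longrightarrow> smooth_form M m \<omega> \<longrightarrow> compactly_supported \<omega> \<longrightarrow>
        form_integral M (\<lambda>x. wedge (Suc k) m (\<theta> x) (\<omega> x)) =
        (- 1) ^ Suc k * form_integral M (\<lambda>x. wedge k (Suc m) (\<phi> x) (ext_d M m \<omega> x)))"

definition Lp_forms ::
  "('a::topological_space, 'n::finite) mfd \<Rightarrow> nat \<Rightarrow> real \<Rightarrow> ('a, 'n) dform set" where
  "Lp_forms M k p = {\<theta>. measurable_form M k \<theta> \<and>
     (\<integral>\<^sup>+x. ennreal (alt_norm (metric M x) k (\<theta> x) powr p) \<partial>(riem_vol M)) < \<infinity>}"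

definition Lp_norm ::
  "('a::topological_space, 'n::finite) mfd \<Rightarrow> nat \<Rightarrow> real \<Rightarrow> ('a, 'n) dform \<Rightarrow> real" where
  "Lp_norm M k p \<theta> = (\<integral>x. alt_norm (metric M x) k (\<theta> x) powr p \<partial>(riem_vol M)) powr (1 / p)"

definition null_forms ::
  "('a::topological_space, 'n::finite) mfd \<Rightarrow> nat \<Rightarrow> ('a, 'n) dform set" where
  "null_forms M k = {\<theta>. measurable_form M k \<theta> \<and> (AE x in riem_vol M. \<theta> x = 0)}"

definition Z_forms ::
  "('a::topological_space, 'n::{finite,wellorder}) mfd \<Rightarrow> nat \<Rightarrow> real \<Rightarrow> ('a, 'n) dform set" where
  "Z_forms M k p = {\<theta> \<in> Lp_forms M k p. weak_d M k \<theta> 0}"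

definition B_forms ::
  "('a::topological_space, 'n::{finite,wellorder}) mfd \<Rightarrow> nat \<Rightarrow> real \<Rightarrow> real \<Rightarrow> ('a, 'n) dform set" where
  "B_forms M k q p = {\<theta> \<in> Lp_forms M k p. \<exists>\<phi>\<in>Lp_forms M (k - 1) q. weak_d M (k - 1) \<phi> \<theta>}"

definition B_closure ::
  "('a::topological_space, 'n::{finite,wellorder}) mfd \<Rightarrow> nat \<Rightarrow> real \<Rightarrow> real \<Rightarrow> ('a, 'n) dform set" where
  "B_closure M k q p =
     {\<theta> \<in> Lp_forms M k p. \<forall>\<epsilon>>0. \<exists>\<beta>\<in>B_forms M k q p. Lp_norm M k p (\<theta> - \<beta>) < \<epsilon>}"

definition Omega_forms ::
  "('a::topological_space, 'n::{finite,wellorder}) mfd \<Rightarrow> nat \<Rightarrow> real \<Rightarrow> real \<Rightarrow> ('a, 'n) dform set" where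
  "Omega_forms M j q p = {\<omega> \<in> Lp_forms M j q. \<exists>\<theta>\<in>Lp_forms M (Suc j) p. weak_d M j \<omega> \<theta>}"

text \<open>The weak differential is only determined almost everywhere, which does not affect the
  norm.\<close>

definition Omega_norm ::
  "('a::topological_space, 'n::{finite,wellorder}) mfd \<Rightarrow> nat \<Rightarrow> real \<Rightarrow> real \<Rightarrow> ('a, 'n) dform \<Rightarrow> real" where
  "Omega_norm M j q p \<omega> = Lp_norm M j q \<omega> + Lp_norm M (Suc j) p (SOME \<theta>. weak_d M j \<omega> \<theta>)"


section \<open>Quotients of spaces of forms\<close>

text \<open>\<open>V\<close> is a linear space of forms, \<open>W\<close> a subspace, and \<open>N\<close> a seminorm on \<open>V\<close>.\<close>

definition quot_rel :: "('a, 'n) dform set \<Rightarrow> ('a, 'n) dform set \<Rightarrow> ('a, 'n) dform rel" where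
  "quot_rel V W = {(u, v). u \<in> V \<and> v \<in> V \<and> u - v \<in> W}"

definition quot :: "('a, 'n) dform set \<Rightarrow> ('a, 'n) dform set \<Rightarrow> ('a, 'n) dform set set" where
  "quot V W = V // quot_rel V W"

definition cls :: "('a, 'n) dform set \<Rightarrow> ('a, 'n) dform set \<Rightarrow> ('a, 'n) dform \<Rightarrow> ('a, 'n) dform set" where
  "cls V W v = quot_rel V W `` {v}"

definition quot_add ::
  "('a, 'n) dform set \<Rightarrow> ('a, 'n) dform set \<Rightarrow> ('a, 'n) dform set \<Rightarrow> ('a, 'n) dform set \<Rightarrow> ('a, 'n) dform set"
  where "quot_add V W X Y = (\<Union>x\<in>X. \<Union>y\<in>Y. cls V W (x + y))"

definition quot_scale ::
  "('a, 'n) dform set \<Rightarrow> ('a, 'n) dform set \<Rightarrow> real \<Rightarrow> ('a, 'n) dform set \<Rightarrow> ('a, 'n) dform set"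
  where "quot_scale V W r X = (\<Union>x\<in>X. cls V W (form_scale r x))"

definition quot_norm :: "(('a, 'n) dform \<Rightarrow> real) \<Rightarrow> ('a, 'n) dform set \<Rightarrow> real" where
  "quot_norm N X = (INF v\<in>X. N v)"

definition quot_linear ::
  "('a, 'n) dform set \<Rightarrow> ('a, 'n) dform set \<Rightarrow> ('b, 'n) dform set \<Rightarrow> ('b, 'n) dform set \<Rightarrow>
   (('a, 'n) dform set \<Rightarrow> ('b, 'n) dform set) \<Rightarrow> bool" where
  "quot_linear V W V' W' F \<longleftrightarrow>
     (\<forall>X\<in>quot V W. F X \<in> quot V' W') \<and>
     (\<forall>X\<in>quot V W. \<forall>Y\<in>quot V W. F (quot_add V W X Y) = quot_add V' W' (F X) (F Y)) \<and>
     (\<forall>r. \<forall>X\<in>quot V W. F (quot_scale V W r X) = quot_scale V' W' r (F X))"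

text \<open>The map \<open>[v] \<mapsto> [T v]\<close> from \<open>V/W\<close> to \<open>V'/W'\<close> is well defined and linear.\<close>

definition induces_linear ::
  "('a, 'n) dform set \<Rightarrow> ('a, 'n) dform set \<Rightarrow> ('b, 'n) dform set \<Rightarrow> ('b, 'n) dform set \<Rightarrow>
   (('a, 'n) dform \<Rightarrow> ('b, 'n) dform) \<Rightarrow> bool" where
  "induces_linear V W V' W' T \<longleftrightarrow> (\<forall>v\<in>V. T v \<in> V') \<and>
     (\<exists>F. (\<forall>v\<in>V. F (cls V W v) = cls V' W' (T v)) \<and> quot_linear V W V' W' F)"

text \<open>The same, and moreover the map is bounded for the quotient norms.\<close>

definition induces_bounded ::
  "('a, 'n) dform set \<Rightarrow> ('a, 'n) dform set \<Rightarrow> (('a, 'n) dform \<Rightarrow> real) \<Rightarrow>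
   ('b, 'n) dform set \<Rightarrow> ('b, 'n) dform set \<Rightarrow> (('b, 'n) dform \<Rightarrow> real) \<Rightarrow>
   (('a, 'n) dform \<Rightarrow> ('b, 'n) dform) \<Rightarrow> bool" where
  "induces_bounded V W N V' W' N' T \<longleftrightarrow> (\<forall>v\<in>V. T v \<in> V') \<and>
     (\<exists>F. (\<forall>v\<in>V. F (cls V W v) = cls V' W' (T v)) \<and> quot_linear V W V' W' F \<and>
       (\<exists>C. \<forall>X\<in>quot V W. quot_norm N' (F X) \<le> C * quot_norm N X))"

definition cohom ::
  "('a::topological_space, 'n::{finite,wellorder}) mfd \<Rightarrow> nat \<Rightarrow> real \<Rightarrow> real \<Rightarrow> ('a, 'n) dform set set" where
  "cohom M k q p = quot (Z_forms M k p) (B_forms M k q p)"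

definition cohom_cls ::
  "('a::topological_space, 'n::{finite,wellorder}) mfd \<Rightarrow> nat \<Rightarrow> real \<Rightarrow> real \<Rightarrow>
   ('a, 'n) dform \<Rightarrow> ('a, 'n) dform set" where
  "cohom_cls M k q p \<omega> = cls (Z_forms M k p) (B_forms M k q p) \<omega>"


section \<open>Diffeomorphisms, pullback and distortion\<close>

definition smooth_map ::
  "('a::topological_space, 'n::finite) mfd \<Rightarrow> ('b::topological_space, 'n) mfd \<Rightarrow> ('a \<Rightarrow> 'b) \<Rightarrow> bool" where
  "smooth_map M N f \<longleftrightarrow> continuous_on UNIV f \<and>
     (\<forall>c\<in>atlas M. \<forall>d\<in>atlas N.
        smooth_on (cmap c ` (cdom c \<inter> f -` cdom d)) (cmap d \<circ> f \<circ> cinv c))"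

definition diffeo ::
  "('a::topological_space, 'n::finite) mfd \<Rightarrow> ('b::topological_space, 'n) mfd \<Rightarrow> ('a \<Rightarrow> 'b) \<Rightarrow> bool" where
  "diffeo M N f \<longleftrightarrow> bij f \<and> smooth_map M N f \<and> smooth_map N M (inv f)"

definition tangent_map ::
  "('a, 'n::finite) mfd \<Rightarrow> ('b, 'n) mfd \<Rightarrow> ('a \<Rightarrow> 'b) \<Rightarrow> 'a \<Rightarrow> real^'n \<Rightarrow> real^'n" where
  "tangent_map M N f x =
     frechet_derivative (cmap (chart_at N (f x)) \<circ> f \<circ> cinv (chart_at M x)) (at (cmap (chart_at M x) x))"

definition pullback ::
  "('a, 'n::finite) mfd \<Rightarrow> ('b, 'n) mfd \<Rightarrow> ('a \<Rightarrow> 'b) \<Rightarrow> ('b, 'n) dform \<Rightarrow> ('a, 'n) dform" where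
  "pullback M N f \<omega> x vs = \<omega> (f x) (map (tangent_map M N f x) vs)"

text \<open>Adjoint of \<open>T\<close> with respect to inner products \<open>G\<close> on the source and \<open>H\<close> on the target.\<close>

definition metric_adjoint ::
  "(real^'n \<Rightarrow> real^'n \<Rightarrow> real) \<Rightarrow> (real^'n \<Rightarrow> real^'n \<Rightarrow> real) \<Rightarrow>
   (real^'n \<Rightarrow> real^'n) \<Rightarrow> real^'n \<Rightarrow> real^'n" where
  "metric_adjoint G H T = (SOME T'. \<forall>u w. H (T u) w = G u (T' w))"

text \<open>The singular values of \<open>df\<^sub>x\<close>, indexed with multiplicity; they are determined up to
  the order, which is irrelevant for the symmetric functions \<open>\<sigma>\<close>.\<close>

definition sing_vals ::
  "('a, 'n::finite) mfd \<Rightarrow> ('b, 'n) mfd \<Rightarrow> ('a \<Rightarrow> 'b) \<Rightarrow> 'a \<Rightarrow> 'n \<Rightarrow> real" where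
  "sing_vals M N f x = (SOME l. (\<forall>i. 0 \<le> l i) \<and>
     (\<exists>E. orthonormal_frame (metric M x) E \<and>
       (\<forall>i. metric_adjoint (metric M x) (metric N (f x)) (tangent_map M N f x)
              (tangent_map M N f x (E i)) = (l i)\<^sup>2 *\<^sub>R E i)))"

definition distortion ::
  "('a, 'n::finite) mfd \<Rightarrow> ('b, 'n) mfd \<Rightarrow> nat \<Rightarrow> ('a \<Rightarrow> 'b) \<Rightarrow> 'a \<Rightarrow> real" where
  "distortion M N m f x = (\<Sum>I\<in>{I. card I = m}. \<Prod>i\<in>I. sing_vals M N f x i)"

definition Jac ::
  "('a, 'n::finite) mfd \<Rightarrow> ('b, 'n) mfd \<Rightarrow> ('a \<Rightarrow> 'b) \<Rightarrow> 'a \<Rightarrow> real" where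
  "Jac M N f x = distortion M N CARD('n) f x"

definition in_Lspace ::
  "('a::topological_space, 'n::finite) mfd \<Rightarrow> ereal \<Rightarrow> ('a \<Rightarrow> real) \<Rightarrow> bool" where
  "in_Lspace M \<tau> h \<longleftrightarrow> h \<in> borel_measurable borel \<and>
     (if \<tau> = \<infinity> then \<exists>C. AE x in riem_vol M. \<bar>h x\<bar> \<le> C
      else (\<integral>\<^sup>+x. ennreal (\<bar>h x\<bar> powr real_of_ereal \<tau>) \<partial>(riem_vol M)) < \<infinity>)"

definition BD ::
  "('a::topological_space, 'n::finite) mfd \<Rightarrow> ('b::topological_space, 'n) mfd \<Rightarrow>
   nat \<Rightarrow> real \<Rightarrow> ereal \<Rightarrow> ('a \<Rightarrow> 'b) set" where
  "BD M N m s \<tau> = {f. diffeo M N f \<and>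
     in_Lspace M \<tau> (\<lambda>x. distortion M N m f x powr s / Jac M N f x)}"

end

theory Submission
  imports Defs
begin

text \<open>
  Let \<open>\<lambda>\<^sub>1, \<dots>, \<lambda>\<^sub>n\<close> be the singular values of \<open>df\<^sub>x\<close>. In singular frames the pullback multiplies the
  component \<open>e\<^sub>I\<close> of a \<open>k\<close>-form by \<open>\<Prod>\<^sub>i\<^sub>\<in>\<^sub>I \<lambda>\<^sub>i \<le> \<sigma>\<^sub>k\<close>, and the pullback by the inverse divides the
  components of a \<open>j\<close>-form by such products, so that
  \<open>|f\<^sup>*\<theta>| \<le> \<sigma>\<^sub>k |\<theta> \<circ> f|\<close> and \<open>|(f\<^sup>-\<^sup>1)\<^sup>*\<phi>| \<circ> f \<le> (\<sigma>\<^sub>n\<^sub>-\<^sub>j / J\<^sub>f) |\<phi>|\<close>.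
  Hoelder's inequality and the substitution \<open>dx \<mapsto> J\<^sub>f dx\<close> turn these pointwise bounds into bounds
  between the \<open>L\<^sup>p\<close> spaces, the distortion hypotheses being exactly what the dual exponent needs.
  Weak differentials are natural because test forms pull back to test forms by the inverse
  diffeomorphism, up to the locally constant sign of the Jacobian determinant. (A) and (C) follow;
  for (B), a primitive of \<open>f\<^sup>*\<omega>\<close> is pulled back by \<open>f\<^sup>-\<^sup>1\<close> to a primitive of \<open>\<omega>\<close>.
  Since weak differentials are only unique almost everywhere, the norm of \<open>\<Omega>\<close> needs the fundamental
  lemma of the calculus of variations, proved with smooth bumps converging to indicators of boxes.
\<close>

section \<open>Calculus of smooth maps\<close>

text \<open>The definitions select frames, adjoints, singular values, base charts and weak
  differentials by \<open>SOME\<close>, and the volume by \<open>THE\<close>. Much of the work is to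
  replace each by something independent of the selection: inverse Gram matrices for norms, singular
  frames for the distortion, arbitrary charts for tangent maps, volume and \<open>d\<close>. Chart
  changes are local representations of the identity map, so most transformation laws are proved
  once, for maps.

  The exponents come from splitting integrands so that the Jacobian \<open>J\<close> cancels. In (A)
  the p-th power of the pulled back norm is at most \<open>W * Y^(p/pt)\<close>, where
  \<open>Y\<close> is \<open>J\<close> times the pt-th power of the norm of \<theta> at
  \<open>f x\<close> and \<open>W = (\<sigma>^pt / J)^(p/pt)\<close>. The exponent conjugate to pt/p
  is pt/(pt-p), so the condition on \<open>W\<close> concerns the power p/(pt-p) of
  \<open>\<sigma>^pt / J\<close>. In (B), with s = qt/(qt-1),
  \<open>W = J * (\<sigma> / J)^qt = (\<sigma>^s / J)^(qt-1)\<close>, and the conjugate exponent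
  q/(q-qt) produces r. Only boundedness is claimed, so the triangle and Hoelder inequalities appear
  with crude constants.\<close>

lemma frechet_derivative_eqI: "(f has_derivative f') (at x) \<Longrightarrow> frechet_derivative f (at x) = f'"
  using frechet_derivative_at by metis

lemma Ck_on_cong:
  assumes "open S" "\<And>x. x \<in> S \<Longrightarrow> f x = g x"
  shows "Ck_on k S f \<longleftrightarrow> Ck_on k S g"
proof -
  have *: "Ck_on k S f \<Longrightarrow> Ck_on k S g" if "\<And>x. x \<in> S \<Longrightarrow> f x = g x" for f g :: "'a \<Rightarrow> 'b"
    using that
  proof (induction k arbitrary: f g)
    case 0
    then show ?case by (metis Ck_on.simps(1) continuous_on_cong)
  next
    case (Suc k)
    have d: "(g has_derivative frechet_derivative f (at x)) (at x)" if "x \<in> S" for x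
    proof -
      have "(f has_derivative frechet_derivative f (at x)) (at x)"
        using Suc.prems that frechet_derivative_works by auto
      then show ?thesis
        using has_derivative_transform_within_open[OF _ assms(1) that] Suc.prems by blast
    qed
    have "frechet_derivative g (at x) = frechet_derivative f (at x)" if "x \<in> S" for x
      using d[OF that] by (rule frechet_derivative_eqI)
    then show ?case
      using d Suc.IH[of "\<lambda>x. frechet_derivative f (at x) v" "\<lambda>x. frechet_derivative g (at x) v" for v]
        Suc.prems by (auto simp: differentiable_def)
  qed
  show ?thesis using *[of f g] *[of g f] assms(2) by auto
qed

lemma Ck_on_SucD:
  "Ck_on (Suc k) S f \<Longrightarrow> x \<in> S \<Longrightarrow> (f has_derivative frechet_derivative f (at x)) (at x)"
  using frechet_derivative_works by auto

text \<open>\<open>Ck_on\<close> speaks of the selected function \<open>frechet_derivative\<close>.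
  On an open set any explicit derivative formula may take its place, which is how the rules for
  sums, products and compositions are proved by induction on the order.\<close>

lemma Ck_on_SucI:
  assumes "open S" "\<And>x. x \<in> S \<Longrightarrow> (f has_derivative f' x) (at x)"
    and "\<And>v. Ck_on k S (\<lambda>x. f' x v)"
  shows "Ck_on (Suc k) S f"
proof -
  have "frechet_derivative f (at x) = f' x" if "x \<in> S" for x
    using assms(2)[OF that] by (rule frechet_derivative_eqI)
  then have "Ck_on k S (\<lambda>x. frechet_derivative f (at x) v)" for v
    using Ck_on_cong[OF assms(1), of "\<lambda>x. frechet_derivative f (at x) v" "\<lambda>x. f' x v"] assms(3) by auto
  then show ?thesis using assms(2) by (auto simp: differentiable_def)
qed

lemma Ck_on_Suc_imp: "Ck_on (Suc k) S f \<Longrightarrow> Ck_on k S f"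
proof (induction k arbitrary: f)
  case 0
  then show ?case
    by (auto simp: continuous_on_eq_continuous_within
        intro!: differentiable_imp_continuous_within intro: differentiable_at_withinI)
qed auto

lemma Ck_on_subset: "Ck_on k S f \<Longrightarrow> T \<subseteq> S \<Longrightarrow> Ck_on k T f"
  by (induction k arbitrary: f) (auto intro: continuous_on_subset)

lemma Ck_on_Union:
  assumes "\<And>U. U \<in> \<U> \<Longrightarrow> open U" "\<And>U. U \<in> \<U> \<Longrightarrow> Ck_on k U f"
  shows "Ck_on k (\<Union>\<U>) f"
  using assms(2)
proof (induction k arbitrary: f)
  case 0
  then show ?case using assms(1) continuous_on_open_Union by (metis Ck_on.simps(1))
next
  case (Suc k) then show ?case by auto
qed

lemma Ck_on_const: "Ck_on k S (\<lambda>x. c)"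
  by (induction k arbitrary: c) auto

lemma Ck_on_linear_compose:
  assumes "open S" "bounded_linear L" "Ck_on k S f"
  shows "Ck_on k S (\<lambda>x. L (f x))"
  using assms(3)
proof (induction k arbitrary: f)
  case 0
  then show ?case using assms(2) linear_continuous_on_compose
    by (auto intro: bounded_linear.continuous_on)
next
  case (Suc k)
  show ?case
    by (rule Ck_on_SucI[OF assms(1) bounded_linear.has_derivative[OF assms(2) Ck_on_SucD[OF Suc.prems]]])
      (use Suc in auto)
qed

lemma Ck_on_id: "Ck_on k S (\<lambda>x. x)"
  by (cases k) (auto intro: Ck_on_const)

lemma Ck_on_add:
  assumes "open S" "Ck_on k S f" "Ck_on k S g"
  shows "Ck_on k S (\<lambda>x. f x + g x)"
  using assms(2,3)
proof (induction k arbitrary: f g)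
  case 0
  then show ?case by (auto intro: continuous_on_add)
next
  case (Suc k)
  show ?case
    by (rule Ck_on_SucI[OF assms(1) has_derivative_add[OF Ck_on_SucD[OF Suc.prems(1)] Ck_on_SucD[OF Suc.prems(2)]]])
      (use Suc in auto)
qed

lemma Ck_on_bilinear:
  assumes "open S" "bounded_bilinear pr" "Ck_on k S f" "Ck_on k S g"
  shows "Ck_on k S (\<lambda>x. pr (f x) (g x))"
  using assms(3,4)
proof (induction k arbitrary: f g)
  case 0
  then show ?case using bounded_bilinear.continuous_on[OF assms(2)] by auto
next
  case (Suc k)
  show ?case
  proof (rule Ck_on_SucI[OF assms(1) bounded_bilinear.FDERIV[OF assms(2)
        Ck_on_SucD[OF Suc.prems(1)] Ck_on_SucD[OF Suc.prems(2)]]])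
    show "Ck_on k S (\<lambda>x. pr (f x) (frechet_derivative g (at x) v) + pr (frechet_derivative f (at x) v) (g x))" for v
      using Suc.prems Ck_on_Suc_imp[OF Suc.prems(1)] Ck_on_Suc_imp[OF Suc.prems(2)]
      by (intro Ck_on_add assms(1) Suc.IH) auto
  qed
qed

lemma Ck_on_sum:
  assumes "open S" "finite I" "\<And>i. i \<in> I \<Longrightarrow> Ck_on k S (f i)"
  shows "Ck_on k S (\<lambda>x. \<Sum>i\<in>I. f i x)"
  using assms(2,3) by (induction I) (auto intro: Ck_on_const Ck_on_add[OF assms(1)])

text \<open>\<open>Ck_on\<close> only controls derivatives in a fixed direction, whereas the chain
  rule applies the derivative of \<open>g\<close> to the moving vector \<open>?f x v\<close>.
  Expanding that vector in \<open>Basis\<close> gives a finite sum of products, and the induction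
  hypothesis applies to each \<open>?g (f x) b\<close>.\<close>

lemma Ck_on_compose:
  fixes f :: "'a::real_normed_vector \<Rightarrow> 'b::euclidean_space" and g :: "'b \<Rightarrow> 'c::real_normed_vector"
  assumes "open S" "f ` S \<subseteq> T" "Ck_on k S f" "Ck_on k T g"
  shows "Ck_on k S (\<lambda>x. g (f x))"
  using assms(3,4)
proof (induction k arbitrary: g)
  case 0
  then show ?case using assms(2) continuous_on_compose2 by (metis Ck_on.simps(1))
next
  case (Suc k)
  let ?f = "\<lambda>x. frechet_derivative f (at x)" and ?g = "\<lambda>y. frechet_derivative g (at y)"
  have d: "((\<lambda>x. g (f x)) has_derivative (\<lambda>v. \<Sum>b\<in>Basis. (?f x v \<bullet> b) *\<^sub>R ?g (f x) b)) (at x)" if "x \<in> S" for x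
  proof -
    have g: "(g has_derivative ?g (f x)) (at (f x))" using Ck_on_SucD[OF Suc.prems(2)] that assms(2) by auto
    have eq: "?g (f x) w = (\<Sum>b\<in>Basis. (w \<bullet> b) *\<^sub>R ?g (f x) b)" for w
      using has_derivative_linear[OF g]
      by (subst euclidean_representation[of w, symmetric]) (simp only: linear_sum linear_cmul)
    show ?thesis
      using diff_chain_at[OF Ck_on_SucD[OF Suc.prems(1) that] g] unfolding o_def eq[symmetric] .
  qed
  show ?case
  proof (rule Ck_on_SucI[OF assms(1) d])
    fix v
    show "Ck_on k S (\<lambda>x. \<Sum>b\<in>Basis. (?f x v \<bullet> b) *\<^sub>R ?g (f x) b)"
      using Suc.prems Ck_on_Suc_imp[OF Suc.prems(1)]
      by (intro Ck_on_sum assms(1) Ck_on_bilinear[OF _ bounded_bilinear_scaleR]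
          Ck_on_linear_compose[OF _ bounded_linear_inner_left] Suc.IH) auto
  qed
qed

lemma smooth_on_cong:
  "open S \<Longrightarrow> (\<And>x. x \<in> S \<Longrightarrow> f x = g x) \<Longrightarrow> smooth_on S f \<longleftrightarrow> smooth_on S g"
  unfolding smooth_on_def using Ck_on_cong by blast

lemma smooth_on_subset: "smooth_on S f \<Longrightarrow> T \<subseteq> S \<Longrightarrow> smooth_on T f"
  unfolding smooth_on_def using Ck_on_subset by blast

lemma smooth_on_locally:
  assumes "\<And>x. x \<in> S \<Longrightarrow> \<exists>U. open U \<and> x \<in> U \<and> smooth_on U f"
  shows "smooth_on S f"
  unfolding smooth_on_def
proof
  fix k
  have "Ck_on k (\<Union>{U. open U \<and> smooth_on U f}) f"
    by (rule Ck_on_Union) (auto simp: smooth_on_def)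
  then show "Ck_on k S f" by (rule Ck_on_subset) (use assms in auto)
qed

lemma smooth_on_const: "smooth_on S (\<lambda>x. c)"
  by (simp add: smooth_on_def Ck_on_const)

lemma smooth_on_id: "smooth_on S (\<lambda>x. x)"
  by (simp add: smooth_on_def Ck_on_id)

lemma smooth_on_linear_compose:
  "open S \<Longrightarrow> bounded_linear L \<Longrightarrow> smooth_on S f \<Longrightarrow> smooth_on S (\<lambda>x. L (f x))"
  by (simp add: smooth_on_def Ck_on_linear_compose)

lemma smooth_on_mult:
  fixes f g :: "'a::real_normed_vector \<Rightarrow> real"
  shows "open S \<Longrightarrow> smooth_on S f \<Longrightarrow> smooth_on S g \<Longrightarrow> smooth_on S (\<lambda>x. f x * g x)"
  by (simp add: smooth_on_def Ck_on_bilinear[OF _ bounded_bilinear_mult])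

lemma smooth_on_sum:
  "open S \<Longrightarrow> finite I \<Longrightarrow> (\<And>i. i \<in> I \<Longrightarrow> smooth_on S (f i)) \<Longrightarrow> smooth_on S (\<lambda>x. \<Sum>i\<in>I. f i x)"
  by (simp add: smooth_on_def Ck_on_sum)

lemma smooth_on_prod:
  fixes f :: "'i \<Rightarrow> 'a::real_normed_vector \<Rightarrow> real"
  assumes "open S" "finite I" "\<And>i. i \<in> I \<Longrightarrow> smooth_on S (f i)"
  shows "smooth_on S (\<lambda>x. \<Prod>i\<in>I. f i x)"
  using assms(2,3) by (induction I) (auto intro: smooth_on_const smooth_on_mult[OF assms(1)])

lemma smooth_on_compose:
  fixes f :: "'a::real_normed_vector \<Rightarrow> 'b::euclidean_space" and g :: "'b \<Rightarrow> 'c::real_normed_vector"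
  shows "open S \<Longrightarrow> f ` S \<subseteq> T \<Longrightarrow> smooth_on S f \<Longrightarrow> smooth_on T g \<Longrightarrow> smooth_on S (\<lambda>x. g (f x))"
  using Ck_on_compose[of S f T] unfolding smooth_on_def by blast

lemma smooth_on_imp_continuous_on: "smooth_on S f \<Longrightarrow> continuous_on S f"
  unfolding smooth_on_def by (metis Ck_on.simps(1))

lemma smooth_on_has_derivative:
  "smooth_on S f \<Longrightarrow> x \<in> S \<Longrightarrow> (f has_derivative frechet_derivative f (at x)) (at x)"
  unfolding smooth_on_def using Ck_on_SucD by blast

lemma smooth_on_derivative: "smooth_on S f \<Longrightarrow> smooth_on S (\<lambda>x. frechet_derivative f (at x) v)"
  unfolding smooth_on_def using Ck_on.simps(2) by blast

text \<open>Two applications of the mean value theorem: to the increment in direction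
  \<open>v\<close> as a function of the \<open>u\<close>-parameter, then to the
  \<open>u\<close>-derivative along \<open>v\<close>. The left side is symmetric in \<open>u\<close>
  and \<open>v\<close>, which the mixed derivative on the right is not yet known to be.\<close>

lemma second_difference_mvt:
  fixes f :: "'a::real_normed_vector \<Rightarrow> real"
  assumes f: "smooth_on S f" and h: "0 < h"
    and S: "\<And>s t. 0 \<le> s \<Longrightarrow> s \<le> h \<Longrightarrow> 0 \<le> t \<Longrightarrow> t \<le> h \<Longrightarrow> x + s *\<^sub>R u + t *\<^sub>R v \<in> S"
  shows "\<exists>s t. 0 < s \<and> s < h \<and> 0 < t \<and> t < h \<and>
    f (x + h *\<^sub>R u + h *\<^sub>R v) - f (x + h *\<^sub>R u) - f (x + h *\<^sub>R v) + f x =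
    h * h * frechet_derivative (\<lambda>y. frechet_derivative f (at y) u) (at (x + s *\<^sub>R u + t *\<^sub>R v)) v"
proof -
  define Du where "Du = (\<lambda>y. frechet_derivative f (at y) u)"
  have Du: "smooth_on S Du" unfolding Du_def using f by (rule smooth_on_derivative)
  have d1: "((\<lambda>s. f (x + s *\<^sub>R u + t *\<^sub>R v)) has_real_derivative Du (x + s *\<^sub>R u + t *\<^sub>R v)) (at s)"
    if "0 \<le> s" "s \<le> h" "0 \<le> t" "t \<le> h" for s t
  proof -
    note fd = smooth_on_has_derivative[OF f S[OF that]]
    have "((\<lambda>s. f (x + s *\<^sub>R u + t *\<^sub>R v)) has_derivative
       (\<lambda>r. frechet_derivative f (at (x + s *\<^sub>R u + t *\<^sub>R v)) (r *\<^sub>R u))) (at s)"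
      by (rule has_derivative_compose[where g = f]) (auto intro!: derivative_eq_intros simp: fd)
    then show ?thesis
      using linear_cmul[OF has_derivative_linear[OF fd]]
      by (simp add: has_field_derivative_def Du_def mult_commute_abs)
  qed
  have d2: "((\<lambda>t. Du (x + s *\<^sub>R u + t *\<^sub>R v)) has_real_derivative
      frechet_derivative Du (at (x + s *\<^sub>R u + t *\<^sub>R v)) v) (at t)"
    if "0 \<le> s" "s \<le> h" "0 \<le> t" "t \<le> h" for s t
  proof -
    note fd = smooth_on_has_derivative[OF Du S[OF that]]
    have "((\<lambda>t. Du (x + s *\<^sub>R u + t *\<^sub>R v)) has_derivative
       (\<lambda>r. frechet_derivative Du (at (x + s *\<^sub>R u + t *\<^sub>R v)) (r *\<^sub>R v))) (at t)"
      by (rule has_derivative_compose[where g = Du]) (auto intro!: derivative_eq_intros simp: fd)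
    then show ?thesis
      using linear_cmul[OF has_derivative_linear[OF fd]]
      by (simp add: has_field_derivative_def mult_commute_abs)
  qed
  have "\<exists>s. 0 < s \<and> s < h \<and> (f (x + h *\<^sub>R u + h *\<^sub>R v) - f (x + h *\<^sub>R u + 0 *\<^sub>R v)) -
     (f (x + 0 *\<^sub>R u + h *\<^sub>R v) - f (x + 0 *\<^sub>R u + 0 *\<^sub>R v)) =
     (h - 0) * (Du (x + s *\<^sub>R u + h *\<^sub>R v) - Du (x + s *\<^sub>R u + 0 *\<^sub>R v))"
    by (rule MVT2[where f = "\<lambda>s. f (x + s *\<^sub>R u + h *\<^sub>R v) - f (x + s *\<^sub>R u + 0 *\<^sub>R v)"
          and f' = "\<lambda>s. Du (x + s *\<^sub>R u + h *\<^sub>R v) - Du (x + s *\<^sub>R u + 0 *\<^sub>R v)"])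
      (use h in \<open>auto intro!: DERIV_diff d1 d1[where t=0, simplified]\<close>)
  then obtain s where s: "0 < s" "s < h" and 1: "f (x + h *\<^sub>R u + h *\<^sub>R v) - f (x + h *\<^sub>R u) - f (x + h *\<^sub>R v) + f x
     = h * (Du (x + s *\<^sub>R u + h *\<^sub>R v) - Du (x + s *\<^sub>R u + 0 *\<^sub>R v))" by auto
  have "\<exists>t. 0 < t \<and> t < h \<and> Du (x + s *\<^sub>R u + h *\<^sub>R v) - Du (x + s *\<^sub>R u + 0 *\<^sub>R v) =
     (h - 0) * frechet_derivative Du (at (x + s *\<^sub>R u + t *\<^sub>R v)) v"
    by (rule MVT2[where f = "\<lambda>t. Du (x + s *\<^sub>R u + t *\<^sub>R v)"]) (use h s in \<open>auto intro!: d2\<close>)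
  then show ?thesis using 1 s unfolding Du_def by auto
qed

text \<open>The symmetric second difference gives both mixed derivatives a common value at points
  arbitrarily close to \<open>x\<close>, so by continuity they agree at \<open>x\<close>.\<close>

lemma second_derivative_symmetric:
  fixes f :: "'a::real_normed_vector \<Rightarrow> real"
  assumes f: "smooth_on S f" and S: "open S" "x \<in> S"
  shows "frechet_derivative (\<lambda>y. frechet_derivative f (at y) u) (at x) v =
         frechet_derivative (\<lambda>y. frechet_derivative f (at y) v) (at x) u"
proof (rule ccontr)
  define D where "D = (\<lambda>u v y. frechet_derivative (\<lambda>y. frechet_derivative f (at y) u) (at y) v)"
  assume "\<not> ?thesis"
  then have ne: "dist (D u v x) (D v u x) > 0" by (simp add: D_def)
  define e where "e = dist (D u v x) (D v u x) / 2"
  have cont: "isCont (D u v) x" for u v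
    using smooth_on_imp_continuous_on[OF smooth_on_derivative[OF smooth_on_derivative[OF f]]] S
    unfolding D_def by (simp add: continuous_on_eq_continuous_at)
  have "e > 0" using ne by (simp add: e_def)
  obtain d1 where d1: "d1 > 0" "\<And>y. dist y x < d1 \<Longrightarrow> dist (D u v y) (D u v x) < e"
    using cont[of u v] \<open>e > 0\<close> unfolding continuous_at_eps_delta by auto
  obtain d2 where d2: "d2 > 0" "\<And>y. dist y x < d2 \<Longrightarrow> dist (D v u y) (D v u x) < e"
    using cont[of v u] \<open>e > 0\<close> unfolding continuous_at_eps_delta by auto
  obtain d3 where d3: "d3 > 0" "ball x d3 \<subseteq> S" using S open_contains_ball by blast
  define d where "d = min d1 (min d2 d3)"
  \<comment> \<open>The summand 1 keeps the denominator positive when \<open>u\<close> and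
    \<open>v\<close> vanish, and makes the estimate on the whole parallelogram strictly smaller than
    \<open>d\<close>.\<close>
  define h where "h = d / (norm u + norm v + 1)"
  have pos: "norm u + norm v + 1 > 0" by (smt (verit) norm_ge_zero)
  have "h > 0" using d1 d2 d3 pos by (simp add: h_def d_def)
  have close: "dist (x + s *\<^sub>R u + t *\<^sub>R v) x < d" if "0 \<le> s" "s \<le> h" "0 \<le> t" "t \<le> h" for s t
  proof -
    have "norm (s *\<^sub>R u + t *\<^sub>R v) \<le> s * norm u + t * norm v"
      using norm_triangle_ineq[of "s *\<^sub>R u" "t *\<^sub>R v"] that by simp
    also have "\<dots> \<le> h * norm u + h * norm v" using that by (intro add_mono mult_right_mono) auto
    also have "\<dots> < h * (norm u + norm v + 1)" using \<open>h > 0\<close> by (simp add: algebra_simps)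
    also have "\<dots> = d" using pos by (simp add: h_def)
    finally show ?thesis by (simp add: dist_norm add.assoc)
  qed
  have inS: "x + s *\<^sub>R u + t *\<^sub>R v \<in> S" if "0 \<le> s" "s \<le> h" "0 \<le> t" "t \<le> h" for s t
    using close[OF that] d3 by (auto simp: d_def dist_commute subset_iff)
  have inS': "x + s *\<^sub>R v + t *\<^sub>R u \<in> S" if "0 \<le> s" "s \<le> h" "0 \<le> t" "t \<le> h" for s t
    using inS[OF that(3,4,1,2)] by (simp add: algebra_simps)
  obtain s t where st: "0 < s" "s < h" "0 < t" "t < h"
    "f (x + h *\<^sub>R u + h *\<^sub>R v) - f (x + h *\<^sub>R u) - f (x + h *\<^sub>R v) + f x = h * h * D u v (x + s *\<^sub>R u + t *\<^sub>R v)"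
    using second_difference_mvt[OF f \<open>h > 0\<close> inS] unfolding D_def by blast
  obtain s' t' where st': "0 < s'" "s' < h" "0 < t'" "t' < h"
    "f (x + h *\<^sub>R v + h *\<^sub>R u) - f (x + h *\<^sub>R v) - f (x + h *\<^sub>R u) + f x = h * h * D v u (x + s' *\<^sub>R v + t' *\<^sub>R u)"
    using second_difference_mvt[OF f \<open>h > 0\<close> inS'] unfolding D_def by blast
  have "x + h *\<^sub>R v + h *\<^sub>R u = x + h *\<^sub>R u + h *\<^sub>R v" by simp
  then have "h * h * D u v (x + s *\<^sub>R u + t *\<^sub>R v) = h * h * D v u (x + s' *\<^sub>R v + t' *\<^sub>R u)"
    using st(5) st'(5) by (simp only:)
  then have eq: "D u v (x + s *\<^sub>R u + t *\<^sub>R v) = D v u (x + s' *\<^sub>R v + t' *\<^sub>R u)" using \<open>h > 0\<close> by (metis mult_cancel_left less_irrefl mult_eq_0_iff)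
  have c: "x + s' *\<^sub>R v + t' *\<^sub>R u = x + t' *\<^sub>R u + s' *\<^sub>R v" by simp
  have 1: "dist (D v u (x + s' *\<^sub>R v + t' *\<^sub>R u)) (D v u x) < e"
    unfolding c using d2(2) close[of t' s'] st'(1-4) by (simp add: d_def)
  have 2: "dist (D u v (x + s *\<^sub>R u + t *\<^sub>R v)) (D u v x) < e"
    using d1(2) close[of s t] st(1-4) by (simp add: d_def)
  have "dist (D u v x) (D v u x) < 2 * e"
    using dist_triangle_lt[of "D u v x" "D v u (x + s' *\<^sub>R v + t' *\<^sub>R u)" "D v u x" "2*e"] 1 2 eq
    by (simp add: dist_commute)
  then show False by (simp add: e_def)
qed

section \<open>Bump functions\<close>

text \<open>The powers of 1/t make the family closed under differentiation: the derivative of a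
  member is a combination of two other members.\<close>

definition flat_exp :: "nat \<Rightarrow> real \<Rightarrow> real" where
  "flat_exp n t = (if 0 < t then exp (- 1 / t) / t ^ n else 0)"

text \<open>A single term of the exponential series bounds exp(1/t) from below by
  \<open>(1/t)^(n+2) / fact (n+2)\<close>. The two extra powers leave \<open>t\<^sup>2\<close>,
  which makes the difference quotient at 0 tend to 0.\<close>

lemma flat_exp_bound: "0 < t \<Longrightarrow> flat_exp n t \<le> fact (n + 2) * t\<^sup>2"
proof -
  assume t: "0 < t"
  have "(1 / t) ^ (n + 2) / fact (n + 2) \<le> exp (1 / t)"
    using sum_le_suminf[of "\<lambda>i. (1/t) ^ i /\<^sub>R fact i" "{n+2}"] t summable_exp_generic[of "1/t"]
    unfolding exp_def by (simp add: divide_inverse mult.commute)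
  then have "exp (- (1 / t)) \<le> fact (n + 2) * t ^ (n + 2)"
    using t by (simp add: exp_minus divide_simps mult.commute)
  then have "exp (- (1 / t)) / t ^ n \<le> fact (n + 2) * t ^ (n + 2) / t ^ n"
    using t by (intro divide_right_mono) auto
  also have "\<dots> = fact (n + 2) * t\<^sup>2" using t by (simp add: power_add power2_eq_square)
  finally show ?thesis using t by (simp add: flat_exp_def)
qed

lemma flat_exp_derivative:
  "(flat_exp n has_real_derivative (flat_exp (n + 2) t - n * flat_exp (n + 1) t)) (at t)"
proof -
  consider "t > 0" | "t < 0" | "t = 0" by linarith
  then show ?thesis
  proof cases
    case 1
    have "((\<lambda>t. exp (- 1 / t) / t ^ n) has_real_derivative (flat_exp (n + 2) t - n * flat_exp (n + 1) t)) (at t)"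
      using 1 apply (auto intro!: derivative_eq_intros simp: flat_exp_def)
      apply (cases n)
       apply (auto simp: field_simps power2_eq_square)
      done
    then show ?thesis
      by (rule has_field_derivative_transform_within_open[where S="{0<..}"]) (use 1 in \<open>auto simp: flat_exp_def\<close>)
  next
    case 2
    have "((\<lambda>t. 0) has_real_derivative (flat_exp (n + 2) t - n * flat_exp (n + 1) t)) (at t)"
      using 2 by (simp add: flat_exp_def)
    then show ?thesis
      by (rule has_field_derivative_transform_within_open[where S="{..<0}"]) (use 2 in \<open>auto simp: flat_exp_def\<close>)
  next
    case 3
    have "((\<lambda>h. (flat_exp n (0 + h) - flat_exp n 0) / h) \<longlongrightarrow> 0) (at 0)"
    proof (rule Lim_null_comparison)
      show "eventually (\<lambda>h. norm ((flat_exp n (0 + h) - flat_exp n 0) / h) \<le> fact (n + 2) * \<bar>h\<bar>) (at 0)"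
      proof (intro always_eventually allI)
        fix h :: real
        show "norm ((flat_exp n (0 + h) - flat_exp n 0) / h) \<le> fact (n + 2) * \<bar>h\<bar>"
        proof (cases "h > 0")
          case True
          then have "flat_exp n h / h \<le> fact (n + 2) * h"
            using flat_exp_bound[OF True, of n] by (simp add: power2_eq_square divide_le_eq mult.assoc)
          moreover have "flat_exp n h \<ge> 0" using True by (simp add: flat_exp_def)
          ultimately show ?thesis using True by (simp add: flat_exp_def[of n 0])
        next
          case False
          then have "flat_exp n (0 + h) = 0" "flat_exp n 0 = 0" by (simp_all add: flat_exp_def)
          then show ?thesis by (metis abs_ge_zero diff_self div_0 fact_ge_zero mult_nonneg_nonneg norm_zero)
        qed
      qed
      have "((\<lambda>h. fact (n + 2) * \<bar>h\<bar>) \<longlongrightarrow> fact (n + 2) * \<bar>0::real\<bar>) (at 0)"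
        by (intro tendsto_intros)
      then show "((\<lambda>h. fact (n + 2) * \<bar>h\<bar>) \<longlongrightarrow> (0::real)) (at 0)" by simp
    qed
    then show ?thesis using 3 by (simp add: DERIV_def flat_exp_def)
  qed
qed

lemma Ck_on_flat_exp: "Ck_on k UNIV (flat_exp n)"
proof (induction k arbitrary: n)
  case 0
  have "isCont (flat_exp n) x" for x by (rule DERIV_isCont[OF flat_exp_derivative])
  then show ?case by (simp add: continuous_on_eq_continuous_at)
next
  case (Suc k)
  show ?case
  proof (rule Ck_on_SucI[OF open_UNIV])
    show "(flat_exp n has_derivative (\<lambda>v. (flat_exp (n + 2) t + (- n) * flat_exp (n + 1) t) * v)) (at t)" for t
      using flat_exp_derivative[of n t] by (simp add: has_field_derivative_def)
    show "Ck_on k UNIV (\<lambda>t. (flat_exp (n + 2) t + (- n) * flat_exp (n + 1) t) * v)" for v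
      by (intro Ck_on_bilinear[OF _ bounded_bilinear_mult] Ck_on_add Ck_on_const Suc.IH open_UNIV)
  qed
qed

text \<open>Each pair of factors is positive exactly between \<open>a $ i\<close> and
  \<open>b $ i\<close>, so the bump is positive exactly on the open box for every \<open>m\<close>.
  Increasing \<open>m\<close> only steepens it, and its values inside the box tend to 1.\<close>

definition box_bump :: "real^'n \<Rightarrow> real^'n \<Rightarrow> nat \<Rightarrow> real^'n \<Rightarrow> real" where
  "box_bump a b m y = (\<Prod>i\<in>UNIV. flat_exp 0 (real (Suc m) * (y $ i - a $ i)) * flat_exp 0 (real (Suc m) * (b $ i - y $ i)))"

lemma flat_exp_0_range: "0 \<le> flat_exp 0 t" "flat_exp 0 t \<le> 1"
  by (auto simp: flat_exp_def)

lemma box_bump_range: "0 \<le> box_bump a b m y" "box_bump a b m y \<le> 1"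
  unfolding box_bump_def by (auto intro!: prod_nonneg prod_le_1 mult_nonneg_nonneg mult_le_one flat_exp_0_range)

lemma box_bump_eq_0: "y \<notin> box a b \<Longrightarrow> box_bump a b m y = 0"
proof -
  assume "y \<notin> box a b"
  then obtain i where "\<not> (a $ i < y $ i \<and> y $ i < b $ i)" by (auto simp: mem_box_cart)
  then have "flat_exp 0 (real (Suc m) * (y $ i - a $ i)) * flat_exp 0 (real (Suc m) * (b $ i - y $ i)) = 0"
    by (auto simp: flat_exp_def zero_less_mult_iff)
  then show ?thesis unfolding box_bump_def by (intro prod_zero[OF finite]) (rule bexI[OF _ UNIV_I])
qed

lemma smooth_on_box_bump: "smooth_on UNIV (box_bump a b m)"
proof -
  have 1: "smooth_on UNIV (flat_exp 0)" by (simp add: smooth_on_def Ck_on_flat_exp)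
  have 2: "smooth_on UNIV (\<lambda>y::real^'n. r * (y $ i - c))" for r i c
  proof -
    have "smooth_on UNIV (\<lambda>y::real^'n. y $ i)"
      using smooth_on_linear_compose[OF open_UNIV bounded_linear_vec_nth smooth_on_id] .
    then have "smooth_on UNIV (\<lambda>y::real^'n. r * (y $ i + (- c)))"
      unfolding smooth_on_def
      by (intro allI Ck_on_bilinear[OF _ bounded_bilinear_mult] Ck_on_add Ck_on_const open_UNIV) auto
    then show ?thesis by simp
  qed
  have 3: "smooth_on UNIV (\<lambda>y::real^'n. r * (c - y $ i))" for r i c
    using 2[of "- r" i c] by (simp add: algebra_simps)
  show ?thesis
    unfolding box_bump_def[abs_def]
    by (rule smooth_on_prod[OF open_UNIV finite], rule smooth_on_mult[OF open_UNIV])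
      (rule smooth_on_compose[OF open_UNIV _ 2 1] smooth_on_compose[OF open_UNIV _ 3 1]; simp)+
qed

lemma box_bump_tendsto: "(\<lambda>m. box_bump a b m y) \<longlonglongrightarrow> indicator (box a b) y"
proof (cases "y \<in> box a b")
  case True
  have *: "(\<lambda>m. flat_exp 0 (real (Suc m) * t)) \<longlonglongrightarrow> 1" if "t > 0" for t :: real
  proof -
    have "(\<lambda>m. exp (- (1 / t) * inverse (real (Suc m)))) \<longlonglongrightarrow> exp (- (1 / t) * 0)"
      by (intro tendsto_exp tendsto_mult tendsto_const LIMSEQ_inverse_real_of_nat)
    moreover have "flat_exp 0 (real (Suc m) * t) = exp (- (1 / t) * inverse (real (Suc m)))" for m
    proof -
      have "real (Suc m) * t > 0" using that by (simp del: of_nat_Suc)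
      then show ?thesis by (simp add: flat_exp_def field_simps del: of_nat_Suc)
    qed
    ultimately show ?thesis by simp
  qed
  have "(\<lambda>m. box_bump a b m y) \<longlonglongrightarrow> (\<Prod>i\<in>(UNIV::'a set). 1 * 1)"
    unfolding box_bump_def by (intro tendsto_prod tendsto_mult *) (use True in \<open>auto simp: mem_box_cart\<close>)
  then show ?thesis using True by simp
qed (simp add: box_bump_eq_0)

section \<open>Multilinear and alternating forms on lists\<close>

text \<open>Expansion in a frame and the bounds on \<open>alt_norm\<close> rest on linearity in each
  slot alone, and this is the property established for \<open>ext_d\<close> of a form before it
  enters a wedge product.\<close>

definition multilinear :: "nat \<Rightarrow> 'n::finite altform \<Rightarrow> bool" where
  "multilinear k \<alpha> \<longleftrightarrow> (\<forall>vs. length vs \<noteq> k \<longrightarrow> \<alpha> vs = 0) \<and>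
     (\<forall>vs i. length vs = k \<longrightarrow> i < k \<longrightarrow> linear (\<lambda>v. \<alpha> (vs[i := v])))"

lemma alternating_imp_multilinear: "alternating k \<alpha> \<Longrightarrow> multilinear k \<alpha>"
  by (simp add: alternating_def multilinear_def)

lemma multilinear_linear:
  assumes "multilinear k \<alpha>" "length xs + Suc (length ys) = k"
  shows "linear (\<lambda>v. \<alpha> (xs @ v # ys))"
proof -
  have "linear (\<lambda>v. \<alpha> ((xs @ 0 # ys)[length xs := v]))"
    using assms unfolding multilinear_def by (metis add.commute add_Suc_right length_Cons length_append less_add_Suc1)
  then show ?thesis by simp
qed

lemma finite_lists_length [simp]: "finite {js::'n::finite list. length js = k}"
  using finite_lists_length_eq[of "UNIV::'n set" k] by simp

lemma sum_lists_Suc: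
  "(\<Sum>js | length js = Suc k. f js) = (\<Sum>j\<in>UNIV. \<Sum>js | length js = k. f (j # js))"
  for f :: "'n::finite list \<Rightarrow> 'b::comm_monoid_add"
proof -
  have "(\<Sum>js | length js = Suc k. f js) = sum f ((\<lambda>(j, js). j # js) ` (UNIV \<times> {js. length js = k}))"
    by (rule sum.cong) (auto simp: length_Suc_conv)
  also have "\<dots> = (\<Sum>(j, js)\<in>UNIV \<times> {js. length js = k}. f (j # js))"
    by (subst sum.reindex) (auto simp: inj_on_def intro!: sum.cong)
  finally show ?thesis by (simp add: sum.cartesian_product)
qed

text \<open>Linearity is applied to one slot at a time; \<open>us\<close> collects the slots already
  filled with frame vectors. The frame is known only through a function \<open>c\<close> that
  expands every vector, so one lemma serves standard, orthonormal and coordinate frames.\<close>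

lemma multilinear_expand_aux:
  fixes \<alpha> :: "'n::finite altform" and e :: "'i::finite \<Rightarrow> real^'n"
  assumes \<alpha>: "multilinear k \<alpha>" and e: "\<And>v. v = (\<Sum>i\<in>UNIV. c v i *\<^sub>R e i)"
    and "length us + length vs = k"
  shows "\<alpha> (us @ vs) = (\<Sum>js | length js = length vs. prod_list (map2 c vs js) * \<alpha> (us @ map e js))"
  using assms(3)
proof (induction vs arbitrary: us)
  case Nil
  have "{js :: 'i list. length js = 0} = {[]}" by auto
  then show ?case by simp
next
  case (Cons v vs)
  have lin: "linear (\<lambda>v. \<alpha> (us @ v # vs))" using Cons.prems by (intro multilinear_linear[OF \<alpha>]) auto
  have "\<alpha> (us @ v # vs) = (\<Sum>i\<in>UNIV. c v i * \<alpha> (us @ e i # vs))"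
    using linear_sum[OF lin, of "\<lambda>i. c v i *\<^sub>R e i" UNIV] e[of v, symmetric] linear_cmul[OF lin] by simp
  also have "\<dots> = (\<Sum>i\<in>UNIV. c v i * (\<Sum>js | length js = length vs. prod_list (map2 c vs js) * \<alpha> ((us @ [e i]) @ map e js)))"
    using Cons.IH[of "us @ [e _]"] Cons.prems by simp
  also have "\<dots> = (\<Sum>js | length js = length (v # vs). prod_list (map2 c (v # vs) js) * \<alpha> (us @ map e js))"
    by (simp add: sum_lists_Suc sum_distrib_left mult.assoc)
  finally show ?case .
qed

lemma multilinear_expand_gen:
  fixes \<alpha> :: "'n::finite altform" and e :: "'i::finite \<Rightarrow> real^'n"
  assumes "multilinear k \<alpha>" "\<And>v. v = (\<Sum>i\<in>UNIV. c v i *\<^sub>R e i)" "length vs = k"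
  shows "\<alpha> vs = (\<Sum>js | length js = k. prod_list (map2 c vs js) * \<alpha> (map e js))"
  using multilinear_expand_aux[OF assms(1,2), of "[]" vs] assms(3) by simp

lemma vec_basis_expand: "(v :: real^'n::finite) = (\<Sum>i\<in>UNIV. v $ i *\<^sub>R axis i 1)"
  using basis_expansion[of v] by (simp add: scalar_mult_eq_scaleR)

abbreviation ax :: "'n::finite \<Rightarrow> real^'n" where "ax i \<equiv> axis i 1"

lemmas multilinear_expand = multilinear_expand_gen[where c = "\<lambda>v i. v $ i" and e = ax, OF _ vec_basis_expand]

lemma prod_list_map2_conv:
  "length xs = k \<Longrightarrow> length ys = k \<Longrightarrow> prod_list (map2 g xs ys) = (\<Prod>r<k. g (xs ! r) (ys ! r))"
  by (simp add: prod.list_conv_set_nth atLeast0LessThan)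

lemma alternating_add: "alternating k \<alpha> \<Longrightarrow> alternating k \<beta> \<Longrightarrow> alternating k (\<alpha> + \<beta>)"
  by (auto simp: alternating_def intro!: linear_compose_add)

lemma alternating_scale: "alternating k \<alpha> \<Longrightarrow> alternating k (\<lambda>vs. r * \<alpha> vs)"
  by (auto simp: alternating_def intro!: linear_compose_scale_right[where 'a="real^'a" and 'b=real, simplified])

lemma alternating_zero: "alternating k 0"
  by (simp add: alternating_def linear_zero)

lemma multilinear_map: "multilinear k \<alpha> \<Longrightarrow> linear T \<Longrightarrow> multilinear k (\<lambda>vs. \<alpha> (map T vs))"
  unfolding multilinear_def by (auto simp: map_update intro: linear_compose[of T, unfolded o_def])

lemma alternating_map: "alternating k \<alpha> \<Longrightarrow> linear T \<Longrightarrow> alternating k (\<lambda>vs. \<alpha> (map T vs))"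
  unfolding alternating_def by (auto simp: map_update intro: linear_compose[of T, unfolded o_def])

lemma alternating_repeat:
  assumes "alternating k \<alpha>" shows "\<alpha> (xs @ u # ys @ u # zs) = 0"
proof (cases "length (xs @ u # ys @ u # zs) = k")
  case True
  let ?vs = "xs @ u # ys @ u # zs" and ?i = "length xs" and ?j = "length xs + Suc (length ys)"
  have "?vs ! ?i = ?vs ! ?j" by (simp add: nth_append)
  moreover have "?i < ?j" "?j < k" using True by auto
  ultimately show ?thesis using assms True unfolding alternating_def by blast
qed (use assms in \<open>auto simp: alternating_def\<close>)

lemma alternating_not_distinct:
  assumes "alternating k \<alpha>" "\<not> distinct js" shows "\<alpha> (map f js) = 0"
proof -
  obtain xs ys zs y where "js = xs @ [y] @ ys @ [y] @ zs" using not_distinct_decomp[OF assms(2)] by blast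
  then show ?thesis using alternating_repeat[OF assms(1)] by simp
qed

lemma alternating_swap:
  assumes "alternating k \<alpha>"
  shows "\<alpha> (xs @ u # ys @ v # zs) = - \<alpha> (xs @ v # ys @ u # zs)"
proof (cases "length xs + Suc (length ys + Suc (length zs)) = k")
  case True
  note ml = alternating_imp_multilinear[OF assms]
  have l1: "linear (\<lambda>u. \<alpha> (xs @ u # ys @ w # zs))" for w
    using multilinear_linear[OF ml, of xs "ys @ w # zs"] True by simp
  have l2: "linear (\<lambda>u. \<alpha> (xs @ w # ys @ u # zs))" for w
    using multilinear_linear[OF ml, of "xs @ w # ys" "zs"] True by simp
  have "0 = \<alpha> (xs @ (u + v) # ys @ (u + v) # zs)" using alternating_repeat[OF assms] by metis
  also have "\<dots> = \<alpha> (xs @ u # ys @ (u + v) # zs) + \<alpha> (xs @ v # ys @ (u + v) # zs)"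
    using linear_add[OF l1] by simp
  also have "\<dots> = \<alpha> (xs @ u # ys @ v # zs) + \<alpha> (xs @ v # ys @ u # zs)"
    using linear_add[OF l2] alternating_repeat[OF assms] by simp
  finally show ?thesis by simp
qed (use assms in \<open>auto simp: alternating_def\<close>)

lemma alternating_move:
  assumes "alternating k \<alpha>"
  shows "\<alpha> (xs @ b # ys @ zs) = (- 1) ^ length ys * \<alpha> (xs @ ys @ b # zs)"
proof (induction ys arbitrary: xs)
  case (Cons y ys)
  have "\<alpha> (xs @ b # y # ys @ zs) = - \<alpha> (xs @ y # b # ys @ zs)"
    using alternating_swap[OF assms, of xs b "[]" y "ys @ zs"] by simp
  then show ?case using Cons[of "xs @ [y]"] by simp
qed simp

text \<open>Induction over the transpositions that make up \<open>p\<close>. As \<open>L\<close> is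
  distinct, each transposition of labels exchanges two positions of the list and flips the sign.
  Permuting labels rather than positions suits \<open>enum_list\<close>, whose labels are the
  coordinates themselves.\<close>

lemma alternating_permute_map:
  assumes "alternating k \<alpha>" "distinct L" "p permutes set L"
  shows "\<alpha> (map (f \<circ> p) L) = of_int (sign p) * \<alpha> (map f L)"
  using assms(3) finite_set[of L]
proof (induction arbitrary: f rule: permutes_induct)
  case id
  then show ?case by simp
next
  case (swap a b p)
  have *: "\<alpha> (map (f \<circ> Transposition.transpose a b) L) = - \<alpha> (map f L)"
    if ab: "L = xs @ a # ys @ b # zs" for a b xs ys zs
  proof -
    have d: "distinct (xs @ a # ys @ b # zs)" using ab assms(2) by simp
    have t: "Transposition.transpose a b x = x" if "x \<in> set xs \<union> set ys \<union> set zs" for x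
      using d that by (intro transpose_apply_other) auto
    have m: "map (f \<circ> Transposition.transpose a b) L = map f xs @ f b # map f ys @ f a # map f zs"
      using t unfolding ab by simp
    have "map f L = map f xs @ f a # map f ys @ f b # map f zs" by (simp add: ab)
    then show ?thesis
      using alternating_swap[OF assms(1), of "map f xs" "f b" "map f ys" "f a" "map f zs"] by (simp only: m)
  qed
  have "(\<exists>xs ys zs. L = xs @ a # ys @ b # zs) \<or> (\<exists>xs ys zs. L = xs @ b # ys @ a # zs)"
  proof -
    obtain xs ys where L: "L = xs @ a # ys" using swap.hyps(1) by (meson split_list)
    then have "b \<in> set xs \<or> b \<in> set ys" using swap.hyps(2,3) by auto
    then show ?thesis unfolding L by (metis append.assoc append_Cons split_list)
  qed
  then have sw: "\<alpha> (map (f \<circ> Transposition.transpose a b) L) = - \<alpha> (map f L)"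
    using * transpose_commute by metis
  have "\<alpha> (map (f \<circ> (Transposition.transpose a b \<circ> p)) L) = of_int (sign p) * \<alpha> (map (f \<circ> Transposition.transpose a b) L)"
    using swap.IH[of "f \<circ> Transposition.transpose a b"] by (simp only: o_assoc)
  moreover have "sign (Transposition.transpose a b \<circ> p) = - sign p"
  proof -
    have "permutation p" using swap.hyps(4) permutation_permutes by blast
    then show ?thesis using swap.hyps(3) by (simp add: sign_compose sign_swap_id permutation_swap_id)
  qed
  ultimately show ?case using sw by (simp only: of_int_minus mult_minus_left mult_minus_right)
qed

lemma alternating_permute_list:
  assumes "alternating k \<alpha>" "p permutes {..<length vs}"
  shows "\<alpha> (permute_list p vs) = of_int (sign p) * \<alpha> vs"
proof -
  have "permute_list p vs = map ((\<lambda>i. vs ! i) \<circ> p) [0..<length vs]" by (simp add: permute_list_def)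
  moreover have "p permutes set [0..<length vs]" using assms(2) by (simp add: atLeast0LessThan)
  ultimately show ?thesis
    using alternating_permute_map[OF assms(1), of "[0..<length vs]" p "\<lambda>i. vs ! i"]
    by (simp only: distinct_upt map_nth)
qed

text \<open>The order in which \<open>form_integral\<close> evaluates a top form on the coordinate
  vectors.\<close>

definition enum_list :: "'n::{finite,wellorder} list" where "enum_list = sorted_list_of_set UNIV"

lemma enum_list [simp]: "distinct (enum_list :: 'n::{finite,wellorder} list)" "set (enum_list :: 'n list) = UNIV"
  "length (enum_list :: 'n list) = CARD('n)"
  by (auto simp: enum_list_def)

text \<open>After expansion in the standard basis only index lists without repetition contribute.
  Those of full length are the rearrangements of \<open>enum_list\<close>, and their signs turn the
  sum into the Leibniz formula.\<close>

lemma alternating_top: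
  fixes \<alpha> :: "'n::{finite,wellorder} altform" and v :: "'n \<Rightarrow> real^'n::_"
  assumes \<alpha>: "alternating CARD('n) \<alpha>"
  shows "\<alpha> (map v enum_list) = det (\<chi> i. v i) * \<alpha> (map ax enum_list)"
proof -
  let ?L = "enum_list :: 'n list" and ?n = "CARD('n)"
  have inj: "inj_on (\<lambda>p. map p ?L) {p. p permutes UNIV}"
    by (auto simp: inj_on_def fun_eq_iff)
  have im: "(\<lambda>p. map p ?L) ` {p. p permutes UNIV} = {js. length js = ?n \<and> distinct js}"
  proof (intro equalityI subsetI)
    fix js assume "js \<in> {js :: 'n list. length js = ?n \<and> distinct js}"
    then have js: "length js = ?n" "distinct js" by auto
    define p where "p = (\<lambda>i. the (map_of (zip ?L js) i))"
    have "map p ?L = js"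
      by (rule nth_equalityI) (use js in \<open>auto simp: p_def map_of_zip_nth\<close>)
    then have "p ` UNIV = set js" by (metis enum_list(2) list.set_map)
    also have "\<dots> = UNIV" using js by (metis card_subset_eq distinct_card finite subset_UNIV)
    finally have "bij p" using finite_UNIV_surj_inj[of p] by (simp add: bij_def)
    then have "p permutes UNIV" by (intro bij_imp_permutes) auto
    then show "js \<in> (\<lambda>p. map p ?L) ` {p. p permutes UNIV}" using \<open>map p ?L = js\<close> by blast
  qed (auto simp: distinct_map permutes_inj inj_on_subset[OF permutes_inj])
  have "\<alpha> (map v ?L) = (\<Sum>js | length js = ?n. prod_list (map2 (\<lambda>v i. v $ i) (map v ?L) js) * \<alpha> (map ax js))"
    by (rule multilinear_expand) (use \<alpha> alternating_imp_multilinear in auto)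
  also have "\<dots> = (\<Sum>js | length js = ?n \<and> distinct js. prod_list (map2 (\<lambda>v i. v $ i) (map v ?L) js) * \<alpha> (map ax js))"
    by (rule sum.mono_neutral_right) (auto simp: alternating_not_distinct[OF \<alpha>])
  also have "\<dots> = (\<Sum>p | p permutes UNIV. prod_list (map2 (\<lambda>v i. v $ i) (map v ?L) (map p ?L)) * \<alpha> (map ax (map p ?L)))"
    unfolding im[symmetric] by (subst sum.reindex[OF inj]) simp
  also have "\<dots> = (\<Sum>p | p permutes UNIV. of_int (sign p) * (\<Prod>i\<in>UNIV. v i $ p i) * \<alpha> (map ax ?L))"
  proof (rule sum.cong[OF refl])
    fix p :: "'n \<Rightarrow> 'n" assume "p \<in> {p. p permutes UNIV}"
    then have "\<alpha> (map ax (map p ?L)) = of_int (sign p) * \<alpha> (map ax ?L)"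
      using alternating_permute_map[OF \<alpha>, of ?L p ax] by simp
    moreover have "map2 (\<lambda>v i. v $ i) (map v ?L) (map p ?L) = map (\<lambda>i. v i $ p i) ?L"
      by (rule nth_equalityI) auto
    moreover have "prod_list (map (\<lambda>i. v i $ p i) ?L) = (\<Prod>i\<in>UNIV. v i $ p i)"
      using prod.distinct_set_conv_list[of ?L "\<lambda>i. v i $ p i"] by simp
    ultimately show "prod_list (map2 (\<lambda>v i. v $ i) (map v ?L) (map p ?L)) * \<alpha> (map ax (map p ?L)) =
      of_int (sign p) * (\<Prod>i\<in>UNIV. v i $ p i) * \<alpha> (map ax ?L)" by simp
  qed
  finally show ?thesis by (simp add: det_def sum_distrib_right)
qed

lemma alternating_top_map:
  fixes \<alpha> :: "'n::{finite,wellorder} altform"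
  assumes "alternating CARD('n) \<alpha>" "linear T"
  shows "\<alpha> (map T (map ax enum_list)) = det (matrix T) * \<alpha> (map ax enum_list)"
proof -
  have "(\<chi> i. T (ax i)) = transpose (matrix T)" by (simp add: matrix_def transpose_def vec_eq_iff)
  then show ?thesis
    using alternating_top[OF assms(1), of "\<lambda>i. T (ax i)"] by (simp add: det_transpose o_def)
qed

section \<open>Wedge products\<close>

lemma permute_list_update:
  assumes "p permutes {..<length vs}" "i < length vs"
  shows "permute_list p (vs[i := v]) = (permute_list p vs)[inv p i := v]"
proof (rule nth_equalityI)
  fix r assume "r < length (permute_list p (vs[i := v]))"
  then have r: "r < length vs" by simp
  have "p r = i \<longleftrightarrow> r = inv p i" using permutes_inv_eq[OF assms(1)] by metis
  moreover have "inv p i < length vs" using permutes_in_image[OF permutes_inv[OF assms(1)], of i] assms(2) by simp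
  moreover have "p r < length vs" using permutes_in_image[OF assms(1), of r] r by simp
  ultimately show "permute_list p (vs[i := v]) ! r = (permute_list p vs)[inv p i := v] ! r"
    using assms r by (auto simp: permute_list_nth nth_list_update)
qed simp

text \<open>Linearity: under \<open>p\<close> the slot \<open>i\<close> moves to
  \<open>inv p i\<close>, which lies in the argument list of exactly one factor. Alternation: if
  \<open>vs ! i = vs ! j\<close>, composing with the transposition of \<open>i\<close> and
  \<open>j\<close> preserves the permuted list and reverses the sign, so the sum equals its own
  negative.\<close>

lemma wedge_alternating:
  assumes \<alpha>: "multilinear k \<alpha>" and \<beta>: "multilinear l \<beta>"
  shows "alternating (k + l) (wedge k l \<alpha> \<beta>)"
  unfolding alternating_def
proof (intro conjI allI impI)
  show "wedge k l \<alpha> \<beta> vs = 0" if "length vs \<noteq> k + l" for vs using that by (simp add: wedge_def)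
  show "linear (\<lambda>v. wedge k l \<alpha> \<beta> (vs[i := v]))" if vs: "length vs = k + l" and i: "i < k + l" for vs i
  proof -
    have "linear (\<lambda>v. of_int (sign p) * \<alpha> (take k (permute_list p (vs[i := v]))) * \<beta> (drop k (permute_list p (vs[i := v]))))"
      if p: "p permutes {..<k + l}" for p
    proof -
      define j where "j = inv p i"
      have eq: "permute_list p (vs[i := v]) = (permute_list p vs)[j := v]" for v
        unfolding j_def by (rule permute_list_update) (use p vs i in auto)
      have j: "j < k + l" using permutes_in_image[OF permutes_inv[OF p], of i] i by (simp add: j_def)
      show ?thesis
      proof (cases "j < k")
        case True
        then have "linear (\<lambda>v. \<alpha> ((take k (permute_list p vs))[j := v]))"
          using \<alpha> vs unfolding multilinear_def by auto
        then have "linear (\<lambda>v. (of_int (sign p) * \<beta> (drop k (permute_list p vs))) *\<^sub>R \<alpha> ((take k (permute_list p vs))[j := v]))"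
          by (rule linear_compose_scale_right)
        then show ?thesis using True by (simp add: eq take_update_swap drop_update_cancel mult.commute mult.left_commute)
      next
        case False
        then have "linear (\<lambda>v. \<beta> ((drop k (permute_list p vs))[j - k := v]))"
          using \<beta> vs j unfolding multilinear_def by auto
        then have "linear (\<lambda>v. (of_int (sign p) * \<alpha> (take k (permute_list p vs))) *\<^sub>R \<beta> ((drop k (permute_list p vs))[j - k := v]))"
          by (rule linear_compose_scale_right)
        then show ?thesis using False by (simp add: eq take_update_cancel drop_update_swap)
      qed
    qed
    then have "linear (\<lambda>v. (1 / (fact k * fact l)) *\<^sub>R (\<Sum>p | p permutes {..<k + l}. of_int (sign p) * \<alpha> (take k (permute_list p (vs[i := v]))) * \<beta> (drop k (permute_list p (vs[i := v])))))"
      by (intro linear_compose_scale_right linear_compose_sum) auto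
    then show ?thesis using vs by (simp add: wedge_def)
  qed
  show "wedge k l \<alpha> \<beta> vs = 0" if vs: "length vs = k + l" and ij: "i < j" "j < k + l" "vs ! i = vs ! j" for vs i j
  proof -
    let ?t = "Transposition.transpose i j"
    define g where "g = (\<lambda>p. of_int (sign p) * \<alpha> (take k (permute_list p vs)) * \<beta> (drop k (permute_list p vs)))"
    have t: "?t permutes {..<k + l}" using ij by (intro permutes_swap_id) auto
    have "g (?t \<circ> p) = - g p" if p: "p permutes {..<k + l}" for p
    proof -
      have "vs ! ?t r = vs ! r" for r using ij by (auto simp: Transposition.transpose_def)
      then have "permute_list (?t \<circ> p) vs = permute_list p vs" by (simp add: permute_list_def)
      moreover have "sign (?t \<circ> p) = - sign p"
      proof -
        have "permutation p" using p permutation_permutes by blast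
        then show ?thesis using ij by (simp add: sign_compose sign_swap_id permutation_swap_id)
      qed
      ultimately show ?thesis by (simp add: g_def)
    qed
    then have "(\<Sum>p | p permutes {..<k + l}. g p) = (\<Sum>p | p permutes {..<k + l}. - g p)"
      by (intro sum.reindex_bij_witness[of _ "\<lambda>p. ?t \<circ> p" "\<lambda>p. ?t \<circ> p"])
        (auto simp: permutes_compose[OF _ t] o_assoc)
    then have "(\<Sum>p | p permutes {..<k + l}. g p) = 0" by (simp add: sum_negf)
    then show ?thesis by (simp add: wedge_def g_def)
  qed
qed

lemma wedge_map:
  "wedge k l (\<lambda>vs. \<alpha> (map T vs)) (\<lambda>vs. \<beta> (map T vs)) vs = wedge k l \<alpha> \<beta> (map T vs)"
  unfolding wedge_def by (auto simp: permute_list_map take_map drop_map intro!: sum.cong)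

lemma wedge_add_left: "wedge k l (\<alpha> + \<alpha>') \<beta> vs = wedge k l \<alpha> \<beta> vs + wedge k l \<alpha>' \<beta> vs"
  by (simp add: wedge_def algebra_simps sum.distrib add_divide_distrib)

lemma wedge_scale_left: "wedge k l (\<lambda>vs. r * \<alpha> vs) \<beta> vs = r * wedge k l \<alpha> \<beta> vs"
  by (simp add: wedge_def sum_distrib_left mult.assoc mult.left_commute)

lemma wedge_scale_right: "wedge k l \<alpha> (\<lambda>vs. r * \<beta> vs) vs = r * wedge k l \<alpha> \<beta> vs"
  by (simp add: wedge_def sum_distrib_left mult.assoc mult.left_commute)

text \<open>Rows of the matrix are indexed by \<open>'n\<close> and arguments by position, so
  \<open>inv_into\<close> finds the position of each coordinate in \<open>enum_list\<close>. This
  normalises the value on the standard basis to 1.\<close>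

definition vol_form :: "'n::{finite,wellorder} altform" where
  "vol_form vs = (if length vs = CARD('n) then det (\<chi> i. vs ! (inv_into {..<CARD('n)} ((!) enum_list) i)) else 0)"

lemma vol_form_alternating: "alternating CARD('n) (vol_form :: 'n::{finite,wellorder} altform)"
proof -
  let ?L = "enum_list :: 'n list"
  define pos where "pos = inv_into {..<CARD('n)} ((!) ?L)"
  have im: "(!) ?L ` {..<CARD('n)} = UNIV" using nth_image[of "CARD('n)" ?L] by (simp add: lessThan_atLeast0)
  have pos: "pos i < CARD('n)" "?L ! pos i = i" for i
    using inv_into_into[of i "(!) ?L" "{..<CARD('n)}"] f_inv_into_f[of i "(!) ?L" "{..<CARD('n)}"] im
    by (auto simp: pos_def)
  have pos_nth: "pos (?L ! r) = r" if "r < CARD('n)" for r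
    using that pos[of "?L ! r"] by (simp add: nth_eq_iff_index_eq)
  have v: "vol_form vs = det (\<chi> i. vs ! pos i)" if "length vs = CARD('n)" for vs
    using that by (simp add: vol_form_def pos_def)
  show ?thesis
    unfolding alternating_def
  proof (intro conjI allI impI)
    show "vol_form vs = (0::real)" if "length vs \<noteq> CARD('n)" for vs :: "(real^'n::_) list"
      using that by (simp add: vol_form_def)
    show "linear (\<lambda>v. vol_form (vs[r := v]) :: real)" if vs: "length vs = CARD('n)" "r < CARD('n)" for vs :: "(real^'n::_) list" and r
    proof -
      have eq: "vol_form (vs[r := v]) = det (\<chi> i. if i = ?L ! r then v else vs ! pos i)" for v :: "real^'n::_"
      proof -
        have "(\<chi> i. vs[r := v] ! pos i) = (\<chi> i. if i = ?L ! r then v else vs ! pos i)"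
          using vs pos pos_nth by (auto simp: vec_eq_iff nth_list_update)
        then show ?thesis using vs by (simp add: v)
      qed
      show ?thesis
      proof (rule linearI)
        show "vol_form (vs[r := x + y]) = vol_form (vs[r := x]) + vol_form (vs[r := y])" for x y
          unfolding eq using det_row_add[of "?L ! r" "\<lambda>_. x" "\<lambda>_. y" "\<lambda>i. vs ! pos i"] .
        show "vol_form (vs[r := c *\<^sub>R x]) = c *\<^sub>R vol_form (vs[r := x])" for c x
          unfolding eq using det_row_mul[of "?L ! r" c "\<lambda>_. x" "\<lambda>i. vs ! pos i"]
          by (simp add: scalar_mult_eq_scaleR cong: if_cong)
      qed
    qed
    show "vol_form vs = (0::real)" if vs: "length vs = CARD('n)" "i < j" "j < CARD('n)" "vs ! i = vs ! j"
      for vs :: "(real^'n::_) list" and i j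
    proof -
      have "?L ! i \<noteq> ?L ! j" using vs by (simp add: nth_eq_iff_index_eq)
      moreover have "row (?L ! i) (\<chi> i. vs ! pos i) = row (?L ! j) (\<chi> i. vs ! pos i)"
        using vs by (simp add: row_def pos_nth)
      ultimately show ?thesis using vs(1) v det_identical_rows by metis
    qed
  qed
qed

lemma vol_form_basis: "vol_form (map ax (enum_list :: 'n::{finite,wellorder} list)) = 1"
proof -
  let ?L = "enum_list :: 'n list"
  have im: "(!) ?L ` {..<CARD('n)} = UNIV" using nth_image[of "CARD('n)" ?L] by (simp add: lessThan_atLeast0)
  have "map ax ?L ! (inv_into {..<CARD('n)} ((!) ?L) i) = (ax i :: real^'n::_)" for i
    using inv_into_into[of i "(!) ?L" "{..<CARD('n)}"] f_inv_into_f[of i "(!) ?L" "{..<CARD('n)}"] im by auto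
  then have "vol_form (map ax ?L) = det ((\<chi> i. ax i) :: ((real,'n) vec,'n) vec)" by (simp add: vol_form_def)
  also have "((\<chi> i. ax i) :: ((real,'n) vec,'n) vec) = mat 1" by (auto simp: vec_eq_iff mat_def axis_def)
  finally show ?thesis by simp
qed

text \<open>The contraction of \<open>vol_form\<close> with the coordinate vectors of
  \<open>I\<close>. Its wedge with a form isolates the coefficient at \<open>I\<close> up to a
  positive factor, which lets test forms single out coefficients.\<close>

definition dual_form :: "'n::{finite,wellorder} list \<Rightarrow> 'n altform" where
  "dual_form I ws = vol_form (map ax I @ ws)"

lemma dual_form_alternating:
  assumes "length (I :: 'n::{finite,wellorder} list) + m = CARD('n)"
  shows "alternating m (dual_form I)"
  unfolding alternating_def
proof (intro conjI allI impI)
  let ?I = "map ax I :: (real^'n::_) list"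
  note va = vol_form_alternating[where 'n='n, unfolded alternating_def]
  show "dual_form I vs = 0" if "length vs \<noteq> m" for vs
    using that assms by (simp add: dual_form_def vol_form_def)
  show "linear (\<lambda>v. dual_form I (vs[i := v]))" if "length vs = m" "i < m" for vs i
  proof -
    have "?I @ vs[i := v] = (?I @ vs)[length I + i := v]" for v by (simp add: list_update_append)
    moreover have "length (?I @ vs) = CARD('n)" "length I + i < CARD('n)" using that assms by auto
    ultimately show ?thesis unfolding dual_form_def using va by presburger
  qed
  show "dual_form I vs = 0" if "length vs = m" "i < j" "j < m" "vs ! i = vs ! j" for vs i j
  proof -
    have "length (?I @ vs) = CARD('n)" "length I + i < length I + j" "length I + j < CARD('n)"
      "(?I @ vs) ! (length I + i) = (?I @ vs) ! (length I + j)"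
      using that assms by (auto simp: nth_append)
    then show ?thesis unfolding dual_form_def using va by blast
  qed
qed

text \<open>In the shuffle sum for \<open>\<alpha> \<and> dual_form I\<close> every term is either \<open>0\<close> or \<open>\<alpha>(e\<^sub>I)\<close>.\<close>

lemma wedge_dual_form:
  fixes I :: "'n::{finite,wellorder} list"
  assumes Im: "length I = k" "k + m = CARD('n)" and I: "distinct I"
  shows "\<exists>c>0. \<forall>\<alpha>. alternating k \<alpha> \<longrightarrow> wedge k m \<alpha> (dual_form I) (map ax enum_list) = c * \<alpha> (map ax I)"
proof -
  let ?L = "enum_list :: 'n list"
  \<comment> \<open>The permutations whose last \<open>m\<close> labels avoid \<open>I\<close>; as
    \<open>I\<close> has \<open>k\<close> distinct labels, their first \<open>k\<close> labels are a
    rearrangement of \<open>I\<close>. For all other permutations \<open>dual_form I\<close> is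
    evaluated with a repeated vector.\<close>
  define Q where "Q = {p. p permutes {..<k + m} \<and> set (drop k (permute_list p ?L)) \<inter> set I = {}}"
  have fin: "finite Q" unfolding Q_def by (rule finite_subset[OF _ finite_permutations[of "{..<k+m}"]]) auto
  obtain J where J: "distinct J" "set J = - set I" using finite_distinct_list[of "- set I"] by auto
  have "mset (I @ J) = mset ?L"
    using I J by (subst set_eq_iff_mset_eq_distinct[symmetric]) auto
  then obtain p0 where "p0 permutes {..<length ?L}" "permute_list p0 ?L = I @ J"
    by (rule mset_eq_permutation)
  then have "p0 \<in> Q" using Im J by (simp add: Q_def)
  then have "card Q > 0" using fin card_gt_0_iff by blast
  moreover have "wedge k m \<alpha> (dual_form I) (map ax ?L) = card Q / (fact k * fact m) * \<alpha> (map ax I)"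
    if \<alpha>: "alternating k \<alpha>" for \<alpha>
  proof -
    define t where "t = (\<lambda>p. of_int (sign p) * \<alpha> (map ax (take k (permute_list p ?L))) *
       dual_form I (map ax (drop k (permute_list p ?L))))"
    have t0: "t p = 0" if p: "p permutes {..<k + m}" "p \<notin> Q" for p
    proof -
      have "\<not> distinct (I @ drop k (permute_list p ?L))" using p by (auto simp: Q_def)
      then have "vol_form (map ax (I @ drop k (permute_list p ?L))) = 0"
        by (rule alternating_not_distinct[OF vol_form_alternating])
      then show ?thesis by (simp add: t_def dual_form_def)
    qed
    have t1: "t p = \<alpha> (map ax I)" if pQ: "p \<in> Q" for p
    proof -
      define P1 P2 where "P1 = take k (permute_list p ?L)" and "P2 = drop k (permute_list p ?L)"
      have p: "p permutes {..<k + m}" and disj: "set P2 \<inter> set I = {}" using pQ by (auto simp: Q_def P2_def)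
      have P: "P1 @ P2 = permute_list p ?L" by (simp add: P1_def P2_def)
      have len: "length P1 = k" "length P2 = m" using Im by (simp_all add: P1_def P2_def)
      have pl: "mset (P1 @ P2) = mset ?L" unfolding P using p Im by (intro mset_permute_list) simp
      have dP: "distinct (P1 @ P2)" "set (P1 @ P2) = UNIV"
        using pl mset_eq_imp_distinct_iff mset_eq_setD enum_list by metis+
      have "set I \<subseteq> set P1" using disj dP by auto
      moreover have "card (set I) = card (set P1)" using I dP Im len distinct_card by (metis distinct_append)
      ultimately have "set I = set P1" by (intro card_subset_eq) auto
      then have "mset P1 = mset I" using I dP by (metis distinct_append set_eq_iff_mset_eq_distinct)
      then obtain s where s: "s permutes {..<length I}" "permute_list s I = P1"
        by (rule mset_eq_permutation)
      have sn: "s permutes {..<length (map ax (I @ P2))}" using s(1) by (rule permutes_subset) auto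
      have "permute_list s (I @ P2) = P1 @ P2"
      proof (rule nth_equalityI)
        fix r assume r: "r < length (permute_list s (I @ P2))"
        show "permute_list s (I @ P2) ! r = (P1 @ P2) ! r"
        proof (cases "r < k")
          case True
          then have "s r < k" using permutes_in_image[OF s(1), of r] Im by simp
          then show ?thesis
            using True s r Im len sn by (simp add: permute_list_nth nth_append flip: s(2))
        next
          case False
          then have "s r = r" using s(1) Im by (simp add: permutes_def)
          then show ?thesis using False r Im len sn by (simp add: permute_list_nth nth_append)
        qed
      qed (use len Im in simp)
      \<comment> \<open>Three signs enter: \<open>sign p\<close> from the wedge,
        \<open>sign s\<close> from rearranging \<open>P1\<close> into \<open>I\<close> inside
        \<alpha>, and \<open>sign s * sign p\<close> from \<open>dual_form I\<close>. Their product
        is 1, so all terms indexed by \<open>Q\<close> coincide and none cancel.\<close>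
      then have "vol_form (map ax (P1 @ P2)) = of_int (sign s) * vol_form (map ax (I @ P2))"
        using alternating_permute_list[OF vol_form_alternating sn] sn
        by (simp add: permute_list_map del: map_append)
      moreover have "\<alpha> (map ax P1) = of_int (sign s) * \<alpha> (map ax I)"
        using alternating_permute_list[OF \<alpha>, of s "map ax I"] s by (simp add: permute_list_map)
      moreover have "vol_form (map ax (P1 @ P2)) = of_int (sign p)"
        using alternating_permute_list[OF vol_form_alternating, of p "map ax ?L"] p Im P
        by (simp add: permute_list_map vol_form_basis del: map_append)
      moreover have "t p = of_int (sign p) * \<alpha> (map ax P1) * vol_form (map ax (I @ P2))"
        by (simp add: t_def P1_def P2_def dual_form_def)
      moreover have "of_int (sign p) * of_int (sign p) = (1::real)"
        by (simp flip: of_int_mult)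
      ultimately show ?thesis by (metis (no_types, lifting) mult.assoc mult.commute mult_1)
    qed
    have "(\<Sum>p | p permutes {..<k + m}. t p) = (\<Sum>p\<in>Q. t p)"
      by (rule sum.mono_neutral_right) (use t0 in \<open>auto simp: Q_def finite_permutations\<close>)
    also have "\<dots> = card Q * \<alpha> (map ax I)" by (simp add: t1)
    finally have "(\<Sum>p | p permutes {..<k + m}. t p) = card Q * \<alpha> (map ax I)" .
    moreover have "(\<Sum>p | p permutes {..<k + m}. of_int (sign p) * \<alpha> (take k (permute_list p (map ax ?L))) *
        dual_form I (drop k (permute_list p (map ax ?L)))) = (\<Sum>p | p permutes {..<k + m}. t p)"
      by (rule sum.cong[OF refl]) (use Im in \<open>simp add: t_def permute_list_map take_map drop_map\<close>)
    ultimately show ?thesis using Im by (simp add: wedge_def)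
  qed
  ultimately show ?thesis by (intro exI[of _ "card Q / (fact k * fact m)"]) auto
qed

section \<open>Inner products and singular values\<close>

definition inner_form :: "('v::real_vector \<Rightarrow> 'v \<Rightarrow> real) \<Rightarrow> bool" where
  "inner_form G \<longleftrightarrow> bilinear G \<and> (\<forall>u v. G u v = G v u) \<and> (\<forall>v. v \<noteq> 0 \<longrightarrow> 0 < G v v)"

lemma inner_form_linear:
  assumes "inner_form G" shows "linear (G u)" "linear (\<lambda>v. G v w)"
  using assms unfolding inner_form_def bilinear_def by auto

lemma linear_lincomb: "linear f \<Longrightarrow> f (\<Sum>i\<in>A. c i *\<^sub>R x i) = (\<Sum>i\<in>A. c i *\<^sub>R f (x i))"
  by (simp add: linear_sum linear_cmul)

text \<open>If \<open>a\<close> were nonzero, the choice \<open>t = - a / d\<close> with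
  \<open>d\<close> positive and larger than \<open>c\<close> would give a value below
  \<open>- (a\<^sup>2 / d)\<close>.\<close>

lemma psd_kernel:
  fixes a c :: real
  assumes "\<And>t. 0 \<le> 2 * t * a + t\<^sup>2 * c" shows "a = 0"
proof (rule ccontr)
  assume "a \<noteq> 0"
  define d where "d = \<bar>c\<bar> + 1"
  have d: "d > 0" "c < d" by (auto simp: d_def)
  have "0 \<le> 2 * (- a / d) * a + (- a / d)\<^sup>2 * c" by (rule assms)
  also have "\<dots> < 2 * (- a / d) * a + (- a / d)\<^sup>2 * d"
    using \<open>a \<noteq> 0\<close> d by (intro add_strict_left_mono mult_strict_left_mono) auto
  also have "\<dots> = - (a\<^sup>2 / d)" using d by (simp add: power2_eq_square field_simps)
  finally show False using d by (simp add: zero_less_divide_iff) (smt (verit) zero_le_power2 divide_nonneg_pos)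
qed

text \<open>Spectral theorem by the Rayleigh quotient. Let \<open>l\<close> be the maximum of
  \<open>B x x / G x x\<close>, attained at \<open>v0\<close>. Then \<open>C = l * G - B\<close> is
  positive semidefinite on \<open>S\<close> and vanishes at \<open>v0\<close>, so \<open>v0\<close>
  lies in its kernel and \<open>B v0\<close> equals \<open>l * G v0\<close> on \<open>S\<close>. The
  induction continues in the \<open>G\<close>-orthogonal complement, which is then also
  \<open>B\<close>-orthogonal to \<open>v0\<close>.\<close>

lemma simultaneous_diagonalization_subspace:
  fixes G B :: "'v::euclidean_space \<Rightarrow> 'v \<Rightarrow> real"
  assumes G: "inner_form G" and B: "bilinear B" "\<And>u v. B u v = B v u" and "subspace S"
  shows "\<exists>X\<subseteq>S. finite X \<and> card X = dim S \<and> (\<forall>x\<in>X. G x x = 1) \<and>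
    (\<forall>x\<in>X. \<forall>y\<in>X. x \<noteq> y \<longrightarrow> G x y = 0 \<and> B x y = 0)"
  using assms(4)
proof (induction "dim S" arbitrary: S)
  case 0
  then show ?case by (intro exI[of _ "{}"]) auto
next
  case (Suc d)
  note S = Suc.prems
  have bG: "bilinear G" and symG: "\<And>u v. G u v = G v u" and posG: "\<And>v. v \<noteq> 0 \<Longrightarrow> 0 < G v v"
    using G by (auto simp: inner_form_def)
  have bbG: "bounded_bilinear G" and bbB: "bounded_bilinear B"
    using bG B(1) by (simp_all add: bilinear_conv_bounded_bilinear)
  \<comment> \<open>The Euclidean unit sphere provides compactness; the quotient is invariant under
    scaling, so its maximum on \<open>K\<close> is its maximum over all nonzero vectors of
    \<open>S\<close>.\<close>
  define K where "K = S \<inter> sphere 0 1"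
  have "compact K" unfolding K_def using closed_subspace[OF S] by (intro closed_Int_compact) auto
  have "S \<noteq> {0}" using Suc.hyps(2) by auto
  then obtain s where s: "s \<in> S" "s \<noteq> 0" using S subspace_0 by blast
  then have "s /\<^sub>R norm s \<in> K" using S by (simp add: K_def subspace_scale)
  then have "K \<noteq> {}" by blast
  have nz: "x \<noteq> 0" if "x \<in> K" for x using that by (auto simp: K_def)
  have "continuous_on K (\<lambda>x. B x x / G x x)"
    using posG nz
    by (intro continuous_on_divide bounded_bilinear.continuous_on[OF bbG] bounded_bilinear.continuous_on[OF bbB])
      (auto simp: less_imp_neq[THEN not_sym] intro: continuous_on_id less_imp_neq[THEN not_sym])
  then obtain v0 where v0: "v0 \<in> K" "\<And>x. x \<in> K \<Longrightarrow> B x x / G x x \<le> B v0 v0 / G v0 v0"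
    using continuous_attains_sup[OF \<open>compact K\<close> \<open>K \<noteq> {}\<close>] by blast
  define l where "l = B v0 v0 / G v0 v0"
  define C where "C = (\<lambda>x y. l * G x y - B x y)"
  have C0: "C x x \<ge> 0" if x: "x \<in> S" for x
  proof (cases "x = 0")
    case True
    then show ?thesis using bilinear_lzero[OF bG] bilinear_lzero[OF B(1)] by (simp add: C_def)
  next
    case False
    define y where "y = x /\<^sub>R norm x"
    have "y \<in> K" using False S x by (simp add: K_def y_def subspace_scale)
    then have "B y y \<le> l * G y y" using v0(2) posG[OF nz] by (simp add: l_def divide_le_eq)
    then have "C y y \<ge> 0" by (simp add: C_def)
    moreover have "x = norm x *\<^sub>R y" using False by (simp add: y_def)
    moreover have "C (r *\<^sub>R y) (r *\<^sub>R y) = r\<^sup>2 * C y y" for r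
      by (simp add: C_def bilinear_lmul[OF bG] bilinear_rmul[OF bG] bilinear_lmul[OF B(1)] bilinear_rmul[OF B(1)]
          power2_eq_square algebra_simps)
    ultimately have "C x x = (norm x)\<^sup>2 * C y y" "C y y \<ge> 0" by metis+
    then show ?thesis by simp
  qed
  have v0S: "v0 \<in> S" and Gv0: "G v0 v0 > 0" using v0(1) posG nz by (auto simp: K_def)
  have Cv0: "C v0 v0 = 0" using Gv0 by (simp add: C_def l_def)
  have C_ortho: "C v0 w = 0" if w: "w \<in> S" for w
  proof (rule psd_kernel)
    fix t
    have "v0 + t *\<^sub>R w \<in> S" using S v0S w by (simp add: subspace_add subspace_scale)
    from C0[OF this] have "0 \<le> C (v0 + t *\<^sub>R w) (v0 + t *\<^sub>R w)" .
    also have "\<dots> = C v0 v0 + 2 * t * C v0 w + t\<^sup>2 * C w w"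
      unfolding C_def
      by (simp add: bilinear_ladd[OF bG] bilinear_radd[OF bG] bilinear_lmul[OF bG] bilinear_rmul[OF bG]
          bilinear_ladd[OF B(1)] bilinear_radd[OF B(1)] bilinear_lmul[OF B(1)] bilinear_rmul[OF B(1)]
          symG[of w v0] B(2)[of w v0] power2_eq_square algebra_simps)
    finally show "0 \<le> 2 * t * C v0 w + t\<^sup>2 * C w w" using Cv0 by simp
  qed
  define v where "v = v0 /\<^sub>R sqrt (G v0 v0)"
  have vS: "v \<in> S" using S v0S by (simp add: v_def subspace_scale)
  have Gv: "G v v = 1"
    using Gv0 by (simp add: v_def bilinear_lmul[OF bG] bilinear_rmul[OF bG] field_simps flip: power2_eq_square)
  have Bv: "B v w = l * G v w" if "w \<in> S" for w
    using C_ortho[OF that] by (simp add: v_def C_def bilinear_lmul[OF bG] bilinear_lmul[OF B(1)])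
  define S' where "S' = {w \<in> S. G v w = 0}"
  have S': "subspace S'"
    unfolding S'_def using S
    by (auto simp: subspace_def bilinear_radd[OF bG] bilinear_rmul[OF bG] bilinear_rzero[OF bG])
  have "v \<notin> S'" using Gv by (simp add: S'_def)
  have sub: "S' \<subseteq> S" by (auto simp: S'_def)
  have "S \<subseteq> span (insert v S')"
  proof
    fix w assume w: "w \<in> S"
    have "G v (w - G v w *\<^sub>R v) = 0" by (simp add: bilinear_rsub[OF bG] bilinear_rmul[OF bG] Gv)
    then have "w - G v w *\<^sub>R v \<in> S'" using S w vS by (simp add: S'_def subspace_diff subspace_scale)
    then have "(w - G v w *\<^sub>R v) + G v w *\<^sub>R v \<in> span (insert v S')"
      by (intro span_add span_scale span_base) auto
    then show "w \<in> span (insert v S')" by simp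
  qed
  moreover have "span (insert v S') \<subseteq> S" using sub vS S by (intro span_minimal) auto
  ultimately have "span (insert v S') = S" by simp
  then have "dim S = dim (insert v S')" by (metis dim_span)
  also have "\<dots> = Suc (dim S')" using \<open>v \<notin> S'\<close> S' by (simp add: dim_insert span_eq_iff[THEN iffD2])
  finally have "d = dim S'" using Suc.hyps(2) by simp
  then obtain X where X: "X \<subseteq> S'" "finite X" "card X = d" "\<forall>x\<in>X. G x x = 1"
    "\<forall>x\<in>X. \<forall>y\<in>X. x \<noteq> y \<longrightarrow> G x y = 0 \<and> B x y = 0"
    using Suc.hyps(1)[OF _ S'] by metis
  have o: "G v x = 0 \<and> B v x = 0 \<and> G x v = 0 \<and> B x v = 0" if "x \<in> X" for x
  proof -
    have x: "x \<in> S" "G v x = 0" using that X(1) by (auto simp: S'_def)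
    then have "B v x = 0" using Bv by simp
    then show ?thesis using x symG[of x v] B(2)[of x v] by simp
  qed
  have "v \<notin> X" using X(1) \<open>v \<notin> S'\<close> by blast
  then show ?case
    using X sub vS Gv o Suc.hyps(2) by (intro exI[of _ "insert v X"]) auto
qed

lemma simultaneous_diagonalization:
  fixes G B :: "real^'n \<Rightarrow> real^'n \<Rightarrow> real"
  assumes "inner_form G" and "bilinear B" "\<And>u v. B u v = B v u"
  shows "\<exists>E. orthonormal_frame G E \<and> (\<forall>i j. i \<noteq> j \<longrightarrow> B (E i) (E j) = 0)"
proof -
  obtain X where X: "finite X" "card X = CARD('n)" "\<forall>x\<in>X. G x x = 1"
    "\<forall>x\<in>X. \<forall>y\<in>X. x \<noteq> y \<longrightarrow> G x y = 0 \<and> B x y = 0"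
    using simultaneous_diagonalization_subspace[OF assms subspace_UNIV] by (auto simp: dim_UNIV)
  then obtain E where E: "bij_betw E (UNIV :: 'n set) X"
    by (metis finite_same_card_bij finite)
  then have "E i \<in> X" "E i = E j \<longleftrightarrow> i = j" for i j by (auto simp: bij_betw_def inj_on_def)
  then show ?thesis using X by (intro exI[of _ E]) (auto simp: orthonormal_frame_def)
qed

lemma orthonormal_frame_exists: "inner_form G \<Longrightarrow> \<exists>E. orthonormal_frame G E"
  using simultaneous_diagonalization[of G G] by (auto simp: inner_form_def)

text \<open>Pairing with \<open>E j\<close> recovers the coefficients of a combination, so the map
  from coefficients to vectors is injective and, by equality of dimensions, surjective.\<close>

lemma orthonormal_expand:
  fixes E :: "'n::finite \<Rightarrow> real^'n"
  assumes G: "inner_form G" and E: "orthonormal_frame G E"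
  shows "v = (\<Sum>i\<in>UNIV. G v (E i) *\<^sub>R E i)"
proof -
  define F where "F = (\<lambda>c::real^'n. \<Sum>i\<in>UNIV. c $ i *\<^sub>R E i)"
  have lin: "linear F" unfolding F_def
    by (intro linearI) (auto simp: algebra_simps sum.distrib scaleR_sum_right)
  have co: "G (F c) (E j) = c $ j" for c j
  proof -
    have "G (F c) (E j) = (\<Sum>i\<in>UNIV. c $ i * G (E i) (E j))"
      unfolding F_def by (simp add: linear_lincomb[OF inner_form_linear(2)[OF G, of "E j"]])
    moreover have "G (E i) (E j) = (if i = j then 1 else 0)" for i using E by (simp add: orthonormal_frame_def)
    ultimately show ?thesis by (simp add: if_distrib cong: if_cong)
  qed
  have "inj F"
  proof (rule injI)
    fix x y assume "F x = F y"
    then show "x = y" using co by (metis vec_eq_iff)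
  qed
  then have "surj F" using linear_injective_imp_surjective lin by blast
  then obtain c where "v = F c" by blast
  then show ?thesis using co by (simp add: F_def)
qed

lemma sum_prod_list_map2_two:
  fixes a b :: "'j::finite \<Rightarrow> 'i \<Rightarrow> real"
  assumes "length is = k" "length ls = k"
  shows "(\<Sum>js | length js = k. prod_list (map2 a js is) * prod_list (map2 b js ls)) =
     prod_list (map2 (\<lambda>i l. \<Sum>j\<in>UNIV. a j i * b j l) is ls)"
  using assms
proof (induction k arbitrary: "is" ls)
  case 0
  have "{js :: 'j list. length js = 0} = {[]}" by auto
  with 0 show ?case by simp
next
  case (Suc k)
  then obtain i is' l ls' where eq: "is = i # is'" "ls = l # ls'" "length is' = k" "length ls' = k"
    by (metis length_Suc_conv)
  have "(\<Sum>js | length js = Suc k. prod_list (map2 a js is) * prod_list (map2 b js ls)) =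
    (\<Sum>j\<in>UNIV. \<Sum>js | length js = k. (a j i * b j l) * (prod_list (map2 a js is') * prod_list (map2 b js ls')))"
    by (simp add: sum_lists_Suc eq mult_ac)
  also have "\<dots> = (\<Sum>j\<in>UNIV. a j i * b j l) * prod_list (map2 (\<lambda>i l. \<Sum>j\<in>UNIV. a j i * b j l) is' ls')"
    by (simp add: sum_distrib_left[symmetric] sum_distrib_right Suc.IH[OF eq(3,4)])
  finally show ?case by (simp add: eq)
qed

text \<open>With \<open>P\<close> the pairings of \<open>e\<close> with the orthonormal frame and
  \<open>C\<close> the coefficients of \<open>E\<close> in \<open>e\<close>, the Gram matrix is
  \<open>P ** transpose P\<close> and \<open>C\<close> inverts \<open>P\<close>. Hence its inverse
  is \<open>transpose C ** C\<close>.\<close>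

lemma gram_inverse_frame:
  fixes E :: "'n::finite \<Rightarrow> real^'n" and e :: "'n \<Rightarrow> real^'n"
  assumes G: "inner_form G" and E: "orthonormal_frame G E"
    and c: "\<And>v. v = (\<Sum>i\<in>UNIV. c v i *\<^sub>R e i)"
  shows "invertible (gram G e)" "matrix_inv (gram G e) $ i $ l = (\<Sum>j\<in>UNIV. c (E j) i * c (E j) l)"
proof -
  define P where "P = (\<chi> i j. G (e i) (E j))"
  define C where "C = (\<chi> j i. c (E j) i)"
  have gr: "gram G e = P ** transpose P"
  proof -
    have "G (e i) (e l) = (\<Sum>j\<in>UNIV. G (e i) (E j) * G (e l) (E j))" for i l
    proof -
      have "G (e i) (e l) = G (e i) (\<Sum>j\<in>UNIV. G (e l) (E j) *\<^sub>R E j)"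
        using orthonormal_expand[OF G E, of "e l"] by simp
      also have "\<dots> = (\<Sum>j\<in>UNIV. G (e l) (E j) * G (e i) (E j))"
        by (simp add: linear_lincomb[OF inner_form_linear(1)[OF G, of "e i"]])
      finally show ?thesis by (simp add: mult.commute)
    qed
    then show ?thesis by (simp add: gram_def P_def matrix_matrix_mult_def transpose_def vec_eq_iff)
  qed
  have "C ** P = mat 1"
  proof -
    have "(\<Sum>i\<in>UNIV. c (E j) i * G (e i) (E m)) = (if j = m then 1 else 0)" for j m
    proof -
      have "(\<Sum>i\<in>UNIV. c (E j) i * G (e i) (E m)) = G (\<Sum>i\<in>UNIV. c (E j) i *\<^sub>R e i) (E m)"
        by (simp add: linear_lincomb[OF inner_form_linear(2)[OF G, of "E m"]])
      also have "\<dots> = G (E j) (E m)" using c[of "E j", symmetric] by simp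
      finally show ?thesis using E by (simp add: orthonormal_frame_def)
    qed
    then show ?thesis by (simp add: C_def P_def matrix_matrix_mult_def mat_def vec_eq_iff)
  qed
  then have PC: "P ** C = mat 1" by (simp add: matrix_left_right_inverse)
  have CtPt: "transpose C ** transpose P = mat 1" "transpose P ** transpose C = mat 1"
    using PC \<open>C ** P = mat 1\<close> by (simp_all flip: matrix_transpose_mul)
  have 1: "(transpose C ** C) ** gram G e = mat 1"
    unfolding gr using CtPt \<open>C ** P = mat 1\<close> by (metis matrix_mul_assoc matrix_mul_rid)
  then have 2: "gram G e ** (transpose C ** C) = mat 1" by (simp add: matrix_left_right_inverse)
  show "invertible (gram G e)" using 1 2 unfolding invertible_def by blast
  have "matrix_inv (gram G e) = transpose C ** C"
  proof -
    have "matrix_inv (gram G e) ** gram G e = mat 1"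
      unfolding matrix_inv_def by (rule someI2[of _ "transpose C ** C"]) (use 1 2 in auto)
    then show ?thesis using 2 by (metis matrix_mul_assoc matrix_mul_lid matrix_mul_rid)
  qed
  then show "matrix_inv (gram G e) $ i $ l = (\<Sum>j\<in>UNIV. c (E j) i * c (E j) l)"
    by (simp add: C_def matrix_matrix_mult_def transpose_def)
qed

text \<open>The right side does not mention \<open>E\<close>. This makes \<open>alt_norm\<close>
  independent of the selected frame and, for coordinate vectors \<open>e\<close>, expresses it
  through the metric coefficients and the components of the form.\<close>

lemma frame_sum_sq:
  fixes E :: "'n::finite \<Rightarrow> real^'n" and e :: "'n \<Rightarrow> real^'n"
  assumes G: "inner_form G" and E: "orthonormal_frame G E"
    and c: "\<And>v. v = (\<Sum>i\<in>UNIV. c v i *\<^sub>R e i)" and \<alpha>: "multilinear k \<alpha>"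
  shows "(\<Sum>js | length js = k. (\<alpha> (map E js))\<^sup>2) =
    (\<Sum>is | length is = k. \<Sum>ls | length ls = k.
       prod_list (map2 (\<lambda>i l. matrix_inv (gram G e) $ i $ l) is ls) * (\<alpha> (map e is) * \<alpha> (map e ls)))"
proof -
  let ?c = "\<lambda>j. c (E j)"
  have "(\<Sum>js | length js = k. (\<alpha> (map E js))\<^sup>2) =
    (\<Sum>js | length js = k. \<Sum>is | length is = k. \<Sum>ls | length ls = k.
      (prod_list (map2 ?c js is) * prod_list (map2 ?c js ls)) * (\<alpha> (map e is) * \<alpha> (map e ls)))"
  proof (rule sum.cong[OF refl])
    fix js :: "'n list" assume js: "js \<in> {js. length js = k}"
    have m2: "map2 c (map E js) is = map2 ?c js is" for "is" by (simp add: zip_map1 case_prod_unfold o_def)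
    have "\<alpha> (map E js) = (\<Sum>is | length is = k. prod_list (map2 ?c js is) * \<alpha> (map e is))"
      using multilinear_expand_gen[OF \<alpha> c, of "map E js"] js by (simp add: m2)
    then show "(\<alpha> (map E js))\<^sup>2 = (\<Sum>is | length is = k. \<Sum>ls | length ls = k.
      (prod_list (map2 ?c js is) * prod_list (map2 ?c js ls)) * (\<alpha> (map e is) * \<alpha> (map e ls)))"
      by (simp add: power2_eq_square sum_product mult_ac)
  qed
  also have "\<dots> = (\<Sum>is | length is = k. \<Sum>ls | length ls = k. (\<Sum>js | length js = k.
      prod_list (map2 ?c js is) * prod_list (map2 ?c js ls)) * (\<alpha> (map e is) * \<alpha> (map e ls)))"
    unfolding sum_distrib_right
    by (subst sum.swap) (intro sum.cong[OF refl] sum.swap)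
  also have "\<dots> = (\<Sum>is | length is = k. \<Sum>ls | length ls = k.
       prod_list (map2 (\<lambda>i l. matrix_inv (gram G e) $ i $ l) is ls) * (\<alpha> (map e is) * \<alpha> (map e ls)))"
    by (intro sum.cong[OF refl]) (simp add: sum_prod_list_map2_two gram_inverse_frame(2)[OF G E c])
  finally show ?thesis .
qed

lemma alt_norm_frame:
  fixes E :: "'n::finite \<Rightarrow> real^'n"
  assumes G: "inner_form G" and E: "orthonormal_frame G E" and \<alpha>: "multilinear k \<alpha>"
  shows "alt_norm G k \<alpha> = sqrt ((\<Sum>js | length js = k. (\<alpha> (map E js))\<^sup>2) / fact k)"
proof -
  have "orthonormal_frame G (SOME E. orthonormal_frame G E)" using someI[of "orthonormal_frame G"] E by blast
  note this[THEN frame_sum_sq[OF G _ vec_basis_expand \<alpha>]]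
  then show ?thesis unfolding alt_norm_def Let_def using frame_sum_sq[OF G E vec_basis_expand \<alpha>] by simp
qed

lemma alt_norm_coords:
  fixes e :: "'n::finite \<Rightarrow> real^'n"
  assumes G: "inner_form G" and c: "\<And>v. v = (\<Sum>i\<in>UNIV. c v i *\<^sub>R e i)" and \<alpha>: "multilinear k \<alpha>"
  shows "alt_norm G k \<alpha> = sqrt ((\<Sum>is | length is = k. \<Sum>ls | length ls = k.
       prod_list (map2 (\<lambda>i l. matrix_inv (gram G e) $ i $ l) is ls) * (\<alpha> (map e is) * \<alpha> (map e ls))) / fact k)"
proof -
  obtain E where E: "orthonormal_frame G E" using orthonormal_frame_exists[OF G] by blast
  show ?thesis unfolding alt_norm_frame[OF G E \<alpha>] frame_sum_sq[OF G E c \<alpha>] ..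
qed

lemma alt_norm_nonneg [simp]: "0 \<le> alt_norm G k \<alpha>"
  by (simp add: alt_norm_def Let_def sum_nonneg)

text \<open>Uses \<open>(a + b)\<^sup>2 \<le> 2 * a\<^sup>2 + 2 * b\<^sup>2\<close> in every
  component. This stands in for the triangle inequality; the loss is a constant.\<close>

lemma alt_norm_add_sq:
  "(alt_norm G k (\<alpha> + \<beta>))\<^sup>2 \<le> 2 * (alt_norm G k \<alpha>)\<^sup>2 + 2 * (alt_norm G k \<beta>)\<^sup>2"
proof -
  define E where "E = (SOME E. orthonormal_frame G E)"
  have "(a + b)\<^sup>2 \<le> 2 * a\<^sup>2 + 2 * b\<^sup>2" for a b :: real
    using zero_le_power2[of "a - b"] by (simp add: power2_eq_square algebra_simps)
  then have "(\<Sum>js | length js = k. ((\<alpha> + \<beta>) (map E js))\<^sup>2) \<le>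
      (\<Sum>js | length js = k. 2 * (\<alpha> (map E js))\<^sup>2 + 2 * (\<beta> (map E js))\<^sup>2)"
    by (intro sum_mono) simp
  then have "(\<Sum>js | length js = k. ((\<alpha> + \<beta>) (map E js))\<^sup>2) / fact k \<le>
      2 * ((\<Sum>js | length js = k. (\<alpha> (map E js))\<^sup>2) / fact k) + 2 * ((\<Sum>js | length js = k. (\<beta> (map E js))\<^sup>2) / fact k)"
    by (simp add: sum.distrib sum_distrib_left[symmetric] add_divide_distrib[symmetric] divide_right_mono)
  then show ?thesis by (simp add: alt_norm_def Let_def sum_nonneg flip: E_def)
qed

lemma alt_norm_scale: "alt_norm G k (\<lambda>vs. r * \<alpha> vs) = \<bar>r\<bar> * alt_norm G k \<alpha>"
proof -
  define E where "E = (SOME E. orthonormal_frame G E)"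
  have "sqrt ((\<Sum>js | length js = k. (r * \<alpha> (map E js))\<^sup>2) / fact k) =
      sqrt (r\<^sup>2 * ((\<Sum>js | length js = k. (\<alpha> (map E js))\<^sup>2) / fact k))"
    by (simp add: power_mult_distrib sum_distrib_left)
  then show ?thesis unfolding alt_norm_def Let_def E_def[symmetric] real_sqrt_mult by simp
qed

lemma alt_norm_zero [simp]: "alt_norm G k 0 = 0"
  by (simp add: alt_norm_def Let_def)

text \<open>Expansion in an orthonormal frame has \<open>CARD('n) ^ k\<close> terms, each with
  \<open>k\<close> coefficients of size at most \<open>R\<close> and a component of at most
  \<open>sqrt (fact k)\<close> times the norm. Requiring \<open>1 \<le> R\<close> lets
  \<open>R\<close> replace its square root as a bound for the coefficients.\<close>

lemma abs_le_alt_norm: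
  fixes G :: "real^'n \<Rightarrow> real^'n \<Rightarrow> real"
  assumes G: "inner_form G" and \<alpha>: "multilinear k \<alpha>" and vs: "length vs = k"
    and R: "1 \<le> R" "\<And>v. v \<in> set vs \<Longrightarrow> G v v \<le> R"
  shows "\<bar>\<alpha> vs\<bar> \<le> real CARD('n) ^ k * R ^ k * sqrt (fact k) * alt_norm G k \<alpha>"
proof -
  obtain E where E: "orthonormal_frame G E" using orthonormal_frame_exists[OF G] by blast
  have Ge: "\<bar>G v (E i)\<bar> \<le> R" if "v \<in> set vs" for v i
  proof -
    have "G v v = G v (\<Sum>i\<in>UNIV. G v (E i) *\<^sub>R E i)" using orthonormal_expand[OF G E, of v] by simp
    also have "\<dots> = (\<Sum>i\<in>UNIV. (G v (E i))\<^sup>2)"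
      by (simp add: linear_lincomb[OF inner_form_linear(1)[OF G, of v]] power2_eq_square)
    finally have "(G v (E i))\<^sup>2 \<le> R" using member_le_sum[of i UNIV "\<lambda>i. (G v (E i))\<^sup>2"] R(2)[OF that] by simp
    also have "R \<le> R\<^sup>2" using R(1) by (simp add: power2_eq_square)
    finally show ?thesis using R(1) abs_le_square_iff[of "G v (E i)" R] by simp
  qed
  have Ej: "\<bar>\<alpha> (map E js)\<bar> \<le> sqrt (fact k) * alt_norm G k \<alpha>" if "length js = k" for js
  proof -
    have "(\<alpha> (map E js))\<^sup>2 \<le> (\<Sum>js | length js = k. (\<alpha> (map E js))\<^sup>2)"
      using that by (intro member_le_sum[of js]) auto
    then have "\<bar>\<alpha> (map E js)\<bar> \<le> sqrt (\<Sum>js | length js = k. (\<alpha> (map E js))\<^sup>2)"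
      by (intro real_le_rsqrt) simp
    then show ?thesis unfolding alt_norm_frame[OF G E \<alpha>] by (simp add: real_sqrt_divide)
  qed
  have "\<alpha> vs = (\<Sum>js | length js = k. prod_list (map2 (\<lambda>v i. G v (E i)) vs js) * \<alpha> (map E js))"
    using multilinear_expand_gen[OF \<alpha> orthonormal_expand[OF G E] vs] .
  also have "\<bar>\<dots>\<bar> \<le> (\<Sum>js :: 'n list | length js = k. R ^ k * (sqrt (fact k) * alt_norm G k \<alpha>))"
  proof (rule order_trans[OF sum_abs sum_mono])
    fix js :: "'n list" assume js: "js \<in> {js. length js = k}"
    have "\<bar>prod_list (map2 (\<lambda>v i. G v (E i)) vs js)\<bar> = (\<Prod>r<k. \<bar>G (vs ! r) (E (js ! r))\<bar>)"
      using vs js by (simp add: prod_list_map2_conv abs_prod)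
    also have "\<dots> \<le> (\<Prod>r<k. R)" using Ge vs by (intro prod_mono) auto
    finally show "\<bar>prod_list (map2 (\<lambda>v i. G v (E i)) vs js) * \<alpha> (map E js)\<bar> \<le> R ^ k * (sqrt (fact k) * alt_norm G k \<alpha>)"
      unfolding abs_mult using Ej js R(1) by (intro mult_mono) auto
  qed
  finally show ?thesis using card_lists_length_eq[of "UNIV::'n set" k] by simp
qed

text \<open>A singular value decomposition without the adjoint: the images of the frame vectors are
  orthogonal of lengths \<open>l i\<close>. \<open>sing_frame_iff\<close> identifies it with the
  eigenvector condition in \<open>sing_vals\<close>.\<close>

definition sing_frame where
  "sing_frame G H T E l \<longleftrightarrow> orthonormal_frame G E \<and> (\<forall>i. 0 \<le> l i) \<and>
     (\<forall>i j. H (T (E i)) (T (E j)) = (if i = j then (l i)\<^sup>2 else 0))"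

text \<open>The adjoint can be written down by its coefficients in an orthonormal frame, so the
  selection in \<open>metric_adjoint\<close> has a witness.\<close>

lemma metric_adjoint:
  fixes G :: "real^'n \<Rightarrow> real^'n \<Rightarrow> real"
  assumes G: "inner_form G" and H: "inner_form H" and T: "linear T"
  shows "H (T u) w = G u (metric_adjoint G H T w)"
proof -
  obtain E where E: "orthonormal_frame G E" using orthonormal_frame_exists[OF G] by blast
  have "\<exists>T'. \<forall>u w. H (T u) w = G u (T' w)"
  proof (intro exI allI)
    fix u w
    have "H (T u) w = H (T (\<Sum>i\<in>UNIV. G u (E i) *\<^sub>R E i)) w" using orthonormal_expand[OF G E, of u] by simp
    also have "\<dots> = (\<Sum>i\<in>UNIV. G u (E i) * H (T (E i)) w)"
      by (simp add: linear_lincomb[OF T] linear_lincomb[OF inner_form_linear(2)[OF H, of w]])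
    also have "\<dots> = G u (\<Sum>i\<in>UNIV. H (T (E i)) w *\<^sub>R E i)"
      by (simp add: linear_lincomb[OF inner_form_linear(1)[OF G, of u]] mult.commute)
    finally show "H (T u) w = G u (\<Sum>i\<in>UNIV. H (T (E i)) w *\<^sub>R E i)" .
  qed
  from someI_ex[OF this] show ?thesis unfolding metric_adjoint_def by blast
qed

lemma inner_form_eqI: "inner_form G \<Longrightarrow> (\<And>u. G u v = G u w) \<Longrightarrow> v = w"
proof -
  assume G: "inner_form G" and eq: "\<And>u. G u v = G u w"
  have "G (v - w) (v - w) = 0" using eq linear_diff[OF inner_form_linear(1)[OF G]] by simp
  then show "v = w" using G unfolding inner_form_def by (metis less_irrefl right_minus_eq)
qed

text \<open>The pulled back form \<open>H (T u) (T v)\<close> is diagonalised against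
  \<open>G\<close>; its diagonal entries are nonnegative and their square roots are the singular
  values.\<close>

lemma sing_frame_exists:
  fixes G :: "real^'n \<Rightarrow> real^'n \<Rightarrow> real"
  assumes G: "inner_form G" and H: "inner_form H" and T: "linear T"
  shows "\<exists>l E. sing_frame G H T E l"
proof -
  define B where "B = (\<lambda>u v. H (T u) (T v))"
  have bil: "bilinear B" unfolding B_def bilinear_def
    using linear_compose[OF T inner_form_linear(1)[OF H]] linear_compose[OF T inner_form_linear(2)[OF H]]
    by (simp add: o_def)
  have sym: "B u v = B v u" for u v using H unfolding B_def inner_form_def by metis
  obtain E where E: "orthonormal_frame G E" "\<And>i j. i \<noteq> j \<Longrightarrow> B (E i) (E j) = 0"
    using simultaneous_diagonalization[OF G bil sym] by blast
  have "B v v \<ge> 0" for v using H linear_0[OF inner_form_linear(1)[OF H]]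
    unfolding B_def inner_form_def by (cases "T v = 0") (auto intro: less_imp_le)
  then have "sing_frame G H T E (\<lambda>i. sqrt (B (E i) (E i)))"
    using E by (auto simp: sing_frame_def B_def)
  then show ?thesis by blast
qed

lemma sing_frame_iff:
  fixes G :: "real^'n \<Rightarrow> real^'n \<Rightarrow> real"
  assumes G: "inner_form G" and H: "inner_form H" and T: "linear T"
  shows "(\<forall>i. 0 \<le> l i) \<and> orthonormal_frame G E \<and>
       (\<forall>i. metric_adjoint G H T (T (E i)) = (l i)\<^sup>2 *\<^sub>R E i) \<longleftrightarrow> sing_frame G H T E l"
proof -
  have "(\<forall>i. metric_adjoint G H T (T (E i)) = (l i)\<^sup>2 *\<^sub>R E i) \<longleftrightarrow>
     (\<forall>i j. H (T (E i)) (T (E j)) = (if i = j then (l i)\<^sup>2 else 0))" if E: "orthonormal_frame G E"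
  proof
    assume *: "\<forall>i. metric_adjoint G H T (T (E i)) = (l i)\<^sup>2 *\<^sub>R E i"
    show "\<forall>i j. H (T (E i)) (T (E j)) = (if i = j then (l i)\<^sup>2 else 0)"
      using E unfolding metric_adjoint[OF G H T] orthonormal_frame_def
      by (simp add: * linear_cmul[OF inner_form_linear(1)[OF G]])
  next
    assume *: "\<forall>i j. H (T (E i)) (T (E j)) = (if i = j then (l i)\<^sup>2 else 0)"
    show "\<forall>i. metric_adjoint G H T (T (E i)) = (l i)\<^sup>2 *\<^sub>R E i"
    proof (intro allI inner_form_eqI[OF G])
      fix i u
      have "G u (metric_adjoint G H T (T (E i))) = H (T u) (T (E i))" using metric_adjoint[OF G H T] by simp
      also have "\<dots> = H (T (\<Sum>j\<in>UNIV. G u (E j) *\<^sub>R E j)) (T (E i))" using orthonormal_expand[OF G E, of u] by simp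
      also have "\<dots> = (\<Sum>j\<in>UNIV. G u (E j) * H (T (E j)) (T (E i)))"
        by (simp add: linear_lincomb[OF T] linear_lincomb[OF inner_form_linear(2)[OF H, of "T (E i)"]])
      also have "\<dots> = G u ((l i)\<^sup>2 *\<^sub>R E i)"
        by (simp add: *[rule_format] linear_cmul[OF inner_form_linear(1)[OF G]] if_distrib cong: if_cong)
      finally show "G u (metric_adjoint G H T (T (E i))) = G u ((l i)\<^sup>2 *\<^sub>R E i)" .
    qed
  qed
  then show ?thesis unfolding sing_frame_def by blast
qed

lemma sing_frame_pos:
  assumes G: "inner_form G" and H: "inner_form H" and T: "linear T" "inj T" and s: "sing_frame G H T E l"
  shows "0 < l i"
proof -
  have "G (E i) (E i) = 1" using s by (simp add: sing_frame_def orthonormal_frame_def)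
  then have "E i \<noteq> 0" using linear_0[OF inner_form_linear(1)[OF G]] by force
  then have "T (E i) \<noteq> 0" using T by (metis linear_0 injD)
  then have "(l i)\<^sup>2 > 0" using H s by (auto simp: inner_form_def sing_frame_def)
  then show ?thesis using s by (auto simp: sing_frame_def less_le)
qed

text \<open>For an alternating form the components at index lists with repetitions vanish, so
  components have to be compared at distinct lists only.\<close>

lemma frame_sum_bound:
  fixes a b :: "'n::finite list \<Rightarrow> real"
  assumes "\<And>js. length js = k \<Longrightarrow> distinct js \<Longrightarrow> \<bar>a js\<bar> \<le> s * \<bar>b js\<bar>"
    and "\<And>js. \<not> distinct js \<Longrightarrow> a js = 0" and "0 \<le> s"
  shows "sqrt ((\<Sum>js | length js = k. (a js)\<^sup>2) / fact k) \<le> s * sqrt ((\<Sum>js | length js = k. (b js)\<^sup>2) / fact k)"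
proof -
  have "(a js)\<^sup>2 \<le> s\<^sup>2 * (b js)\<^sup>2" if "length js = k" for js
  proof (cases "distinct js")
    case True
    have "\<bar>a js\<bar>\<^sup>2 \<le> (s * \<bar>b js\<bar>)\<^sup>2" using assms(1)[OF that True] by (intro power_mono) auto
    then show ?thesis by (simp add: power_mult_distrib)
  qed (use assms(2) in simp)
  then have "(\<Sum>js | length js = k. (a js)\<^sup>2) / fact k \<le> s\<^sup>2 * ((\<Sum>js | length js = k. (b js)\<^sup>2) / fact k)"
    unfolding times_divide_eq_right sum_distrib_left by (intro divide_right_mono sum_mono) auto
  then have "sqrt ((\<Sum>js | length js = k. (a js)\<^sup>2) / fact k) \<le> sqrt (s\<^sup>2 * ((\<Sum>js | length js = k. (b js)\<^sup>2) / fact k))"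
    by (rule real_sqrt_le_mono)
  then show ?thesis using assms(3) unfolding real_sqrt_mult[of "s\<^sup>2"] by simp
qed

text \<open>\<open>T\<close> sends \<open>E j\<close> to \<open>l j\<close> times the
  \<open>H\<close>-orthonormal vector \<open>F j\<close>, so both pullbacks act on components by a
  product of singular values or its reciprocal. One product over a \<open>k\<close>-set is at most
  the sum of all of them, since the \<open>l i\<close> are positive.\<close>

lemma alt_norm_pullback_le:
  fixes G :: "real^'n \<Rightarrow> real^'n \<Rightarrow> real"
  assumes G: "inner_form G" and H: "inner_form H" and T: "linear T" "inj T"
    and s: "sing_frame G H T E l" and \<alpha>: "alternating k \<alpha>"
  shows "alt_norm G k (\<lambda>vs. \<alpha> (map T vs)) \<le> (\<Sum>I | card I = k. \<Prod>i\<in>I. l i) * alt_norm H k \<alpha>"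
    and "alt_norm H k (\<lambda>vs. \<alpha> (map (inv T) vs)) \<le>
      (\<Sum>I | card I = CARD('n) - k. \<Prod>i\<in>I. l i) / (\<Prod>i\<in>UNIV. l i) * alt_norm G k \<alpha>"
proof -
  note pos = sing_frame_pos[OF G H T s]
  have E: "orthonormal_frame G E" using s by (simp add: sing_frame_def)
  define F where "F = (\<lambda>i. T (E i) /\<^sub>R l i)"
  have F: "orthonormal_frame H F"
    using s pos unfolding orthonormal_frame_def sing_frame_def F_def
    by (auto simp: linear_cmul[OF inner_form_linear(1)[OF H]] linear_cmul[OF inner_form_linear(2)[OF H]]
        less_imp_neq[THEN not_sym] power2_eq_square field_simps)
  note ml = alternating_imp_multilinear[OF \<alpha>]
  have expand: "\<beta> (map (\<lambda>j. r j *\<^sub>R X j) js) = (\<Prod>j\<in>set js. r j) * \<beta> (map X js)"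
    if \<beta>: "multilinear k \<beta>" and js: "length js = k" "distinct js" for \<beta> r and X :: "'n \<Rightarrow> real^'n" and js
  proof -
    have "\<beta> (map (\<lambda>j. r j *\<^sub>R X j) us @ map X ws) = (\<Prod>j\<in>set us. r j) * \<beta> (map X (us @ ws))"
      if "length us + length ws = k" "distinct us" for us ws
      using that
    proof (induction us arbitrary: ws rule: rev_induct)
      case (snoc u us)
      have lin: "linear (\<lambda>v. \<beta> (map (\<lambda>j. r j *\<^sub>R X j) us @ v # map X ws))"
        using snoc.prems by (intro multilinear_linear[OF \<beta>]) auto
      show ?case using snoc.IH[of "u # ws"] snoc.prems linear_cmul[OF lin, of "r u" "X u"] by simp
    qed simp
    from this[of js "[]"] show ?thesis using js by simp
  qed
  have lnn: "0 \<le> l i" for i using pos[of i] by simp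
  have lprod: "(\<Prod>i\<in>set js. l i) \<le> (\<Sum>I | card I = k. \<Prod>i\<in>I. l i)" if "length js = k" "distinct js" for js k
  proof -
    have "set js \<in> {I. card I = k}" using that by (simp add: distinct_card)
    then show ?thesis by (rule member_le_sum) (simp_all add: prod_nonneg lnn)
  qed
  have snn: "0 \<le> (\<Sum>I | card I = m. \<Prod>i\<in>I. l i)" for m
    by (intro sum_nonneg prod_nonneg lnn)
  have TE: "map T (map E js) = map (\<lambda>j. l j *\<^sub>R F j) js" for js
    using pos by (simp add: F_def less_imp_neq[THEN not_sym])
  have "\<bar>\<alpha> (map T (map E js))\<bar> \<le> (\<Sum>I | card I = k. \<Prod>i\<in>I. l i) * \<bar>\<alpha> (map F js)\<bar>"
    if js: "length js = k" "distinct js" for js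
  proof -
    have "0 \<le> (\<Prod>i\<in>set js. l i)" by (intro prod_nonneg lnn)
    then show ?thesis
      unfolding TE expand[OF ml js] abs_mult using lprod[OF js] by (intro mult_right_mono) auto
  qed
  then show "alt_norm G k (\<lambda>vs. \<alpha> (map T vs)) \<le> (\<Sum>I | card I = k. \<Prod>i\<in>I. l i) * alt_norm H k \<alpha>"
    unfolding alt_norm_frame[OF G E multilinear_map[OF ml T(1)]] alt_norm_frame[OF H F ml]
    using alternating_not_distinct[OF alternating_map[OF \<alpha> T(1)]] snn
    by (intro frame_sum_bound) auto
  have inv: "linear (inv T)" "inv T (T v) = v" for v
  proof -
    show "inv T (T v) = v" using T by simp
    have "surj T" using T linear_injective_imp_surjective by blast
    then have r: "T (inv T w) = w" for w by (rule surj_f_inv_f)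
    show "linear (inv T)"
    proof (rule linearI)
      show "inv T (x + y) = inv T x + inv T y" for x y
        by (rule injD[OF T(2)]) (simp add: linear_add[OF T(1)] r)
      show "inv T (c *\<^sub>R x) = c *\<^sub>R inv T x" for c x
        by (rule injD[OF T(2)]) (simp add: linear_cmul[OF T(1)] r)
    qed
  qed
  have iF: "map (inv T) (map F js) = map (\<lambda>j. (1 / l j) *\<^sub>R E j) js" for js
    by (simp add: F_def linear_cmul[OF inv(1)] inv(2) divide_inverse)
  define s where "s = (\<Sum>I | card I = CARD('n) - k. \<Prod>i\<in>I. l i) / (\<Prod>i\<in>UNIV. l i)"
  have Jpos: "0 < (\<Prod>i\<in>UNIV. l i)" using pos by (intro prod_pos) auto
  have "\<bar>\<alpha> (map (inv T) (map F js))\<bar> \<le> s * \<bar>\<alpha> (map E js)\<bar>"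
    if js: "length js = k" "distinct js" for js
  proof -
    \<comment> \<open>The reciprocal of the product over \<open>set js\<close> is the product over
      the complement divided by the full product. The complement has \<open>CARD('n) - k\<close>
      elements, which brings in the symmetric function of complementary degree.\<close>
    obtain js' where js': "distinct js'" "set js' = - set js" using finite_distinct_list[of "- set js"] by auto
    have "length js' = card (- set js)" using js' by (metis distinct_card)
    also have "\<dots> = CARD('n) - k" using js by (simp add: Compl_eq_Diff_UNIV card_Diff_subset distinct_card)
    finally have len: "length js' = CARD('n) - k" .
    have "(\<Prod>i\<in>UNIV. l i) = (\<Prod>i\<in>set js \<union> set js'. l i)" using js' by (simp add: Compl_partition)
    also have "\<dots> = (\<Prod>i\<in>set js. l i) * (\<Prod>i\<in>set js'. l i)" using js' by (intro prod.union_disjoint) auto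
    finally have J: "(\<Prod>i\<in>UNIV. l i) = (\<Prod>i\<in>set js. l i) * (\<Prod>i\<in>set js'. l i)" .
    have ppos: "0 < (\<Prod>i\<in>set js. l i)" "0 < (\<Prod>i\<in>set js'. l i)" using pos by (auto intro!: prod_pos)
    have "(\<Prod>i\<in>set js. 1 / l i) = (\<Prod>i\<in>set js'. l i) / (\<Prod>i\<in>UNIV. l i)"
    proof -
      have "1 / a = b / (a * b)" if "0 < b" for a b :: real using that by simp
      from this[OF ppos(2), of "\<Prod>i\<in>set js. l i"] show ?thesis
        unfolding J by (simp only: prod_dividef prod.neutral_const)
    qed
    also have "\<dots> \<le> s" unfolding s_def using lprod[OF len js'(1)] Jpos by (intro divide_right_mono) auto
    finally have "(\<Prod>i\<in>set js. 1 / l i) \<le> s" .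
    moreover have "0 \<le> (\<Prod>i\<in>set js. 1 / l i)" by (intro prod_nonneg) (simp add: lnn)
    ultimately show ?thesis
      unfolding iF expand[OF ml js] abs_mult by (intro mult_right_mono) auto
  qed
  moreover have "0 \<le> s" unfolding s_def using snn Jpos by auto
  ultimately show "alt_norm H k (\<lambda>vs. \<alpha> (map (inv T) vs)) \<le>
      (\<Sum>I | card I = CARD('n) - k. \<Prod>i\<in>I. l i) / (\<Prod>i\<in>UNIV. l i) * alt_norm G k \<alpha>"
    unfolding alt_norm_frame[OF H F multilinear_map[OF ml inv(1)]] alt_norm_frame[OF G E ml]
    using alternating_not_distinct[OF alternating_map[OF \<alpha> inv(1)]]
    by (fold s_def, intro frame_sum_bound) auto
qed

section \<open>Gram determinants and the volume distortion of a linear map\<close>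

lemma gram_linear_image:
  fixes G :: "real^'n \<Rightarrow> real^'n \<Rightarrow> real"
  assumes G: "inner_form G"
  shows "gram G e = transpose (\<chi> i j. e j $ i) ** gram G ax ** (\<chi> i j. e j $ i)"
proof -
  have "G (e i) (e j) = (\<Sum>k\<in>UNIV. (\<Sum>m\<in>UNIV. e i $ m * G (ax m) (ax k)) * e j $ k)" for i j
  proof -
    have 1: "G u (e j) = (\<Sum>k\<in>UNIV. e j $ k * G u (ax k))" for u
      using linear_lincomb[OF inner_form_linear(1)[OF G, of u], of "\<lambda>k. e j $ k" ax UNIV]
        vec_basis_expand[of "e j", symmetric] by simp
    have 2: "G (e i) w = (\<Sum>m\<in>UNIV. e i $ m * G (ax m) w)" for w
      using linear_lincomb[OF inner_form_linear(2)[OF G, of w], of "\<lambda>m. e i $ m" ax UNIV]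
        vec_basis_expand[of "e i", symmetric] by simp
    show ?thesis unfolding 1 by (subst 2) (simp add: mult.commute)
  qed
  then show ?thesis by (simp add: gram_def matrix_matrix_mult_def transpose_def vec_eq_iff)
qed

lemma det_gram_linear:
  fixes G :: "real^'n \<Rightarrow> real^'n \<Rightarrow> real"
  assumes G: "inner_form G"
  shows "det (gram G (\<lambda>i. A (ax i))) = (det (matrix A))\<^sup>2 * det (gram G ax)"
proof -
  have "matrix A = (\<chi> i j. A (ax j) $ i)" by (simp add: matrix_def)
  then have "gram G (\<lambda>i. A (ax i)) = transpose (matrix A) ** gram G ax ** matrix A"
    using gram_linear_image[OF G, of "\<lambda>i. A (ax i)"] by simp
  then show ?thesis by (simp add: det_mul det_transpose power2_eq_square mult_ac)
qed

text \<open>The Gram matrix of an orthonormal frame is the identity, so 1 is a square times the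
  determinant in question.\<close>

lemma det_gram_pos:
  fixes G :: "real^'n \<Rightarrow> real^'n \<Rightarrow> real"
  assumes G: "inner_form G" shows "0 < det (gram G ax)"
proof -
  obtain E where E: "orthonormal_frame G E" using orthonormal_frame_exists[OF G] by blast
  have "gram G E = mat 1" using E by (simp add: gram_def orthonormal_frame_def mat_def vec_eq_iff)
  then have "1 = (det (\<chi> i j. E j $ i))\<^sup>2 * det (gram G ax)"
    using arg_cong[OF gram_linear_image[OF G, of E], of det]
    by (simp add: det_mul det_transpose power2_eq_square mult_ac)
  then show ?thesis by (metis zero_less_mult_pos zero_less_one zero_le_power2 zero_less_mult_iff not_less)
qed

text \<open>The Gram determinant of the vectors \<open>T (E i)\<close> for \<open>H\<close> is
  computed twice: as the product of the squared singular values, and by the transformation rule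
  under the matrix of \<open>T\<close> times \<open>e\<close>. Orthonormality of \<open>E\<close>
  for \<open>G\<close> then eliminates \<open>det e\<close>.\<close>

lemma sing_frame_prod:
  fixes G :: "real^'n \<Rightarrow> real^'n \<Rightarrow> real"
  assumes G: "inner_form G" and H: "inner_form H" and T: "linear T" and s: "sing_frame G H T E l"
  shows "(\<Prod>i\<in>UNIV. l i) * sqrt (det (gram G ax)) = \<bar>det (matrix T)\<bar> * sqrt (det (gram H ax))"
proof -
  define e where "e = (\<chi> i j. E j $ i)"
  have "gram G E = mat 1" using s by (simp add: sing_frame_def gram_def orthonormal_frame_def mat_def vec_eq_iff)
  then have 1: "(det e)\<^sup>2 * det (gram G ax) = 1"
    using arg_cong[OF gram_linear_image[OF G, of E], of det]
    by (simp add: det_mul det_transpose power2_eq_square mult_ac e_def)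
  have TE: "(\<chi> i j. T (E j) $ i) = matrix T ** e"
  proof -
    have "T (E j) $ i = (\<Sum>k\<in>UNIV. T (ax k) $ i * E j $ k)" for i j
    proof -
      have "T (E j) = (\<Sum>k\<in>UNIV. E j $ k *\<^sub>R T (ax k))"
        using linear_lincomb[OF T, of "\<lambda>k. E j $ k" ax UNIV] vec_basis_expand[of "E j", symmetric] by simp
      then show ?thesis by (simp add: mult.commute)
    qed
    then show ?thesis by (simp add: e_def matrix_matrix_mult_def matrix_def vec_eq_iff)
  qed
  have "gram H (\<lambda>i. T (E i)) = (\<chi> i j. if i = j then (l i)\<^sup>2 else 0)"
    using s by (simp add: sing_frame_def gram_def vec_eq_iff)
  then have "det (gram H (\<lambda>i. T (E i))) = (\<Prod>i\<in>UNIV. (l i)\<^sup>2)"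
    by (subst det_diagonal) auto
  moreover have "det (gram H (\<lambda>i. T (E i))) = (det (matrix T))\<^sup>2 * (det e)\<^sup>2 * det (gram H ax)"
    unfolding gram_linear_image[OF H, of "\<lambda>i. T (E i)"] TE
    by (simp add: det_mul det_transpose power2_eq_square mult_ac)
  ultimately have "(\<Prod>i\<in>UNIV. l i)\<^sup>2 * det (gram G ax) = (det (matrix T))\<^sup>2 * det (gram H ax) * ((det e)\<^sup>2 * det (gram G ax))"
    by (simp add: prod_power_distrib mult_ac)
  then have "sqrt ((\<Prod>i\<in>UNIV. l i)\<^sup>2 * det (gram G ax)) = sqrt ((det (matrix T))\<^sup>2 * det (gram H ax))"
    by (simp add: 1)
  moreover have "0 \<le> (\<Prod>i\<in>UNIV. l i)" using s by (intro prod_nonneg) (auto simp: sing_frame_def)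
  ultimately show ?thesis by (simp add: real_sqrt_mult)
qed

section \<open>Charts and tangent maps\<close>

locale rmfd =
  fixes M :: "('a::{t2_space,second_countable_topology}, 'n::{finite,wellorder}) mfd"
  assumes M: "oriented_riemannian_mfd M"
begin

lemma chart:
  assumes "c \<in> atlas M"
  shows "open (cdom c)" "open (cimg c)" "continuous_on (cdom c) (cmap c)" "continuous_on (cimg c) (cinv c)"
    "x \<in> cdom c \<Longrightarrow> cinv c (cmap c x) = x" "x \<in> cdom c \<Longrightarrow> cmap c x \<in> cimg c"
    "y \<in> cimg c \<Longrightarrow> cmap c (cinv c y) = y" "y \<in> cimg c \<Longrightarrow> cinv c y \<in> cdom c"
proof -
  have "is_chart c" using assms M by (auto simp: oriented_riemannian_mfd_def oriented_smooth_atlas_def)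
  then have h: "open (cdom c)" "open (cimg c)" "homeomorphism (cdom c) (cimg c) (cmap c) (cinv c)"
    by (auto simp: is_chart_def)
  show "open (cdom c)" "open (cimg c)" by (fact h)+
  show "continuous_on (cdom c) (cmap c)" "continuous_on (cimg c) (cinv c)"
    "x \<in> cdom c \<Longrightarrow> cinv c (cmap c x) = x" "x \<in> cdom c \<Longrightarrow> cmap c x \<in> cimg c"
    "y \<in> cimg c \<Longrightarrow> cmap c (cinv c y) = y" "y \<in> cimg c \<Longrightarrow> cinv c y \<in> cdom c"
    using h(3) by (auto simp: homeomorphism_def)
qed

lemma chart_at: "chart_at M x \<in> atlas M" "x \<in> cdom (chart_at M x)"
proof -
  have "(\<Union>c\<in>atlas M. cdom c) = UNIV"
    using M unfolding oriented_riemannian_mfd_def oriented_smooth_atlas_def by blast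
  then have "\<exists>c. c \<in> atlas M \<and> x \<in> cdom c" by (metis UNIV_I UN_E)
  from someI_ex[OF this] show "chart_at M x \<in> atlas M" "x \<in> cdom (chart_at M x)"
    unfolding chart_at_def by auto
qed

lemma open_chart_preimage:
  assumes "c \<in> atlas M" "open V" "continuous_on UNIV f"
  shows "open {y \<in> cimg c. f (cinv c y) \<in> V}"
proof -
  have "continuous_on (cimg c) (\<lambda>y. f (cinv c y))"
    using continuous_on_compose2[OF assms(3) chart(4)[OF assms(1)]] by auto
  then have "open (cimg c \<inter> (\<lambda>y. f (cinv c y)) -` V)"
    by (rule continuous_open_preimage[OF _ chart(2)[OF assms(1)] assms(2)])
  then show ?thesis by (simp add: vimage_def Int_def)
qed

lemma chart_image: "c \<in> atlas M \<Longrightarrow> cmap c ` (cdom c \<inter> V) = {y \<in> cimg c. cinv c y \<in> V}"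
proof (intro equalityI subsetI)
  fix y assume c: "c \<in> atlas M" and "y \<in> {y \<in> cimg c. cinv c y \<in> V}"
  then have "y = cmap c (cinv c y)" "cinv c y \<in> cdom c \<inter> V" using chart(7,8)[OF c] by auto
  then show "y \<in> cmap c ` (cdom c \<inter> V)" by (rule image_eqI)
qed (auto simp: chart)

lemma metric_inner: "inner_form (metric M x)"
  using M by (auto simp: oriented_riemannian_mfd_def inner_form_def)

text \<open>Chart transitions are the local representations of the identity. Facts about changing
  charts are obtained below by applying the lemmas on maps to \<open>id\<close>.\<close>

lemma smooth_map_id: "smooth_map M M id"
  using M unfolding smooth_map_def oriented_riemannian_mfd_def oriented_smooth_atlas_def
  by (auto intro: continuous_on_id)

lemma diffeo_id: "diffeo M M id"
  using smooth_map_id by (simp add: diffeo_def)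

lemma coord_to_tan_bij:
  assumes "c \<in> atlas M" "x \<in> cdom c"
  shows "linear (coord_to_tan M c x)" "0 < det (matrix (coord_to_tan M c x))"
proof -
  let ?d = "chart_at M x"
  have y: "cmap c x \<in> cmap c ` (cdom c \<inter> cdom ?d)" using assms chart_at by auto
  have "smooth_on (cmap c ` (cdom c \<inter> cdom ?d)) (cmap ?d \<circ> cinv c)"
    and 2: "0 < det (matrix (frechet_derivative (cmap ?d \<circ> cinv c) (at (cmap c x))))"
    using M assms(1) chart_at(1)[of x] y unfolding oriented_riemannian_mfd_def oriented_smooth_atlas_def by blast+
  then show "linear (coord_to_tan M c x)"
    unfolding coord_to_tan_def using has_derivative_linear[OF smooth_on_has_derivative[OF _ y]] by blast
  show "0 < det (matrix (coord_to_tan M c x))" using 2 by (simp add: coord_to_tan_def)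
qed

lemma coord_to_tan_basis:
  assumes "c \<in> atlas M" "x \<in> cdom c"
  obtains b where "\<And>v. v = (\<Sum>i\<in>UNIV. b v i *\<^sub>R coord_to_tan M c x (ax i))"
proof -
  let ?A = "coord_to_tan M c x"
  note lin = coord_to_tan_bij(1)[OF assms]
  have "inj ?A" using coord_to_tan_bij(2)[OF assms] det_nz_iff_inj[OF lin] by simp
  then have "surj ?A" using linear_injective_imp_surjective lin by blast
  then have "\<forall>v. \<exists>w. v = ?A w" by (meson surjD)
  then obtain W where W: "\<And>v. v = ?A (W v)" by metis
  have "?A w = (\<Sum>i\<in>UNIV. w $ i *\<^sub>R ?A (ax i))" for w
    using linear_lincomb[OF lin, of "\<lambda>i. w $ i" ax UNIV] vec_basis_expand[of w, symmetric] by simp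
  then show ?thesis using W by (intro that[of "\<lambda>v i. W v $ i"]) metis
qed

definition vol_dens :: "('a, 'n) chart \<Rightarrow> real^'n::_ \<Rightarrow> real" where
  "vol_dens c y = sqrt (det (gram (metric M (cinv c y)) (\<lambda>i. coord_to_tan M c (cinv c y) (ax i))))"

text \<open>All charts are positively oriented, so the determinant of \<open>coord_to_tan\<close> is
  positive and the square root of its square carries no absolute value.\<close>

lemma vol_dens_eq:
  assumes "c \<in> atlas M" "y \<in> cimg c"
  shows "vol_dens c y = det (matrix (coord_to_tan M c (cinv c y))) * sqrt (det (gram (metric M (cinv c y)) ax))"
  using coord_to_tan_bij(2)[OF assms(1) chart(8)[OF assms]]
  by (simp add: vol_dens_def det_gram_linear[OF metric_inner, of _ "coord_to_tan M c (cinv c y)"] real_sqrt_mult)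

lemma vol_dens_pos: "c \<in> atlas M \<Longrightarrow> y \<in> cimg c \<Longrightarrow> 0 < vol_dens c y"
  using coord_to_tan_bij(2)[OF _ chart(8)] det_gram_pos[OF metric_inner] by (simp add: vol_dens_eq)

lemma continuous_on_det:
  fixes A :: "'z::topological_space \<Rightarrow> real^'m^'m"
  assumes "\<And>i j. continuous_on S (\<lambda>y. A y $ i $ j)"
  shows "continuous_on S (\<lambda>y. det (A y))"
  unfolding det_def by (intro continuous_on_sum continuous_on_mult continuous_on_prod continuous_on_const assms)

lemma continuous_on_metric_coords:
  assumes "c \<in> atlas M"
  shows "continuous_on (cimg c) (\<lambda>y. metric M (cinv c y) (coord_to_tan M c (cinv c y) u) (coord_to_tan M c (cinv c y) v))"
  using M assms by (intro smooth_on_imp_continuous_on) (auto simp: oriented_riemannian_mfd_def)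

lemma continuous_on_vol_dens: "c \<in> atlas M \<Longrightarrow> continuous_on (cimg c) (vol_dens c)"
  unfolding vol_dens_def[abs_def] gram_def
  by (intro continuous_on_real_sqrt continuous_on_det) (simp add: continuous_on_metric_coords)

end

section \<open>Local representations of maps and their tangent maps\<close>

locale rmfd_pair = M: rmfd M + N: rmfd N
  for M :: "('a::{t2_space,second_countable_topology}, 'n::{finite,wellorder}) mfd"
    and N :: "('b::{t2_space,second_countable_topology}, 'n) mfd"

definition loc_rep :: "('a, 'n) chart \<Rightarrow> ('b, 'n) chart \<Rightarrow> ('a \<Rightarrow> 'b) \<Rightarrow> real^'n \<Rightarrow> real^'n" where
  "loc_rep c d f = cmap d \<circ> f \<circ> cinv c"

definition loc_dom :: "('a, 'n::finite) chart \<Rightarrow> ('b, 'n) chart \<Rightarrow> ('a \<Rightarrow> 'b) \<Rightarrow> (real^'n) set" where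
  "loc_dom c d f = {y \<in> cimg c. f (cinv c y) \<in> cdom d}"

abbreviation loc_D where "loc_D c d f y \<equiv> frechet_derivative (loc_rep c d f) (at y)"

context rmfd_pair
begin

lemma smooth_map_continuous: "smooth_map M N f \<Longrightarrow> continuous_on UNIV f"
  by (simp add: smooth_map_def)

lemma loc_rep:
  assumes f: "smooth_map M N f" and c: "c \<in> atlas M" and d: "d \<in> atlas N"
  shows "open (loc_dom c d f)" "smooth_on (loc_dom c d f) (loc_rep c d f)"
    "loc_dom c d f \<subseteq> cimg c"
    "y \<in> loc_dom c d f \<Longrightarrow> loc_rep c d f y \<in> cimg d"
    "y \<in> loc_dom c d f \<Longrightarrow> cinv d (loc_rep c d f y) = f (cinv c y)"
    "y \<in> loc_dom c d f \<Longrightarrow> (loc_rep c d f has_derivative loc_D c d f y) (at y)"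
    "y \<in> loc_dom c d f \<Longrightarrow> linear (loc_D c d f y)"
proof -
  show "open (loc_dom c d f)" unfolding loc_dom_def
    using f by (intro M.open_chart_preimage c N.chart(1)[OF d]) (simp add: smooth_map_def)
  have "cmap c ` (cdom c \<inter> f -` cdom d) = loc_dom c d f"
    using M.chart_image[OF c, of "f -` cdom d"] by (simp add: loc_dom_def)
  then show s: "smooth_on (loc_dom c d f) (loc_rep c d f)"
    using f c d unfolding smooth_map_def loc_rep_def by metis
  show "loc_dom c d f \<subseteq> cimg c" by (auto simp: loc_dom_def)
  show "y \<in> loc_dom c d f \<Longrightarrow> loc_rep c d f y \<in> cimg d"
    "y \<in> loc_dom c d f \<Longrightarrow> cinv d (loc_rep c d f y) = f (cinv c y)"
    using N.chart[OF d] by (auto simp: loc_dom_def loc_rep_def)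
  show "y \<in> loc_dom c d f \<Longrightarrow> (loc_rep c d f has_derivative loc_D c d f y) (at y)"
    using s by (rule smooth_on_has_derivative)
  then show "y \<in> loc_dom c d f \<Longrightarrow> linear (loc_D c d f y)"
    using has_derivative_linear by blast
qed

lemma tangent_map_linear: assumes f: "smooth_map M N f" shows "linear (tangent_map M N f x)"
proof -
  let ?c = "chart_at M x" and ?d = "chart_at N (f x)"
  have "cmap ?c x \<in> loc_dom ?c ?d f"
    using M.chart_at[of x] N.chart_at[of "f x"] M.chart[OF M.chart_at(1)] by (simp add: loc_dom_def)
  from loc_rep(7)[OF f M.chart_at(1) N.chart_at(1) this]
  show ?thesis by (simp add: tangent_map_def loc_rep_def)
qed

text \<open>Near \<open>y\<close>, passing to the selected chart and then applying the map agrees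
  with applying the map in \<open>c\<close>, \<open>d\<close> and then passing to the selected
  chart. Differentiating both composites frees \<open>tangent_map\<close> from the charts selected
  by \<open>chart_at\<close>.\<close>

lemma tangent_coord:
  assumes f: "smooth_map M N f" and c: "c \<in> atlas M" and d: "d \<in> atlas N" and y: "y \<in> loc_dom c d f"
  shows "tangent_map M N f (cinv c y) (coord_to_tan M c (cinv c y) v) =
    coord_to_tan N d (f (cinv c y)) (loc_D c d f y v)"
proof -
  define x where "x = cinv c y"
  let ?c0 = "chart_at M x" and ?d0 = "chart_at N (f x)"
  note c0 = M.chart_at[of x] and d0 = N.chart_at[of "f x"]
  interpret MM: rmfd_pair M M by unfold_locales
  interpret NN: rmfd_pair N N by unfold_locales
  have y1: "y \<in> loc_dom c ?c0 id" using y c0 by (simp add: loc_dom_def x_def)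
  have x: "x \<in> cdom c" "cmap c x = y" "f x \<in> cdom d"
    using M.chart[OF c] y by (auto simp: x_def loc_dom_def)
  have y2: "loc_rep c ?c0 id y \<in> loc_dom ?c0 ?d0 f"
    using MM.loc_rep(4,5)[OF M.smooth_map_id c c0(1) y1] d0 by (simp add: loc_dom_def x_def)
  have y3: "loc_rep c d f y \<in> loc_dom d ?d0 id"
    using loc_rep(4,5)[OF f c d y] d0 by (simp add: loc_dom_def x_def)
  note D1 = diff_chain_at[OF MM.loc_rep(6)[OF M.smooth_map_id c c0(1) y1] loc_rep(6)[OF f c0(1) d0(1) y2]]
  note D2 = diff_chain_at[OF loc_rep(6)[OF f c d y] NN.loc_rep(6)[OF N.smooth_map_id d d0(1) y3]]
  define U where "U = loc_dom c ?c0 id \<inter> loc_dom c d f"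
  have U: "open U" "y \<in> U"
    using MM.loc_rep(1)[OF M.smooth_map_id c c0(1)] loc_rep(1)[OF f c d] y y1 by (auto simp: U_def)
  have eq: "(loc_rep ?c0 ?d0 f \<circ> loc_rep c ?c0 id) z = (loc_rep d ?d0 id \<circ> loc_rep c d f) z" if "z \<in> U" for z
    using that M.chart[OF c] M.chart[OF c0(1)] N.chart[OF d]
    by (auto simp: U_def loc_dom_def loc_rep_def)
  have "loc_D ?c0 ?d0 f (loc_rep c ?c0 id y) \<circ> loc_D c ?c0 id y = loc_D d ?d0 id (loc_rep c d f y) \<circ> loc_D c d f y"
    using has_derivative_unique[OF has_derivative_transform_within_open[OF D1 U eq] D2] by simp
  moreover have "loc_rep c ?c0 id y = cmap ?c0 x" "loc_rep c d f y = cmap d (f x)" by (simp_all add: loc_rep_def x_def)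
  ultimately have "loc_D ?c0 ?d0 f (cmap ?c0 x) (loc_D c ?c0 id y v) = loc_D d ?d0 id (cmap d (f x)) (loc_D c d f y v)"
    by (metis comp_apply)
  then show ?thesis
    unfolding tangent_map_def coord_to_tan_def x_def[symmetric] by (simp add: loc_rep_def x)
qed

lemma tangent_coord_map:
  assumes "smooth_map M N f" "c \<in> atlas M" "d \<in> atlas N" "y \<in> loc_dom c d f"
  shows "map (tangent_map M N f (cinv c y)) (map (coord_to_tan M c (cinv c y)) vs) =
    map (coord_to_tan N d (f (cinv c y))) (map (loc_D c d f y) vs)"
  using tangent_coord[OF assms] by simp

lemma local_form_pullback:
  assumes f: "smooth_map M N f" and c: "c \<in> atlas M" and d: "d \<in> atlas N" and y: "y \<in> loc_dom c d f"
  shows "local_form M c (pullback M N f \<omega>) y vs = local_form N d \<omega> (loc_rep c d f y) (map (loc_D c d f y) vs)"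
  unfolding local_form_def pullback_def tangent_coord_map[OF assms] loc_rep(5)[OF f c d y] ..

lemma diffeo_tangent_inv:
  assumes f: "diffeo M N f"
  shows "tangent_map N M (inv f) (f x) (tangent_map M N f x v) = v"
proof -
  interpret NM: rmfd_pair N M by unfold_locales
  have sf: "smooth_map M N f" and sg: "smooth_map N M (inv f)" and b: "bij f" using f by (auto simp: diffeo_def)
  have inv: "inv f (f z) = z" for z using b by (simp add: bij_is_inj)
  let ?c = "chart_at M x" and ?d = "chart_at N (f x)"
  note c = M.chart_at[of x] and d = N.chart_at[of "f x"]
  let ?y = "cmap ?c x"
  have y: "?y \<in> loc_dom ?c ?d f" using c d M.chart[OF c(1)] by (simp add: loc_dom_def)
  have z: "loc_rep ?c ?d f ?y \<in> loc_dom ?d ?c (inv f)"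
    using loc_rep(4,5)[OF sf c(1) d(1) y] c M.chart(5)[OF c(1)] by (simp add: loc_dom_def inv)
  note D = diff_chain_at[OF loc_rep(6)[OF sf c(1) d(1) y] NM.loc_rep(6)[OF sg d(1) c(1) z]]
  have "(loc_rep ?d ?c (inv f) \<circ> loc_rep ?c ?d f) w = w" if "w \<in> loc_dom ?c ?d f" for w
    using that M.chart[OF c(1)] N.chart[OF d(1)] by (auto simp: loc_dom_def loc_rep_def inv)
  from has_derivative_transform_within_open[OF D loc_rep(1)[OF sf c(1) d(1)] y this]
  have "loc_D ?d ?c (inv f) (loc_rep ?c ?d f ?y) \<circ> loc_D ?c ?d f ?y = (\<lambda>x. x)"
    using has_derivative_unique[OF _ has_derivative_ident] by blast
  then have "loc_D ?d ?c (inv f) (loc_rep ?c ?d f ?y) (loc_D ?c ?d f ?y v) = v" by (metis comp_apply)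
  moreover have "loc_rep ?c ?d f ?y = cmap ?d (f x)" using M.chart(5)[OF c] by (simp add: loc_rep_def)
  ultimately show ?thesis by (simp add: tangent_map_def loc_rep_def inv)
qed

lemma diffeo_inv: "diffeo M N f \<Longrightarrow> diffeo N M (inv f)"
  by (simp add: diffeo_def bij_imp_bij_inv inv_inv_eq)

end

lemma (in rmfd_pair) diffeo_tangent_inv':
  assumes f: "diffeo M N f"
  shows "tangent_map M N f x (tangent_map N M (inv f) (f x) v) = v"
proof -
  interpret NM: rmfd_pair N M by unfold_locales
  show ?thesis using NM.diffeo_tangent_inv[OF diffeo_inv[OF f], of "f x" v] f
    by (simp add: diffeo_def inv_inv_eq bij_is_inj)
qed

lemma (in rmfd_pair) diffeo_tangent_inj: "diffeo M N f \<Longrightarrow> inj (tangent_map M N f x)"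
  using diffeo_tangent_inv by (metis injI)

lemma (in rmfd_pair) diffeo_inv_tangent:
  "diffeo M N f \<Longrightarrow> inv (tangent_map M N f x) = tangent_map N M (inv f) (f x)"
  using diffeo_tangent_inv diffeo_tangent_inv' by (intro inv_unique_comp) auto

lemma (in rmfd_pair) pullback_inv:
  assumes f: "diffeo M N f" shows "pullback N M (inv f) (pullback M N f \<omega>) = \<omega>"
proof (rule ext)+
  fix z vs
  obtain x where z: "z = f x" using f by (metis diffeo_def bij_pointE)
  have "inv f z = x" using f z by (simp add: diffeo_def bij_is_inj)
  then show "pullback N M (inv f) (pullback M N f \<omega>) z vs = \<omega> z vs"
    by (simp add: pullback_def z diffeo_tangent_inv'[OF f] o_def)
qed

lemma (in rmfd) tangent_map_id: "tangent_map M M id x v = v"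
proof -
  interpret rmfd_pair M M by unfold_locales
  show ?thesis
  proof -
    let ?c = "chart_at M x"
    have "(cmap ?c \<circ> id \<circ> cinv ?c has_derivative (\<lambda>v. v)) (at (cmap ?c x))"
      by (rule has_derivative_transform_within_open[OF has_derivative_ident chart(2)[OF chart_at(1)]])
        (use chart[OF chart_at(1)[of x]] chart_at(2)[of x] in auto)
    then show ?thesis unfolding tangent_map_def by (simp add: frechet_derivative_eqI)
  qed
qed

lemma (in rmfd) pullback_id: "pullback M M id \<omega> = \<omega>"
proof -
  have "tangent_map M M id x = (\<lambda>v. v)" for x using tangent_map_id by blast
  then show ?thesis by (intro ext) (simp add: pullback_def)
qed

section \<open>Singular values and the Jacobian\<close>

context rmfd_pair
begin

lemma sing_vals_frame:
  assumes f: "smooth_map M N f"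
  shows "\<exists>E. sing_frame (metric M x) (metric N (f x)) (tangent_map M N f x) E (sing_vals M N f x)"
proof -
  note iff = sing_frame_iff[OF M.metric_inner N.metric_inner tangent_map_linear[OF f], of _ x _ "f x" x]
  have "\<exists>l. (\<forall>i. 0 \<le> l i) \<and> (\<exists>E. orthonormal_frame (metric M x) E \<and>
       (\<forall>i. metric_adjoint (metric M x) (metric N (f x)) (tangent_map M N f x)
              (tangent_map M N f x (E i)) = (l i)\<^sup>2 *\<^sub>R E i))"
    using sing_frame_exists[OF M.metric_inner N.metric_inner tangent_map_linear[OF f], of x "f x" x] iff by blast
  from someI_ex[OF this] show ?thesis unfolding sing_vals_def[symmetric] using iff by blast
qed

lemma Jac_eq_prod: "Jac M N f x = (\<Prod>i\<in>UNIV. sing_vals M N f x i)"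
proof -
  have "{I :: 'n set. card I = CARD('n)} = {UNIV}"
    using card_subset_eq[OF finite subset_UNIV] by blast
  then show ?thesis by (simp add: Jac_def distortion_def)
qed

lemma Jac_pos: assumes "diffeo M N f" shows "0 < Jac M N f x"
proof -
  have f: "smooth_map M N f" using assms by (simp add: diffeo_def)
  obtain E where "sing_frame (metric M x) (metric N (f x)) (tangent_map M N f x) E (sing_vals M N f x)"
    using sing_vals_frame[OF f] by blast
  from sing_frame_pos[OF M.metric_inner N.metric_inner tangent_map_linear[OF f] diffeo_tangent_inj[OF assms] this]
  show ?thesis by (simp add: Jac_eq_prod prod_pos)
qed

lemma distortion_nonneg: assumes "smooth_map M N f" shows "0 \<le> distortion M N m f x"
  using sing_vals_frame[OF assms, of x] unfolding sing_frame_def distortion_def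
  by (auto intro!: sum_nonneg prod_nonneg)

lemma Jac_tangent:
  assumes "smooth_map M N f"
  shows "Jac M N f x * sqrt (det (gram (metric M x) ax)) =
    \<bar>det (matrix (tangent_map M N f x))\<bar> * sqrt (det (gram (metric N (f x)) ax))"
  using sing_vals_frame[OF assms, of x]
    sing_frame_prod[OF M.metric_inner N.metric_inner tangent_map_linear[OF assms]]
  by (auto simp: Jac_eq_prod)

lemma det_tangent_coord:
  assumes f: "smooth_map M N f" and c: "c \<in> atlas M" and d: "d \<in> atlas N" and y: "y \<in> loc_dom c d f"
  shows "det (matrix (tangent_map M N f (cinv c y))) * det (matrix (coord_to_tan M c (cinv c y))) =
    det (matrix (coord_to_tan N d (f (cinv c y)))) * det (matrix (loc_D c d f y))"
proof -
  have x: "cinv c y \<in> cdom c" "f (cinv c y) \<in> cdom d" using y M.chart[OF c] by (auto simp: loc_dom_def)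
  have "tangent_map M N f (cinv c y) \<circ> coord_to_tan M c (cinv c y) = coord_to_tan N d (f (cinv c y)) \<circ> loc_D c d f y"
    using tangent_coord[OF assms] by auto
  then have "matrix (tangent_map M N f (cinv c y)) ** matrix (coord_to_tan M c (cinv c y)) =
     matrix (coord_to_tan N d (f (cinv c y))) ** matrix (loc_D c d f y)"
    using matrix_compose[OF M.coord_to_tan_bij(1)[OF c x(1)] tangent_map_linear[OF f]]
      matrix_compose[OF loc_rep(7)[OF f c d y] N.coord_to_tan_bij(1)[OF d x(2)]] by metis
  then show ?thesis by (metis det_mul)
qed

text \<open>The pointwise content of the substitution formula: it trades the coordinate determinant
  for \<open>Jac\<close>. The determinants of \<open>coord_to_tan\<close> are positive, so the
  absolute value falls on the map alone.\<close>

lemma vol_dens_transform: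
  assumes f: "smooth_map M N f" and c: "c \<in> atlas M" and d: "d \<in> atlas N" and y: "y \<in> loc_dom c d f"
  shows "\<bar>det (matrix (loc_D c d f y))\<bar> * N.vol_dens d (loc_rep c d f y) = Jac M N f (cinv c y) * M.vol_dens c y"
proof -
  have x: "cinv c y \<in> cdom c" "f (cinv c y) \<in> cdom d" "y \<in> cimg c" using y M.chart[OF c] by (auto simp: loc_dom_def)
  have pA: "det (matrix (coord_to_tan M c (cinv c y))) > 0" and pB: "det (matrix (coord_to_tan N d (f (cinv c y)))) > 0"
    using M.coord_to_tan_bij(2)[OF c x(1)] N.coord_to_tan_bij(2)[OF d x(2)] .
  have "\<bar>det (matrix (tangent_map M N f (cinv c y)))\<bar> * det (matrix (coord_to_tan M c (cinv c y))) =
    det (matrix (coord_to_tan N d (f (cinv c y)))) * \<bar>det (matrix (loc_D c d f y))\<bar>"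
    using arg_cong[OF det_tangent_coord[OF assms], of abs] pA pB by (simp add: abs_mult)
  then show ?thesis
    using Jac_tangent[OF f, of "cinv c y"]
    unfolding M.vol_dens_eq[OF c x(3)] N.vol_dens_eq[OF d loc_rep(4)[OF f c d y]] loc_rep(5)[OF f c d y]
  proof -
    have "D * (B * H) = J * (A * G)" if "T * A = B * D" "J * G = T * H" for A B D G H J T :: real
    proof -
      have "D * (B * H) = (B * D) * H" by simp
      also have "\<dots> = A * (T * H)" by (simp flip: that(1))
      also have "\<dots> = J * (A * G)" by (simp flip: that(2))
      finally show ?thesis .
    qed
    then show "T * A = B * D \<Longrightarrow> J * G = T * H \<Longrightarrow> D * (B * H) = J * (A * G)" for A B D G H J T :: real .
  qed
qed

lemma continuous_on_det_loc_D:
  assumes f: "smooth_map M N f" and c: "c \<in> atlas M" and d: "d \<in> atlas N"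
  shows "continuous_on (loc_dom c d f) (\<lambda>y. det (matrix (loc_D c d f y)))"
proof (rule M.continuous_on_det)
  fix i j
  have "continuous_on (loc_dom c d f) (\<lambda>y. loc_D c d f y (ax j))"
    by (intro smooth_on_imp_continuous_on smooth_on_derivative loc_rep(2)[OF assms])
  then show "continuous_on (loc_dom c d f) (\<lambda>y. matrix (loc_D c d f y) $ i $ j)"
    by (simp add: matrix_def continuous_on_component)
qed

end

text \<open>Measurable functions are glued over countably many pieces; second countability supplies
  them through the Lindelof property.\<close>

lemma borel_measurable_restrict_locally:
  fixes h :: "'z::second_countable_topology \<Rightarrow> 'w::topological_space"
  assumes "\<And>x. x \<in> S \<Longrightarrow> \<exists>U. open U \<and> x \<in> U \<and> h \<in> borel_measurable (restrict_space borel (U \<inter> S))"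
  shows "h \<in> borel_measurable (restrict_space borel S)"
proof -
  define \<F> where "\<F> = {U. open U \<and> h \<in> borel_measurable (restrict_space borel (U \<inter> S))}"
  obtain \<F>' where F: "\<F>' \<subseteq> \<F>" "countable \<F>'" "\<Union>\<F>' = \<Union>\<F>"
    using Lindelof[of \<F>] by (auto simp: \<F>_def)
  show ?thesis
  proof (rule measurable_piecewise_restrict[of "(\<lambda>U. U \<inter> S) ` \<F>'"])
    show "countable ((\<lambda>U. U \<inter> S) ` \<F>')" using F by simp
    show "space (restrict_space borel S) \<subseteq> \<Union> ((\<lambda>U. U \<inter> S) ` \<F>')"
    proof
      fix x assume "x \<in> space (restrict_space borel S)"
      then have x: "x \<in> S" by (simp add: space_restrict_space)
      then have "x \<in> \<Union>\<F>" using assms by (auto simp: \<F>_def)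
      then show "x \<in> \<Union> ((\<lambda>U. U \<inter> S) ` \<F>')" using x F(3) by auto
    qed
    fix \<Omega> assume "\<Omega> \<in> (\<lambda>U. U \<inter> S) ` \<F>'"
    then obtain U where U: "U \<in> \<F>" "\<Omega> = U \<inter> S" using F by auto
    have "open U" using U by (simp add: \<F>_def)
    then show "\<Omega> \<inter> space (restrict_space borel S) \<in> sets (restrict_space borel S)"
      unfolding U(2) by (auto simp: space_restrict_space sets_restrict_space image_iff intro!: bexI[of _ U])
    have eq: "sets (restrict_space (restrict_space borel S) \<Omega>) = sets (restrict_space borel \<Omega> :: 'z measure)"
      unfolding U(2) by (simp add: sets_restrict_restrict_space Int_ac)
    have "h \<in> borel_measurable (restrict_space borel \<Omega>)" using U by (simp add: \<F>_def)
    then show "h \<in> borel_measurable (restrict_space (restrict_space borel S) \<Omega>)"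
      by (subst measurable_cong_sets[OF eq refl])
  qed
qed

lemma borel_measurable_locally:
  fixes h :: "'z::second_countable_topology \<Rightarrow> 'w::topological_space"
  assumes "\<And>x. \<exists>U. open U \<and> x \<in> U \<and> h \<in> borel_measurable (restrict_space borel U)"
  shows "h \<in> borel_measurable borel"
  using borel_measurable_restrict_locally[of UNIV h] assms
  by (simp add: measurable_cong_sets[OF sets_restrict_UNIV refl])

section \<open>The Riemannian volume\<close>

text \<open>A countable subcover, made disjoint, splits every Borel set into pieces on which the
  measures agree, and countable additivity reassembles them.\<close>

lemma measure_eqI_locally:
  fixes \<mu> \<nu> :: "'z::second_countable_topology measure"
  assumes sets: "sets \<mu> = sets borel" "sets \<nu> = sets borel"
    and loc: "\<And>x. \<exists>U. open U \<and> x \<in> U \<and> (\<forall>A\<in>sets borel. A \<subseteq> U \<longrightarrow> emeasure \<mu> A = emeasure \<nu> A)"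
  shows "\<mu> = \<nu>"
proof (rule measure_eqI)
  show "sets \<mu> = sets \<nu>" using sets by simp
  define \<F> where "\<F> = {U. open U \<and> (\<forall>A\<in>sets borel. A \<subseteq> U \<longrightarrow> emeasure \<mu> A = emeasure \<nu> A)}"
  obtain \<F>' where F: "\<F>' \<subseteq> \<F>" "countable \<F>'" "\<Union>\<F>' = \<Union>\<F>"
    using Lindelof[of \<F>] by (auto simp: \<F>_def)
  have U: "\<Union>\<F>' = UNIV" using loc unfolding F(3) \<F>_def by blast
  then have "\<F>' \<noteq> {}" by auto
  define D where "D = disjointed (from_nat_into \<F>')"
  have mem: "from_nat_into \<F>' n \<in> \<F>" for n using from_nat_into[OF \<open>\<F>' \<noteq> {}\<close>] F(1) by blast
  have D: "D n \<in> sets borel" for n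
    unfolding D_def using mem by (intro sets.range_disjointed_sets'[THEN subsetD, OF _ rangeI]) (auto simp: \<F>_def)
  have Dsub: "D n \<subseteq> from_nat_into \<F>' n" for n unfolding D_def by (rule disjointed_subset)
  have un: "(\<Union>n. D n) = UNIV"
    unfolding D_def UN_disjointed_eq using U F(2) \<open>\<F>' \<noteq> {}\<close> range_from_nat_into[of \<F>'] by auto
  have disj: "disjoint_family D" unfolding D_def by (rule disjoint_family_disjointed)
  fix A assume "A \<in> sets \<mu>"
  then have A: "A \<in> sets borel" using sets by simp
  have split: "emeasure \<rho> A = (\<Sum>n. emeasure \<rho> (A \<inter> D n))" if "sets \<rho> = sets borel" for \<rho> :: "'z measure"
  proof -
    have "(\<Sum>n. emeasure \<rho> (A \<inter> D n)) = emeasure \<rho> (\<Union>n. A \<inter> D n)"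
    proof (rule suminf_emeasure)
      show "disjoint_family (\<lambda>n. A \<inter> D n)" using disj unfolding disjoint_family_on_def by blast
    qed (use A D that in auto)
    then show ?thesis using un by (simp add: Int_UN_distrib[symmetric])
  qed
  have "emeasure \<mu> (A \<inter> D n) = emeasure \<nu> (A \<inter> D n)" for n
  proof -
    have "A \<inter> D n \<in> sets borel" "A \<inter> D n \<subseteq> from_nat_into \<F>' n" using A D[of n] Dsub[of n] by auto
    then show ?thesis using mem[of n] unfolding \<F>_def by blast
  qed
  then show "emeasure \<mu> A = emeasure \<nu> A" using split[OF sets(1)] split[OF sets(2)] by simp
qed

text \<open>Derived from the substitution theorem for absolutely integrable functions. That theorem
  transfers integrability in both directions, so in the remaining case neither side is integrable
  and both nonnegative integrals are infinite.\<close>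

lemma nn_integral_change_of_variables:
  fixes g :: "real^'n::{finite,wellorder} \<Rightarrow> real^'n::_" and h :: "real^'n::_ \<Rightarrow> real"
  assumes S: "S \<in> sets borel" and gS: "g ` S \<in> sets borel"
    and der: "\<And>x. x \<in> S \<Longrightarrow> (g has_derivative g' x) (at x within S)" and inj: "inj_on g S"
    and h: "h \<in> borel_measurable (restrict_space borel (g ` S))"
    and hg: "(\<lambda>x. \<bar>det (matrix (g' x))\<bar> * h (g x)) \<in> borel_measurable (restrict_space borel S)"
    and nn: "\<And>x. x \<in> S \<Longrightarrow> 0 \<le> h (g x)"
  shows "(\<integral>\<^sup>+y. ennreal (h y) * indicator (g ` S) y \<partial>lborel) =
    (\<integral>\<^sup>+x. ennreal (\<bar>det (matrix (g' x))\<bar> * h (g x)) * indicator S x \<partial>lborel)"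
proof -
  define F where "F = (\<lambda>x. \<bar>det (matrix (g' x))\<bar> * h (g x))"
  define fS where "fS = (\<lambda>x. indicator S x *\<^sub>R F x)"
  define hS where "hS = (\<lambda>y. indicator (g ` S) y *\<^sub>R h y)"
  have m: "fS \<in> borel_measurable borel" "hS \<in> borel_measurable borel"
    unfolding fS_def hS_def F_def using S gS h hg
    by (simp_all add: borel_measurable_restrict_space_iff)
  have nnS: "0 \<le> fS x" "0 \<le> hS x" for x using nn by (auto simp: fS_def hS_def F_def indicator_def)
  have fin: "(\<integral>\<^sup>+x. ennreal (u x) \<partial>lborel) = ennreal (integral\<^sup>L lborel u)" if "integrable lborel u" "\<And>x. 0 \<le> u x"
    for u :: "real^'n::_ \<Rightarrow> real" using that by (simp add: nn_integral_eq_integral)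
  have inf: "(\<integral>\<^sup>+x. ennreal (u x) \<partial>lborel) = \<infinity>"
    if "\<not> integrable lborel u" "\<And>x. 0 \<le> u x" "u \<in> borel_measurable borel" for u :: "real^'n::_ \<Rightarrow> real"
    using integrableI_nonneg[of u lborel] that by (auto simp: less_top[symmetric])
  \<comment> \<open>The substitution theorem is applied to vector valued functions, so
    \<open>h\<close> is wrapped as a function into \<open>real^1\<close> and unwrapped again in
    \<open>cov'\<close>.\<close>
  define H where "H = (\<lambda>y. vec (h y) :: real^1)"
  have cov: "((\<lambda>x. \<bar>det (matrix (g' x))\<bar> *\<^sub>R H (g x)) absolutely_integrable_on S \<and>
      integral S (\<lambda>x. \<bar>det (matrix (g' x))\<bar> *\<^sub>R H (g x)) = vec b) \<longleftrightarrow>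
      (H absolutely_integrable_on (g ` S) \<and> integral (g ` S) H = vec b)" for b
    by (rule has_absolute_integral_change_of_variables) (use S der inj in auto)
  have e1: "(\<lambda>x. \<bar>det (matrix (g' x))\<bar> *\<^sub>R H (g x)) = (\<lambda>x. vec (F x) :: real^1)"
    by (auto simp: H_def F_def vec_eq_iff)
  have v1: "(\<lambda>x. vec (u x) :: real^1) absolutely_integrable_on T \<longleftrightarrow> u absolutely_integrable_on T"
    for u :: "real^'n::_ \<Rightarrow> real" and T by (simp add: absolutely_integrable_on_1_iff)
  have v2: "integral T (\<lambda>x. vec (u x) :: real^1) = vec b \<longleftrightarrow> integral T u = b"
    if "u absolutely_integrable_on T" for u :: "real^'n::_ \<Rightarrow> real" and T b
    using that by (simp add: integral_on_1_eq v1 absolutely_integrable_on_def integrable_on_1_iff vec_eq_iff)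
  have cov': "(F absolutely_integrable_on S \<and> integral S F = b) \<longleftrightarrow>
     (h absolutely_integrable_on (g ` S) \<and> integral (g ` S) h = b)" for b
    using cov[of b] unfolding e1 unfolding H_def v1 using v2 by metis
  have ai: "u absolutely_integrable_on T \<longleftrightarrow> integrable lborel (\<lambda>x. indicator T x *\<^sub>R u x)"
    if "(\<lambda>x. indicator T x *\<^sub>R u x) \<in> borel_measurable borel" for u :: "real^'n::_ \<Rightarrow> real" and T
    using that by (simp add: set_integrable_def integrable_completion)
  have ii: "integral T u = integral\<^sup>L lborel (\<lambda>x. indicator T x *\<^sub>R u x)"
    if "(\<lambda>x. indicator T x *\<^sub>R u x) \<in> borel_measurable borel" "u absolutely_integrable_on T"
    for u :: "real^'n::_ \<Rightarrow> real" and T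
    using that set_lebesgue_integral_eq_integral(2)[OF that(2)]
    by (simp add: set_lebesgue_integral_def integral_completion)
  have "(\<integral>\<^sup>+y. ennreal (hS y) \<partial>lborel) = (\<integral>\<^sup>+x. ennreal (fS x) \<partial>lborel)"
  proof (cases "F absolutely_integrable_on S")
    case True
    then have h': "h absolutely_integrable_on (g ` S)" "integral (g ` S) h = integral S F" using cov' by auto
    have "integrable lborel fS" "integrable lborel hS"
      using True h'(1) ai m unfolding fS_def hS_def by blast+
    moreover have "integral\<^sup>L lborel hS = integral\<^sup>L lborel fS"
      using ii[of S F] ii[of "g ` S" h] m True h' unfolding fS_def hS_def by simp
    ultimately show ?thesis using fin nnS by simp
  next
    case False
    then have "\<not> h absolutely_integrable_on (g ` S)" using cov' by blast
    then have "\<not> integrable lborel fS" "\<not> integrable lborel hS"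
      using False ai m unfolding fS_def hS_def by blast+
    then show ?thesis using inf nnS m by simp
  qed
  moreover have "ennreal (hS y) = ennreal (h y) * indicator (g ` S) y" "ennreal (fS y) = ennreal (F y) * indicator S y" for y
    by (auto simp: hS_def fS_def indicator_def)
  ultimately show ?thesis by (simp add: F_def)
qed

text \<open>The volume of a single chart, as a measure on the whole manifold that vanishes outside
  the chart domain. \<open>volume_exists\<close> glues these measures.\<close>

definition chart_measure :: "('a::topological_space, 'n::finite) mfd \<Rightarrow> ('a, 'n) chart \<Rightarrow> 'a measure" where
  "chart_measure M c = distr (density (restrict_space lborel (cimg c))
     (\<lambda>y. ennreal (sqrt (det (gram (metric M (cinv c y)) (\<lambda>i. coord_to_tan M c (cinv c y) (axis i 1))))))) borel (cinv c)"

context rmfd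
begin

lemma sets_chart_measure [simp]: "sets (chart_measure M c) = sets borel"
  by (simp add: chart_measure_def)

lemma vol_dens_measurable: "c \<in> atlas M \<Longrightarrow> vol_dens c \<in> borel_measurable (restrict_space borel (cimg c))"
  by (rule borel_measurable_continuous_on_restrict[OF continuous_on_vol_dens])

lemma cinv_measurable: "c \<in> atlas M \<Longrightarrow> cinv c \<in> borel_measurable (restrict_space borel (cimg c))"
  by (rule borel_measurable_continuous_on_restrict[OF chart(4)])

lemma nn_integral_chart_measure:
  assumes c: "c \<in> atlas M" and h: "h \<in> borel_measurable borel"
  shows "(\<integral>\<^sup>+x. h x \<partial>chart_measure M c) =
    (\<integral>\<^sup>+y. (ennreal (vol_dens c y) * h (cinv c y)) * indicator (cimg c) y \<partial>lborel)"
proof -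
  have R: "measurable (restrict_space lborel (cimg c)) L = measurable (restrict_space borel (cimg c)) L" for L
    by (rule measurable_cong_sets[OF sets_restrict_space_cong[OF sets_lborel] refl])
  have "(\<integral>\<^sup>+x. h x \<partial>chart_measure M c) =
     (\<integral>\<^sup>+y. h (cinv c y) \<partial>(density (restrict_space lborel (cimg c)) (\<lambda>y. ennreal (vol_dens c y))))"
    unfolding chart_measure_def vol_dens_def using h cinv_measurable[OF c]
    by (intro nn_integral_distr) (simp_all add: R)
  also have "\<dots> = (\<integral>\<^sup>+y. ennreal (vol_dens c y) * h (cinv c y) \<partial>(restrict_space lborel (cimg c)))"
    using measurable_compose[OF cinv_measurable[OF c] h] vol_dens_measurable[OF c]
    by (intro nn_integral_density) (simp_all add: R)
  also have "\<dots> = (\<integral>\<^sup>+y. (ennreal (vol_dens c y) * h (cinv c y)) * indicator (cimg c) y \<partial>lborel)"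
    using chart(2)[OF c] by (subst nn_integral_restrict_space) auto
  finally show ?thesis .
qed

lemma emeasure_chart_measure:
  assumes c: "c \<in> atlas M" and A: "A \<in> sets borel" "A \<subseteq> cdom c"
  shows "emeasure (chart_measure M c) A = (\<integral>\<^sup>+y. ennreal (vol_dens c y) * indicator (cmap c ` A) y \<partial>lborel)"
proof -
  have "emeasure (chart_measure M c) A = (\<integral>\<^sup>+x. indicator A x \<partial>chart_measure M c)" using A by simp
  also have "\<dots> = (\<integral>\<^sup>+y. (ennreal (vol_dens c y) * indicator A (cinv c y)) * indicator (cimg c) y \<partial>lborel)"
    using nn_integral_chart_measure[OF c, of "indicator A"] A by simp
  also have "\<dots> = (\<integral>\<^sup>+y. ennreal (vol_dens c y) * indicator (cmap c ` A) y \<partial>lborel)"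
  proof (intro nn_integral_cong)
    fix y
    have "y \<in> cmap c ` A \<longleftrightarrow> y \<in> cimg c \<and> cinv c y \<in> A"
      using chart_image[OF c, of A] A(2) by (auto simp: Int_absorb1)
    then show "ennreal (vol_dens c y) * indicator A (cinv c y) * indicator (cimg c) y =
      ennreal (vol_dens c y) * indicator (cmap c ` A) y" by (auto simp: indicator_def)
  qed
  finally show ?thesis .
qed

lemma chart_image_borel:
  assumes c: "c \<in> atlas M" and A: "A \<in> sets borel" "A \<subseteq> cdom c"
  shows "cmap c ` A \<in> sets borel"
proof -
  have "cmap c ` A = {y \<in> cimg c. cinv c y \<in> A}" using chart_image[OF c, of A] A(2) by (simp add: Int_absorb1)
  also have "\<dots> = cinv c -` A \<inter> space (restrict_space borel (cimg c))" by (auto simp: space_restrict_space)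
  also have "\<dots> \<in> sets (restrict_space borel (cimg c))" using cinv_measurable[OF c] A(1) by (rule measurable_sets)
  finally show ?thesis using chart(2)[OF c] by (simp add: sets_restrict_space_iff)
qed

end

context rmfd_pair
begin

text \<open>The singular values are selected separately at each point, so measurability cannot be
  read off the definition. In charts \<open>vol_dens_transform\<close> presents \<open>Jac\<close>
  as a quotient of continuous functions.\<close>

lemma Jac_measurable:
  assumes f: "diffeo M N f" shows "Jac M N f \<in> borel_measurable borel"
proof (rule borel_measurable_locally)
  fix x
  have sf: "smooth_map M N f" using f by (simp add: diffeo_def)
  let ?c = "chart_at M x" and ?d = "chart_at N (f x)"
  note c = M.chart_at[of x] and d = N.chart_at[of "f x"]
  define U where "U = cdom ?c \<inter> f -` cdom ?d"
  have "open U" unfolding U_def using sf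
    by (intro open_Int open_vimage M.chart(1)[OF c(1)] N.chart(1)[OF d(1)]) (simp add: smooth_map_def)
  have mU: "cmap ?c z \<in> loc_dom ?c ?d f" if "z \<in> U" for z
    using that M.chart[OF c(1)] by (auto simp: U_def loc_dom_def)
  have cm: "continuous_on U (cmap ?c)" by (rule continuous_on_subset[OF M.chart(3)[OF c(1)]]) (simp add: U_def)
  have eq: "Jac M N f z = \<bar>det (matrix (loc_D ?c ?d f (cmap ?c z)))\<bar> *
      N.vol_dens ?d (loc_rep ?c ?d f (cmap ?c z)) / M.vol_dens ?c (cmap ?c z)" if z: "z \<in> U" for z
    using vol_dens_transform[OF sf c(1) d(1) mU[OF z]] M.vol_dens_pos[OF c(1), of "cmap ?c z"]
      z M.chart[OF c(1)] by (simp add: U_def field_simps)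
  have sub: "cmap ?c ` U \<subseteq> loc_dom ?c ?d f" using mU by auto
  have "continuous_on U (\<lambda>z. \<bar>det (matrix (loc_D ?c ?d f (cmap ?c z)))\<bar> *
      N.vol_dens ?d (loc_rep ?c ?d f (cmap ?c z)) / M.vol_dens ?c (cmap ?c z))"
  proof (intro continuous_on_divide continuous_on_mult continuous_on_rabs)
    show "continuous_on U (\<lambda>z. det (matrix (loc_D ?c ?d f (cmap ?c z))))"
      by (rule continuous_on_compose2[OF continuous_on_det_loc_D[OF sf c(1) d(1)] cm sub])
    have 1: "continuous_on U (\<lambda>z. loc_rep ?c ?d f (cmap ?c z))"
      by (rule continuous_on_compose2[OF smooth_on_imp_continuous_on[OF loc_rep(2)[OF sf c(1) d(1)]] cm sub])
    show "continuous_on U (\<lambda>z. N.vol_dens ?d (loc_rep ?c ?d f (cmap ?c z)))"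
      by (rule continuous_on_compose2[OF N.continuous_on_vol_dens[OF d(1)] 1]) (use loc_rep(4)[OF sf c(1) d(1)] mU in auto)
    have sub': "cmap ?c ` U \<subseteq> cimg ?c" using sub loc_rep(3)[OF sf c(1) d(1)] by auto
    show "continuous_on U (\<lambda>z. M.vol_dens ?c (cmap ?c z))"
      by (rule continuous_on_compose2[OF M.continuous_on_vol_dens[OF c(1)] cm sub'])
    show "\<forall>z\<in>U. M.vol_dens ?c (cmap ?c z) \<noteq> 0"
      using M.vol_dens_pos[OF c(1)] sub' by (metis image_subset_iff less_irrefl)
  qed
  then have "continuous_on U (Jac M N f)" by (subst continuous_on_cong[OF refl eq])
  then show "\<exists>U. open U \<and> x \<in> U \<and> Jac M N f \<in> borel_measurable (restrict_space borel U)"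
    using \<open>open U\<close> c d borel_measurable_continuous_on_restrict by (intro exI[of _ U]) (auto simp: U_def)
qed

lemma diffeo_image_borel:
  assumes "diffeo M N f" "A \<in> sets borel" shows "f ` A \<in> sets borel"
proof -
  have "inv f \<in> borel_measurable borel"
    using assms by (intro borel_measurable_continuous_onI) (auto simp: diffeo_def smooth_map_def)
  then have "inv f -` A \<inter> space borel \<in> sets borel" using assms(2) by (rule measurable_sets)
  then show ?thesis using assms(1) by (simp add: diffeo_def bij_vimage_eq_inv_image bij_imp_bij_inv inv_inv_eq)
qed

text \<open>Substitution in coordinates along \<open>loc_rep c d f\<close>, after which
  \<open>vol_dens_transform\<close> rewrites the determinant.\<close>

lemma chart_measure_transform:
  assumes f: "diffeo M N f" and c: "c \<in> atlas M" and d: "d \<in> atlas N"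
    and A: "A \<in> sets borel" "A \<subseteq> cdom c" "f ` A \<subseteq> cdom d"
  shows "emeasure (chart_measure N d) (f ` A) = (\<integral>\<^sup>+x. ennreal (Jac M N f x) * indicator A x \<partial>chart_measure M c)"
proof -
  have sf: "smooth_map M N f" and bf: "bij f" using f by (auto simp: diffeo_def)
  let ?F = "loc_rep c d f"
  define S where "S = cmap c ` A"
  have SA: "S = {y \<in> cimg c. cinv c y \<in> A}" using M.chart_image[OF c, of A] A(2) by (simp add: S_def Int_absorb1)
  have Sdom: "S \<subseteq> loc_dom c d f" using SA A(3) by (auto simp: loc_dom_def)
  have FS: "?F ` S = cmap d ` (f ` A)"
    using M.chart(5)[OF c] A(2) by (force simp: S_def loc_rep_def image_iff)
  have S: "S \<in> sets borel" unfolding S_def using c A by (intro M.chart_image_borel)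
  have FSb: "?F ` S \<in> sets borel" unfolding FS using d A diffeo_image_borel[OF f A(1)] by (intro N.chart_image_borel)
  have cont_F: "continuous_on S ?F"
    using smooth_on_imp_continuous_on[OF loc_rep(2)[OF sf c d]] Sdom continuous_on_subset by blast
  have FSsub: "?F ` S \<subseteq> cimg d" using loc_rep(4)[OF sf c d] Sdom by auto
  have "emeasure (chart_measure N d) (f ` A) = (\<integral>\<^sup>+y. ennreal (N.vol_dens d y) * indicator (?F ` S) y \<partial>lborel)"
    unfolding FS using A diffeo_image_borel[OF f A(1)] by (intro N.emeasure_chart_measure d)
  also have "\<dots> = (\<integral>\<^sup>+y. ennreal (\<bar>det (matrix (loc_D c d f y))\<bar> * N.vol_dens d (?F y)) * indicator S y \<partial>lborel)"
  proof (rule nn_integral_change_of_variables[OF S FSb])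
    show "(?F has_derivative loc_D c d f y) (at y within S)" if "y \<in> S" for y
      using loc_rep(6)[OF sf c d] that Sdom by (auto intro: has_derivative_at_withinI)
    show "inj_on ?F S"
    proof (rule inj_onI)
      fix y z assume yz: "y \<in> S" "z \<in> S" "?F y = ?F z"
      then have "f (cinv c y) = f (cinv c z)" using loc_rep(5)[OF sf c d] Sdom by (metis subsetD)
      then have "cinv c y = cinv c z" using bf by (simp add: bij_is_inj inj_eq)
      then show "y = z" using yz SA M.chart(7)[OF c] by (metis (mono_tags, lifting) mem_Collect_eq)
    qed
    show "N.vol_dens d \<in> borel_measurable (restrict_space borel (?F ` S))"
      using N.continuous_on_vol_dens[OF d] FSsub continuous_on_subset
      by (intro borel_measurable_continuous_on_restrict) blast
    have "continuous_on S (\<lambda>y. \<bar>det (matrix (loc_D c d f y))\<bar> * N.vol_dens d (?F y))"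
      using continuous_on_compose2[OF N.continuous_on_vol_dens[OF d] cont_F FSsub]
        continuous_on_subset[OF continuous_on_det_loc_D[OF sf c d] Sdom]
      by (intro continuous_on_mult continuous_on_rabs)
    then show "(\<lambda>y. \<bar>det (matrix (loc_D c d f y))\<bar> * N.vol_dens d (?F y)) \<in> borel_measurable (restrict_space borel S)"
      by (rule borel_measurable_continuous_on_restrict)
    show "0 \<le> N.vol_dens d (?F y)" if "y \<in> S" for y
      using N.vol_dens_pos[OF d, of "?F y"] FSsub that by auto
  qed
  also have "\<dots> = (\<integral>\<^sup>+y. (ennreal (M.vol_dens c y) * (ennreal (Jac M N f (cinv c y)) * indicator A (cinv c y))) * indicator (cimg c) y \<partial>lborel)"
  proof (intro nn_integral_cong)
    fix y
    show "ennreal (\<bar>det (matrix (loc_D c d f y))\<bar> * N.vol_dens d (?F y)) * indicator S y =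
      (ennreal (M.vol_dens c y) * (ennreal (Jac M N f (cinv c y)) * indicator A (cinv c y))) * indicator (cimg c) y"
    proof (cases "y \<in> S")
      case True
      then have "\<bar>det (matrix (loc_D c d f y))\<bar> * N.vol_dens d (?F y) = M.vol_dens c y * Jac M N f (cinv c y)"
        using vol_dens_transform[OF sf c d] Sdom by (metis mult.commute subsetD)
      moreover have "0 < M.vol_dens c y" "0 < Jac M N f (cinv c y)"
        using True SA M.vol_dens_pos[OF c] Jac_pos[OF f] by auto
      ultimately show ?thesis using True SA by (simp add: ennreal_mult)
    qed (use SA in \<open>auto simp: indicator_def\<close>)
  qed
  also have "\<dots> = (\<integral>\<^sup>+x. ennreal (Jac M N f x) * indicator A x \<partial>chart_measure M c)"
    using A(1) Jac_measurable[OF f] by (intro M.nn_integral_chart_measure[OF c, symmetric]) auto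
  finally show ?thesis .
qed

end

context rmfd
begin

lemma Jac_id: "Jac M M id x = 1"
proof -
  interpret rmfd_pair M M by unfold_locales
  have "tangent_map M M id x = (\<lambda>v. v)" using tangent_map_id by blast
  moreover have "matrix (\<lambda>v::real^'n::_. v) = mat 1" using matrix_id_mat_1 by (simp add: id_def)
  ultimately show ?thesis
    using Jac_tangent[OF smooth_map_id, of x] det_gram_pos[OF metric_inner, of x] by simp
qed

text \<open>The substitution formula for the identity, whose Jacobian is 1.\<close>

lemma chart_measure_agree:
  assumes "c \<in> atlas M" "d \<in> atlas M" "A \<in> sets borel" "A \<subseteq> cdom c" "A \<subseteq> cdom d"
  shows "emeasure (chart_measure M c) A = emeasure (chart_measure M d) A"
proof -
  interpret rmfd_pair M M by unfold_locales
  show ?thesis using chart_measure_transform[OF diffeo_id assms(1-3)] assms by (simp add: Jac_id)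
qed

text \<open>Countably many chart domains cover the manifold. Made disjoint, each piece is measured
  in its own chart; by \<open>chart_measure_agree\<close> any other chart containing the same points
  would measure them alike.\<close>

lemma volume_exists:
  "\<exists>\<mu>. sets \<mu> = sets borel \<and> (\<forall>c\<in>atlas M. \<forall>A\<in>sets borel. A \<subseteq> cdom c \<longrightarrow> emeasure \<mu> A = emeasure (chart_measure M c) A)"
proof -
  obtain \<F>' where F: "\<F>' \<subseteq> cdom ` atlas M" "countable \<F>'" "\<Union>\<F>' = \<Union>(cdom ` atlas M)"
    by (rule Lindelof[of "cdom ` atlas M"]) (use chart(1) in blast)+
  have U: "\<Union>\<F>' = UNIV" unfolding F(3) using chart_at by blast
  then have "\<F>' \<noteq> {}" by auto
  have "\<forall>n. \<exists>c\<in>atlas M. cdom c = from_nat_into \<F>' n" using from_nat_into[OF \<open>\<F>' \<noteq> {}\<close>] F(1) by (metis imageE subsetD)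
  then obtain c where c: "\<And>n. c n \<in> atlas M" "\<And>n. cdom (c n) = from_nat_into \<F>' n" by metis
  define D where "D = disjointed (\<lambda>n. cdom (c n))"
  have D: "D n \<in> sets borel" for n
    unfolding D_def using chart(1)[OF c(1)] by (intro sets.range_disjointed_sets'[THEN subsetD, OF _ rangeI]) auto
  have Dsub: "D n \<subseteq> cdom (c n)" for n unfolding D_def by (rule disjointed_subset)
  have un: "(\<Union>n. D n) = UNIV"
    unfolding D_def UN_disjointed_eq c using U F(2) \<open>\<F>' \<noteq> {}\<close> range_from_nat_into[of \<F>'] by auto
  have disj: "disjoint_family D" unfolding D_def by (rule disjoint_family_disjointed)
  define m where "m = (\<lambda>A. \<Sum>n. emeasure (chart_measure M (c n)) (A \<inter> D n))"
  define \<mu> where "\<mu> = measure_of UNIV (sets (borel :: 'a measure)) m"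
  have "countably_additive (sets (borel :: 'a measure)) m"
    unfolding countably_additive_def
  proof (intro allI impI)
    fix A :: "nat \<Rightarrow> 'a set" assume A: "range A \<subseteq> sets borel" "disjoint_family A"
    have sub: "emeasure (chart_measure M (c n)) ((\<Union>i. A i) \<inter> D n) = (\<Sum>i. emeasure (chart_measure M (c n)) (A i \<inter> D n))" for n
    proof -
      have "(\<Sum>i. emeasure (chart_measure M (c n)) (A i \<inter> D n)) = emeasure (chart_measure M (c n)) (\<Union>i. A i \<inter> D n)"
      proof (rule suminf_emeasure)
        show "disjoint_family (\<lambda>i. A i \<inter> D n)" using A(2) unfolding disjoint_family_on_def by blast
      qed (use A(1) D in auto)
      then show ?thesis by (simp add: Int_UN_distrib2)
    qed
    \<comment> \<open>Countable additivity amounts to exchanging two infinite sums. One of them is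
      read as an integral over \<open>count_space\<close>, through which a nonnegative series passes
      termwise.\<close>
    have "m (\<Union>i. A i) = (\<integral>\<^sup>+n. (\<Sum>i. emeasure (chart_measure M (c n)) (A i \<inter> D n)) \<partial>count_space UNIV)"
      by (simp add: m_def sub nn_integral_count_space_nat)
    also have "\<dots> = (\<Sum>i. \<integral>\<^sup>+n. emeasure (chart_measure M (c n)) (A i \<inter> D n) \<partial>count_space UNIV)"
      by (rule nn_integral_suminf) simp
    finally show "(\<Sum>i. m (A i)) = m (\<Union>i. A i)" by (simp add: m_def nn_integral_count_space_nat)
  qed
  then have em: "emeasure \<mu> A = m A" if "A \<in> sets borel" for A
    unfolding \<mu>_def using that sets.sigma_algebra_axioms[of "borel :: 'a measure"]
    by (intro emeasure_measure_of_sigma) (auto simp: positive_def m_def)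
  have "sets \<mu> = sets borel"
    unfolding \<mu>_def using sets.sigma_sets_eq[of "borel :: 'a measure"] by (simp add: sets_measure_of)
  moreover have "emeasure \<mu> A = emeasure (chart_measure M d) A" if d: "d \<in> atlas M" "A \<in> sets borel" "A \<subseteq> cdom d" for d A
  proof -
    have "emeasure \<mu> A = (\<Sum>n. emeasure (chart_measure M d) (A \<inter> D n))"
      unfolding em[OF d(2)] m_def using d D Dsub c
      by (intro suminf_cong chart_measure_agree) (auto intro: sets.Int)
    also have "\<dots> = emeasure (chart_measure M d) (\<Union>n. A \<inter> D n)"
    proof (rule suminf_emeasure)
      show "disjoint_family (\<lambda>n. A \<inter> D n)" using disj unfolding disjoint_family_on_def by blast
    qed (use d D in auto)
    finally show ?thesis using un by (simp add: Int_UN_distrib[symmetric])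
  qed
  ultimately show ?thesis by blast
qed

lemma volume_unique:
  assumes "sets \<mu> = sets borel" "\<And>c A. c \<in> atlas M \<Longrightarrow> A \<in> sets borel \<Longrightarrow> A \<subseteq> cdom c \<Longrightarrow> emeasure \<mu> A = emeasure (chart_measure M c) A"
    and "sets \<nu> = sets borel" "\<And>c A. c \<in> atlas M \<Longrightarrow> A \<in> sets borel \<Longrightarrow> A \<subseteq> cdom c \<Longrightarrow> emeasure \<nu> A = emeasure (chart_measure M c) A"
  shows "\<mu> = \<nu>"
proof (rule measure_eqI_locally[OF assms(1,3)])
  fix x
  show "\<exists>U. open U \<and> x \<in> U \<and> (\<forall>A\<in>sets borel. A \<subseteq> U \<longrightarrow> emeasure \<mu> A = emeasure \<nu> A)"
    using chart_at[of x] chart(1)[OF chart_at(1)] assms(2,4) by (intro exI[of _ "cdom (chart_at M x)"]) auto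
qed

lemma riem_vol: "sets (riem_vol M) = sets borel"
  "c \<in> atlas M \<Longrightarrow> A \<in> sets borel \<Longrightarrow> A \<subseteq> cdom c \<Longrightarrow> emeasure (riem_vol M) A = emeasure (chart_measure M c) A"
proof -
  have iff: "(sets \<mu> = sets borel \<and>
     (\<forall>c\<in>atlas M. \<forall>A\<in>sets borel. A \<subseteq> cdom c \<longrightarrow>
        emeasure \<mu> A =
          (\<integral>\<^sup>+y. ennreal (sqrt (det (gram (metric M (cinv c y))
                 (\<lambda>i. coord_to_tan M c (cinv c y) (axis i 1))))) * indicator (cmap c ` A) y \<partial>lborel))) \<longleftrightarrow>
    (sets \<mu> = sets borel \<and> (\<forall>c\<in>atlas M. \<forall>A\<in>sets borel. A \<subseteq> cdom c \<longrightarrow> emeasure \<mu> A = emeasure (chart_measure M c) A))" for \<mu>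
    using emeasure_chart_measure unfolding vol_dens_def by auto
  have "\<exists>!\<mu>. sets \<mu> = sets borel \<and> (\<forall>c\<in>atlas M. \<forall>A\<in>sets borel. A \<subseteq> cdom c \<longrightarrow> emeasure \<mu> A = emeasure (chart_measure M c) A)"
  proof (rule ex_ex1I[OF volume_exists], elim conjE)
    fix \<mu> \<nu> :: "'a measure"
    assume 1: "sets \<mu> = sets borel" "sets \<nu> = sets borel"
      and 2: "\<forall>c\<in>atlas M. \<forall>A\<in>sets borel. A \<subseteq> cdom c \<longrightarrow> emeasure \<mu> A = emeasure (chart_measure M c) A"
      and 3: "\<forall>c\<in>atlas M. \<forall>A\<in>sets borel. A \<subseteq> cdom c \<longrightarrow> emeasure \<nu> A = emeasure (chart_measure M c) A"
    show "\<mu> = \<nu>" by (rule volume_unique[OF 1(1) _ 1(2)]) (simp_all only: 2 3)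
  qed
  from theI'[OF this[folded iff]] have *: "sets (riem_vol M) = sets borel \<and>
    (\<forall>c\<in>atlas M. \<forall>A\<in>sets borel. A \<subseteq> cdom c \<longrightarrow> emeasure (riem_vol M) A = emeasure (chart_measure M c) A)"
    unfolding iff riem_vol_def .
  show "sets (riem_vol M) = sets borel"
    "c \<in> atlas M \<Longrightarrow> A \<in> sets borel \<Longrightarrow> A \<subseteq> cdom c \<Longrightarrow> emeasure (riem_vol M) A = emeasure (chart_measure M c) A"
    using * by auto
qed

lemma measurable_riem_vol [simp]: "measurable (riem_vol M) L = measurable borel L"
  by (rule measurable_cong_sets) (simp_all add: riem_vol)

lemma riem_vol_restrict:
  assumes c: "c \<in> atlas M" shows "density (riem_vol M) (indicator (cdom c)) = chart_measure M c"
proof (rule measure_eqI)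
  fix A assume "A \<in> sets (density (riem_vol M) (indicator (cdom c)))"
  then have A: "A \<in> sets borel" by (simp add: riem_vol)
  have Ac: "A \<inter> cdom c \<in> sets borel" using A chart(1)[OF c] by auto
  have "emeasure (density (riem_vol M) (indicator (cdom c))) A = (\<integral>\<^sup>+x. indicator (cdom c) x * indicator A x \<partial>riem_vol M)"
    using A chart(1)[OF c] by (subst emeasure_density) (auto simp: riem_vol)
  also have "\<dots> = (\<integral>\<^sup>+x. indicator (A \<inter> cdom c) x \<partial>riem_vol M)" by (intro nn_integral_cong) (auto simp: indicator_def)
  also have "\<dots> = emeasure (chart_measure M c) (A \<inter> cdom c)" using Ac riem_vol(2)[OF c Ac] by (simp add: riem_vol)
  also have "\<dots> = (\<integral>\<^sup>+x. indicator (A \<inter> cdom c) x \<partial>chart_measure M c)" using Ac by simp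
  also have "\<dots> = (\<integral>\<^sup>+x. indicator A x \<partial>chart_measure M c)"
    using A Ac chart(8)[OF c] by (subst (1 2) nn_integral_chart_measure[OF c]) (auto intro!: nn_integral_cong simp: indicator_def)
  finally show "emeasure (density (riem_vol M) (indicator (cdom c))) A = emeasure (chart_measure M c) A" using A by simp
qed (simp add: riem_vol)

lemma nn_integral_riem_vol_chart:
  assumes c: "c \<in> atlas M" and h: "h \<in> borel_measurable borel"
  shows "(\<integral>\<^sup>+x. h x * indicator (cdom c) x \<partial>riem_vol M) =
    (\<integral>\<^sup>+y. (ennreal (vol_dens c y) * h (cinv c y)) * indicator (cimg c) y \<partial>lborel)"
proof -
  have "(\<integral>\<^sup>+x. h x * indicator (cdom c) x \<partial>riem_vol M) = (\<integral>\<^sup>+x. h x \<partial>density (riem_vol M) (indicator (cdom c)))"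
    using h chart(1)[OF c] by (subst nn_integral_density) (auto simp: mult.commute)
  then show ?thesis using nn_integral_chart_measure[OF assms] by (simp add: riem_vol_restrict[OF c])
qed

end

context rmfd_pair
begin

text \<open>Both measures are compared on Borel sets that lie in a chart of \<open>N\<close> and
  have their preimage in a chart of \<open>M\<close>; there the claim is
  \<open>chart_measure_transform\<close>.\<close>

lemma riem_vol_transform:
  assumes f: "diffeo M N f"
  shows "riem_vol N = distr (density (riem_vol M) (\<lambda>x. ennreal (Jac M N f x))) borel f"
proof (rule measure_eqI_locally)
  have sf: "smooth_map M N f" and bf: "bij f" using f by (auto simp: diffeo_def)
  have cf: "continuous_on UNIV f" using sf by (simp add: smooth_map_def)
  have mf: "f \<in> borel_measurable borel" using cf by (rule borel_measurable_continuous_onI)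
  show "sets (riem_vol N) = sets borel"
    "sets (distr (density (riem_vol M) (\<lambda>x. ennreal (Jac M N f x))) borel f) = sets borel" by (auto simp: N.riem_vol)
  fix z
  obtain x where z: "z = f x" using bf by (metis bij_pointE)
  let ?c = "chart_at M x" and ?d = "chart_at N (f x)"
  note c = M.chart_at[of x] and d = N.chart_at[of "f x"]
  define U where "U = cdom ?d \<inter> inv f -` cdom ?c"
  have "open U" unfolding U_def using f
    by (intro open_Int open_vimage M.chart(1)[OF c(1)] N.chart(1)[OF d(1)]) (simp add: diffeo_def smooth_map_def)
  moreover have "z \<in> U" using c d bf by (simp add: U_def z bij_is_inj)
  moreover have "emeasure (riem_vol N) A = emeasure (distr (density (riem_vol M) (\<lambda>x. ennreal (Jac M N f x))) borel f) A"
    if A: "A \<in> sets borel" "A \<subseteq> U" for A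
  proof -
    define B where "B = f -` A"
    have B: "B \<in> sets borel" using measurable_sets[OF mf A(1)] by (simp add: B_def)
    have fB: "f ` B = A" using bf by (simp add: B_def bij_is_surj)
    have sub: "B \<subseteq> cdom ?c" "f ` B \<subseteq> cdom ?d" using A(2) bf fB by (auto simp: B_def U_def bij_is_inj dest!: subsetD)
    have "emeasure (riem_vol N) A = emeasure (chart_measure N ?d) (f ` B)"
      using N.riem_vol(2)[OF d(1) A(1)] sub fB by simp
    also have "\<dots> = (\<integral>\<^sup>+x. ennreal (Jac M N f x) * indicator B x \<partial>chart_measure M ?c)"
      by (rule chart_measure_transform[OF f c(1) d(1) B sub])
    also have "\<dots> = (\<integral>\<^sup>+x. ennreal (Jac M N f x) * indicator B x * indicator (cdom ?c) x \<partial>riem_vol M)"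
      unfolding M.riem_vol_restrict[OF c(1), symmetric]
      using Jac_measurable[OF f] B M.chart(1)[OF c(1)] by (subst nn_integral_density) (auto simp: mult_ac)
    also have "\<dots> = (\<integral>\<^sup>+x. ennreal (Jac M N f x) * indicator B x \<partial>riem_vol M)"
      using sub(1) by (intro nn_integral_cong) (auto simp: indicator_def)
    also have "\<dots> = emeasure (density (riem_vol M) (\<lambda>x. ennreal (Jac M N f x))) B"
      using Jac_measurable[OF f] B by (subst emeasure_density) (auto simp: M.riem_vol)
    also have "\<dots> = emeasure (distr (density (riem_vol M) (\<lambda>x. ennreal (Jac M N f x))) borel f) A"
      using mf A(1) by (subst emeasure_distr) (auto simp: B_def sets_eq_imp_space_eq[OF M.riem_vol(1)])
    finally show ?thesis .
  qed
  ultimately show "\<exists>U. open U \<and> z \<in> U \<and> (\<forall>A\<in>sets borel. A \<subseteq> U \<longrightarrow>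
    emeasure (riem_vol N) A = emeasure (distr (density (riem_vol M) (\<lambda>x. ennreal (Jac M N f x))) borel f) A)"
    by blast
qed

lemma nn_integral_transform:
  assumes f: "diffeo M N f" and h: "h \<in> borel_measurable borel"
  shows "(\<integral>\<^sup>+z. h z \<partial>riem_vol N) = (\<integral>\<^sup>+x. ennreal (Jac M N f x) * h (f x) \<partial>riem_vol M)"
proof -
  have mf: "f \<in> borel_measurable borel"
    using f by (intro borel_measurable_continuous_onI) (auto simp: diffeo_def smooth_map_def)
  show ?thesis
    unfolding riem_vol_transform[OF f]
    using mf h Jac_measurable[OF f] by (simp add: nn_integral_distr nn_integral_density measurable_compose[OF mf h])
qed

lemma integral_transform:
  fixes h :: "'b \<Rightarrow> real"
  assumes f: "diffeo M N f" and h: "h \<in> borel_measurable borel"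
  shows "(\<integral>z. h z \<partial>riem_vol N) = (\<integral>x. Jac M N f x * h (f x) \<partial>riem_vol M)"
proof -
  have mf: "f \<in> borel_measurable borel"
    using f by (intro borel_measurable_continuous_onI) (auto simp: diffeo_def smooth_map_def)
  show ?thesis
    unfolding riem_vol_transform[OF f]
    using mf h Jac_measurable[OF f] Jac_pos[OF f, THEN less_imp_le]
    by (simp add: integral_distr integral_density measurable_compose[OF mf h])
qed

text \<open>The integral of \<open>Jac\<close> over the preimage of a null set is zero, and
  \<open>Jac\<close> is positive.\<close>

lemma AE_transform:
  assumes f: "diffeo M N f" and ae: "AE z in riem_vol N. P z"
  shows "AE x in riem_vol M. P (f x)"
proof -
  have mf: "f \<in> borel_measurable borel"
    using f by (intro borel_measurable_continuous_onI) (auto simp: diffeo_def smooth_map_def)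
  from ae obtain A where A: "{z \<in> space (riem_vol N). \<not> P z} \<subseteq> A" "emeasure (riem_vol N) A = 0" "A \<in> sets (riem_vol N)"
    by (rule AE_E)
  have Ab: "A \<in> sets borel" using A(3) by (simp add: N.riem_vol)
  have B: "f -` A \<in> sets borel" using measurable_sets[OF mf Ab] by simp
  have "0 = (\<integral>\<^sup>+z. indicator A z \<partial>riem_vol N)" using A by simp
  also have "\<dots> = (\<integral>\<^sup>+x. ennreal (Jac M N f x) * indicator A (f x) \<partial>riem_vol M)"
    using nn_integral_transform[OF f, of "indicator A"] Ab by simp
  finally have "AE x in riem_vol M. ennreal (Jac M N f x) * indicator A (f x) = 0"
    using Jac_measurable[OF f] Ab measurable_compose[OF mf, of "indicator A :: _ \<Rightarrow> ennreal" borel]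
    by (subst nn_integral_0_iff_AE[symmetric]) auto
  then show ?thesis
  proof (rule AE_mp, intro AE_I2 impI)
    fix x assume "ennreal (Jac M N f x) * indicator A (f x) = 0"
    then have "f x \<notin> A" using Jac_pos[OF f, of x] by (auto simp: indicator_def split: if_splits)
    then show "P (f x)" using A(1) by (auto simp: sets_eq_imp_space_eq[OF N.riem_vol(1)])
  qed
qed

end

section \<open>The exterior derivative in coordinates\<close>

text \<open>The formula of \<open>ext_d\<close> for a family of forms on \<open>real^'n\<close>,
  detached from the chart selected at a point, so that coordinate changes can be studied in
  Euclidean space.\<close>

definition eucl_d :: "nat \<Rightarrow> (real^'n \<Rightarrow> 'n::finite altform) \<Rightarrow> real^'n \<Rightarrow> 'n altform" where
  "eucl_d k \<Omega> y vs = (if length vs = Suc k then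
     (\<Sum>i\<le>k. (- 1) ^ i * frechet_derivative (\<lambda>y. \<Omega> y (take i vs @ drop (Suc i) vs)) (at y) (vs ! i)) else 0)"

lemma ext_d_eucl_d: "ext_d M k \<omega> x = eucl_d k (local_form M (chart_at M x) \<omega>) (cmap (chart_at M x) x)"
  by (rule ext) (simp add: ext_d_def eucl_d_def)

lemma frechet_derivative_cong_open:
  assumes "open U" "y \<in> U" "\<And>z. z \<in> U \<Longrightarrow> f z = g z" "(f has_derivative f') (at y)"
  shows "frechet_derivative g (at y) = frechet_derivative f (at y)"
  using has_derivative_transform_within_open[OF assms(4,1,2,3)] assms(4) by (simp add: frechet_derivative_eqI)

lemma eucl_d_cong:
  assumes U: "open U" "y \<in> U" and eq: "\<And>z us. z \<in> U \<Longrightarrow> length us = k \<Longrightarrow> \<Omega> z us = \<Psi> z us"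
    and sm: "\<And>us. length us = k \<Longrightarrow> smooth_on U (\<lambda>z. \<Omega> z us)"
  shows "eucl_d k \<Omega> y vs = eucl_d k \<Psi> y vs"
proof (cases "length vs = Suc k")
  case True
  have "frechet_derivative (\<lambda>y. \<Psi> y (take i vs @ drop (Suc i) vs)) (at y) =
      frechet_derivative (\<lambda>y. \<Omega> y (take i vs @ drop (Suc i) vs)) (at y)" if "i \<le> k" for i
  proof -
    have l: "length (take i vs @ drop (Suc i) vs) = k" using True that by simp
    show ?thesis
      by (rule frechet_derivative_cong_open[OF U eq[OF _ l] smooth_on_has_derivative[OF sm[OF l] U(2)]])
  qed
  then show ?thesis unfolding eucl_d_def by (auto intro!: sum.cong)
qed (simp add: eucl_d_def)

lemma prod_list_update:
  fixes us :: "(real^'n) list"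
  assumes "length us = k" "length js = k" "r < k"
  shows "(\<Prod>s<k. us[r := b] ! s $ (js ! s)) = b $ (js ! r) * (\<Prod>s\<in>{..<k} - {r}. us ! s $ (js ! s))"
proof -
  have "(\<Prod>s<k. us[r := b] ! s $ (js ! s)) = us[r := b] ! r $ (js ! r) * (\<Prod>s\<in>{..<k} - {r}. us[r := b] ! s $ (js ! s))"
    using assms by (intro prod.remove) auto
  also have "(\<Prod>s\<in>{..<k} - {r}. us[r := b] ! s $ (js ! s)) = (\<Prod>s\<in>{..<k} - {r}. us ! s $ (js ! s))"
    by (intro prod.cong) auto
  finally show ?thesis using assms by simp
qed

lemma multilinear_expand_nth:
  fixes \<alpha> :: "'n::finite altform"
  assumes "multilinear k \<alpha>" "length vs = k"
  shows "\<alpha> vs = (\<Sum>js | length js = k. (\<Prod>r<k. vs ! r $ (js ! r)) * \<alpha> (map ax js))"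
  unfolding multilinear_expand[OF assms]
  by (intro sum.cong refl) (simp add: prod_list_map2_conv assms(2))

text \<open>Product rule after expansion in components. The first term differentiates the
  coefficients of the form; in the others the derivative hits one argument \<open>DF y w\<close> and
  replaces it by a second derivative of \<open>F\<close>.\<close>

lemma has_derivative_form_compose:
  fixes F :: "real^'n \<Rightarrow> real^'n"
  assumes U: "open U" "y \<in> U" and V: "open V" "F ` U \<subseteq> V" and F: "smooth_on U F"
    and \<Omega>: "\<And>z. z \<in> V \<Longrightarrow> multilinear k (\<Omega> z)"
    and sm: "\<And>us. length us = k \<Longrightarrow> smooth_on V (\<lambda>z. \<Omega> z us)"
    and ws: "length ws = k"
  defines "DF \<equiv> \<lambda>y. frechet_derivative F (at y)"
  defines "D2 \<equiv> \<lambda>v w. frechet_derivative (\<lambda>y. DF y w) (at y) v"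
  shows "((\<lambda>y. \<Omega> (F y) (map (DF y) ws)) has_derivative
     (\<lambda>v. frechet_derivative (\<lambda>z. \<Omega> z (map (DF y) ws)) (at (F y)) (DF y v) +
       (\<Sum>r<k. \<Omega> (F y) ((map (DF y) ws)[r := D2 v (ws ! r)])))) (at y)"
proof -
  have Fy: "F y \<in> V" using U V by auto
  define dO where "dO = (\<lambda>us. frechet_derivative (\<lambda>z. \<Omega> z us) (at (F y)))"
  have dO: "((\<lambda>z. \<Omega> z us) has_derivative dO us) (at (F y))" if "length us = k" for us
    unfolding dO_def by (rule smooth_on_has_derivative[OF sm[OF that] Fy])
  have dF: "(F has_derivative DF y) (at y)" unfolding DF_def by (rule smooth_on_has_derivative[OF F U(2)])
  have dD: "((\<lambda>y. DF y w $ j) has_derivative (\<lambda>v. D2 v w $ j)) (at y)" for w j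
    unfolding D2_def DF_def
    by (rule bounded_linear.has_derivative[OF bounded_linear_vec_nth smooth_on_has_derivative[OF smooth_on_derivative[OF F] U(2)]])
  have dP: "((\<lambda>y. \<Prod>r<k. DF y (ws ! r) $ (js ! r)) has_derivative
      (\<lambda>v. \<Sum>r<k. D2 v (ws ! r) $ (js ! r) * (\<Prod>s\<in>{..<k} - {r}. DF y (ws ! s) $ (js ! s)))) (at y)" for js
    by (rule has_derivative_prod[OF dD])
  define us where "us = map (DF y) ws"
  have us: "length us = k" "\<And>r. r < k \<Longrightarrow> us ! r = DF y (ws ! r)" using ws by (auto simp: us_def)
  have dOe: "dO us w = (\<Sum>js | length js = k. (\<Prod>r<k. us ! r $ (js ! r)) * dO (map ax js) w)" for w
  proof -
    have "((\<lambda>z. \<Sum>js | length js = k. (\<Prod>r<k. us ! r $ (js ! r)) * \<Omega> z (map ax js)) has_derivative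
      (\<lambda>w. \<Sum>js | length js = k. (\<Prod>r<k. us ! r $ (js ! r)) * dO (map ax js) w)) (at (F y))"
      by (intro has_derivative_sum has_derivative_mult_right dO) auto
    then have "((\<lambda>z. \<Omega> z us) has_derivative
      (\<lambda>w. \<Sum>js | length js = k. (\<Prod>r<k. us ! r $ (js ! r)) * dO (map ax js) w)) (at (F y))"
      by (rule has_derivative_transform_within_open[OF _ V(1) Fy]) (simp add: multilinear_expand_nth[OF \<Omega> us(1)])
    from has_derivative_unique[OF dO[OF us(1)] this] show ?thesis by (rule fun_cong)
  qed
  have up: "\<Omega> (F y) (us[r := b]) = (\<Sum>js | length js = k. (b $ (js ! r) * (\<Prod>s\<in>{..<k} - {r}. us ! s $ (js ! s))) * \<Omega> (F y) (map ax js))"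
    if "r < k" for r b
    using multilinear_expand_nth[OF \<Omega>[OF Fy], of "us[r := b]"] us that by (simp add: prod_list_update)
  have "((\<lambda>y. \<Sum>js | length js = k. (\<Prod>r<k. DF y (ws ! r) $ (js ! r)) * \<Omega> (F y) (map ax js)) has_derivative
     (\<lambda>v. \<Sum>js | length js = k. (\<Prod>r<k. DF y (ws ! r) $ (js ! r)) * dO (map ax js) (DF y v) +
       (\<Sum>r<k. D2 v (ws ! r) $ (js ! r) * (\<Prod>s\<in>{..<k} - {r}. DF y (ws ! s) $ (js ! s))) * \<Omega> (F y) (map ax js))) (at y)"
    by (intro has_derivative_sum has_derivative_mult dP has_derivative_compose[OF dF dO]) auto
  moreover have "(\<Sum>js | length js = k. (\<Prod>r<k. DF y (ws ! r) $ (js ! r)) * dO (map ax js) (DF y v) +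
       (\<Sum>r<k. D2 v (ws ! r) $ (js ! r) * (\<Prod>s\<in>{..<k} - {r}. DF y (ws ! s) $ (js ! s))) * \<Omega> (F y) (map ax js)) =
     dO us (DF y v) + (\<Sum>r<k. \<Omega> (F y) (us[r := D2 v (ws ! r)]))" for v
  proof -
    have "(\<Sum>r<k. \<Omega> (F y) (us[r := D2 v (ws ! r)])) = (\<Sum>js | length js = k.
        (\<Sum>r<k. D2 v (ws ! r) $ (js ! r) * (\<Prod>s\<in>{..<k} - {r}. DF y (ws ! s) $ (js ! s))) * \<Omega> (F y) (map ax js))"
      unfolding sum_distrib_right
      by (subst sum.swap) (auto intro!: sum.cong simp: up us(2))
    then show ?thesis by (simp add: sum.distrib dOe us(2))
  qed
  ultimately have "((\<lambda>y. \<Sum>js | length js = k. (\<Prod>r<k. DF y (ws ! r) $ (js ! r)) * \<Omega> (F y) (map ax js)) has_derivative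
     (\<lambda>v. dO us (DF y v) + (\<Sum>r<k. \<Omega> (F y) (us[r := D2 v (ws ! r)])))) (at y)" by simp
  then have "((\<lambda>y. \<Omega> (F y) (map (DF y) ws)) has_derivative
     (\<lambda>v. dO us (DF y v) + (\<Sum>r<k. \<Omega> (F y) (us[r := D2 v (ws ! r)])))) (at y)"
  proof (rule has_derivative_transform_within_open[OF _ U])
    fix z assume "z \<in> U"
    then have "F z \<in> V" using V by auto
    then show "(\<Sum>js | length js = k. (\<Prod>r<k. DF z (ws ! r) $ (js ! r)) * \<Omega> (F z) (map ax js)) = \<Omega> (F z) (map (DF z) ws)"
      using multilinear_expand_nth[OF \<Omega>, of "F z" "map (DF z) ws"] ws by simp
  qed
  then show ?thesis by (simp add: dO_def us_def)
qed

text \<open>The second derivative of \<open>F\<close> is symmetric, so that its contributions cancel in pairs.\<close>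

lemma sum_second_derivative_zero:
  fixes T :: "real^'n \<Rightarrow> real^'n"
  assumes \<alpha>: "alternating k \<alpha>" and sym: "\<And>v w. B v w = B w v" and vs: "length vs = Suc k"
  shows "(\<Sum>i\<le>k. (- 1) ^ i * (\<Sum>r<k. \<alpha> ((map T (take i vs @ drop (Suc i) vs))[r := B (vs ! i) ((take i vs @ drop (Suc i) vs) ! r)]))) = 0"
proof -
  define t where "t = (\<lambda>(i, r). (- 1) ^ i * \<alpha> ((map T (take i vs @ drop (Suc i) vs))[r := B (vs ! i) ((take i vs @ drop (Suc i) vs) ! r)]))"
  \<comment> \<open>Deleting entry \<open>i\<close> and altering slot \<open>r\<close> of the
    shortened list involves the same two vectors of \<open>vs\<close>, at positions \<open>i\<close>
    and \<open>Suc r\<close>, as deleting entry \<open>Suc r\<close> and altering slot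
    \<open>i\<close>. Moving the new vector past the \<open>r - i\<close> vectors in between,
    together with the change of the alternating sign from \<open>i\<close> to \<open>Suc r\<close>,
    leaves a total factor -1.\<close>
  have key: "t (i, r) = - t (Suc r, i)" if ir: "i \<le> r" "r < k" for i r
  proof -
    define xs ys zs where "xs = take i vs" and "ys = take (r - i) (drop (Suc i) vs)" and "zs = drop (Suc (Suc r)) vs"
    define a b where "a = vs ! i" and "b = vs ! Suc r"
    have len: "length xs = i" "length ys = r - i" using vs ir by (auto simp: xs_def ys_def)
    have "drop (Suc i) vs = ys @ drop (Suc r) vs"
    proof -
      have "drop (r - i) (drop (Suc i) vs) = drop (Suc r) vs" using ir by simp
      then show ?thesis unfolding ys_def by (metis append_take_drop_id)
    qed
    moreover have "drop (Suc r) vs = b # zs" using vs ir by (simp add: b_def zs_def Cons_nth_drop_Suc)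
    ultimately have d1: "drop (Suc i) vs = ys @ b # zs" by simp
    have d0: "vs = xs @ a # ys @ b # zs"
      using id_take_nth_drop[of i vs] vs ir d1 by (simp add: xs_def a_def)
    have 1: "take i vs @ drop (Suc i) vs = xs @ ys @ b # zs" using d1 by (simp add: xs_def)
    have 2: "take (Suc r) vs @ drop (Suc (Suc r)) vs = xs @ a # ys @ zs"
      using ir len by (subst (1) d0) (simp add: zs_def take_Cons')
    have "t (i, r) = (- 1) ^ i * \<alpha> (map T xs @ map T ys @ B a b # map T zs)"
      using ir len unfolding t_def prod.case 1 by (simp add: a_def[symmetric] nth_append list_update_append)
    moreover have "t (Suc r, i) = (- 1) ^ Suc r * \<alpha> (map T xs @ B b a # map T ys @ map T zs)"
      using ir len unfolding t_def prod.case 2 by (simp add: b_def[symmetric] nth_append list_update_append)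
    moreover have "\<alpha> (map T xs @ B b a # map T ys @ map T zs) = (- 1) ^ (r - i) * \<alpha> (map T xs @ map T ys @ B a b # map T zs)"
      using alternating_move[OF \<alpha>, of "map T xs" "B b a" "map T ys" "map T zs"] len sym[of a b] by simp
    moreover have "(- 1) ^ Suc r * (- 1) ^ (r - i) = - ((- 1) ^ i :: real)"
    proof -
      have "(- 1) ^ Suc r * (- 1) ^ (r - i) = ((- 1) ^ Suc (i + 2 * (r - i)) :: real)"
      proof -
        have "Suc r + (r - i) = Suc (i + 2 * (r - i))" using ir by simp
        then show ?thesis by (simp only: power_add[symmetric])
      qed
      then show ?thesis by (simp add: power_add power_mult)
    qed
    ultimately show ?thesis by (simp add: mult.assoc[symmetric])
  qed
  have "(\<Sum>i\<le>k. \<Sum>r<k. t (i, r)) = (\<Sum>p\<in>{..k} \<times> {..<k}. t p)" by (simp add: sum.cartesian_product)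
  also have "{..k} \<times> {..<k} = {(i, r). i \<le> r \<and> r < k} \<union> {(i, r). r < i \<and> i \<le> k}" by auto
  also have "(\<Sum>p\<in>\<dots>. t p) = (\<Sum>p\<in>{(i, r). i \<le> r \<and> r < k}. t p) + (\<Sum>p\<in>{(i, r). r < i \<and> i \<le> k}. t p)"
    by (rule sum.union_disjoint)
      (auto intro: finite_subset[of _ "{..k} \<times> {..<k}"])
  also have "(\<Sum>p\<in>{(i, r). r < i \<and> i \<le> k}. t p) = (\<Sum>p\<in>{(i, r). i \<le> r \<and> r < k}. - t p)"
    by (rule sum.reindex_bij_witness[of _ "\<lambda>(i, r). (Suc r, i)" "\<lambda>(i, r). (r, i - 1)"]) (auto simp: key)
  finally have "(\<Sum>i\<le>k. \<Sum>r<k. t (i, r)) = 0" by (simp add: sum_negf)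
  then show ?thesis by (simp add: t_def sum_distrib_left)
qed

text \<open>The second order terms of \<open>has_derivative_form_compose\<close> form exactly the
  sum treated in \<open>sum_second_derivative_zero\<close>; what remains is the pullback of the
  derivative.\<close>

lemma eucl_d_pullback:
  fixes F :: "real^'n \<Rightarrow> real^'n"
  assumes U: "open U" "y \<in> U" and V: "open V" "F ` U \<subseteq> V" and F: "smooth_on U F"
    and \<Omega>: "\<And>z. z \<in> V \<Longrightarrow> alternating k (\<Omega> z)"
    and sm: "\<And>us. length us = k \<Longrightarrow> smooth_on V (\<lambda>z. \<Omega> z us)"
  shows "eucl_d k (\<lambda>y us. \<Omega> (F y) (map (frechet_derivative F (at y)) us)) y vs =
    eucl_d k \<Omega> (F y) (map (frechet_derivative F (at y)) vs)"
proof (cases "length vs = Suc k")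
  case True
  define DF where "DF = (\<lambda>y. frechet_derivative F (at y))"
  define D2 where "D2 = (\<lambda>v w. frechet_derivative (\<lambda>y. DF y w) (at y) v)"
  have Fy: "F y \<in> V" using U V by auto
  have sym: "D2 v w = D2 w v" for v w
  proof (rule vec_eq_iff[THEN iffD2], rule allI)
    fix j
    have Fj: "smooth_on U (\<lambda>y. F y $ j)" by (rule smooth_on_linear_compose[OF U(1) bounded_linear_vec_nth F])
    have 1: "frechet_derivative (\<lambda>y. F y $ j) (at z) = (\<lambda>v. DF z v $ j)" if "z \<in> U" for z
      unfolding DF_def
      by (rule frechet_derivative_eqI[OF bounded_linear.has_derivative[OF bounded_linear_vec_nth smooth_on_has_derivative[OF F that]]])
    have 2: "frechet_derivative (\<lambda>z. frechet_derivative (\<lambda>y. F y $ j) (at z) w) (at y) v = D2 v w $ j" for v w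
    proof -
      have "((\<lambda>z. DF z w $ j) has_derivative (\<lambda>v. D2 v w $ j)) (at y)"
        unfolding D2_def DF_def
        by (rule bounded_linear.has_derivative[OF bounded_linear_vec_nth smooth_on_has_derivative[OF smooth_on_derivative[OF F] U(2)]])
      then have "((\<lambda>z. frechet_derivative (\<lambda>y. F y $ j) (at z) w) has_derivative (\<lambda>v. D2 v w $ j)) (at y)"
        by (rule has_derivative_transform_within_open[OF _ U]) (simp add: 1)
      then show ?thesis by (simp add: frechet_derivative_eqI)
    qed
    show "D2 v w $ j = D2 w v $ j"
      using second_derivative_symmetric[OF Fj U, of w v] 2 by simp
  qed
  let ?w = "\<lambda>i. take i vs @ drop (Suc i) vs"
  have d: "frechet_derivative (\<lambda>y. \<Omega> (F y) (map (DF y) (?w i))) (at y) v =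
      frechet_derivative (\<lambda>z. \<Omega> z (map (DF y) (?w i))) (at (F y)) (DF y v) +
       (\<Sum>r<k. \<Omega> (F y) ((map (DF y) (?w i))[r := D2 v (?w i ! r)]))" if "i \<le> k" for i v
  proof -
    have "length (?w i) = k" using that True by simp
    from frechet_derivative_eqI[OF has_derivative_form_compose[OF U V F alternating_imp_multilinear[OF \<Omega>] sm this]]
    show ?thesis unfolding DF_def D2_def by simp
  qed
  have "eucl_d k (\<lambda>y us. \<Omega> (F y) (map (DF y) us)) y vs =
    (\<Sum>i\<le>k. (- 1) ^ i * frechet_derivative (\<lambda>z. \<Omega> z (map (DF y) (?w i))) (at (F y)) (DF y (vs ! i))) +
    (\<Sum>i\<le>k. (- 1) ^ i * (\<Sum>r<k. \<Omega> (F y) ((map (DF y) (?w i))[r := D2 (vs ! i) (?w i ! r)])))"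
    using True unfolding eucl_d_def sum.distrib[symmetric] by (auto intro!: sum.cong simp: d ring_distribs simp del: map_append)
  also have "\<dots> = (\<Sum>i\<le>k. (- 1) ^ i * frechet_derivative (\<lambda>z. \<Omega> z (map (DF y) (?w i))) (at (F y)) (DF y (vs ! i)))"
    by (simp only: sum_second_derivative_zero[where B = D2 and T = "DF y", OF \<Omega>[OF Fy] sym True] add_0_right)
  also have "\<dots> = eucl_d k \<Omega> (F y) (map (DF y) vs)"
    using True unfolding eucl_d_def by (auto intro!: sum.cong simp: take_map drop_map)
  finally show ?thesis by (simp add: DF_def)
qed (simp add: eucl_d_def)

lemma eucl_d_multilinear:
  assumes V: "open V" "y \<in> V" and \<Omega>: "\<And>z. z \<in> V \<Longrightarrow> multilinear k (\<Omega> z)"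
    and sm: "\<And>us. length us = k \<Longrightarrow> smooth_on V (\<lambda>z. \<Omega> z us)"
  shows "multilinear (Suc k) (eucl_d k \<Omega> y)"
  unfolding multilinear_def
proof (intro conjI allI impI)
  show "eucl_d k \<Omega> y vs = 0" if "length vs \<noteq> Suc k" for vs using that by (simp add: eucl_d_def)
  fix vs :: "(real^'a) list" and i assume vs: "length vs = Suc k" and i: "i < Suc k"
  have D: "((\<lambda>z. \<Omega> z us) has_derivative frechet_derivative (\<lambda>z. \<Omega> z us) (at y)) (at y)" if "length us = k" for us
    by (rule smooth_on_has_derivative[OF sm[OF that] V(2)])
  have lin: "linear (\<lambda>v. frechet_derivative (\<lambda>z. \<Omega> z (ws[r := v])) (at y) b)" if "length ws = k" "r < k" for ws r b
  proof (rule linearI)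
    have l: "linear (\<lambda>v. \<Omega> z (ws[r := v]))" if "z \<in> V" for z
      using \<Omega>[OF that] \<open>length ws = k\<close> \<open>r < k\<close> unfolding multilinear_def by blast
    have len: "length (ws[r := v]) = k" for v using that by simp
    fix u v :: "real^'a" and s :: real
    have "((\<lambda>z. \<Omega> z (ws[r := u + v])) has_derivative (\<lambda>b. frechet_derivative (\<lambda>z. \<Omega> z (ws[r := u])) (at y) b +
       frechet_derivative (\<lambda>z. \<Omega> z (ws[r := v])) (at y) b)) (at y)"
      by (rule has_derivative_transform_within_open[OF has_derivative_add[OF D[OF len] D[OF len]] V])
        (simp add: linear_add[OF l])
    then show "frechet_derivative (\<lambda>z. \<Omega> z (ws[r := u + v])) (at y) b = frechet_derivative (\<lambda>z. \<Omega> z (ws[r := u])) (at y) b +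
       frechet_derivative (\<lambda>z. \<Omega> z (ws[r := v])) (at y) b" by (simp add: frechet_derivative_eqI)
    have "((\<lambda>z. \<Omega> z (ws[r := s *\<^sub>R u])) has_derivative (\<lambda>b. s *\<^sub>R frechet_derivative (\<lambda>z. \<Omega> z (ws[r := u])) (at y) b)) (at y)"
      by (rule has_derivative_transform_within_open[OF has_derivative_scaleR_right[OF D[OF len]] V])
        (simp add: linear_cmul[OF l])
    then show "frechet_derivative (\<lambda>z. \<Omega> z (ws[r := s *\<^sub>R u])) (at y) b = s *\<^sub>R frechet_derivative (\<lambda>z. \<Omega> z (ws[r := u])) (at y) b"
      by (simp add: frechet_derivative_eqI)
  qed
  have "linear (\<lambda>v. (- 1) ^ j * frechet_derivative (\<lambda>y. \<Omega> y (take j (vs[i := v]) @ drop (Suc j) (vs[i := v]))) (at y) (vs[i := v] ! j))"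
    if j: "j \<le> k" for j
  proof (cases "j = i")
    case True
    have "length (take j vs @ drop (Suc j) vs) = k" using j vs by simp
    from has_derivative_linear[OF D[OF this]]
    have "linear (\<lambda>v. ((- 1) ^ j) *\<^sub>R frechet_derivative (\<lambda>y. \<Omega> y (take j vs @ drop (Suc j) vs)) (at y) v)"
      by (rule linear_compose_scale_right)
    then show ?thesis using True vs i by (simp add: take_update_cancel drop_update_cancel)
  next
    case False
    \<comment> \<open>The position of entry \<open>i\<close> once entry \<open>j\<close> has been
      deleted.\<close>
    define i' where "i' = (if i < j then i else i - 1)"
    have len: "length (take j vs @ drop (Suc j) vs) = k" "i' < k" using j vs i False by (auto simp: i'_def)
    have "take j (vs[i := v]) @ drop (Suc j) (vs[i := v]) = (take j vs @ drop (Suc j) vs)[i' := v]" for v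
    proof (cases "i < j")
      case True
      then show ?thesis using j vs by (simp add: i'_def take_update_swap drop_update_cancel list_update_append)
    next
      case F: False
      then have "i > j" using False by simp
      then have "\<not> i - 1 < j" "i - 1 - j = i - Suc j" by auto
      then show ?thesis using j vs \<open>i > j\<close> by (simp add: i'_def take_update_cancel drop_update_swap list_update_append)
    qed
    moreover have "vs[i := v] ! j = vs ! j" for v using False by simp
    ultimately show ?thesis
      using linear_compose_scale_right[OF lin[OF len, of "vs ! j"], of "(- 1) ^ j"] by simp
  qed
  then have "linear (\<lambda>v. \<Sum>j\<le>k. (- 1) ^ j * frechet_derivative (\<lambda>y. \<Omega> y (take j (vs[i := v]) @ drop (Suc j) (vs[i := v]))) (at y) (vs[i := v] ! j))"
    by (intro linear_compose_sum) auto
  then show "linear (\<lambda>v. eucl_d k \<Omega> y (vs[i := v]))" using vs by (simp add: eucl_d_def)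
qed

lemma smooth_on_eucl_d:
  assumes V: "open V" and sm: "\<And>us. length us = k \<Longrightarrow> smooth_on V (\<lambda>z. \<Omega> z us)"
  shows "smooth_on V (\<lambda>y. eucl_d k \<Omega> y vs)"
proof (cases "length vs = Suc k")
  case True
  have "smooth_on V (\<lambda>y. \<Sum>i\<le>k. (- 1) ^ i * frechet_derivative (\<lambda>y. \<Omega> y (take i vs @ drop (Suc i) vs)) (at y) (vs ! i))"
    using True by (intro smooth_on_sum V smooth_on_mult smooth_on_const smooth_on_derivative sm) auto
  then show ?thesis using True by (simp add: eucl_d_def)
qed (simp add: eucl_d_def smooth_on_const)

section \<open>Pullback of forms\<close>

lemma pullback_alt: "pullback M N f \<omega> x = (\<lambda>vs. \<omega> (f x) (map (tangent_map M N f x) vs))"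
  by (rule ext) (simp add: pullback_def)

context rmfd
begin

lemma local_form_alternating:
  assumes "c \<in> atlas M" "y \<in> cimg c" "alternating k (\<omega> (cinv c y))"
  shows "alternating k (local_form M c \<omega> y)"
  using alternating_map[OF assms(3) coord_to_tan_bij(1)[OF assms(1) chart(8)[OF assms(1,2)]]]
  by (simp add: local_form_def[abs_def])

lemma set_measurable_iff:
  "c \<in> atlas M \<Longrightarrow> set_borel_measurable borel (cimg c) h \<longleftrightarrow> h \<in> borel_measurable (restrict_space borel (cimg c))" for h :: "_ \<Rightarrow> real"
  using chart(2) by (simp add: set_borel_measurable_def borel_measurable_restrict_space_iff)

lemma measurable_formD:
  assumes "measurable_form M k \<omega>" "c \<in> atlas M"
  shows "(\<lambda>y. local_form M c \<omega> y vs) \<in> borel_measurable (restrict_space borel (cimg c))"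
proof (cases "length vs = k")
  case False
  then have "local_form M c \<omega> y vs = 0" for y
    using assms(1) by (simp add: local_form_def measurable_form_def alternating_def)
  then show ?thesis by simp
qed (use assms set_measurable_iff in \<open>auto simp: measurable_form_def\<close>)

lemma measurable_formI:
  assumes "\<And>x. alternating k (\<omega> x)"
    "\<And>c vs. c \<in> atlas M \<Longrightarrow> length vs = k \<Longrightarrow> (\<lambda>y. local_form M c \<omega> y vs) \<in> borel_measurable (restrict_space borel (cimg c))"
  shows "measurable_form M k \<omega>"
  using assms set_measurable_iff by (simp add: measurable_form_def)

end

context rmfd_pair
begin

lemma pullback_alternating:
  "smooth_map M N f \<Longrightarrow> alternating k (\<omega> (f x)) \<Longrightarrow> alternating k (pullback M N f \<omega> x)"
  unfolding pullback_alt by (intro alternating_map tangent_map_linear)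

text \<open>The arguments \<open>loc_D c d f y v\<close> move with \<open>y\<close>, whereas
  measurability and smoothness of a form are formulated for constant arguments. The expansion
  separates the moving coefficients from constant basis vectors.\<close>

lemma local_form_pullback_expand:
  assumes f: "smooth_map M N f" and c: "c \<in> atlas M" and d: "d \<in> atlas N" and y: "y \<in> loc_dom c d f"
    and \<omega>: "\<And>x. alternating k (\<omega> x)" and vs: "length vs = k"
  shows "local_form M c (pullback M N f \<omega>) y vs = (\<Sum>js | length js = k.
    (\<Prod>r<k. loc_D c d f y (vs ! r) $ (js ! r)) * local_form N d \<omega> (loc_rep c d f y) (map ax js))"
proof -
  have "multilinear k (local_form N d \<omega> (loc_rep c d f y))"
    by (intro alternating_imp_multilinear N.local_form_alternating d loc_rep(4)[OF f c d y] \<omega>)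
  from multilinear_expand_nth[OF this, of "map (loc_D c d f y) vs"] show ?thesis
    using vs by (simp add: local_form_pullback[OF f c d y])
qed

lemma smooth_on_loc_D_component:
  assumes "smooth_map M N f" "c \<in> atlas M" "d \<in> atlas N"
  shows "smooth_on (loc_dom c d f) (\<lambda>y. loc_D c d f y v $ j)"
  by (rule smooth_on_linear_compose[OF loc_rep(1)[OF assms] bounded_linear_vec_nth smooth_on_derivative[OF loc_rep(2)[OF assms]]])

lemma pullback_measurable:
  assumes f: "smooth_map M N f" and \<omega>: "measurable_form N k \<omega>"
  shows "measurable_form M k (pullback M N f \<omega>)"
proof (rule M.measurable_formI)
  have alt: "alternating k (\<omega> x)" for x using \<omega> by (simp add: measurable_form_def)
  show "alternating k (pullback M N f \<omega> x)" for x by (rule pullback_alternating[OF f alt])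
  fix c and vs :: "(real^'n::_) list" assume c: "c \<in> atlas M" and vs: "length vs = k"
  show "(\<lambda>y. local_form M c (pullback M N f \<omega>) y vs) \<in> borel_measurable (restrict_space borel (cimg c))"
  proof (rule borel_measurable_restrict_locally)
    fix y assume y: "y \<in> cimg c"
    define d where "d = chart_at N (f (cinv c y))"
    have d: "d \<in> atlas N" "y \<in> loc_dom c d f" using N.chart_at y by (auto simp: d_def loc_dom_def)
    let ?U = "loc_dom c d f"
    note U = loc_rep[OF f c d(1)]
    have mF: "loc_rep c d f \<in> measurable (restrict_space borel ?U) (restrict_space borel (cimg d))"
      using U(4) by (intro measurable_restrict_space2 borel_measurable_continuous_on_restrict smooth_on_imp_continuous_on[OF U(2)])
        (auto simp: space_restrict_space)
    have "(\<lambda>y. \<Sum>js | length js = k. (\<Prod>r<k. loc_D c d f y (vs ! r) $ (js ! r)) * local_form N d \<omega> (loc_rep c d f y) (map ax js))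
       \<in> borel_measurable (restrict_space borel ?U)"
      by (intro borel_measurable_sum borel_measurable_times borel_measurable_prod
          measurable_compose[OF mF N.measurable_formD[OF \<omega> d(1)]]
          borel_measurable_continuous_on_restrict smooth_on_imp_continuous_on[OF smooth_on_loc_D_component[OF f c d(1)]])
    then have "(\<lambda>y. local_form M c (pullback M N f \<omega>) y vs) \<in> borel_measurable (restrict_space borel ?U)"
      by (rule measurable_cong[THEN iffD2, rotated])
        (simp add: space_restrict_space local_form_pullback_expand[OF f c d(1) _ alt vs])
    moreover have "?U \<inter> cimg c = ?U" using U(3) by blast
    ultimately show "\<exists>U. open U \<and> y \<in> U \<and> (\<lambda>y. local_form M c (pullback M N f \<omega>) y vs) \<in> borel_measurable (restrict_space borel (U \<inter> cimg c))"
      using U(1) d(2) by (intro exI[of _ ?U]) simp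
  qed
qed

lemma pullback_smooth:
  assumes f: "smooth_map M N f" and \<omega>: "smooth_form N k \<omega>"
  shows "smooth_form M k (pullback M N f \<omega>)"
  unfolding smooth_form_def
proof (intro conjI allI ballI impI)
  have alt: "alternating k (\<omega> x)" for x using \<omega> by (simp add: smooth_form_def)
  show "alternating k (pullback M N f \<omega> x)" for x by (rule pullback_alternating[OF f alt])
  fix c and vs :: "(real^'n::_) list" assume c: "c \<in> atlas M" and vs: "length vs = k"
  show "smooth_on (cimg c) (\<lambda>y. local_form M c (pullback M N f \<omega>) y vs)"
  proof (rule smooth_on_locally)
    fix y assume y: "y \<in> cimg c"
    define d where "d = chart_at N (f (cinv c y))"
    have d: "d \<in> atlas N" "y \<in> loc_dom c d f" using N.chart_at y by (auto simp: d_def loc_dom_def)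
    let ?U = "loc_dom c d f"
    note U = loc_rep[OF f c d(1)]
    have im: "loc_rep c d f ` ?U \<subseteq> cimg d" using U(4) by auto
    have sm: "smooth_on (cimg d) (\<lambda>z. local_form N d \<omega> z (map ax js))" if "length js = k" for js
      using \<omega> d(1) that by (simp add: smooth_form_def)
    have "smooth_on ?U (\<lambda>y. \<Sum>js | length js = k. (\<Prod>r<k. loc_D c d f y (vs ! r) $ (js ! r)) * local_form N d \<omega> (loc_rep c d f y) (map ax js))"
      by (intro smooth_on_sum smooth_on_mult smooth_on_prod U(1) smooth_on_loc_D_component[OF f c d(1)]
        smooth_on_compose[OF U(1) im U(2) sm]) auto
    then have "smooth_on ?U (\<lambda>y. local_form M c (pullback M N f \<omega>) y vs)"
      by (rule smooth_on_cong[OF U(1), THEN iffD2, rotated]) (simp add: local_form_pullback_expand[OF f c d(1) _ alt vs])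
    then show "\<exists>U. open U \<and> y \<in> U \<and> smooth_on U (\<lambda>y. local_form M c (pullback M N f \<omega>) y vs)"
      using U(1) d(2) by blast
  qed
qed

lemma eucl_d_local_pullback:
  assumes f: "smooth_map M N f" and c: "c \<in> atlas M" and d: "d \<in> atlas N" and y: "y \<in> loc_dom c d f"
    and \<omega>: "smooth_form N k \<omega>"
  shows "eucl_d k (local_form M c (pullback M N f \<omega>)) y vs =
    eucl_d k (local_form N d \<omega>) (loc_rep c d f y) (map (loc_D c d f y) vs)"
proof -
  note U = loc_rep[OF f c d]
  have alt: "alternating k (local_form N d \<omega> z)" if "z \<in> cimg d" for z
    using N.local_form_alternating[OF d that] \<omega> by (simp add: smooth_form_def)
  have sm: "smooth_on (cimg d) (\<lambda>z. local_form N d \<omega> z us)" if "length us = k" for us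
    using \<omega> d that by (simp add: smooth_form_def)
  have sm': "smooth_on (loc_dom c d f) (\<lambda>z. local_form M c (pullback M N f \<omega>) z us)" if "length us = k" for us
    by (rule smooth_on_subset[OF _ U(3)]) (use pullback_smooth[OF f \<omega>] c that in \<open>simp add: smooth_form_def\<close>)
  have "eucl_d k (local_form M c (pullback M N f \<omega>)) y vs =
    eucl_d k (\<lambda>y us. local_form N d \<omega> (loc_rep c d f y) (map (loc_D c d f y) us)) y vs"
    by (rule eucl_d_cong[OF U(1) y local_form_pullback[OF f c d] sm'])
  also have "\<dots> = eucl_d k (local_form N d \<omega>) (loc_rep c d f y) (map (loc_D c d f y) vs)"
    by (rule eucl_d_pullback[OF U(1) y N.chart(2)[OF d] _ U(2) alt sm]) (use U(4) in auto)
  finally show ?thesis .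
qed

lemma ext_d_pullback:
  assumes f: "smooth_map M N f" and \<omega>: "smooth_form N k \<omega>"
  shows "ext_d M k (pullback M N f \<omega>) = pullback M N f (ext_d N k \<omega>)"
proof (rule ext)+
  fix x vs
  let ?c = "chart_at M x" and ?d = "chart_at N (f x)"
  note c = M.chart_at[of x] and d = N.chart_at[of "f x"]
  have y: "cmap ?c x \<in> loc_dom ?c ?d f" using c d M.chart[OF c(1)] by (simp add: loc_dom_def)
  show "ext_d M k (pullback M N f \<omega>) x vs = pullback M N f (ext_d N k \<omega>) x vs"
    unfolding pullback_def[of M N f "ext_d N k \<omega>"] ext_d_eucl_d eucl_d_local_pullback[OF f c(1) d(1) y \<omega>]
    using M.chart(5)[OF c] by (simp add: loc_rep_def tangent_map_def)
qed

end

context rmfd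
begin

text \<open>\<open>ext_d\<close> is computed in the chart selected at each point; naturality under
  the identity shows that every chart gives the same result.\<close>

lemma local_form_ext_d:
  assumes \<omega>: "smooth_form M k \<omega>" and c: "c \<in> atlas M" and y: "y \<in> cimg c"
  shows "local_form M c (ext_d M k \<omega>) y vs = eucl_d k (local_form M c \<omega>) y vs"
proof -
  interpret rmfd_pair M M by unfold_locales
  define x where "x = cinv c y"
  let ?d = "chart_at M x"
  note d = chart_at[of x]
  have y': "y \<in> loc_dom c ?d id" using y d by (simp add: loc_dom_def x_def)
  have "cmap c x = y" using chart(7)[OF c y] by (simp add: x_def)
  then show ?thesis
    using eucl_d_local_pullback[OF smooth_map_id c d(1) y' \<omega>, of vs]
    by (simp add: pullback_id local_form_def[of M c "ext_d M k \<omega>"] ext_d_eucl_d loc_rep_def coord_to_tan_def x_def[symmetric])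
qed

lemma ext_d_multilinear:
  assumes \<omega>: "smooth_form M k \<omega>" shows "multilinear (Suc k) (ext_d M k \<omega> x)"
  unfolding ext_d_eucl_d
proof (rule eucl_d_multilinear)
  note c = chart_at[of x]
  show "open (cimg (chart_at M x))" "cmap (chart_at M x) x \<in> cimg (chart_at M x)" using chart[OF c(1)] c by auto
  show "multilinear k (local_form M (chart_at M x) \<omega> z)" if "z \<in> cimg (chart_at M x)" for z
    using \<omega> by (intro alternating_imp_multilinear local_form_alternating c that) (simp add: smooth_form_def)
  show "smooth_on (cimg (chart_at M x)) (\<lambda>z. local_form M (chart_at M x) \<omega> z us)" if "length us = k" for us
    using \<omega> that c by (simp add: smooth_form_def)
qed

lemma smooth_on_local_ext_d:
  assumes \<omega>: "smooth_form M k \<omega>" and c: "c \<in> atlas M"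
  shows "smooth_on (cimg c) (\<lambda>y. local_form M c (ext_d M k \<omega>) y vs)"
proof -
  have "smooth_on (cimg c) (\<lambda>y. eucl_d k (local_form M c \<omega>) y vs)"
    using \<omega> c by (intro smooth_on_eucl_d chart(2)[OF c]) (simp add: smooth_form_def)
  then show ?thesis by (rule smooth_on_cong[OF chart(2)[OF c], THEN iffD2, rotated]) (simp add: local_form_ext_d[OF \<omega> c])
qed

lemma locally_constant_chart:
  assumes s: "\<And>x. \<exists>U. open U \<and> x \<in> U \<and> (\<forall>z\<in>U. s z = (s x :: real))" and c: "c \<in> atlas M" and y: "y \<in> cimg c"
  shows "\<exists>U. open U \<and> y \<in> U \<and> U \<subseteq> cimg c \<and> (\<forall>z\<in>U. s (cinv c z) = s (cinv c y))"
proof -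
  obtain W where W: "open W" "cinv c y \<in> W" "\<forall>z\<in>W. s z = s (cinv c y)" using s by blast
  define U where "U = {z \<in> cimg c. cinv c z \<in> W}"
  have "open U" using open_chart_preimage[OF c W(1) continuous_on_id] by (simp add: U_def)
  moreover have "y \<in> U" "U \<subseteq> cimg c" "\<forall>z\<in>U. s (cinv c z) = s (cinv c y)"
    using W(2,3) y unfolding U_def by blast+
  ultimately show ?thesis by blast
qed

text \<open>Meant for the orientation sign of a diffeomorphism: near each point the factor is a
  constant, and both smoothness and the differential are local.\<close>

lemma smooth_form_locally_constant:
  assumes s: "\<And>x. \<exists>U. open U \<and> x \<in> U \<and> (\<forall>z\<in>U. s z = (s x :: real))" and \<omega>: "smooth_form M k \<omega>"
  shows "smooth_form M k (\<lambda>x vs. s x * \<omega> x vs)" "ext_d M k (\<lambda>x vs. s x * \<omega> x vs) = (\<lambda>x vs. s x * ext_d M k \<omega> x vs)"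
proof -
  have loc: "local_form M c (\<lambda>x vs. s x * \<omega> x vs) y vs = s (cinv c y) * local_form M c \<omega> y vs" for c y vs
    by (simp add: local_form_def)
  have sm: "\<exists>U. open U \<and> y \<in> U \<and> (\<forall>us. length us = k \<longrightarrow>
      smooth_on U (\<lambda>z. s (cinv c y) * local_form M c \<omega> z us) \<and>
      (\<forall>z\<in>U. local_form M c (\<lambda>x vs. s x * \<omega> x vs) z us = s (cinv c y) * local_form M c \<omega> z us))"
    if c: "c \<in> atlas M" and y: "y \<in> cimg c" for c y
  proof -
    obtain U where U: "open U" "y \<in> U" "U \<subseteq> cimg c" "\<forall>z\<in>U. s (cinv c z) = s (cinv c y)"
      using locally_constant_chart[OF s c y] by blast
    have "smooth_on U (\<lambda>z. s (cinv c y) * local_form M c \<omega> z us)" if "length us = k" for us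
      using \<omega> c that
      by (intro smooth_on_mult U(1) smooth_on_const) (rule smooth_on_subset[OF _ U(3)], simp add: smooth_form_def)
    moreover have "local_form M c (\<lambda>x vs. s x * \<omega> x vs) z us = s (cinv c y) * local_form M c \<omega> z us" if "z \<in> U" for z us
      using U(4)[rule_format, OF that] by (simp only: loc)
    ultimately show ?thesis using U(1,2) by blast
  qed
  show "smooth_form M k (\<lambda>x vs. s x * \<omega> x vs)"
    unfolding smooth_form_def
  proof (intro conjI allI ballI impI)
    show "alternating k (\<lambda>vs. s x * \<omega> x vs)" for x using \<omega> by (intro alternating_scale) (simp add: smooth_form_def)
    fix c and vs :: "(real^'n::_) list" assume c: "c \<in> atlas M" and vs: "length vs = k"
    show "smooth_on (cimg c) (\<lambda>y. local_form M c (\<lambda>x vs. s x * \<omega> x vs) y vs)"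
    proof (rule smooth_on_locally)
      fix y assume "y \<in> cimg c"
      from sm[OF c this] obtain U where U: "open U" "y \<in> U" "smooth_on U (\<lambda>z. s (cinv c y) * local_form M c \<omega> z vs)"
        "\<forall>z\<in>U. local_form M c (\<lambda>x vs. s x * \<omega> x vs) z vs = s (cinv c y) * local_form M c \<omega> z vs"
        using vs by blast
      then show "\<exists>U. open U \<and> y \<in> U \<and> smooth_on U (\<lambda>y. local_form M c (\<lambda>x vs. s x * \<omega> x vs) y vs)"
        using smooth_on_cong[OF U(1) U(4)[rule_format], THEN iffD2, OF _ U(3)] by blast
    qed
  qed
  show "ext_d M k (\<lambda>x vs. s x * \<omega> x vs) = (\<lambda>x vs. s x * ext_d M k \<omega> x vs)"
  proof (rule ext)+
    fix x vs
    let ?c = "chart_at M x" and ?y = "cmap (chart_at M x) x"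
    note c = chart_at[of x]
    have y: "?y \<in> cimg ?c" "cinv ?c ?y = x" using chart[OF c(1)] c by auto
    obtain U where U: "open U" "?y \<in> U" "\<And>us. length us = k \<Longrightarrow> smooth_on U (\<lambda>z. s x * local_form M ?c \<omega> z us)"
      "\<And>us z. length us = k \<Longrightarrow> z \<in> U \<Longrightarrow> local_form M ?c (\<lambda>x vs. s x * \<omega> x vs) z us = s x * local_form M ?c \<omega> z us"
      using sm[OF c(1) y(1)] unfolding y(2) by blast
    have "ext_d M k (\<lambda>x vs. s x * \<omega> x vs) x vs = eucl_d k (\<lambda>z us. s x * local_form M ?c \<omega> z us) ?y vs"
      unfolding ext_d_eucl_d by (rule eucl_d_cong[OF U(1,2), symmetric]) (use U(3,4) in auto)
    also have "\<dots> = s x * ext_d M k \<omega> x vs"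
    proof (cases "length vs = Suc k")
      case True
      have "frechet_derivative (\<lambda>z. s x * local_form M ?c \<omega> z (take i vs @ drop (Suc i) vs)) (at ?y) v =
         s x * frechet_derivative (\<lambda>z. local_form M ?c \<omega> z (take i vs @ drop (Suc i) vs)) (at ?y) v" if "i \<le> k" for i v
      proof -
        have "smooth_on (cimg ?c) (\<lambda>z. local_form M ?c \<omega> z (take i vs @ drop (Suc i) vs))"
          using \<omega> c True that by (simp add: smooth_form_def)
        from has_derivative_mult_right[OF smooth_on_has_derivative[OF this y(1)], of "s x"]
        show ?thesis by (simp add: frechet_derivative_eqI)
      qed
      then show ?thesis
        using True by (auto simp: ext_d_eucl_d eucl_d_def sum_distrib_left mult.left_commute intro!: sum.cong)
    qed (simp add: ext_d_eucl_d eucl_d_def)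
    finally show "ext_d M k (\<lambda>x vs. s x * \<omega> x vs) x vs = s x * ext_d M k \<omega> x vs" .
  qed
qed

end

section \<open>Integration of forms\<close>

text \<open>The factor \<open>h\<close> in \<eta> = h vol, that is, the integrand of
  \<open>form_integral\<close>.\<close>

definition form_density :: "('a, 'n::{finite,wellorder}) mfd \<Rightarrow> ('a, 'n) dform \<Rightarrow> 'a \<Rightarrow> real" where
  "form_density M \<eta> x = \<eta> x (map ax enum_list) / sqrt (det (gram (metric M x) ax))"

lemma form_integral_density: "form_integral M \<eta> = (\<integral>x. form_density M \<eta> x \<partial>riem_vol M)"
  by (simp add: form_integral_def form_density_def enum_list_def)

lemma local_form_wedge:
  "local_form M c (\<lambda>x. wedge k l (\<theta> x) (\<omega> x)) y vs = wedge k l (local_form M c \<theta> y) (local_form M c \<omega> y) vs"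
proof -
  let ?T = "coord_to_tan M c (cinv c y)"
  have "local_form M c \<theta> y = (\<lambda>vs. \<theta> (cinv c y) (map ?T vs))" "local_form M c \<omega> y = (\<lambda>vs. \<omega> (cinv c y) (map ?T vs))"
    by (simp_all add: local_form_def[abs_def])
  then show ?thesis by (simp add: wedge_map local_form_def)
qed

lemma pullback_wedge:
  "pullback M N f (\<lambda>x. wedge k l (\<theta> x) (\<omega> x)) x = wedge k l (pullback M N f \<theta> x) (pullback M N f \<omega> x)"
  unfolding pullback_alt by (rule ext) (simp add: wedge_map)

context rmfd
begin

lemma form_density_chart:
  assumes "c \<in> atlas M" "y \<in> cimg c" "alternating CARD('n) (\<eta> (cinv c y))"
  shows "form_density M \<eta> (cinv c y) = local_form M c \<eta> y (map ax enum_list) / vol_dens c y"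
  using coord_to_tan_bij(2)[OF assms(1) chart(8)[OF assms(1,2)]]
  unfolding form_density_def local_form_def vol_dens_eq[OF assms(1,2)]
    alternating_top_map[OF assms(3) coord_to_tan_bij(1)[OF assms(1) chart(8)[OF assms(1,2)]]]
  by simp

lemma measurable_chart_compose:
  assumes c: "c \<in> atlas M" and g: "g \<in> borel_measurable (restrict_space borel (cimg c))"
  shows "(\<lambda>z. g (cmap c z)) \<in> borel_measurable (restrict_space borel (cdom c))"
proof (rule measurable_compose[OF _ g])
  show "cmap c \<in> measurable (restrict_space borel (cdom c)) (restrict_space borel (cimg c))"
    using chart[OF c] by (intro measurable_restrict_space2 borel_measurable_continuous_on_restrict)
      (auto simp: space_restrict_space)
qed

lemma borel_measurable_by_charts:
  assumes "\<And>c. c \<in> atlas M \<Longrightarrow> (\<lambda>y. h (cinv c y)) \<in> borel_measurable (restrict_space borel (cimg c))"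
  shows "(h :: 'a \<Rightarrow> real) \<in> borel_measurable borel"
proof (rule borel_measurable_locally)
  fix x
  let ?c = "chart_at M x"
  note c = chart_at[of x]
  have "(\<lambda>z. h (cinv ?c (cmap ?c z))) \<in> borel_measurable (restrict_space borel (cdom ?c))"
    by (rule measurable_chart_compose[OF c(1) assms[OF c(1)]])
  then have "h \<in> borel_measurable (restrict_space borel (cdom ?c))"
    by (rule measurable_cong[THEN iffD1, rotated]) (simp add: space_restrict_space chart(5)[OF c(1)])
  then show "\<exists>U. open U \<and> x \<in> U \<and> h \<in> borel_measurable (restrict_space borel U)"
    using c chart(1)[OF c(1)] by blast
qed

lemma form_density_measurable:
  assumes "\<And>x. alternating CARD('n) (\<eta> x)"
    and "\<And>c. c \<in> atlas M \<Longrightarrow> (\<lambda>y. local_form M c \<eta> y (map ax enum_list)) \<in> borel_measurable (restrict_space borel (cimg c))"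
  shows "form_density M \<eta> \<in> borel_measurable borel"
proof (rule borel_measurable_by_charts)
  fix c assume c: "c \<in> atlas M"
  have "(\<lambda>y. local_form M c \<eta> y (map ax enum_list) / vol_dens c y) \<in> borel_measurable (restrict_space borel (cimg c))"
    by (intro borel_measurable_divide assms(2) c vol_dens_measurable)
  then show "(\<lambda>y. form_density M \<eta> (cinv c y)) \<in> borel_measurable (restrict_space borel (cimg c))"
    by (rule measurable_cong[THEN iffD2, rotated]) (simp add: space_restrict_space form_density_chart[OF c _ assms(1)])
qed

end

lemma set_integrable_mult_continuous:
  fixes h g :: "real^'n \<Rightarrow> real"
  assumes K: "compact K" and g: "continuous_on K g" and h: "set_integrable lborel K h"
  shows "set_integrable lborel K (\<lambda>y. h y * g y)"
proof -
  obtain B where B: "\<And>y. y \<in> K \<Longrightarrow> \<bar>g y\<bar> \<le> B"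
    using compact_imp_bounded[OF compact_continuous_image[OF g K]] unfolding bounded_iff by auto
  have gm: "(\<lambda>y. indicator K y *\<^sub>R g y) \<in> borel_measurable borel"
    using borel_measurable_continuous_on_restrict[OF g] borel_closed[OF compact_imp_closed[OF K]]
    by (subst borel_measurable_restrict_space_iff[symmetric]) auto
  have hi: "integrable lborel (\<lambda>y. indicator K y *\<^sub>R h y)" using h by (simp add: set_integrable_def)
  have m: "(\<lambda>y. (indicator K y *\<^sub>R h y) * (indicator K y *\<^sub>R g y)) \<in> borel_measurable lborel"
    using gm borel_measurable_integrable[OF hi] by (intro borel_measurable_times) auto
  have i: "integrable lborel (\<lambda>y. B * (indicator K y *\<^sub>R h y))" using hi by (rule integrable_mult_right)
  have n: "norm ((indicator K y *\<^sub>R h y) * (indicator K y *\<^sub>R g y)) \<le> norm (B * (indicator K y *\<^sub>R h y))" for y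
    using B[of y] by (cases "y \<in> K") (auto simp: abs_mult mult.commute intro!: mult_right_mono)
  have "integrable lborel (\<lambda>y. (indicator K y *\<^sub>R h y) * (indicator K y *\<^sub>R g y))"
    by (rule Bochner_Integration.integrable_bound[OF i m AE_I2[OF n]])
  moreover have "(indicator K y *\<^sub>R h y) * (indicator K y *\<^sub>R g y) = indicator K y *\<^sub>R (h y * g y)" for y
    by (simp add: indicator_def)
  ultimately show ?thesis unfolding set_integrable_def by (simp only:)
qed

text \<open>Cramer's rule writes every entry of the inverse as a quotient of determinants, which are
  polynomials in matrix entries.\<close>

lemma continuous_on_matrix_inv:
  fixes A :: "'z::topological_space \<Rightarrow> real^'m^'m"
  assumes A: "\<And>i j. continuous_on S (\<lambda>y. A y $ i $ j)" and inv: "\<And>y. y \<in> S \<Longrightarrow> invertible (A y)"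
  shows "continuous_on S (\<lambda>y. matrix_inv (A y) $ i $ j)"
proof -
  have eq: "matrix_inv (A y) $ i $ j = det (\<chi> a b. if b = i then axis j 1 $ a else A y $ a $ b) / det (A y)" if "y \<in> S" for y
  proof -
    have 1: "A y ** matrix_inv (A y) = mat 1"
      using someI_ex[of "\<lambda>B. A y ** B = mat 1 \<and> B ** A y = mat 1"] inv[OF that]
      unfolding invertible_def matrix_inv_def by blast
    have d: "det (A y) \<noteq> 0" using inv[OF that] by (simp add: invertible_det_nz)
    have "A y *v (matrix_inv (A y) *v axis j 1) = axis j 1"
      by (simp add: matrix_vector_mul_assoc 1)
    then have c1: "matrix_inv (A y) *v axis j 1 = (\<chi> k. det (\<chi> a b. if b = k then axis j 1 $ a else A y $ a $ b) / det (A y))"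
      using cramer[OF d] by blast
    have c2: "(matrix_inv (A y) *v axis j 1) $ i = matrix_inv (A y) $ i $ j"
      by (simp add: matrix_vector_mul_component inner_axis)
    show ?thesis unfolding c2[symmetric] c1 by simp
  qed
  have cd: "continuous_on S (\<lambda>y. det (B y))" if "\<And>i j. continuous_on S (\<lambda>y. B y $ i $ j)" for B :: "'z \<Rightarrow> real^'m^'m"
    unfolding det_def by (intro continuous_on_sum continuous_on_mult continuous_on_prod continuous_on_const that)
  have "continuous_on S (\<lambda>y. det (\<chi> a b. if b = i then axis j 1 $ a else A y $ a $ b) / det (A y))"
  proof (intro continuous_on_divide cd A)
    show "continuous_on S (\<lambda>y. (\<chi> a b. if b = i then axis j 1 $ a else A y $ a $ b) $ a $ b)" for a b
      using A by (cases "b = i") (auto simp: continuous_on_const)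
    show "\<forall>y\<in>S. det (A y) \<noteq> 0" using inv by (simp add: invertible_det_nz)
  qed
  then show ?thesis by (subst continuous_on_cong[OF refl eq])
qed

context rmfd
begin

text \<open>The compact support is covered by finitely many sets corresponding to balls whose
  closures stay inside a chart image. On each of them \<open>vol_dens\<close> cancels and leaves the
  local coefficient, which is integrable on compact sets by \<open>int\<close>.\<close>

lemma integrable_form_density:
  assumes alt: "\<And>x. alternating CARD('n) (\<eta> x)"
    and meas: "\<And>c. c \<in> atlas M \<Longrightarrow> (\<lambda>y. local_form M c \<eta> y (map ax enum_list)) \<in> borel_measurable (restrict_space borel (cimg c))"
    and int: "\<And>c K. c \<in> atlas M \<Longrightarrow> compact K \<Longrightarrow> K \<subseteq> cimg c \<Longrightarrow> set_integrable lborel K (\<lambda>y. local_form M c \<eta> y (map ax enum_list))"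
    and supp: "compact C" "\<And>x. x \<notin> C \<Longrightarrow> \<eta> x = 0"
  shows "integrable (riem_vol M) (form_density M \<eta>)"
proof -
  let ?h = "form_density M \<eta>"
  have hm: "?h \<in> borel_measurable borel" by (rule form_density_measurable[OF alt meas])
  have "\<exists>r>0. cball (cmap (chart_at M x) x) r \<subseteq> cimg (chart_at M x)" for x
    using chart[OF chart_at(1)] chart_at(2) open_contains_cball by blast
  then obtain r where r: "\<And>x. r x > 0" "\<And>x. cball (cmap (chart_at M x) x) (r x) \<subseteq> cimg (chart_at M x)" by metis
  define O' where "O' = (\<lambda>x. {z \<in> cdom (chart_at M x). cmap (chart_at M x) z \<in> ball (cmap (chart_at M x) x) (r x)})"
  have oO: "open (O' x)" for x
  proof -
    have "O' x = cdom (chart_at M x) \<inter> cmap (chart_at M x) -` ball (cmap (chart_at M x) x) (r x)" by (auto simp: O'_def)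
    then show ?thesis using chart[OF chart_at(1)[of x]] by (metis continuous_open_preimage open_ball)
  qed
  have "C \<subseteq> (\<Union>x\<in>C. O' x)" using r(1) chart_at(2) by (auto simp: O'_def)
  then obtain D where D: "D \<subseteq> C" "finite D" "C \<subseteq> (\<Union>x\<in>D. O' x)"
    using compactE_image[OF supp(1), of C O'] oO by blast
  have fin: "(\<integral>\<^sup>+z. ennreal \<bar>?h z\<bar> * indicator (O' x) z \<partial>riem_vol M) < \<infinity>" for x
  proof -
    let ?c = "chart_at M x" and ?K = "cball (cmap (chart_at M x) x) (r x)"
    note c = chart_at(1)[of x]
    let ?L = "\<lambda>y. local_form M ?c \<eta> y (map ax enum_list)"
    have "(\<integral>\<^sup>+z. ennreal \<bar>?h z\<bar> * indicator (O' x) z \<partial>riem_vol M) =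
       (\<integral>\<^sup>+z. (ennreal \<bar>?h z\<bar> * indicator (O' x) z) * indicator (cdom ?c) z \<partial>riem_vol M)"
      by (intro nn_integral_cong) (auto simp: O'_def indicator_def)
    also have "\<dots> = (\<integral>\<^sup>+y. (ennreal (vol_dens ?c y) * (ennreal \<bar>?h (cinv ?c y)\<bar> * indicator (O' x) (cinv ?c y))) * indicator (cimg ?c) y \<partial>lborel)"
      using hm oO by (intro nn_integral_riem_vol_chart[OF c]) auto
    also have "\<dots> \<le> (\<integral>\<^sup>+y. ennreal (norm (indicator ?K y *\<^sub>R ?L y)) \<partial>lborel)"
    proof (intro nn_integral_mono)
      fix y
      show "(ennreal (vol_dens ?c y) * (ennreal \<bar>?h (cinv ?c y)\<bar> * indicator (O' x) (cinv ?c y))) * indicator (cimg ?c) y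
         \<le> ennreal (norm (indicator ?K y *\<^sub>R ?L y))"
      proof (cases "y \<in> cimg ?c \<and> cinv ?c y \<in> O' x")
        case True
        then have y: "y \<in> cimg ?c" "y \<in> ?K" using chart(7)[OF c] by (auto simp: O'_def)
        have "vol_dens ?c y * \<bar>?h (cinv ?c y)\<bar> = \<bar>?L y\<bar>"
          using vol_dens_pos[OF c y(1)] by (simp add: form_density_chart[OF c y(1) alt] abs_divide)
        then show ?thesis using True y vol_dens_pos[OF c y(1)] by (simp add: ennreal_mult[symmetric])
      qed (auto simp: indicator_def)
    qed
    also have "\<dots> < \<infinity>"
      using int[OF c compact_cball r(2)] unfolding set_integrable_def by (simp add: integrable_iff_bounded)
    finally show ?thesis .
  qed
  have "(\<integral>\<^sup>+z. ennreal (norm (?h z)) \<partial>riem_vol M) \<le> (\<integral>\<^sup>+z. (\<Sum>x\<in>D. ennreal \<bar>?h z\<bar> * indicator (O' x) z) \<partial>riem_vol M)"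
  proof (intro nn_integral_mono)
    fix z
    show "ennreal (norm (?h z)) \<le> (\<Sum>x\<in>D. ennreal \<bar>?h z\<bar> * indicator (O' x) z)"
    proof (cases "z \<in> C")
      case True
      then obtain x where "x \<in> D" "z \<in> O' x" using D by blast
      then have "ennreal \<bar>?h z\<bar> * indicator (O' x) z \<le> (\<Sum>x\<in>D. ennreal \<bar>?h z\<bar> * indicator (O' x) z)"
        using D(2) by (intro member_le_sum) auto
      then show ?thesis using \<open>z \<in> O' x\<close> by simp
    next
      case False
      then show ?thesis using supp(2) by (simp add: form_density_def)
    qed
  qed
  also have "\<dots> = (\<Sum>x\<in>D. \<integral>\<^sup>+z. ennreal \<bar>?h z\<bar> * indicator (O' x) z \<partial>riem_vol M)"
    using hm oO by (intro nn_integral_sum) auto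
  also have "\<dots> < \<infinity>" using fin D(2) by simp
  finally show ?thesis using hm by (simp add: integrable_iff_bounded)
qed

lemma wedge_zero_right: "wedge k l \<alpha> 0 = 0"
  by (rule ext) (simp add: wedge_def)

text \<open>Phrased for a multilinear family \<omega> with continuous coefficients that vanishes off
  a compact set, so that it applies both to a test form and to its differential.\<close>

lemma wedge_density:
  assumes \<theta>: "L1loc_form M k \<theta>" and kl: "k + l = CARD('n)"
    and ml: "\<And>x. multilinear l (\<omega> x)"
    and cont: "\<And>c us. c \<in> atlas M \<Longrightarrow> continuous_on (cimg c) (\<lambda>y. local_form M c \<omega> y us)"
    and supp: "compact C" "\<And>x. x \<notin> C \<Longrightarrow> \<omega> x = 0"
  shows "form_density M (\<lambda>x. wedge k l (\<theta> x) (\<omega> x)) \<in> borel_measurable borel"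
    "integrable (riem_vol M) (form_density M (\<lambda>x. wedge k l (\<theta> x) (\<omega> x)))"
proof -
  let ?\<eta> = "\<lambda>x. wedge k l (\<theta> x) (\<omega> x)" and ?es = "map ax enum_list :: (real^'n::_) list"
  have mf: "measurable_form M k \<theta>" using \<theta> by (simp add: L1loc_form_def)
  have alt: "alternating CARD('n) (?\<eta> x)" for x
    using wedge_alternating[OF alternating_imp_multilinear ml] mf kl unfolding measurable_form_def by metis
  have loc: "local_form M c ?\<eta> y ?es = (\<Sum>p | p permutes {..<k + l}. (of_int (sign p) / (fact k * fact l)) *
      (local_form M c \<theta> y (take k (permute_list p ?es)) * local_form M c \<omega> y (drop k (permute_list p ?es))))" for c y
    using kl by (simp add: local_form_wedge wedge_def sum_divide_distrib mult_ac)
  have len: "length (take k (permute_list p ?es)) = k" for p using kl by simp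
  have cm: "(\<lambda>y. local_form M c ?\<eta> y ?es) \<in> borel_measurable (restrict_space borel (cimg c))" if c: "c \<in> atlas M" for c
    unfolding loc
    by (intro borel_measurable_sum borel_measurable_times borel_measurable_const measurable_formD[OF mf c]
        borel_measurable_continuous_on_restrict cont c)
  have ci: "set_integrable lborel K (\<lambda>y. local_form M c ?\<eta> y ?es)" if c: "c \<in> atlas M" and K: "compact K" "K \<subseteq> cimg c" for c K
  proof -
    have "set_integrable lborel K (\<lambda>y. (of_int (sign p) / (fact k * fact l)) *
      (local_form M c \<theta> y (take k (permute_list p ?es)) * local_form M c \<omega> y (drop k (permute_list p ?es))))" for p
      using \<theta> c K len
      by (intro set_integrable_mult_right set_integrable_mult_continuous continuous_on_subset[OF cont])
        (auto simp: L1loc_form_def)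
    then show ?thesis unfolding loc set_integrable_def
      by (simp only: scaleR_sum_right) (intro Bochner_Integration.integrable_sum)
  qed
  have z: "?\<eta> x = 0" if "x \<notin> C" for x using supp(2)[OF that] by (simp add: wedge_zero_right)
  show "form_density M ?\<eta> \<in> borel_measurable borel" by (rule form_density_measurable[OF alt cm])
  show "integrable (riem_vol M) (form_density M ?\<eta>)" by (rule integrable_form_density[OF alt cm ci supp(1) z])
qed

section \<open>The spaces $L^p$\<close>

text \<open>\<open>alt_norm\<close> selects a frame at every point without any regularity.
  \<open>alt_norm_coords\<close> replaces it by the inverse Gram matrix of the coordinate vectors,
  which is continuous, and the measurable local coefficients.\<close>

lemma alt_norm_measurable:
  assumes \<theta>: "measurable_form M k \<theta>"
  shows "(\<lambda>x. alt_norm (metric M x) k (\<theta> x)) \<in> borel_measurable borel"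
proof (rule borel_measurable_by_charts)
  fix c assume c: "c \<in> atlas M"
  let ?e = "\<lambda>y i. coord_to_tan M c (cinv c y) (ax i)"
  let ?K = "\<lambda>y. matrix_inv (gram (metric M (cinv c y)) (?e y))"
  have gc: "continuous_on (cimg c) (\<lambda>y. gram (metric M (cinv c y)) (?e y) $ i $ j)" for i j
    by (simp add: gram_def continuous_on_metric_coords[OF c])
  have gi: "invertible (gram (metric M (cinv c y)) (?e y))" if "y \<in> cimg c" for y
    using vol_dens_pos[OF c that] by (auto simp: vol_dens_def invertible_det_nz)
  have eq: "alt_norm (metric M (cinv c y)) k (\<theta> (cinv c y)) =
     sqrt ((\<Sum>is | length is = k. \<Sum>ls | length ls = k.
       (\<Prod>r<k. ?K y $ (is ! r) $ (ls ! r)) * (local_form M c \<theta> y (map ax is) * local_form M c \<theta> y (map ax ls))) / fact k)"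
    if y: "y \<in> cimg c" for y
  proof -
    obtain b where b: "\<And>v. v = (\<Sum>i\<in>UNIV. b v i *\<^sub>R ?e y i)"
      using coord_to_tan_basis[OF c chart(8)[OF c y]] by blast
    have ml: "multilinear k (\<theta> (cinv c y))"
      using \<theta> by (intro alternating_imp_multilinear) (simp add: measurable_form_def)
    show ?thesis
      unfolding alt_norm_coords[OF metric_inner b ml]
      by (intro arg_cong[of _ _ sqrt] arg_cong2[of _ _ _ _ "(/)"] sum.cong refl)
        (simp add: prod_list_map2_conv local_form_def o_def)
  qed
  have "(\<lambda>y. (\<Sum>is | length is = k. \<Sum>ls | length ls = k.
       (\<Prod>r<k. ?K y $ (is ! r) $ (ls ! r)) * (local_form M c \<theta> y (map ax is) * local_form M c \<theta> y (map ax ls))) / fact k)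
     \<in> borel_measurable (restrict_space borel (cimg c))"
    by (intro borel_measurable_divide borel_measurable_const borel_measurable_sum borel_measurable_times
        borel_measurable_prod measurable_formD[OF \<theta> c]
        borel_measurable_continuous_on_restrict continuous_on_matrix_inv gc gi)
  from measurable_compose[OF this, of sqrt borel]
  have "(\<lambda>y. sqrt ((\<Sum>is | length is = k. \<Sum>ls | length ls = k.
       (\<Prod>r<k. ?K y $ (is ! r) $ (ls ! r)) * (local_form M c \<theta> y (map ax is) * local_form M c \<theta> y (map ax ls))) / fact k))
     \<in> borel_measurable (restrict_space borel (cimg c))"
    by (simp add: borel_measurable_continuous_onI continuous_on_real_sqrt)
  then show "(\<lambda>y. alt_norm (metric M (cinv c y)) k (\<theta> (cinv c y))) \<in> borel_measurable (restrict_space borel (cimg c))"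
    by (rule measurable_cong[THEN iffD2, rotated]) (simp add: space_restrict_space eq)
qed

text \<open>The constant is uniform in the form: it comes from bounding the metric on the finitely
  many coordinate vector fields given by \<open>us\<close> over \<open>K\<close>.\<close>

lemma local_form_bound:
  assumes c: "c \<in> atlas M" and K: "compact K" "K \<subseteq> cimg c" and us: "length us = k"
  shows "\<exists>C\<ge>0. \<forall>\<theta> y. measurable_form M k \<theta> \<longrightarrow> y \<in> K \<longrightarrow>
    \<bar>local_form M c \<theta> y us\<bar> \<le> C * alt_norm (metric M (cinv c y)) k (\<theta> (cinv c y))"
proof -
  let ?G = "\<lambda>y u. metric M (cinv c y) (coord_to_tan M c (cinv c y) u) (coord_to_tan M c (cinv c y) u)"
  have "\<exists>R. \<forall>y\<in>K. ?G y u \<le> R" for u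
  proof -
    have cK: "continuous_on K (\<lambda>y. ?G y u)" using continuous_on_metric_coords[OF c] K(2) continuous_on_subset by blast
    obtain B where "\<forall>z\<in>(\<lambda>y. ?G y u) ` K. norm z \<le> B"
      using compact_imp_bounded[OF compact_continuous_image[OF cK K(1)]] unfolding bounded_iff by blast
    then show ?thesis by (intro exI[of _ B]) force
  qed
  then obtain R where R: "\<And>u y. y \<in> K \<Longrightarrow> ?G y u \<le> R u" by metis
  define R' where "R' = Max (insert 1 (R ` set us))"
  have R': "1 \<le> R'" "\<And>u. u \<in> set us \<Longrightarrow> R u \<le> R'" by (auto simp: R'_def)
  show ?thesis
  proof (intro exI[of _ "real CARD('n) ^ k * R' ^ k * sqrt (fact k)"] conjI allI impI)
    show "0 \<le> real CARD('n) ^ k * R' ^ k * sqrt (fact k)" using R'(1) by simp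
    fix \<theta> y assume \<theta>: "measurable_form M k \<theta>" and y: "y \<in> K"
    have ml: "multilinear k (\<theta> (cinv c y))"
      using \<theta> by (intro alternating_imp_multilinear) (simp add: measurable_form_def)
    show "\<bar>local_form M c \<theta> y us\<bar> \<le> real CARD('n) ^ k * R' ^ k * sqrt (fact k) * alt_norm (metric M (cinv c y)) k (\<theta> (cinv c y))"
      unfolding local_form_def
      by (rule abs_le_alt_norm[OF metric_inner ml]) (use us R' R[OF y] order_trans in \<open>auto, blast\<close>)
  qed
qed

text \<open>On a compact subset of a chart the inequality \<open>a \<le> 1 + a powr p\<close>
  replaces Hoelder's, and the volume density has a positive lower bound \<open>m\<close>, so
  Lebesgue measure is controlled by the Riemannian volume.\<close>

lemma Lp_imp_L1loc:
  assumes \<theta>: "\<theta> \<in> Lp_forms M k p" and p: "1 \<le> p"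
  shows "L1loc_form M k \<theta>"
  unfolding L1loc_form_def
proof (intro conjI ballI allI impI)
  show mf: "measurable_form M k \<theta>" using \<theta> by (simp add: Lp_forms_def)
  fix c K and us :: "(real^'n::_) list"
  assume c: "c \<in> atlas M" and K: "compact K" "K \<subseteq> cimg c" and us: "length us = k"
  let ?a = "\<lambda>x. alt_norm (metric M x) k (\<theta> x)"
  have am: "?a \<in> borel_measurable borel" by (rule alt_norm_measurable[OF mf])
  obtain C where C: "0 \<le> C" "\<And>y. y \<in> K \<Longrightarrow> \<bar>local_form M c \<theta> y us\<bar> \<le> C * ?a (cinv c y)"
    using local_form_bound[OF c K us] mf by blast
  obtain m where m: "m > 0" "\<And>y. y \<in> K \<Longrightarrow> m \<le> vol_dens c y"
  proof (cases "K = {}")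
    case True
    then show ?thesis using that[of 1] by simp
  next
    case False
    obtain y0 where "y0 \<in> K" "\<forall>y\<in>K. vol_dens c y0 \<le> vol_dens c y"
      using continuous_attains_inf[OF K(1) False continuous_on_subset[OF continuous_on_vol_dens[OF c] K(2)]] by blast
    then show ?thesis using that[of "vol_dens c y0"] vol_dens_pos[OF c] K(2) by blast
  qed
  have Kb: "K \<in> sets borel" by (rule borel_closed[OF compact_imp_closed[OF K(1)]])
  have meas: "(\<lambda>y. indicator K y *\<^sub>R local_form M c \<theta> y us) \<in> borel_measurable borel"
  proof -
    have "(\<lambda>y. indicator K y * (indicator (cimg c) y *\<^sub>R local_form M c \<theta> y us)) \<in> borel_measurable borel"
      using mf c us Kb by (intro borel_measurable_times) (auto simp: measurable_form_def set_borel_measurable_def)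
    moreover have "indicator K y * (indicator (cimg c) y *\<^sub>R local_form M c \<theta> y us) = indicator K y *\<^sub>R local_form M c \<theta> y us" for y
      using K(2) by (auto simp: indicator_def)
    ultimately show ?thesis by (simp only:)
  qed
  have "(\<integral>\<^sup>+y. ennreal (norm (indicator K y *\<^sub>R local_form M c \<theta> y us)) \<partial>lborel) \<le>
     (\<integral>\<^sup>+y. ennreal C * indicator K y + ennreal (C / m) * ((ennreal (vol_dens c y) * ennreal (?a (cinv c y) powr p)) * indicator (cimg c) y) \<partial>lborel)"
  proof (intro nn_integral_mono)
    fix y
    show "ennreal (norm (indicator K y *\<^sub>R local_form M c \<theta> y us)) \<le>
      ennreal C * indicator K y + ennreal (C / m) * ((ennreal (vol_dens c y) * ennreal (?a (cinv c y) powr p)) * indicator (cimg c) y)"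
    proof (cases "y \<in> K")
      case True
      let ?A = "?a (cinv c y)"
      have "?A \<le> 1 + ?A powr p"
      proof (cases "?A \<le> 1")
        case False
        then have "?A powr 1 \<le> ?A powr p" using p by (intro powr_mono) auto
        then show ?thesis using False by simp
      qed (smt (verit) powr_ge_zero)
      then have "\<bar>local_form M c \<theta> y us\<bar> \<le> C * (1 + ?A powr p)"
        using C(2)[OF True] C(1) by (meson mult_left_mono order_trans)
      also have "\<dots> = C + C / m * (m * ?A powr p)" using m(1) by (simp add: algebra_simps)
      also have "\<dots> \<le> C + C / m * (vol_dens c y * ?A powr p)"
        using m(1) m(2)[OF True] C(1) by (intro add_left_mono mult_left_mono mult_right_mono) auto
      finally have "ennreal \<bar>local_form M c \<theta> y us\<bar> \<le> ennreal (C + C / m * (vol_dens c y * ?A powr p))" by (rule ennreal_leI)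
      also have "\<dots> = ennreal C + ennreal (C / m) * (ennreal (vol_dens c y) * ennreal (?A powr p))"
      proof -
        have v: "0 \<le> vol_dens c y" "0 \<le> C / m" using m(1) m(2)[OF True] C(1) by auto
        have "ennreal (C + C / m * (vol_dens c y * ?A powr p)) = ennreal C + ennreal (C / m * (vol_dens c y * ?A powr p))"
          by (rule ennreal_plus[OF C(1)]) (intro mult_nonneg_nonneg v powr_ge_zero)
        also have "ennreal (C / m * (vol_dens c y * ?A powr p)) = ennreal (C / m) * ennreal (vol_dens c y * ?A powr p)"
          by (rule ennreal_mult) (intro mult_nonneg_nonneg v powr_ge_zero)+
        also have "ennreal (vol_dens c y * ?A powr p) = ennreal (vol_dens c y) * ennreal (?A powr p)"
          by (rule ennreal_mult) (intro v powr_ge_zero)+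
        finally show ?thesis .
      qed
      finally show ?thesis using True K(2) by (auto simp: indicator_def)
    qed simp
  qed
  also have "\<dots> = ennreal C * emeasure lborel K + ennreal (C / m) *
      (\<integral>\<^sup>+y. (ennreal (vol_dens c y) * ennreal (?a (cinv c y) powr p)) * indicator (cimg c) y \<partial>lborel)"
  proof -
    have "(\<lambda>y. (ennreal (vol_dens c y) * ennreal (?a (cinv c y) powr p)) * indicator (cimg c) y) \<in> borel_measurable borel"
    proof -
      have "(\<lambda>y. ennreal (vol_dens c y) * ennreal (?a (cinv c y) powr p)) \<in> borel_measurable (restrict_space borel (cimg c))"
        using measurable_compose[OF cinv_measurable[OF c] am] vol_dens_measurable[OF c] by measurable
      then show ?thesis using chart(2)[OF c] by (subst borel_measurable_restrict_space_iff_ennreal[symmetric]) auto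
    qed
    then show ?thesis using Kb by (subst nn_integral_add) (auto simp: nn_integral_cmult)
  qed
  also have "\<dots> = ennreal C * emeasure lborel K + ennreal (C / m) *
      (\<integral>\<^sup>+x. ennreal (?a x powr p) * indicator (cdom c) x \<partial>riem_vol M)"
    using am by (subst nn_integral_riem_vol_chart[OF c]) auto
  also have "\<dots> < \<infinity>"
  proof -
    have "(\<integral>\<^sup>+x. ennreal (?a x powr p) * indicator (cdom c) x \<partial>riem_vol M) \<le> (\<integral>\<^sup>+x. ennreal (?a x powr p) \<partial>riem_vol M)"
      by (intro nn_integral_mono) (auto simp: indicator_def)
    also have "\<dots> < \<infinity>" using \<theta> by (simp add: Lp_forms_def)
    finally show ?thesis using emeasure_compact_finite[OF K(1)] by (auto simp: ennreal_mult_less_top)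
  qed
  finally show "set_integrable lborel K (\<lambda>y. local_form M c \<theta> y us)"
    unfolding set_integrable_def using meas by (simp add: integrable_iff_bounded)
qed

section \<open>Linear structure of the spaces of forms\<close>

lemma local_form_add: "local_form M c (\<theta> + \<theta>') y vs = local_form M c \<theta> y vs + local_form M c \<theta>' y vs"
  by (simp add: local_form_def)

lemma local_form_scale: "local_form M c (form_scale r \<theta>) y vs = r * local_form M c \<theta> y vs"
  by (simp add: local_form_def form_scale_def)

lemma measurable_form_add: "measurable_form M k \<theta> \<Longrightarrow> measurable_form M k \<theta>' \<Longrightarrow> measurable_form M k (\<theta> + \<theta>')"
proof (rule measurable_formI)
  assume m: "measurable_form M k \<theta>" "measurable_form M k \<theta>'"
  show "alternating k ((\<theta> + \<theta>') x)" for x using m by (simp add: measurable_form_def alternating_add)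
  show "(\<lambda>y. local_form M c (\<theta> + \<theta>') y vs) \<in> borel_measurable (restrict_space borel (cimg c))" if "c \<in> atlas M" for c vs
    unfolding local_form_add using m that by (intro borel_measurable_add measurable_formD)
qed

lemma measurable_form_scale: "measurable_form M k \<theta> \<Longrightarrow> measurable_form M k (form_scale r \<theta>)"
proof (rule measurable_formI)
  assume m: "measurable_form M k \<theta>"
  show "alternating k (form_scale r \<theta> x)" for x
    unfolding form_scale_def by (rule alternating_scale) (use m in \<open>simp add: measurable_form_def\<close>)
  show "(\<lambda>y. local_form M c (form_scale r \<theta>) y vs) \<in> borel_measurable (restrict_space borel (cimg c))" if "c \<in> atlas M" for c vs
    unfolding local_form_scale using m that by (intro borel_measurable_times borel_measurable_const measurable_formD)
qed

lemma measurable_form_zero: "measurable_form M k 0"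
  by (intro measurable_formI) (auto simp: local_form_def alternating_zero)

lemma L1loc_form_add: "L1loc_form M k \<theta> \<Longrightarrow> L1loc_form M k \<theta>' \<Longrightarrow> L1loc_form M k (\<theta> + \<theta>')"
  unfolding L1loc_form_def by (auto simp: local_form_add measurable_form_add intro!: set_integral_add)

lemma L1loc_form_scale: "L1loc_form M k \<theta> \<Longrightarrow> L1loc_form M k (form_scale r \<theta>)"
  unfolding L1loc_form_def by (auto simp: local_form_scale measurable_form_scale intro!: set_integrable_mult_right)

lemma L1loc_form_zero: "L1loc_form M k 0"
  unfolding L1loc_form_def by (auto simp: local_form_def measurable_form_zero set_integrable_def)

text \<open>The \<open>p\<close>-th power of the norm, kept in \<open>ennreal\<close> so that one
  estimate yields both finiteness and size.\<close>

definition Lp_int :: "nat \<Rightarrow> real \<Rightarrow> ('a, 'n) dform \<Rightarrow> ennreal" where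
  "Lp_int k p \<theta> = (\<integral>\<^sup>+x. ennreal (alt_norm (metric M x) k (\<theta> x) powr p) \<partial>riem_vol M)"

lemma Lp_forms_iff: "\<theta> \<in> Lp_forms M k p \<longleftrightarrow> measurable_form M k \<theta> \<and> Lp_int k p \<theta> < \<infinity>"
  by (simp add: Lp_forms_def Lp_int_def)

lemma alt_norm_powr_measurable:
  "measurable_form M k \<theta> \<Longrightarrow> (\<lambda>x. alt_norm (metric M x) k (\<theta> x) powr p) \<in> borel_measurable borel"
  using alt_norm_measurable by measurable

lemma Lp_norm_eq: "measurable_form M k \<theta> \<Longrightarrow> Lp_norm M k p \<theta> = enn2real (Lp_int k p \<theta>) powr (1 / p)"
  unfolding Lp_norm_def Lp_int_def using alt_norm_powr_measurable
  by (subst integral_eq_nn_integral) auto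

lemma Lp_norm_nonneg: "0 \<le> Lp_norm M k p \<theta>"
  by (simp add: Lp_norm_def)

lemma Lp_int_eq:
  assumes "\<theta> \<in> Lp_forms M k p" "0 < p" shows "Lp_int k p \<theta> = ennreal (Lp_norm M k p \<theta> powr p)"
  using assms by (simp add: Lp_forms_iff Lp_norm_eq powr_powr)

text \<open>With \<open>m\<close> the larger of the two norms, \<open>alt_norm_add_sq\<close> bounds
  the norm of the sum by \<open>2 * m\<close>, and \<open>m powr p\<close> is one of the two
  summands on the right.\<close>

lemma alt_norm_add_powr:
  assumes "0 \<le> p"
  shows "alt_norm G k (\<alpha> + \<beta>) powr p \<le> 2 powr p * (alt_norm G k \<alpha> powr p + alt_norm G k \<beta> powr p)"
proof -
  define m where "m = max (alt_norm G k \<alpha>) (alt_norm G k \<beta>)"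
  have m: "0 \<le> m" "alt_norm G k \<alpha> \<le> m" "alt_norm G k \<beta> \<le> m" by (auto simp: m_def le_max_iff_disj)
  have "(alt_norm G k (\<alpha> + \<beta>))\<^sup>2 \<le> 2 * m\<^sup>2 + 2 * m\<^sup>2"
    using alt_norm_add_sq[of G k \<alpha> \<beta>] power_mono[OF m(2), of 2] power_mono[OF m(3), of 2] by simp
  then have "(alt_norm G k (\<alpha> + \<beta>))\<^sup>2 \<le> (2 * m)\<^sup>2" by (simp add: power_mult_distrib)
  then have "alt_norm G k (\<alpha> + \<beta>) \<le> 2 * m" by (rule power2_le_imp_le) (use m(1) in simp)
  then have "alt_norm G k (\<alpha> + \<beta>) powr p \<le> (2 * m) powr p" using assms by (intro powr_mono2) auto
  also have "\<dots> = 2 powr p * m powr p" using m by (simp add: powr_mult)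
  also have "m powr p \<le> alt_norm G k \<alpha> powr p + alt_norm G k \<beta> powr p" by (simp add: m_def max_def)
  finally show ?thesis by simp
qed

lemma Lp_int_add:
  assumes "measurable_form M k \<theta>" "measurable_form M k \<theta>'" "0 \<le> p"
  shows "Lp_int k p (\<theta> + \<theta>') \<le> ennreal (2 powr p) * (Lp_int k p \<theta> + Lp_int k p \<theta>')"
proof -
  have "Lp_int k p (\<theta> + \<theta>') \<le> (\<integral>\<^sup>+x. ennreal (2 powr p) * (ennreal (alt_norm (metric M x) k (\<theta> x) powr p) +
     ennreal (alt_norm (metric M x) k (\<theta>' x) powr p)) \<partial>riem_vol M)"
    unfolding Lp_int_def using alt_norm_add_powr[OF assms(3)]
    by (intro nn_integral_mono) (simp add: ennreal_mult[symmetric] ennreal_plus[symmetric] del: ennreal_plus)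
  also have "\<dots> = ennreal (2 powr p) * (Lp_int k p \<theta> + Lp_int k p \<theta>')"
    unfolding Lp_int_def using alt_norm_powr_measurable[OF assms(1)] alt_norm_powr_measurable[OF assms(2)]
    by (subst nn_integral_cmult) (auto simp: nn_integral_add)
  finally show ?thesis .
qed

lemma Lp_int_scale:
  assumes "measurable_form M k \<theta>"
  shows "Lp_int k p (form_scale r \<theta>) = ennreal (\<bar>r\<bar> powr p) * Lp_int k p \<theta>"
proof -
  have "Lp_int k p (form_scale r \<theta>) = (\<integral>\<^sup>+x. ennreal (\<bar>r\<bar> powr p) * ennreal (alt_norm (metric M x) k (\<theta> x) powr p) \<partial>riem_vol M)"
    unfolding Lp_int_def form_scale_def alt_norm_scale by (simp add: powr_mult ennreal_mult)
  then show ?thesis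
    unfolding Lp_int_def using alt_norm_powr_measurable[OF assms] by (simp add: nn_integral_cmult)
qed

lemma Lp_forms_add: "\<theta> \<in> Lp_forms M k p \<Longrightarrow> \<theta>' \<in> Lp_forms M k p \<Longrightarrow> 0 \<le> p \<Longrightarrow> \<theta> + \<theta>' \<in> Lp_forms M k p"
  unfolding Lp_forms_iff using Lp_int_add[of k \<theta> \<theta>' p]
  by (auto simp: measurable_form_add ennreal_mult_less_top intro: le_less_trans)

lemma Lp_forms_scale: "\<theta> \<in> Lp_forms M k p \<Longrightarrow> form_scale r \<theta> \<in> Lp_forms M k p"
  unfolding Lp_forms_iff by (simp add: Lp_int_scale measurable_form_scale ennreal_mult_less_top)

lemma Lp_forms_zero: "0 \<in> Lp_forms M k p"
  unfolding Lp_forms_iff by (simp add: Lp_int_def measurable_form_zero)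

lemma Lp_norm_scale: "measurable_form M k \<theta> \<Longrightarrow> 0 < p \<Longrightarrow> Lp_norm M k p (form_scale r \<theta>) = \<bar>r\<bar> * Lp_norm M k p \<theta>"
  by (simp add: Lp_norm_eq measurable_form_scale Lp_int_scale enn2real_mult powr_mult powr_powr)

text \<open>One factor 2 comes from \<open>alt_norm_add_powr\<close>, the other from bounding
  \<open>2 * m powr p\<close> by \<open>2 powr p * m powr p\<close>; the \<open>p\<close>-th root
  turns their product into 4. This is enough to make \<open>B_closure\<close> a subspace.\<close>

lemma Lp_norm_add:
  assumes "\<theta> \<in> Lp_forms M k p" "\<theta>' \<in> Lp_forms M k p" "1 \<le> p"
  shows "Lp_norm M k p (\<theta> + \<theta>') \<le> 4 * (Lp_norm M k p \<theta> + Lp_norm M k p \<theta>')"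
proof -
  define m where "m = max (Lp_norm M k p \<theta>) (Lp_norm M k p \<theta>')"
  have m: "0 \<le> m" "Lp_norm M k p \<theta> \<le> m" "Lp_norm M k p \<theta>' \<le> m" by (auto simp: m_def Lp_norm_nonneg le_max_iff_disj)
  have mf: "measurable_form M k \<theta>" "measurable_form M k \<theta>'" using assms by (auto simp: Lp_forms_iff)
  have "Lp_int k p (\<theta> + \<theta>') \<le> ennreal (2 powr p) * (Lp_int k p \<theta> + Lp_int k p \<theta>')"
    using Lp_int_add[OF mf] assms(3) by simp
  also have "\<dots> = ennreal (2 powr p * (Lp_norm M k p \<theta> powr p + Lp_norm M k p \<theta>' powr p))"
    using assms by (simp add: Lp_int_eq ennreal_mult ennreal_plus)
  also have "\<dots> \<le> ennreal (2 powr p * (m powr p + m powr p))"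
    using m assms(3) Lp_norm_nonneg by (intro ennreal_leI mult_left_mono add_mono powr_mono2) auto
  finally have "enn2real (Lp_int k p (\<theta> + \<theta>')) \<le> 2 powr p * (m powr p + m powr p)"
    by (rule enn2real_leI[rotated]) simp
  also have "\<dots> \<le> 2 powr p * (2 powr p * m powr p)"
  proof -
    have "2 * m powr p \<le> 2 powr p * m powr p" using powr_mono[of 1 p 2] assms(3) by (intro mult_right_mono) auto
    then show ?thesis by (intro mult_left_mono) auto
  qed
  also have "\<dots> = (4 * m) powr p" using m(1) by (simp add: powr_mult mult.assoc[symmetric] flip: powr_mult)
  finally have "enn2real (Lp_int k p (\<theta> + \<theta>')) powr (1 / p) \<le> ((4 * m) powr p) powr (1 / p)"
    using assms(3) by (intro powr_mono2) auto
  then have "Lp_norm M k p (\<theta> + \<theta>') \<le> 4 * m"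
    using m(1) assms(3) by (simp add: Lp_norm_eq measurable_form_add[OF mf] powr_powr)
  also have "m \<le> Lp_norm M k p \<theta> + Lp_norm M k p \<theta>'" by (simp add: m_def Lp_norm_nonneg)
  finally show ?thesis by simp
qed

lemma Lp_norm_cong_AE:
  assumes "measurable_form M k \<theta>" "measurable_form M k \<theta>'" "AE x in riem_vol M. \<theta> x = \<theta>' x"
  shows "Lp_norm M k p \<theta> = Lp_norm M k p \<theta>'"
proof -
  have "Lp_int k p \<theta> = Lp_int k p \<theta>'" unfolding Lp_int_def
    by (intro nn_integral_cong_AE) (use assms(3) in \<open>auto elim!: eventually_mono\<close>)
  then show ?thesis using assms by (simp add: Lp_norm_eq)
qed

end

text \<open>Young's inequality without the weights: both factors are bounded by powers of
  \<open>max X Z\<close>, whose exponents add up to 1.\<close>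

lemma powr_interpolate_le:
  fixes X Z t :: real
  assumes "0 \<le> X" "0 \<le> Z" "0 < t" "t < 1"
  shows "X powr (1 - t) * Z powr t \<le> X + Z"
proof -
  define m where "m = max X Z"
  have m: "X \<le> m" "Z \<le> m" "0 \<le> m" using assms by (auto simp: m_def)
  have "X powr (1 - t) * Z powr t \<le> m powr (1 - t) * m powr t"
    using assms m by (intro mult_mono powr_mono2) auto
  also have "\<dots> = m" using m(3) by (simp flip: powr_add)
  also have "\<dots> \<le> X + Z" using assms by (simp add: m_def)
  finally show ?thesis .
qed

text \<open>A substitute for Hoelder's inequality with a non-optimal constant.\<close>

lemma weighted_powr_bound:
  fixes W :: "'z \<Rightarrow> real"
  assumes p: "0 < p" "p \<le> q" and W: "W \<in> borel_measurable \<mu>" "\<And>x. 0 \<le> W x"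
    and bd: "p = q \<Longrightarrow> \<exists>C. AE x in \<mu>. W x \<le> C"
    and fin: "p < q \<Longrightarrow> (\<integral>\<^sup>+x. ennreal (W x powr (q / (q - p))) \<partial>\<mu>) < \<infinity>"
  shows "\<exists>C\<ge>0. \<forall>Y B. Y \<in> borel_measurable \<mu> \<longrightarrow> (\<forall>x. 0 \<le> Y x) \<longrightarrow> 0 \<le> B \<longrightarrow>
    (\<integral>\<^sup>+x. ennreal (Y x) \<partial>\<mu>) = ennreal B \<longrightarrow> (\<integral>\<^sup>+x. ennreal (W x * Y x powr (p / q)) \<partial>\<mu>) \<le> ennreal (C * B powr (p / q))"
proof (cases "p = q")
  case True
  then obtain C where C: "AE x in \<mu>. W x \<le> C" using bd by blast
  show ?thesis
  proof (intro exI[of _ "max 0 C"] conjI allI impI)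
    fix Y :: "'z \<Rightarrow> real" and B
    assume Y: "Y \<in> borel_measurable \<mu>" "\<forall>x. 0 \<le> Y x" and B: "0 \<le> B" "(\<integral>\<^sup>+x. ennreal (Y x) \<partial>\<mu>) = ennreal B"
    have "(\<integral>\<^sup>+x. ennreal (W x * Y x powr (p / q)) \<partial>\<mu>) \<le> (\<integral>\<^sup>+x. ennreal (max 0 C) * ennreal (Y x) \<partial>\<mu>)"
    proof (rule nn_integral_mono_AE, rule AE_mp[OF C], intro AE_I2 impI)
      fix x assume "W x \<le> C"
      then have "W x * Y x \<le> max 0 C * Y x" using Y by (intro mult_right_mono) auto
      then show "ennreal (W x * Y x powr (p / q)) \<le> ennreal (max 0 C) * ennreal (Y x)"
        using True p Y by (simp add: ennreal_mult[symmetric] ennreal_leI)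
    qed
    also have "\<dots> = ennreal (max 0 C) * ennreal B" using Y(1) B by (subst nn_integral_cmult) auto
    finally show "(\<integral>\<^sup>+x. ennreal (W x * Y x powr (p / q)) \<partial>\<mu>) \<le> ennreal (max 0 C * B powr (p / q))"
      using True p B by (simp add: ennreal_mult)
  qed simp
next
  case False
  then have pq: "p < q" using p by simp
  define t a where "t = p / q" and "a = q / (q - p)"
  have t: "0 < t" "t < 1" using p pq by (auto simp: t_def)
  \<comment> \<open>\<open>a\<close> is the exponent conjugate to \<open>1 / t = q / p\<close>, so
    \<open>W\<close> is the power \<open>1 - t\<close> of the integrable function
    \<open>W powr a\<close>.\<close>
  have a: "a * (1 - t) = 1" using p pq by (simp add: a_def t_def field_simps)
  define A where "A = enn2real (\<integral>\<^sup>+x. ennreal (W x powr a) \<partial>\<mu>)"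
  have A: "(\<integral>\<^sup>+x. ennreal (W x powr a) \<partial>\<mu>) = ennreal A" "0 \<le> A" using fin[OF pq] by (auto simp: A_def a_def)
  show ?thesis
  proof (intro exI[of _ "A + 1"] conjI allI impI)
    show "0 \<le> A + 1" using A by simp
    fix Y :: "'z \<Rightarrow> real" and B
    assume Y: "Y \<in> borel_measurable \<mu>" "\<forall>x. 0 \<le> Y x" and B: "0 \<le> B" "(\<integral>\<^sup>+x. ennreal (Y x) \<partial>\<mu>) = ennreal B"
    show "(\<integral>\<^sup>+x. ennreal (W x * Y x powr (p / q)) \<partial>\<mu>) \<le> ennreal ((A + 1) * B powr (p / q))"
    proof (cases "B = 0")
      case True
      then have "AE x in \<mu>. ennreal (Y x) = 0" using B Y(1) by (subst nn_integral_0_iff_AE[symmetric]) auto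
      then have "AE x in \<mu>. ennreal (W x * Y x powr (p / q)) = 0"
        using Y(2) by (auto elim!: eventually_mono simp: antisym)
      then have "(\<integral>\<^sup>+x. ennreal (W x * Y x powr (p / q)) \<partial>\<mu>) = (\<integral>\<^sup>+x. 0 \<partial>\<mu>)" by (rule nn_integral_cong_AE)
      then show ?thesis by simp
    next
      case False
      then have B0: "B > 0" using B by simp
      \<comment> \<open>Dividing \<open>Y\<close> by its integral \<open>B\<close>, positive in this
        case, makes the bound homogeneous: the two summands integrate to \<open>A\<close> and 1, and
        the factor \<open>B powr t\<close> stays outside.\<close>
      have pt: "W x * Y x powr t \<le> B powr t * (W x powr a + Y x / B)" for x
      proof -
        have "Y x powr t = B powr t * (Y x / B) powr t" using B0 Y by (simp flip: powr_mult)
        then have "W x * Y x powr t = B powr t * ((W x powr a) powr (1 - t) * (Y x / B) powr t)"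
          using W(2)[of x] a by (simp add: powr_powr)
        also have "\<dots> \<le> B powr t * (W x powr a + Y x / B)"
          using B0 Y t by (intro mult_left_mono powr_interpolate_le) auto
        finally show ?thesis .
      qed
      have "(\<integral>\<^sup>+x. ennreal (W x * Y x powr t) \<partial>\<mu>) \<le> (\<integral>\<^sup>+x. ennreal (B powr t) * (ennreal (W x powr a) + ennreal (1 / B) * ennreal (Y x)) \<partial>\<mu>)"
        using pt B0 Y by (intro nn_integral_mono)
          (simp add: ennreal_mult[symmetric] ennreal_plus[symmetric] ennreal_leI del: ennreal_plus)
      also have "\<dots> = ennreal (B powr t) * (ennreal A + ennreal (1 / B) * ennreal B)"
        using W Y by (simp add: nn_integral_cmult nn_integral_add A B)
      also have "\<dots> = ennreal ((A + 1) * B powr t)"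
      proof -
        have "ennreal (1 / B) * ennreal B = ennreal 1" using B0 by (simp add: ennreal_mult[symmetric])
        then have e: "ennreal A + ennreal (1 / B) * ennreal B = ennreal (A + 1)" using A(2) ennreal_plus[of A 1] by simp
        show ?thesis unfolding e by (subst ennreal_mult[symmetric]) (use A(2) in \<open>auto simp: mult.commute\<close>)
      qed
      finally show ?thesis by (simp add: t_def)
    qed
  qed
qed

section \<open>Boundedness of pullbacks between L^p spaces\<close>

context rmfd_pair
begin

lemma alt_norm_pullback:
  assumes f: "smooth_map M N f" "inj (tangent_map M N f x)" and \<theta>: "alternating k (\<theta> (f x))"
  shows "alt_norm (metric M x) k (pullback M N f \<theta> x) \<le> distortion M N k f x * alt_norm (metric N (f x)) k (\<theta> (f x))"
proof -
  obtain E where E: "sing_frame (metric M x) (metric N (f x)) (tangent_map M N f x) E (sing_vals M N f x)"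
    using sing_vals_frame[OF f(1)] by blast
  from alt_norm_pullback_le(1)[OF M.metric_inner N.metric_inner tangent_map_linear[OF f(1)] f(2) this \<theta>]
  show ?thesis by (simp add: distortion_def pullback_alt)
qed

lemma alt_norm_pullback_inv:
  assumes f: "diffeo M N f" and \<phi>: "alternating k (\<phi> x)"
  shows "alt_norm (metric N (f x)) k (pullback N M (inv f) \<phi> (f x)) \<le>
     distortion M N (CARD('n) - k) f x / Jac M N f x * alt_norm (metric M x) k (\<phi> x)"
proof -
  have sf: "smooth_map M N f" using f by (simp add: diffeo_def)
  obtain E where E: "sing_frame (metric M x) (metric N (f x)) (tangent_map M N f x) E (sing_vals M N f x)"
    using sing_vals_frame[OF sf] by blast
  have "inv f (f x) = x" using f by (simp add: diffeo_def bij_is_inj)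
  then show ?thesis
    using alt_norm_pullback_le(2)[OF M.metric_inner N.metric_inner tangent_map_linear[OF sf] diffeo_tangent_inj[OF f] E \<phi>]
    by (simp add: distortion_def pullback_alt Jac_eq_prod diffeo_inv_tangent[OF f])
qed

lemma BD_diffeo: "f \<in> BD M N m s \<tau> \<Longrightarrow> diffeo M N f"
  by (simp add: BD_def)

lemma pullback_Lp:
  assumes p: "1 \<le> p" "p \<le> pt" and f: "f \<in> BD M N k pt (if p = pt then \<infinity> else ereal (p / (pt - p)))"
  shows "\<exists>C\<ge>0. \<forall>\<theta>\<in>Lp_forms N k pt. pullback M N f \<theta> \<in> Lp_forms M k p \<and>
    Lp_norm M k p (pullback M N f \<theta>) \<le> C * Lp_norm N k pt \<theta>"
proof -
  have df: "diffeo M N f" using f by (rule BD_diffeo)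
  then have sf: "smooth_map M N f" by (simp add: diffeo_def)
  let ?\<sigma> = "distortion M N k f" and ?J = "Jac M N f"
  define R where "R = (\<lambda>x. ?\<sigma> x powr pt / ?J x)"
  define W where "W = (\<lambda>x. R x powr (p / pt))"
  have J: "0 < ?J x" for x by (rule Jac_pos[OF df])
  have \<sigma>: "0 \<le> ?\<sigma> x" for x by (rule distortion_nonneg[OF sf])
  have R0: "0 \<le> R x" for x using J[of x] by (simp add: R_def)
  have L: "in_Lspace M (if p = pt then \<infinity> else ereal (p / (pt - p))) R" using f by (simp add: BD_def R_def)
  have Rm: "R \<in> borel_measurable borel" using L by (simp add: in_Lspace_def)
  have Wm: "W \<in> borel_measurable (riem_vol M)" unfolding W_def using Rm by simp
  have "\<exists>C\<ge>0. \<forall>Y B. Y \<in> borel_measurable (riem_vol M) \<longrightarrow> (\<forall>x. 0 \<le> Y x) \<longrightarrow> 0 \<le> B \<longrightarrow>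
    (\<integral>\<^sup>+x. ennreal (Y x) \<partial>riem_vol M) = ennreal B \<longrightarrow>
    (\<integral>\<^sup>+x. ennreal (W x * Y x powr (p / pt)) \<partial>riem_vol M) \<le> ennreal (C * B powr (p / pt))"
  proof (rule weighted_powr_bound)
    show "0 < p" "p \<le> pt" using p by auto
    show "W \<in> borel_measurable (riem_vol M)" by (rule Wm)
    show "0 \<le> W x" for x by (simp add: W_def)
    show "\<exists>C. AE x in riem_vol M. W x \<le> C" if "p = pt"
    proof -
      have "\<exists>C. AE x in riem_vol M. \<bar>R x\<bar> \<le> C" using L by (simp add: in_Lspace_def that)
      then obtain C where "AE x in riem_vol M. \<bar>R x\<bar> \<le> C" by blast
      then have "AE x in riem_vol M. W x \<le> C"
        using R0 that p by (auto elim!: eventually_mono simp: W_def)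
      then show ?thesis by blast
    qed
    show "(\<integral>\<^sup>+x. ennreal (W x powr (pt / (pt - p))) \<partial>riem_vol M) < \<infinity>" if "p < pt"
    proof -
      have "(p / pt) * (pt / (pt - p)) = p / (pt - p)" using p that by simp
      then show ?thesis using L that R0 by (simp add: in_Lspace_def W_def powr_powr)
    qed
  qed
  then obtain C where C: "C \<ge> 0" "\<And>Y B. Y \<in> borel_measurable (riem_vol M) \<Longrightarrow> (\<And>x. 0 \<le> Y x) \<Longrightarrow> 0 \<le> B \<Longrightarrow>
    (\<integral>\<^sup>+x. ennreal (Y x) \<partial>riem_vol M) = ennreal B \<Longrightarrow>
    (\<integral>\<^sup>+x. ennreal (W x * Y x powr (p / pt)) \<partial>riem_vol M) \<le> ennreal (C * B powr (p / pt))" by blast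
  show ?thesis
  proof (intro exI[of _ "C powr (1 / p)"] conjI ballI)
    fix \<theta> assume \<theta>: "\<theta> \<in> Lp_forms N k pt"
    have mf: "measurable_form N k \<theta>" using \<theta> by (simp add: N.Lp_forms_iff)
    have alt: "alternating k (\<theta> z)" for z using mf by (simp add: measurable_form_def)
    have pm: "measurable_form M k (pullback M N f \<theta>)" by (rule pullback_measurable[OF sf mf])
    define b where "b = (\<lambda>x. alt_norm (metric N (f x)) k (\<theta> (f x)))"
    \<comment> \<open>The Jacobian is placed in \<open>Y\<close>, so that substitution turns its
      integral into the \<open>pt\<close>-th power of the norm on \<open>N\<close>; the compensating
      reciprocal sits in \<open>R\<close>.\<close>
    define Y where "Y = (\<lambda>x. ?J x * b x powr pt)"
    define B where "B = Lp_norm N k pt \<theta> powr pt"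
    have fm: "f \<in> borel_measurable borel" using sf by (intro borel_measurable_continuous_onI) (simp add: smooth_map_def)
    have bm: "b \<in> borel_measurable borel" unfolding b_def by (rule measurable_compose[OF fm N.alt_norm_measurable[OF mf]])
    have Ym: "Y \<in> borel_measurable borel" unfolding Y_def using bm Jac_measurable[OF df] by measurable
    have Y0: "0 \<le> Y x" for x using J[of x] by (simp add: Y_def)
    have "(\<integral>\<^sup>+x. ennreal (Y x) \<partial>riem_vol M) = (\<integral>\<^sup>+x. ennreal (?J x) * ennreal (b x powr pt) \<partial>riem_vol M)"
      using J by (simp add: Y_def ennreal_mult less_imp_le)
    also have "\<dots> = N.Lp_int k pt \<theta>"
      unfolding N.Lp_int_def b_def
      using N.alt_norm_powr_measurable[OF mf] by (subst nn_integral_transform[OF df]) auto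
    also have "\<dots> = ennreal B" unfolding B_def using p by (intro N.Lp_int_eq \<theta>) auto
    finally have YB: "(\<integral>\<^sup>+x. ennreal (Y x) \<partial>riem_vol M) = ennreal B" .
    have pt: "alt_norm (metric M x) k (pullback M N f \<theta> x) powr p \<le> W x * Y x powr (p / pt)" for x
    proof -
      have "alt_norm (metric M x) k (pullback M N f \<theta> x) powr p \<le> (?\<sigma> x * b x) powr p"
        using alt_norm_pullback[where \<theta> = \<theta>, OF sf diffeo_tangent_inj[OF df] alt] p unfolding b_def by (intro powr_mono2) auto
      also have "\<dots> = ?\<sigma> x powr p * b x powr p" using \<sigma> by (simp add: powr_mult b_def)
      also have "\<dots> = W x * Y x powr (p / pt)"
      proof -
        have "W x * Y x powr (p / pt) = (R x * Y x) powr (p / pt)"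
          unfolding W_def using R0 Y0 by (simp add: powr_mult)
        also have "R x * Y x = ?\<sigma> x powr pt * b x powr pt" using J[of x] by (simp add: R_def Y_def)
        also have "\<dots> powr (p / pt) = ?\<sigma> x powr p * b x powr p" using p by (simp add: powr_mult powr_powr)
        finally show ?thesis by simp
      qed
      finally show ?thesis .
    qed
    have "M.Lp_int k p (pullback M N f \<theta>) \<le> (\<integral>\<^sup>+x. ennreal (W x * Y x powr (p / pt)) \<partial>riem_vol M)"
      unfolding M.Lp_int_def by (intro nn_integral_mono ennreal_leI pt)
    also have "\<dots> \<le> ennreal (C * B powr (p / pt))"
      using Ym Y0 YB by (intro C(2)) (auto simp: B_def)
    finally have le: "M.Lp_int k p (pullback M N f \<theta>) \<le> ennreal (C * B powr (p / pt))" .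
    then show "pullback M N f \<theta> \<in> Lp_forms M k p" unfolding M.Lp_forms_iff using pm
      by (auto intro: le_less_trans)
    have "enn2real (M.Lp_int k p (pullback M N f \<theta>)) \<le> C * B powr (p / pt)"
      using le C(1) by (intro enn2real_leI) auto
    then have "Lp_norm M k p (pullback M N f \<theta>) \<le> (C * B powr (p / pt)) powr (1 / p)"
      unfolding M.Lp_norm_eq[OF pm] using p by (intro powr_mono2) auto
    also have "\<dots> = C powr (1 / p) * Lp_norm N k pt \<theta>"
      using p C(1) N.Lp_norm_nonneg by (simp add: powr_mult powr_powr B_def)
    finally show "Lp_norm M k p (pullback M N f \<theta>) \<le> C powr (1 / p) * Lp_norm N k pt \<theta>" .
  qed simp
qed

text \<open>Membership is what (B) asks of a primitive. The form has degree \<open>k - 1\<close>, so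
  its pullback by the inverse meets the symmetric function of degree
  \<open>CARD('n) - (k - 1)\<close>, which is the one in the second distortion hypothesis.\<close>

lemma pullback_inv_Lp:
  assumes q: "1 < qt" "qt \<le> q" and k: "1 \<le> k" "k \<le> CARD('n)"
    and f: "f \<in> BD M N (CARD('n) - k + 1) (qt / (qt - 1)) (if q = qt then \<infinity> else ereal (q * (qt - 1) / (q - qt)))"
    and \<phi>: "\<phi> \<in> Lp_forms M (k - 1) q"
  shows "pullback N M (inv f) \<phi> \<in> Lp_forms N (k - 1) qt"
proof -
  interpret NM: rmfd_pair N M by unfold_locales
  have df: "diffeo M N f" using f by (rule BD_diffeo)
  then have sf: "smooth_map M N f" and sg: "smooth_map N M (inv f)" by (auto simp: diffeo_def)
  let ?m = "CARD('n) - k + 1"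
  have m: "CARD('n) - (k - 1) = ?m" using k by simp
  let ?\<sigma> = "distortion M N ?m f" and ?J = "Jac M N f"
  define R where "R = (\<lambda>x. ?\<sigma> x powr (qt / (qt - 1)) / ?J x)"
  define W where "W = (\<lambda>x. R x powr (qt - 1))"
  have J: "0 < ?J x" for x by (rule Jac_pos[OF df])
  have \<sigma>: "0 \<le> ?\<sigma> x" for x by (rule distortion_nonneg[OF sf])
  have R0: "0 \<le> R x" for x using J[of x] by (simp add: R_def)
  have L: "in_Lspace M (if q = qt then \<infinity> else ereal (q * (qt - 1) / (q - qt))) R" using f by (simp add: BD_def R_def)
  have Rm: "R \<in> borel_measurable borel" using L by (simp add: in_Lspace_def)
  have Wm: "W \<in> borel_measurable (riem_vol M)" unfolding W_def using Rm by simp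
  \<comment> \<open>The conjugate exponent times \<open>qt - 1\<close> is \<open>qt\<close>. The
    remaining power \<open>1 - qt\<close> of the Jacobian splits into one factor from the
    substitution and \<open>- qt\<close> from the pointwise bound.\<close>
  have Weq: "W x = ?J x * (?\<sigma> x / ?J x) powr qt" for x
  proof -
    have "W x = ?\<sigma> x powr qt / ?J x powr (qt - 1)"
      unfolding W_def R_def using \<sigma> J[of x] q by (simp add: powr_divide powr_powr)
    also have "\<dots> = ?J x * (?\<sigma> x / ?J x) powr qt"
      using \<sigma> J[of x] by (simp add: powr_divide powr_diff)
    finally show ?thesis .
  qed
  have "\<exists>C\<ge>0. \<forall>Y B. Y \<in> borel_measurable (riem_vol M) \<longrightarrow> (\<forall>x. 0 \<le> Y x) \<longrightarrow> 0 \<le> B \<longrightarrow>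
    (\<integral>\<^sup>+x. ennreal (Y x) \<partial>riem_vol M) = ennreal B \<longrightarrow>
    (\<integral>\<^sup>+x. ennreal (W x * Y x powr (qt / q)) \<partial>riem_vol M) \<le> ennreal (C * B powr (qt / q))"
  proof (rule weighted_powr_bound)
    show "0 < qt" "qt \<le> q" using q by auto
    show "W \<in> borel_measurable (riem_vol M)" by (rule Wm)
    show "0 \<le> W x" for x by (simp add: W_def)
    show "\<exists>C. AE x in riem_vol M. W x \<le> C" if "qt = q"
    proof -
      have "\<exists>C. AE x in riem_vol M. \<bar>R x\<bar> \<le> C" using L by (simp add: in_Lspace_def that)
      then obtain C where "AE x in riem_vol M. \<bar>R x\<bar> \<le> C" by blast
      then have "AE x in riem_vol M. W x \<le> C powr (qt - 1)"
        using R0 q by (auto elim!: eventually_mono simp: W_def intro!: powr_mono2)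
      then show ?thesis by blast
    qed
    show "(\<integral>\<^sup>+x. ennreal (W x powr (q / (q - qt))) \<partial>riem_vol M) < \<infinity>" if "qt < q"
    proof -
      have "(qt - 1) * (q / (q - qt)) = q * (qt - 1) / (q - qt)" by simp
      then show ?thesis using L that R0 by (simp add: in_Lspace_def W_def powr_powr mult.commute[of q])
    qed
  qed
  then obtain C where C: "C \<ge> 0" "\<And>Y B. Y \<in> borel_measurable (riem_vol M) \<Longrightarrow> (\<And>x. 0 \<le> Y x) \<Longrightarrow> 0 \<le> B \<Longrightarrow>
    (\<integral>\<^sup>+x. ennreal (Y x) \<partial>riem_vol M) = ennreal B \<Longrightarrow>
    (\<integral>\<^sup>+x. ennreal (W x * Y x powr (qt / q)) \<partial>riem_vol M) \<le> ennreal (C * B powr (qt / q))" by blast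
  have mf: "measurable_form M (k - 1) \<phi>" using \<phi> by (simp add: M.Lp_forms_iff)
  have alt: "alternating (k - 1) (\<phi> x)" for x using mf by (simp add: measurable_form_def)
  let ?g = "pullback N M (inv f) \<phi>"
  have gm: "measurable_form N (k - 1) ?g" by (rule NM.pullback_measurable[OF sg mf])
  define b where "b = (\<lambda>x. alt_norm (metric M x) (k - 1) (\<phi> x))"
  have bm: "b \<in> borel_measurable borel" unfolding b_def by (rule M.alt_norm_measurable[OF mf])
  have "N.Lp_int (k - 1) qt ?g = (\<integral>\<^sup>+x. ennreal (?J x) * ennreal (alt_norm (metric N (f x)) (k - 1) (?g (f x)) powr qt) \<partial>riem_vol M)"
    unfolding N.Lp_int_def using N.alt_norm_powr_measurable[OF gm] by (subst nn_integral_transform[OF df]) auto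
  also have "\<dots> \<le> (\<integral>\<^sup>+x. ennreal (W x * (b x powr q) powr (qt / q)) \<partial>riem_vol M)"
  proof (intro nn_integral_mono)
    fix x
    have "alt_norm (metric N (f x)) (k - 1) (?g (f x)) powr qt \<le> (?\<sigma> x / ?J x * b x) powr qt"
      using alt_norm_pullback_inv[where \<phi> = \<phi>, OF df alt] q unfolding b_def m by (intro powr_mono2) auto
    also have "\<dots> = (?\<sigma> x / ?J x) powr qt * b x powr qt"
      using \<sigma>[of x] J[of x] unfolding b_def by (intro powr_mult)
    finally have "?J x * alt_norm (metric N (f x)) (k - 1) (?g (f x)) powr qt \<le> ?J x * ((?\<sigma> x / ?J x) powr qt * b x powr qt)"
      using J[of x] by (intro mult_left_mono) auto
    also have "\<dots> = W x * (b x powr q) powr (qt / q)" using q by (simp add: Weq powr_powr)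
    finally show "ennreal (?J x) * ennreal (alt_norm (metric N (f x)) (k - 1) (?g (f x)) powr qt) \<le> ennreal (W x * (b x powr q) powr (qt / q))"
      using J[of x] by (simp add: ennreal_mult[symmetric] ennreal_leI)
  qed
  also have "\<dots> \<le> ennreal (C * (Lp_norm M (k - 1) q \<phi> powr q) powr (qt / q))"
  proof (rule C(2))
    show "(\<lambda>x. b x powr q) \<in> borel_measurable (riem_vol M)" using bm by simp
    have "(\<integral>\<^sup>+x. ennreal (b x powr q) \<partial>riem_vol M) = M.Lp_int (k - 1) q \<phi>" by (simp add: M.Lp_int_def b_def)
    then show "(\<integral>\<^sup>+x. ennreal (b x powr q) \<partial>riem_vol M) = ennreal (Lp_norm M (k - 1) q \<phi> powr q)"
      using M.Lp_int_eq[OF \<phi>] q by simp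
  qed auto
  also have "\<dots> < \<infinity>" by simp
  finally show ?thesis unfolding N.Lp_forms_iff using gm by simp
qed

end

section \<open>The weak exterior differential\<close>

context rmfd
begin

definition supp :: "('a, 'n) dform \<Rightarrow> 'a set" where
  "supp \<omega> = closure {x. \<exists>vs. \<omega> x vs \<noteq> 0}"

lemma supp_zero: "x \<notin> supp \<omega> \<Longrightarrow> \<omega> x = 0"
proof (rule ext)
  fix vs
  assume x: "x \<notin> supp \<omega>"
  have "{x. \<exists>vs. \<omega> x vs \<noteq> 0} \<subseteq> supp \<omega>" unfolding supp_def by (rule closure_subset)
  with x have "x \<notin> {x. \<exists>vs. \<omega> x vs \<noteq> 0}" by blast
  then show "\<omega> x vs = 0 vs" by simp
qed

text \<open>The complement of the support is open, and the form vanishes near each of its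
  points.\<close>

lemma ext_d_supp:
  assumes \<omega>: "smooth_form M m \<omega>" and x: "x \<notin> supp \<omega>" shows "ext_d M m \<omega> x = 0"
proof (rule ext)
  fix vs
  let ?c = "chart_at M x"
  note c = chart_at[of x]
  have "open (- supp \<omega>)" unfolding supp_def by (rule open_Compl[OF closed_closure])
  from open_chart_preimage[OF c(1) this continuous_on_id]
  have U: "open {y \<in> cimg ?c. cinv ?c y \<in> - supp \<omega>}" by simp
  have y: "cmap ?c x \<in> {y \<in> cimg ?c. cinv ?c y \<in> - supp \<omega>}" using chart[OF c(1)] c(2) x by simp
  have z: "local_form M ?c \<omega> z us = 0" if "z \<in> {y \<in> cimg ?c. cinv ?c y \<in> - supp \<omega>}" for z us
    using that supp_zero by (simp add: local_form_def)
  have "eucl_d m (\<lambda>_ _. 0) (cmap ?c x) vs = ext_d M m \<omega> x vs"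
    unfolding ext_d_eucl_d by (rule eucl_d_cong[OF U y]) (simp_all add: z smooth_on_const)
  moreover have "eucl_d m (\<lambda>_ _. 0) (cmap ?c x) vs = 0" by (simp add: eucl_d_def)
  ultimately show "ext_d M m \<omega> x vs = 0 vs" by simp
qed

lemma wedge_density_smooth:
  assumes \<theta>: "L1loc_form M k \<theta>" and km: "k + m = CARD('n)" and \<omega>: "smooth_form M m \<omega>" "compactly_supported \<omega>"
  shows "form_density M (\<lambda>x. wedge k m (\<theta> x) (\<omega> x)) \<in> borel_measurable borel"
    "integrable (riem_vol M) (form_density M (\<lambda>x. wedge k m (\<theta> x) (\<omega> x)))"
proof -
  have alt: "alternating m (\<omega> x)" for x using \<omega>(1) by (simp add: smooth_form_def)
  have cont: "continuous_on (cimg c) (\<lambda>y. local_form M c \<omega> y us)" if c: "c \<in> atlas M" for c us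
  proof (cases "length us = m")
    case True
    then show ?thesis using \<omega>(1) c by (intro smooth_on_imp_continuous_on) (simp add: smooth_form_def)
  next
    case False
    then have "local_form M c \<omega> y us = 0" for y using alt by (simp add: local_form_def alternating_def)
    then show ?thesis by simp
  qed
  have C: "compact (supp \<omega>)" using \<omega>(2) by (simp add: compactly_supported_def supp_def)
  show "form_density M (\<lambda>x. wedge k m (\<theta> x) (\<omega> x)) \<in> borel_measurable borel"
    "integrable (riem_vol M) (form_density M (\<lambda>x. wedge k m (\<theta> x) (\<omega> x)))"
    by (rule wedge_density[where \<omega> = \<omega>, OF \<theta> km alternating_imp_multilinear[OF alt] cont C supp_zero[of _ \<omega>]]; assumption)+
qed

lemma wedge_density_ext_d:
  assumes \<theta>: "L1loc_form M k \<theta>" and km: "k + Suc m = CARD('n)" and \<omega>: "smooth_form M m \<omega>" "compactly_supported \<omega>"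
  shows "form_density M (\<lambda>x. wedge k (Suc m) (\<theta> x) (ext_d M m \<omega> x)) \<in> borel_measurable borel"
    "integrable (riem_vol M) (form_density M (\<lambda>x. wedge k (Suc m) (\<theta> x) (ext_d M m \<omega> x)))"
proof -
  have C: "compact (supp \<omega>)" using \<omega>(2) by (simp add: compactly_supported_def supp_def)
  show "form_density M (\<lambda>x. wedge k (Suc m) (\<theta> x) (ext_d M m \<omega> x)) \<in> borel_measurable borel"
    "integrable (riem_vol M) (form_density M (\<lambda>x. wedge k (Suc m) (\<theta> x) (ext_d M m \<omega> x)))"
    by (rule wedge_density[where \<omega> = "ext_d M m \<omega>", OF \<theta> km ext_d_multilinear[OF \<omega>(1)]
        smooth_on_imp_continuous_on[OF smooth_on_local_ext_d[OF \<omega>(1)]] C ext_d_supp[OF \<omega>(1)]]; assumption)+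
qed

lemma form_density_wedge_add:
  "form_density M (\<lambda>x. wedge k l ((\<theta> + \<theta>') x) (\<omega> x)) =
    (\<lambda>x. form_density M (\<lambda>x. wedge k l (\<theta> x) (\<omega> x)) x + form_density M (\<lambda>x. wedge k l (\<theta>' x) (\<omega> x)) x)"
  by (rule ext) (simp add: form_density_def wedge_add_left add_divide_distrib)

lemma form_density_wedge_scale:
  "form_density M (\<lambda>x. wedge k l (form_scale r \<theta> x) (\<omega> x)) = (\<lambda>x. r * form_density M (\<lambda>x. wedge k l (\<theta> x) (\<omega> x)) x)"
  by (rule ext) (simp add: form_density_def form_scale_def wedge_scale_left)

text \<open>The Bochner integral is additive on integrable functions, so integrability of the wedge
  with the test form and of the wedge with its differential enters here.\<close>

lemma weak_d_add:
  assumes "weak_d M j \<phi> \<theta>" "weak_d M j \<phi>' \<theta>'" shows "weak_d M j (\<phi> + \<phi>') (\<theta> + \<theta>')"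
  unfolding weak_d_def
proof (intro conjI allI impI)
  show "L1loc_form M j (\<phi> + \<phi>')" "L1loc_form M (Suc j) (\<theta> + \<theta>')"
    using assms L1loc_form_add by (auto simp: weak_d_def)
  fix m \<omega> assume m: "Suc j + m = CARD('n)" and \<omega>: "smooth_form M m \<omega>" "compactly_supported \<omega>"
  have L: "L1loc_form M j \<phi>" "L1loc_form M j \<phi>'" "L1loc_form M (Suc j) \<theta>" "L1loc_form M (Suc j) \<theta>'"
    using assms by (auto simp: weak_d_def)
  have m': "j + Suc m = CARD('n)" using m by simp
  have e: "form_integral M (\<lambda>x. wedge (Suc j) m (\<theta> x) (\<omega> x)) = (- 1) ^ Suc j * form_integral M (\<lambda>x. wedge j (Suc m) (\<phi> x) (ext_d M m \<omega> x))"
    "form_integral M (\<lambda>x. wedge (Suc j) m (\<theta>' x) (\<omega> x)) = (- 1) ^ Suc j * form_integral M (\<lambda>x. wedge j (Suc m) (\<phi>' x) (ext_d M m \<omega> x))"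
    using assms m \<omega> by (auto simp: weak_d_def)
  show "form_integral M (\<lambda>x. wedge (Suc j) m ((\<theta> + \<theta>') x) (\<omega> x)) = (- 1) ^ Suc j * form_integral M (\<lambda>x. wedge j (Suc m) ((\<phi> + \<phi>') x) (ext_d M m \<omega> x))"
    using e wedge_density_smooth(2)[OF L(3) m \<omega>] wedge_density_smooth(2)[OF L(4) m \<omega>]
      wedge_density_ext_d(2)[OF L(1) m' \<omega>] wedge_density_ext_d(2)[OF L(2) m' \<omega>]
    unfolding form_integral_density form_density_wedge_add by (simp add: distrib_left)
qed

lemma weak_d_scale:
  assumes "weak_d M j \<phi> \<theta>" shows "weak_d M j (form_scale r \<phi>) (form_scale r \<theta>)"
  using assms L1loc_form_scale unfolding weak_d_def form_integral_density form_density_wedge_scale by simp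

lemma form_scale_zero: "form_scale r 0 = 0"
  by (intro ext) (simp add: form_scale_def)

lemma form_scale_minus_one: "\<phi> + form_scale (- 1) \<psi> = \<phi> - \<psi>"
  by (intro ext) (simp add: form_scale_def)

lemma weak_d_zero: "weak_d M j 0 0"
proof -
  have "wedge k l (0 :: 'n altform) \<beta> = 0" for k l and \<beta> :: "'n altform" by (rule ext) (simp add: wedge_def)
  moreover have "form_density M (\<lambda>x. 0) = (\<lambda>x. 0)" by (rule ext) (simp add: form_density_def)
  ultimately show ?thesis
    unfolding weak_d_def form_integral_density by (simp add: L1loc_form_zero)
qed

lemma weak_d_diff: "weak_d M j \<phi> \<theta> \<Longrightarrow> weak_d M j \<phi>' \<theta>' \<Longrightarrow> weak_d M j (\<phi> - \<phi>') (\<theta> - \<theta>')"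
  using weak_d_add[OF _ weak_d_scale[of j \<phi>' \<theta>' "- 1"]] by (simp add: form_scale_minus_one)

end

subsection \<open>Naturality\<close>

context rmfd_pair
begin

text \<open>The diffeomorphism may reverse the orientation on some components.\<close>

definition orient_sign :: "('a \<Rightarrow> 'b) \<Rightarrow> 'a \<Rightarrow> real" where
  "orient_sign f x = sgn (det (matrix (tangent_map M N f x)))"

text \<open>The determinants of \<open>coord_to_tan\<close> are positive, so in charts the sign is
  that of the coordinate determinant, which is continuous and nowhere zero.\<close>

lemma orient_sign_locally_constant:
  assumes f: "diffeo M N f"
  shows "\<exists>U. open U \<and> x \<in> U \<and> (\<forall>z\<in>U. orient_sign f z = orient_sign f x)"
proof -
  have sf: "smooth_map M N f" using f by (simp add: diffeo_def)
  let ?c = "chart_at M x" and ?d = "chart_at N (f x)"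
  note c = M.chart_at[of x] and d = N.chart_at[of "f x"]
  let ?D = "\<lambda>y. det (matrix (loc_D ?c ?d f y))"
  have nz: "det (matrix (tangent_map M N f z)) \<noteq> 0" for z
    using diffeo_tangent_inj[OF f] det_nz_iff_inj[OF tangent_map_linear[OF sf]] by simp
  have sg: "orient_sign f (cinv ?c y) = sgn (?D y)" if y: "y \<in> loc_dom ?c ?d f" for y
  proof -
    have x: "cinv ?c y \<in> cdom ?c" "f (cinv ?c y) \<in> cdom ?d" using y M.chart[OF c(1)] by (auto simp: loc_dom_def)
    show ?thesis
      using arg_cong[OF det_tangent_coord[OF sf c(1) d(1) y], of sgn]
        M.coord_to_tan_bij(2)[OF c(1) x(1)] N.coord_to_tan_bij(2)[OF d(1) x(2)]
      by (simp add: orient_sign_def sgn_mult)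
  qed
  define y0 where "y0 = cmap ?c x"
  have y0: "y0 \<in> loc_dom ?c ?d f" "cinv ?c y0 = x" using c d M.chart[OF c(1)] by (auto simp: y0_def loc_dom_def)
  have D0: "?D y0 \<noteq> 0" using sg[OF y0(1)] nz[of x] y0(2) by (auto simp: orient_sign_def sgn_zero_iff)
  have "continuous_on (loc_dom ?c ?d f) (\<lambda>y. ?D y * ?D y0)"
    by (intro continuous_on_mult continuous_on_const continuous_on_det_loc_D sf c d)
  then have "open (loc_dom ?c ?d f \<inter> (\<lambda>y. ?D y * ?D y0) -` {0<..})"
    by (rule continuous_open_preimage[OF _ loc_rep(1)[OF sf c(1) d(1)] open_greaterThan])
  then have V: "open {y \<in> loc_dom ?c ?d f. 0 < ?D y * ?D y0}" by (simp add: vimage_def Int_def)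
  define V where "V = {y \<in> loc_dom ?c ?d f. 0 < ?D y * ?D y0}"
  define U where "U = cdom ?c \<inter> cmap ?c -` V"
  have "open U" unfolding U_def using V by (intro continuous_open_preimage M.chart c) (simp add: V_def)
  moreover have "x \<in> U" using c y0(1) D0 by (simp add: U_def V_def flip: y0_def) (simp add: zero_less_mult_iff linorder_neq_iff disj_commute)
  moreover have "orient_sign f z = orient_sign f x" if z: "z \<in> U" for z
  proof -
    have zz: "cmap ?c z \<in> loc_dom ?c ?d f" "cinv ?c (cmap ?c z) = z" "0 < ?D (cmap ?c z) * ?D y0"
      using z M.chart(5)[OF c(1)] by (auto simp: U_def V_def)
    then have "sgn (?D (cmap ?c z)) = sgn (?D y0)" by (auto simp: zero_less_mult_iff)
    then show ?thesis using sg[OF zz(1)] sg[OF y0(1)] zz(2) y0(2) by simp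
  qed
  ultimately show ?thesis by blast
qed

text \<open>A top form pulls back by the determinant of the tangent map, while \<open>Jac\<close> is
  the absolute value of that determinant relative to the two volume forms; the discrepancy is the
  orientation sign.\<close>

lemma form_density_pullback:
  assumes f: "diffeo M N f" and \<eta>: "alternating CARD('n) (\<eta> (f x))"
  shows "form_density M (pullback M N f \<eta>) x = orient_sign f x * (Jac M N f x * form_density N \<eta> (f x))"
proof -
  have sf: "smooth_map M N f" using f by (simp add: diffeo_def)
  let ?T = "tangent_map M N f x" and ?es = "map ax enum_list :: (real^'n::_) list"
  have g: "0 < sqrt (det (gram (metric M x) ax))" "0 < sqrt (det (gram (metric N (f x)) ax))"
    using det_gram_pos M.metric_inner N.metric_inner by auto
  have "pullback M N f \<eta> x ?es = det (matrix ?T) * \<eta> (f x) ?es"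
    using alternating_top_map[OF \<eta> tangent_map_linear[OF sf]] by (simp add: pullback_alt)
  also have "det (matrix ?T) = orient_sign f x * \<bar>det (matrix ?T)\<bar>" by (simp add: orient_sign_def mult_sgn_abs)
  also have "\<bar>det (matrix ?T)\<bar> = Jac M N f x * sqrt (det (gram (metric M x) ax)) / sqrt (det (gram (metric N (f x)) ax))"
    using Jac_tangent[OF sf, of x] g by (simp add: field_simps)
  finally show ?thesis using g by (simp add: form_density_def)
qed

text \<open>A test form on \<open>M\<close> is carried to \<open>N\<close> by the inverse map and
  multiplied by the orientation sign. This keeps it smooth and multiplies its differential by the
  same sign, so both integrals in the definition transform alike.\<close>

lemma weak_d_pullback:
  assumes f: "diffeo M N f" and w: "weak_d N j \<phi> \<theta>"
    and L: "L1loc_form M j (pullback M N f \<phi>)" "L1loc_form M (Suc j) (pullback M N f \<theta>)"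
  shows "weak_d M j (pullback M N f \<phi>) (pullback M N f \<theta>)"
  unfolding weak_d_def
proof (intro conjI allI impI L)
  interpret NM: rmfd_pair N M by unfold_locales
  have sf: "smooth_map M N f" and sg: "smooth_map N M (inv f)" and bf: "bij f" using f by (auto simp: diffeo_def)
  have dg: "diffeo N M (inv f)" by (rule diffeo_inv[OF f])
  have inv: "inv f (f x) = x" for x using bf by (simp add: bij_is_inj)
  have invinv: "inv (inv f) = f" using bf by (rule inv_inv_eq)
  fix m \<omega> assume m: "Suc j + m = CARD('n)" and \<omega>: "smooth_form M m \<omega>" "compactly_supported \<omega>"
  define s where "s = (\<lambda>z. orient_sign f (inv f z))"
  define \<eta> where "\<eta> = (\<lambda>z vs. s z * pullback N M (inv f) \<omega> z vs)"
  have cg: "continuous_on UNIV (inv f)" using sg by (simp add: smooth_map_def)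
  have s: "\<exists>U. open U \<and> z \<in> U \<and> (\<forall>z'\<in>U. s z' = s z)" for z
  proof -
    obtain U where U: "open U" "inv f z \<in> U" "\<forall>x\<in>U. orient_sign f x = orient_sign f (inv f z)"
      using orient_sign_locally_constant[OF f] by blast
    have "open (inv f -` U)" by (rule open_vimage[OF U(1) cg])
    moreover have "z \<in> inv f -` U" using U(2) by simp
    moreover have "\<forall>z'\<in>inv f -` U. s z' = s z" unfolding s_def using U(3) by blast
    ultimately show ?thesis by blast
  qed
  have sp: "smooth_form N m (pullback N M (inv f) \<omega>)" by (rule NM.pullback_smooth[OF sg \<omega>(1)])
  have \<eta>s: "smooth_form N m \<eta>" unfolding \<eta>_def by (rule N.smooth_form_locally_constant(1)[OF s sp])
  have \<eta>d: "ext_d N m \<eta> = (\<lambda>z vs. s z * pullback N M (inv f) (ext_d M m \<omega>) z vs)"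
    unfolding \<eta>_def N.smooth_form_locally_constant(2)[OF s sp] NM.ext_d_pullback[OF sg \<omega>(1)] ..
  have "compactly_supported \<eta>"
  proof -
    have C: "compact (M.supp \<omega>)" using \<omega>(2) by (simp add: compactly_supported_def M.supp_def)
    have fC: "compact (f ` M.supp \<omega>)"
      by (rule compact_continuous_image[OF continuous_on_subset[OF smooth_map_continuous[OF sf] subset_UNIV] C])
    have "{z. \<exists>vs. \<eta> z vs \<noteq> 0} \<subseteq> f ` M.supp \<omega>"
    proof
      fix z assume "z \<in> {z. \<exists>vs. \<eta> z vs \<noteq> 0}"
      then obtain vs where "\<eta> z vs \<noteq> 0" by blast
      then have "\<omega> (inv f z) (map (tangent_map N M (inv f) z) vs) \<noteq> 0" by (auto simp: \<eta>_def pullback_def)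
      then have "inv f z \<in> M.supp \<omega>" using M.supp_zero by force
      moreover have "z = f (inv f z)" using bf by (simp add: bij_is_surj surj_f_inv_f)
      ultimately show "z \<in> f ` M.supp \<omega>" by blast
    qed
    then have sub: "closure {z. \<exists>vs. \<eta> z vs \<noteq> 0} \<subseteq> f ` M.supp \<omega>"
      using compact_imp_closed[OF fC] by (rule closure_minimal)
    then have eq: "closure {z. \<exists>vs. \<eta> z vs \<noteq> 0} = f ` M.supp \<omega> \<inter> closure {z. \<exists>vs. \<eta> z vs \<noteq> 0}" by blast
    show ?thesis unfolding compactly_supported_def by (subst eq) (rule compact_Int_closed[OF fC closed_closure])
  qed
  note \<eta>c = this
  have L': "L1loc_form N j \<phi>" "L1loc_form N (Suc j) \<theta>" using w by (auto simp: weak_d_def)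
  \<comment> \<open>Stated for general degrees so that it covers the wedge with \<omega> and the
    wedge with its differential. The assumption \<open>meas\<close> is what
    \<open>integral_transform\<close> asks for.\<close>
  have key: "form_integral M (\<lambda>x. wedge a b (pullback M N f \<xi> x) (\<zeta> x)) = form_integral N (\<lambda>z. wedge a b (\<xi> z) (\<lambda>vs. s z * pullback N M (inv f) \<zeta> z vs))"
    if ab: "a + b = CARD('n)" and \<xi>: "\<And>z. alternating a (\<xi> z)" and \<zeta>: "\<And>x. multilinear b (\<zeta> x)"
      and meas: "form_density N (\<lambda>z. wedge a b (\<xi> z) (\<lambda>vs. s z * pullback N M (inv f) \<zeta> z vs)) \<in> borel_measurable borel"
    for a b \<xi> \<zeta>
  proof -
    let ?\<rho> = "\<lambda>z. wedge a b (\<xi> z) (pullback N M (inv f) \<zeta> z)"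
    have mlz: "multilinear b (pullback N M (inv f) \<zeta> z)" for z
      unfolding pullback_alt by (intro multilinear_map \<zeta> NM.tangent_map_linear sg)
    have alt: "alternating CARD('n) (?\<rho> z)" for z
      using wedge_alternating[OF alternating_imp_multilinear[OF \<xi>] mlz] ab by metis
    have "pullback M N f (pullback N M (inv f) \<zeta>) = \<zeta>"
      using NM.pullback_inv[OF dg] unfolding invinv .
    then have e1: "(\<lambda>x. wedge a b (pullback M N f \<xi> x) (\<zeta> x)) = pullback M N f ?\<rho>"
      by (intro ext) (simp add: pullback_wedge)
    have e2: "form_density N (\<lambda>z. wedge a b (\<xi> z) (\<lambda>vs. s z * pullback N M (inv f) \<zeta> z vs)) (f x) = orient_sign f x * form_density N ?\<rho> (f x)" for x
      by (simp add: form_density_def wedge_scale_right s_def inv)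
    have "form_integral M (\<lambda>x. wedge a b (pullback M N f \<xi> x) (\<zeta> x)) = (\<integral>x. orient_sign f x * (Jac M N f x * form_density N ?\<rho> (f x)) \<partial>riem_vol M)"
    proof -
      have "form_density M (pullback M N f ?\<rho>) x = orient_sign f x * (Jac M N f x * form_density N ?\<rho> (f x))" for x
        by (rule form_density_pullback[OF f]) (rule alt)
      then show ?thesis unfolding e1 form_integral_density by (rule Bochner_Integration.integral_cong[OF refl])
    qed
    also have "\<dots> = form_integral N (\<lambda>z. wedge a b (\<xi> z) (\<lambda>vs. s z * pullback N M (inv f) \<zeta> z vs))"
      unfolding form_integral_density integral_transform[OF f meas] e2 by (simp add: mult.left_commute)
    finally show ?thesis .
  qed
  have m': "j + Suc m = CARD('n)" using m by simp
  have alt\<theta>: "alternating (Suc j) (\<theta> z)" "alternating j (\<phi> z)" for z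
    using L' by (auto simp: L1loc_form_def measurable_form_def)
  have "form_integral M (\<lambda>x. wedge (Suc j) m (pullback M N f \<theta> x) (\<omega> x)) = form_integral N (\<lambda>z. wedge (Suc j) m (\<theta> z) (\<eta> z))"
    using key[OF m alt\<theta>(1), of \<omega>] N.wedge_density_smooth(1)[OF L'(2) m \<eta>s \<eta>c] \<omega>(1)
    by (simp add: \<eta>_def smooth_form_def alternating_imp_multilinear)
  also have "\<dots> = (- 1) ^ Suc j * form_integral N (\<lambda>z. wedge j (Suc m) (\<phi> z) (ext_d N m \<eta> z))"
    using w m \<eta>s \<eta>c by (simp add: weak_d_def)
  also have "form_integral N (\<lambda>z. wedge j (Suc m) (\<phi> z) (ext_d N m \<eta> z)) = form_integral M (\<lambda>x. wedge j (Suc m) (pullback M N f \<phi> x) (ext_d M m \<omega> x))"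
    using key[OF m' alt\<theta>(2) M.ext_d_multilinear[OF \<omega>(1)]] N.wedge_density_ext_d(1)[OF L'(1) m' \<eta>s \<eta>c]
    by (simp add: \<eta>d)
  finally show "form_integral M (\<lambda>x. wedge (Suc j) m (pullback M N f \<theta> x) (\<omega> x)) =
    (- 1) ^ Suc j * form_integral M (\<lambda>x. wedge j (Suc m) (pullback M N f \<phi> x) (ext_d M m \<omega> x))" .
qed

end

subsection \<open>Uniqueness\<close>

text \<open>The positive and negative parts of \<open>g\<close> are densities of two finite
  measures. They agree on the boxes, a generator closed under intersection, hence everywhere, and
  densities are unique almost everywhere.\<close>

lemma integrable_box_zero_AE:
  fixes g :: "real^'n \<Rightarrow> real"
  assumes g: "integrable lborel g" and z: "\<And>a b. (\<integral>y. indicator (box a b) y * g y \<partial>lborel) = 0"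
  shows "AE y in lborel. g y = 0"
proof -
  let ?p = "\<lambda>y. ennreal (g y)" and ?n = "\<lambda>y. ennreal (- g y)"
  have gm: "g \<in> borel_measurable lborel" using g by simp
  have fin: "(\<integral>\<^sup>+y. ennreal (g y) \<partial>lborel) < \<infinity>" "(\<integral>\<^sup>+y. ennreal (- g y) \<partial>lborel) < \<infinity>"
    using g by (simp_all add: real_integrable_def less_top)
  have "density lborel ?p = density lborel ?n"
  proof (rule measure_eqI_generator_eq[of "range (\<lambda>(a, b). box a b)" UNIV _ _ "\<lambda>i. box (- (real i *\<^sub>R One)) (real i *\<^sub>R One)"])
    show "Int_stable (range (\<lambda>(a::real^'n, b). box a b))"
    proof (rule Int_stableI)
      fix A B :: "(real^'n) set" assume "A \<in> range (\<lambda>(a, b). box a b)" "B \<in> range (\<lambda>(a, b). box a b)"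
      then obtain a b c d where "A = box a b" "B = box c d" by auto
      then show "A \<inter> B \<in> range (\<lambda>(a, b). box a b)" using box_Int_box[of a b c d] by (auto simp: image_iff)
    qed
    show "sets (density lborel ?p) = sigma_sets UNIV (range (\<lambda>(a, b). box a b))"
      "sets (density lborel ?n) = sigma_sets UNIV (range (\<lambda>(a, b). box a b))"
      by (simp_all add: borel_eq_box)
    show "range (\<lambda>i. box (- (real i *\<^sub>R One)) (real i *\<^sub>R One)) \<subseteq> range (\<lambda>(a::real^'n, b). box a b)" by auto
    show "(\<Union>i. box (- (real i *\<^sub>R One)) (real i *\<^sub>R One)) = (UNIV :: (real^'n) set)" by (rule UN_box_eq_UNIV)
    show "emeasure (density lborel ?p) (box (- (real i *\<^sub>R One)) (real i *\<^sub>R One)) \<noteq> \<infinity>" for i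
    proof -
      have "emeasure (density lborel ?p) (box (- (real i *\<^sub>R One)) (real i *\<^sub>R One)) \<le> emeasure (density lborel ?p) UNIV"
        by (intro emeasure_mono) auto
      also have "\<dots> < \<infinity>" using fin(1) gm by (simp add: emeasure_density)
      finally show ?thesis by simp
    qed
    fix X :: "(real^'n) set" assume "X \<in> range (\<lambda>(a, b). box a b)"
    then obtain a b where X: "X = box a b" by auto
    have ii: "integrable lborel (\<lambda>y. indicator X y * g y)"
      using g integrable_real_mult_indicator[of X lborel g] X by (simp add: mult.commute)
    then have "(\<integral>y. indicator X y * g y \<partial>lborel) = enn2real (\<integral>\<^sup>+y. ennreal (indicator X y * g y) \<partial>lborel) - enn2real (\<integral>\<^sup>+y. ennreal (- (indicator X y * g y)) \<partial>lborel)"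
      by (rule real_lebesgue_integral_def)
    then have "enn2real (\<integral>\<^sup>+y. ennreal (indicator X y * g y) \<partial>lborel) = enn2real (\<integral>\<^sup>+y. ennreal (- (indicator X y * g y)) \<partial>lborel)"
      using z[of a b] X by simp
    moreover have "(\<integral>\<^sup>+y. ennreal (indicator X y * g y) \<partial>lborel) \<noteq> \<infinity>" "(\<integral>\<^sup>+y. ennreal (- (indicator X y * g y)) \<partial>lborel) \<noteq> \<infinity>"
      using ii by (auto simp: real_integrable_def)
    ultimately have "(\<integral>\<^sup>+y. ennreal (indicator X y * g y) \<partial>lborel) = (\<integral>\<^sup>+y. ennreal (- (indicator X y * g y)) \<partial>lborel)"
    proof -
      have "u = v" if "enn2real u = enn2real v" "u \<noteq> \<infinity>" "v \<noteq> \<infinity>" for u v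
        using that by (cases u; cases v) auto
      then show "enn2real u = enn2real v \<Longrightarrow> u \<noteq> \<infinity> \<Longrightarrow> v \<noteq> \<infinity> \<Longrightarrow> u = v" for u v .
    qed
    moreover have "(\<integral>\<^sup>+y. ennreal (indicator X y * g y) \<partial>lborel) = emeasure (density lborel ?p) X"
      using gm X by (subst emeasure_density) (auto intro!: nn_integral_cong simp: indicator_def)
    moreover have "(\<integral>\<^sup>+y. ennreal (- (indicator X y * g y)) \<partial>lborel) = emeasure (density lborel ?n) X"
      using gm X by (subst emeasure_density) (auto intro!: nn_integral_cong simp: indicator_def)
    ultimately show "emeasure (density lborel ?p) X = emeasure (density lborel ?n) X" by simp
  qed auto
  then have "AE y in lborel. ?p y = ?n y"
    using gm fin by (subst finite_density_unique[symmetric]) auto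
  then show ?thesis
  proof (rule AE_mp, intro AE_I2 impI)
    fix y assume pn: "?p y = ?n y"
    show "g y = 0"
    proof (cases "0 \<le> g y")
      case True
      then show ?thesis using pn by (simp add: ennreal_neg)
    next
      case False
      then have "ennreal (- g y) = 0" using pn by (simp add: ennreal_neg)
      then show ?thesis using False by (simp add: ennreal_eq_0_iff)
    qed
  qed
qed

text \<open>Cutting \<open>h\<close> off outside \<open>box a b\<close>, with
  \<open>cbox a b\<close> inside \<open>S\<close>, gives an integrable function on the whole space
  whose box integrals are integrals of \<open>h\<close> over smaller boxes. \<open>S\<close> is a
  countable union of such closed boxes.\<close>

lemma AE_zero_of_boxes:
  fixes h :: "real^'n \<Rightarrow> real"
  assumes S: "open S" and int: "\<And>a b. cbox a b \<subseteq> S \<Longrightarrow> set_integrable lborel (cbox a b) h"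
    and z: "\<And>a b. cbox a b \<subseteq> S \<Longrightarrow> (\<integral>y. indicator (box a b) y * h y \<partial>lborel) = 0"
  shows "AE y in lborel. y \<in> S \<longrightarrow> h y = 0"
proof -
  have one: "AE y in lborel. y \<in> cbox a b \<longrightarrow> h y = 0" if ab: "cbox a b \<subseteq> S" for a b
  proof -
    define g where "g = (\<lambda>y. indicator (box a b) y * h y)"
    have gi: "integrable lborel g"
    proof -
      have "integrable lborel (\<lambda>y. indicator (box a b) y *\<^sub>R (indicator (cbox a b) y *\<^sub>R h y))"
        using int[OF ab] unfolding set_integrable_def by (rule integrable_mult_indicator[rotated]) simp
      moreover have "indicator (box a b) y *\<^sub>R (indicator (cbox a b) y *\<^sub>R h y) = g y" for y
        using box_subset_cbox[of a b] by (auto simp: g_def indicator_def)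
      ultimately show ?thesis by (simp only:)
    qed
    have gz: "(\<integral>y. indicator (box c d) y * g y \<partial>lborel) = 0" for c d
    proof -
      obtain e f where ef: "box a b \<inter> box c d = box e f" using box_Int_box[of a b c d] by blast
      have eq: "indicator (box c d) y * g y = indicator (box e f) y * h y" for y
        unfolding g_def ef[symmetric] by (auto simp: indicator_def)
      show ?thesis
      proof (cases "box e f = {}")
        case True
        then show ?thesis unfolding eq by simp
      next
        case False
        have "cbox e f = closure (box e f)" using closure_box[OF False] by simp
        also have "\<dots> \<subseteq> cbox a b" using ef box_subset_cbox[of a b] by (intro closure_minimal) auto
        finally show ?thesis unfolding eq using ab by (intro z) auto
      qed
    qed
    have "AE y in lborel. g y = 0" by (rule integrable_box_zero_AE[OF gi gz])
    \<comment> \<open>The cut-off says nothing about \<open>h\<close> on the boundary of the box,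
      but that is a null set.\<close>
    moreover have "AE y in lborel. y \<notin> cbox a b - box a b"
    proof (rule AE_not_in)
      have "emeasure lborel (cbox a b - box a b) = emeasure lborel (cbox a b) - emeasure lborel (box a b)"
        using box_subset_cbox[of a b] emeasure_lborel_box_finite[of a b] by (intro emeasure_Diff) auto
      also have "\<dots> = 0" by (simp add: emeasure_lborel_box_eq emeasure_lborel_cbox_eq)
      finally show "cbox a b - box a b \<in> null_sets lborel" by (intro null_setsI) auto
    qed
    ultimately show ?thesis by eventually_elim (auto simp: g_def indicator_def split: if_splits)
  qed
  obtain \<D> where D: "countable \<D>" "\<D> \<subseteq> Pow S" "\<And>X. X \<in> \<D> \<Longrightarrow> \<exists>a b. X = cbox a b" "\<Union>\<D> = S"
    using open_countable_Union_open_cbox[OF S] by metis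
  have "AE y in lborel. \<forall>X\<in>\<D>. y \<in> X \<longrightarrow> h y = 0"
    using one D by (subst AE_ball_countable[OF D(1)]) blast
  then show ?thesis by eventually_elim (use D(4) in blast)
qed

section \<open>Test forms that isolate one coefficient\<close>

context rmfd
begin

text \<open>In the chart \<open>c\<close> this is the bump times \<open>dual_form I\<close>. Tangent
  vectors are given in the selected chart, so the inverse of \<open>coord_to_tan\<close> first
  converts them to components in \<open>c\<close>.\<close>

definition test_form :: "('a, 'n) chart \<Rightarrow> real^'n::_ \<Rightarrow> real^'n::_ \<Rightarrow> nat \<Rightarrow> 'n list \<Rightarrow> ('a, 'n) dform" where
  "test_form c a b i I x ws = (if x \<in> cdom c
     then box_bump a b i (cmap c x) * dual_form I (map (inv (coord_to_tan M c x)) ws) else 0)"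

lemma coord_to_tan_inv:
  assumes "c \<in> atlas M" "x \<in> cdom c"
  shows "inv (coord_to_tan M c x) (coord_to_tan M c x v) = v" "linear (inv (coord_to_tan M c x))"
proof -
  let ?A = "coord_to_tan M c x"
  note lin = coord_to_tan_bij(1)[OF assms]
  have inj: "inj ?A" using coord_to_tan_bij(2)[OF assms] det_nz_iff_inj[OF lin] by simp
  then show "inv ?A (?A v) = v" by simp
  have "surj ?A" using linear_injective_imp_surjective lin inj by blast
  then have r: "?A (inv ?A w) = w" for w by (rule surj_f_inv_f)
  show "linear (inv ?A)"
  proof (rule linearI)
    show "inv ?A (x + y) = inv ?A x + inv ?A y" for x y
      by (rule injD[OF inj]) (simp add: linear_add[OF lin] r)
    show "inv ?A (s *\<^sub>R x) = s *\<^sub>R inv ?A x" for s x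
      by (rule injD[OF inj]) (simp add: linear_cmul[OF lin] r)
  qed
qed

lemma local_test_form:
  assumes c: "c \<in> atlas M" and y: "y \<in> cimg c"
  shows "local_form M c (test_form c a b i I) y ws = box_bump a b i y * dual_form I ws"
proof -
  have "map (inv (coord_to_tan M c (cinv c y))) (map (coord_to_tan M c (cinv c y)) ws) = ws"
    using coord_to_tan_inv(1)[OF c chart(8)[OF c y]] by (simp add: o_def)
  then show ?thesis using chart(7,8)[OF c y] by (simp add: local_form_def test_form_def)
qed

text \<open>In another chart \<open>d\<close> smoothness is checked on two kinds of open sets:
  inside the domain of \<open>c\<close> through the transition map, and off the compact set
  \<open>K\<close>, where the form is zero. As \<open>K\<close> lies in \<open>cdom c\<close>, these
  cover everything.\<close>

lemma test_form:
  assumes c: "c \<in> atlas M" and ab: "cbox a b \<subseteq> cimg c" and I: "length I + m = CARD('n)"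
  shows "smooth_form M m (test_form c a b i I)" "compactly_supported (test_form c a b i I)"
proof -
  let ?\<omega> = "test_form c a b i I"
  define K where "K = cinv c ` cbox a b"
  have K: "compact K" unfolding K_def
    using continuous_on_subset[OF chart(4)[OF c] ab] by (intro compact_continuous_image) auto
  have out: "?\<omega> x = 0" if "x \<notin> K" for x
  proof (rule ext)
    fix ws
    have "cmap c x \<notin> box a b" if "x \<in> cdom c"
      using \<open>x \<notin> K\<close> chart(5)[OF c that] box_subset_cbox[of a b] unfolding K_def by (metis image_eqI subsetD)
    then show "?\<omega> x ws = 0 ws" by (auto simp: test_form_def box_bump_eq_0)
  qed
  have "{x. \<exists>vs. ?\<omega> x vs \<noteq> 0} \<subseteq> K" using out by (force simp: fun_eq_iff)
  then have "closure {x. \<exists>vs. ?\<omega> x vs \<noteq> 0} \<subseteq> K" using compact_imp_closed[OF K] by (rule closure_minimal)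
  then have eq: "closure {x. \<exists>vs. ?\<omega> x vs \<noteq> 0} = K \<inter> closure {x. \<exists>vs. ?\<omega> x vs \<noteq> 0}" by blast
  show "compactly_supported ?\<omega>"
    unfolding compactly_supported_def by (subst eq) (rule compact_Int_closed[OF K closed_closure])
  have da: "alternating m (dual_form I)" by (rule dual_form_alternating[OF I])
  show "smooth_form M m ?\<omega>"
    unfolding smooth_form_def
  proof (intro conjI allI ballI impI)
    show "alternating m (?\<omega> x)" for x
    proof (cases "x \<in> cdom c")
      case True
      then have "?\<omega> x = (\<lambda>ws. box_bump a b i (cmap c x) * dual_form I (map (inv (coord_to_tan M c x)) ws))"
        by (simp add: test_form_def[abs_def])
      then show ?thesis
        using alternating_scale[OF alternating_map[OF da coord_to_tan_inv(2)[OF c True]]] by simp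
    next
      case False
      then have "?\<omega> x = 0" by (simp add: test_form_def[abs_def] fun_eq_iff)
      then show ?thesis by (simp add: alternating_zero)
    qed
    fix d and ws :: "(real^'n::_) list" assume d: "d \<in> atlas M" and ws: "length ws = m"
    interpret P: rmfd_pair M M by unfold_locales
    show "smooth_on (cimg d) (\<lambda>y. local_form M d ?\<omega> y ws)"
    proof (rule smooth_on_locally)
      fix y assume y: "y \<in> cimg d"
      show "\<exists>U. open U \<and> y \<in> U \<and> smooth_on U (\<lambda>y. local_form M d ?\<omega> y ws)"
      proof (cases "cinv d y \<in> cdom c")
        case True
        let ?U = "loc_dom d c id"
        note U = P.loc_rep[OF smooth_map_id d c]
        have im: "loc_rep d c id ` ?U \<subseteq> UNIV" by simp
        have eq: "local_form M d ?\<omega> z ws = box_bump a b i (loc_rep d c id z) *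
           (\<Sum>js | length js = m. (\<Prod>r<m. loc_D d c id z (ws ! r) $ (js ! r)) * dual_form I (map ax js))" if z: "z \<in> ?U" for z
        proof -
          have "local_form M d ?\<omega> z ws = box_bump a b i (loc_rep d c id z) * dual_form I (map (loc_D d c id z) ws)"
            using P.local_form_pullback[OF smooth_map_id d c z, of ?\<omega> ws] local_test_form[OF c U(4)[OF z]]
            by (simp add: pullback_id)
          also have "dual_form I (map (loc_D d c id z) ws) =
             (\<Sum>js | length js = m. (\<Prod>r<m. loc_D d c id z (ws ! r) $ (js ! r)) * dual_form I (map ax js))"
            using multilinear_expand_nth[OF alternating_imp_multilinear[OF da], of "map (loc_D d c id z) ws"] ws by simp
          finally show ?thesis .
        qed
        have "smooth_on ?U (\<lambda>z. box_bump a b i (loc_rep d c id z) *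
           (\<Sum>js | length js = m. (\<Prod>r<m. loc_D d c id z (ws ! r) $ (js ! r)) * dual_form I (map ax js)))"
          by (rule smooth_on_mult[OF U(1) smooth_on_compose[OF U(1) im U(2) smooth_on_box_bump]])
            (intro smooth_on_sum smooth_on_mult smooth_on_prod smooth_on_const U(1) P.smooth_on_loc_D_component[OF smooth_map_id d c]; simp)
        then have "smooth_on ?U (\<lambda>y. local_form M d ?\<omega> y ws)"
          by (rule smooth_on_cong[OF U(1), THEN iffD2, rotated]) (rule eq)
        then show ?thesis using U(1) y True by (intro exI[of _ ?U]) (simp add: loc_dom_def)
      next
        case False
        have "K \<subseteq> cdom c" using ab chart(8)[OF c] by (auto simp: K_def)
        then have yK: "cinv d y \<in> - K" using False by blast
        have oK: "open (- K)" using compact_imp_closed[OF K] by (simp add: open_closed)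
        have U: "open {y \<in> cimg d. cinv d y \<in> - K}" using open_chart_preimage[OF d oK continuous_on_id] by simp
        have "smooth_on {y \<in> cimg d. cinv d y \<in> - K} (\<lambda>y. local_form M d ?\<omega> y ws)"
          by (rule smooth_on_cong[OF U, THEN iffD2, OF _ smooth_on_const[of _ 0]]) (simp add: local_form_def out)
        then show ?thesis using U y yK by blast
      qed
    qed
  qed
qed

lemma integral_riem_vol_chart:
  fixes h :: "'a \<Rightarrow> real"
  assumes c: "c \<in> atlas M" and h: "h \<in> borel_measurable borel" and supp: "\<And>x. x \<notin> cdom c \<Longrightarrow> h x = 0"
  shows "(\<integral>x. h x \<partial>riem_vol M) = (\<integral>y. indicator (cimg c) y * (vol_dens c y * h (cinv c y)) \<partial>lborel)"
proof -
  have R: "measurable (restrict_space lborel (cimg c)) (borel :: real measure) = measurable (restrict_space borel (cimg c)) borel"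
    "measurable (restrict_space lborel (cimg c)) (borel :: 'a measure) = measurable (restrict_space borel (cimg c)) borel"
    by (rule measurable_cong_sets[OF sets_restrict_space_cong[OF sets_lborel] refl])+
  have "(\<integral>x. h x \<partial>riem_vol M) = (\<integral>x. indicator (cdom c) x *\<^sub>R h x \<partial>riem_vol M)"
    using supp by (intro Bochner_Integration.integral_cong) (auto simp: indicator_def)
  also have "\<dots> = (\<integral>x. h x \<partial>density (riem_vol M) (\<lambda>x. ennreal (indicator (cdom c) x)))"
    using h chart(1)[OF c] by (subst integral_density) auto
  also have "density (riem_vol M) (\<lambda>x. ennreal (indicator (cdom c) x)) = chart_measure M c"
    using riem_vol_restrict[OF c] by (simp add: ennreal_indicator)
  also have "(\<integral>x. h x \<partial>chart_measure M c) = (\<integral>y. h (cinv c y) \<partial>density (restrict_space lborel (cimg c)) (\<lambda>y. ennreal (vol_dens c y)))"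
    unfolding chart_measure_def vol_dens_def using h cinv_measurable[OF c]
    by (intro integral_distr) (simp_all add: R)
  also have "\<dots> = (\<integral>y. vol_dens c y *\<^sub>R h (cinv c y) \<partial>restrict_space lborel (cimg c))"
  proof (rule integral_density)
    show "(\<lambda>y. h (cinv c y)) \<in> borel_measurable (restrict_space lborel (cimg c))"
      unfolding R by (rule measurable_compose[OF cinv_measurable[OF c] h])
    show "vol_dens c \<in> borel_measurable (restrict_space lborel (cimg c))"
      unfolding R by (rule vol_dens_measurable[OF c])
    show "AE y in restrict_space lborel (cimg c). 0 \<le> vol_dens c y"
      by (rule AE_I2) (use vol_dens_pos[OF c] in \<open>auto simp: space_restrict_space intro: less_imp_le\<close>)
  qed
  also have "\<dots> = (\<integral>y. indicator (cimg c) y * (vol_dens c y * h (cinv c y)) \<partial>lborel)"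
    using chart(2)[OF c] by (subst integral_restrict_space) auto
  finally show ?thesis .
qed

text \<open>Countably many charts suffice, so the exceptional sets unite to a null set. Borel
  measurability of the exceptional set allows its volume to be computed in each chart.\<close>

lemma AE_by_charts:
  assumes P: "\<And>c. c \<in> atlas M \<Longrightarrow> AE y in lborel. y \<in> cimg c \<longrightarrow> P (cinv c y)" and m: "{x. \<not> P x} \<in> sets borel"
  shows "AE x in riem_vol M. P x"
proof -
  obtain \<F>' where F: "\<F>' \<subseteq> cdom ` atlas M" "countable \<F>'" "\<Union>\<F>' = \<Union>(cdom ` atlas M)"
    by (rule Lindelof[of "cdom ` atlas M"]) (use chart(1) in blast)+
  have U: "\<Union>\<F>' = UNIV" unfolding F(3) using chart_at by blast
  have "AE x in riem_vol M. x \<in> V \<longrightarrow> P x" if V: "V \<in> \<F>'" for V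
  proof -
    obtain c where c: "c \<in> atlas M" "V = cdom c" using V F(1) by blast
    have m': "{x. \<not> P x} \<inter> cdom c \<in> sets borel" using m chart(1)[OF c(1)] by auto
    have "emeasure (riem_vol M) ({x. \<not> P x} \<inter> cdom c) = (\<integral>\<^sup>+x. indicator {x. \<not> P x} x * indicator (cdom c) x \<partial>riem_vol M)"
      using m' by (subst nn_integral_indicator[symmetric]) (auto simp: riem_vol indicator_inter_arith intro!: nn_integral_cong simp del: nn_integral_indicator)
    also have "\<dots> = (\<integral>\<^sup>+y. (ennreal (vol_dens c y) * indicator {x. \<not> P x} (cinv c y)) * indicator (cimg c) y \<partial>lborel)"
      using m by (intro nn_integral_riem_vol_chart[OF c(1)]) auto
    also have "\<dots> = (\<integral>\<^sup>+(y::real^'n::_). 0 \<partial>lborel)"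
      by (rule nn_integral_cong_AE) (use P[OF c(1)] in \<open>auto elim!: eventually_mono simp: indicator_def\<close>)
    finally have "{x. \<not> P x} \<inter> cdom c \<in> null_sets (riem_vol M)" using m' by (intro null_setsI) (auto simp: riem_vol)
    from AE_not_in[OF this] show ?thesis unfolding c(2) by eventually_elim auto
  qed
  then have "AE x in riem_vol M. \<forall>V\<in>\<F>'. x \<in> V \<longrightarrow> P x" by (subst AE_ball_countable[OF F(2)]) blast
  then show ?thesis by eventually_elim (use U in blast)
qed

text \<open>The difference \<delta> is a weak differential of 0, so its wedge with every test form
  integrates to 0. By \<open>wedge_dual_form\<close>, a test form built on
  \<open>dual_form I\<close> sees only the coefficient of \<delta> at \<open>I\<close>, which
  reduces the claim to scalar functions in a chart.\<close>

lemma weak_d_unique: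
  assumes w: "weak_d M j \<phi> \<theta>" "weak_d M j \<phi> \<theta>'" and j: "Suc j \<le> CARD('n)"
  shows "AE x in riem_vol M. \<theta> x = \<theta>' x"
proof -
  define \<delta> where "\<delta> = \<theta> - \<theta>'"
  have wd: "weak_d M j (\<phi> - \<phi>) \<delta>" unfolding \<delta>_def by (rule weak_d_diff[OF w])
  then have L: "L1loc_form M (Suc j) \<delta>" by (simp add: weak_d_def)
  define m where "m = CARD('n) - Suc j"
  have m: "Suc j + m = CARD('n)" using j by (simp add: m_def)
  have "wedge k l (0 :: 'n altform) \<beta> = 0" for k l and \<beta> :: "'n altform" by (rule ext) (simp add: wedge_def)
  then have fi: "form_integral M (\<lambda>x. wedge (Suc j) m (\<delta> x) (\<omega> x)) = 0" if "smooth_form M m \<omega>" "compactly_supported \<omega>" for \<omega>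
    using wd m that by (auto simp: weak_d_def form_integral_density form_density_def)
  have mf: "measurable_form M (Suc j) \<delta>" using L by (simp add: L1loc_form_def)
  have alt: "alternating (Suc j) (\<delta> x)" for x using mf by (simp add: measurable_form_def)
  have comp: "AE y in lborel. y \<in> cimg c \<longrightarrow> local_form M c \<delta> y (map ax I) = 0"
    if c: "c \<in> atlas M" and I: "length I = Suc j" for c I
  proof (cases "distinct I")
    case False
    have "local_form M c \<delta> y (map ax I) = 0" if "y \<in> cimg c" for y
      using alternating_not_distinct[OF local_form_alternating[OF c that alt] False] .
    then show ?thesis by simp
  next
    case True
    let ?h = "\<lambda>y. local_form M c \<delta> y (map ax I)"
    obtain cc where cc: "cc > 0" "\<And>\<alpha>. alternating (Suc j) \<alpha> \<Longrightarrow> wedge (Suc j) m \<alpha> (dual_form I) (map ax enum_list) = cc * \<alpha> (map ax I)"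
      using wedge_dual_form[OF I m True] by blast
    show ?thesis
    proof (rule AE_zero_of_boxes[OF chart(2)[OF c]])
      fix a b assume ab: "cbox a b \<subseteq> cimg c"
      show si: "set_integrable lborel (cbox a b) ?h" using L c ab I by (auto simp: L1loc_form_def)
      have bz: "(\<integral>y. box_bump a b i y * ?h y \<partial>lborel) = 0" for i
      proof -
        let ?\<omega> = "test_form c a b i I"
        have Im: "length I + m = CARD('n)" using I m by simp
        note tf = test_form[OF c ab Im, of i]
        let ?\<eta> = "\<lambda>x. wedge (Suc j) m (\<delta> x) (?\<omega> x)"
        have alt\<eta>: "alternating CARD('n) (?\<eta> x)" for x
          using wedge_alternating[OF alternating_imp_multilinear[OF alt] alternating_imp_multilinear] tf(1) m
          unfolding smooth_form_def by metis
        have "0 = (\<integral>x. form_density M ?\<eta> x \<partial>riem_vol M)" using fi[OF tf] by (simp add: form_integral_density)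
        also have "\<dots> = (\<integral>y. indicator (cimg c) y * (vol_dens c y * form_density M ?\<eta> (cinv c y)) \<partial>lborel)"
        proof (rule integral_riem_vol_chart[OF c wedge_density_smooth(1)[OF L m tf]])
          fix x assume "x \<notin> cdom c"
          then have "?\<omega> x = 0" by (simp add: test_form_def[abs_def] fun_eq_iff)
          then show "form_density M ?\<eta> x = 0" by (simp add: form_density_def wedge_zero_right)
        qed
        also have "\<dots> = (\<integral>y. cc * (box_bump a b i y * ?h y) \<partial>lborel)"
        proof (rule Bochner_Integration.integral_cong[OF refl])
          fix y
          show "indicator (cimg c) y * (vol_dens c y * form_density M ?\<eta> (cinv c y)) = cc * (box_bump a b i y * ?h y)"
          proof (cases "y \<in> cimg c")
            case True
            have "local_form M c ?\<omega> y = (\<lambda>ws. box_bump a b i y * dual_form I ws)"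
              using local_test_form[OF c True] by blast
            then have "local_form M c ?\<eta> y (map ax enum_list) = box_bump a b i y * (cc * ?h y)"
              by (simp add: local_form_wedge wedge_scale_right cc(2)[OF local_form_alternating[OF c True alt]])
            then show ?thesis
              using True vol_dens_pos[OF c True] by (simp add: form_density_chart[OF c True alt\<eta>])
          next
            case False
            then have "y \<notin> box a b" using ab box_subset_cbox[of a b] by blast
            then show ?thesis using False by (simp add: box_bump_eq_0)
          qed
        qed
        finally show ?thesis using cc(1) by simp
      qed
      \<comment> \<open>The bumps lie between 0 and 1 and vanish outside the box, so the absolute
        value of the coefficient on the closed box dominates.\<close>
      have "(\<lambda>i. \<integral>y. box_bump a b i y * ?h y \<partial>lborel) \<longlonglongrightarrow> (\<integral>y. indicator (box a b) y * ?h y \<partial>lborel)"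
      proof (rule integral_dominated_convergence[where w = "\<lambda>y. \<bar>indicator (cbox a b) y *\<^sub>R ?h y\<bar>"])
        have hm: "(\<lambda>y. indicator (cbox a b) y *\<^sub>R ?h y) \<in> borel_measurable lborel"
          using si unfolding set_integrable_def by (rule borel_measurable_integrable)
        have bm: "box_bump a b i \<in> borel_measurable borel" for i
          by (intro borel_measurable_continuous_onI smooth_on_imp_continuous_on smooth_on_box_bump)
        have e1: "box_bump a b i y * ?h y = box_bump a b i y * (indicator (cbox a b) y *\<^sub>R ?h y)" for i y
          using box_bump_eq_0[of y a b i] box_subset_cbox[of a b] by (auto simp: indicator_def)
        have e2: "indicator (box a b) y * ?h y = indicator (box a b) y * (indicator (cbox a b) y *\<^sub>R ?h y)" for y
          using box_subset_cbox[of a b] by (auto simp: indicator_def)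
        show "(\<lambda>y. box_bump a b i y * ?h y) \<in> borel_measurable lborel" for i
          unfolding e1 using bm hm by (intro borel_measurable_times) auto
        show "(\<lambda>y. indicator (box a b) y * ?h y) \<in> borel_measurable lborel"
          unfolding e2 using hm by (intro borel_measurable_times) auto
        show "integrable lborel (\<lambda>y. \<bar>indicator (cbox a b) y *\<^sub>R ?h y\<bar>)"
          using si unfolding set_integrable_def by (rule integrable_abs)
        show "AE y in lborel. (\<lambda>i. box_bump a b i y * ?h y) \<longlonglongrightarrow> indicator (box a b) y * ?h y"
          by (intro AE_I2 tendsto_mult box_bump_tendsto tendsto_const)
        show "AE y in lborel. norm (box_bump a b i y * ?h y) \<le> \<bar>indicator (cbox a b) y *\<^sub>R ?h y\<bar>" for i
        proof (rule AE_I2)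
          fix y
          have "\<bar>box_bump a b i y\<bar> * \<bar>indicator (cbox a b) y *\<^sub>R ?h y\<bar> \<le> 1 * \<bar>indicator (cbox a b) y *\<^sub>R ?h y\<bar>"
            using box_bump_range[of a b i y] by (intro mult_right_mono) auto
          then show "norm (box_bump a b i y * ?h y) \<le> \<bar>indicator (cbox a b) y *\<^sub>R ?h y\<bar>"
            unfolding e1 by (simp add: abs_mult)
        qed
      qed
      then show "(\<integral>y. indicator (box a b) y * ?h y \<partial>lborel) = 0"
        unfolding bz using LIMSEQ_unique tendsto_const by blast
    qed
  qed
  \<comment> \<open>The norm provides a Borel exceptional set for \<open>AE_by_charts\<close>; a
    form vanishes at every point where its norm does.\<close>
  have "AE x in riem_vol M. alt_norm (metric M x) (Suc j) (\<delta> x) = 0"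
  proof (rule AE_by_charts)
    have "{x. alt_norm (metric M x) (Suc j) (\<delta> x) \<noteq> 0} = (\<lambda>x. alt_norm (metric M x) (Suc j) (\<delta> x)) -` (- {0}) \<inter> space borel"
      by auto
    also have "\<dots> \<in> sets borel" by (rule measurable_sets[OF alt_norm_measurable[OF mf]]) auto
    finally show "{x. alt_norm (metric M x) (Suc j) (\<delta> x) \<noteq> 0} \<in> sets borel" .
    fix c assume c: "c \<in> atlas M"
    have "AE y in lborel. \<forall>I\<in>{I :: 'n list. length I = Suc j}. y \<in> cimg c \<longrightarrow> local_form M c \<delta> y (map ax I) = 0"
      by (subst AE_ball_countable[OF countable_finite[OF finite_lists_length]]) (use comp[OF c] in blast)
    then show "AE y in lborel. y \<in> cimg c \<longrightarrow> alt_norm (metric M (cinv c y)) (Suc j) (\<delta> (cinv c y)) = 0"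
    proof (eventually_elim, intro impI)
      fix y assume z: "\<forall>I\<in>{I :: 'n list. length I = Suc j}. y \<in> cimg c \<longrightarrow> local_form M c \<delta> y (map ax I) = 0" and y: "y \<in> cimg c"
      obtain bb where bb: "\<And>v. v = (\<Sum>i\<in>UNIV. bb v i *\<^sub>R coord_to_tan M c (cinv c y) (ax i))"
        using coord_to_tan_basis[OF c chart(8)[OF c y]] by blast
      have "\<delta> (cinv c y) (map (\<lambda>i. coord_to_tan M c (cinv c y) (ax i)) I) = 0" if "length I = Suc j" for I
        using z y that by (simp add: local_form_def o_def)
      then have "\<delta> (cinv c y) vs = 0" if "length vs = Suc j" for vs
        using multilinear_expand_gen[OF alternating_imp_multilinear[OF alt] bb that] by simp
      then have "\<delta> (cinv c y) = 0" using alt[of "cinv c y"] by (auto simp: alternating_def fun_eq_iff)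
      then show "alt_norm (metric M (cinv c y)) (Suc j) (\<delta> (cinv c y)) = 0" by simp
    qed
  qed
  then show ?thesis
  proof (rule AE_mp, intro AE_I2 impI)
    fix x assume z: "alt_norm (metric M x) (Suc j) (\<delta> x) = 0"
    have "\<delta> x vs = 0" for vs
    proof (cases "length vs = Suc j")
      case True
      define R where "R = Max (insert 1 ((\<lambda>v. metric M x v v) ` set vs))"
      have "1 \<le> R" "\<And>v. v \<in> set vs \<Longrightarrow> metric M x v v \<le> R" by (auto simp: R_def)
      from abs_le_alt_norm[OF metric_inner alternating_imp_multilinear[OF alt[of x]] True this] show ?thesis using z by simp
    qed (use alt[of x] in \<open>simp add: alternating_def\<close>)
    then have "\<theta> x vs - \<theta>' x vs = 0" for vs by (simp add: \<delta>_def)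
    then show "\<theta> x = \<theta>' x" by (intro ext) simp
  qed
qed

end

section \<open>Maps between quotients\<close>

definition form_subspace :: "('a, 'n) dform set \<Rightarrow> bool" where
  "form_subspace V \<longleftrightarrow> 0 \<in> V \<and> (\<forall>u\<in>V. \<forall>v\<in>V. u + v \<in> V) \<and> (\<forall>r. \<forall>u\<in>V. form_scale r u \<in> V)"

lemma form_subspace_zero: "form_subspace V \<Longrightarrow> 0 \<in> V"
  by (simp add: form_subspace_def)

lemma form_subspace_add: "form_subspace V \<Longrightarrow> u \<in> V \<Longrightarrow> v \<in> V \<Longrightarrow> u + v \<in> V"
  by (simp add: form_subspace_def)

lemma form_subspace_scale: "form_subspace V \<Longrightarrow> u \<in> V \<Longrightarrow> form_scale r u \<in> V"
  by (simp add: form_subspace_def)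

lemma form_diff_eq: "u - v = u + form_scale (- 1) v"
  by (intro ext) (simp add: form_scale_def)

lemma form_subspace_diff: "form_subspace V \<Longrightarrow> u \<in> V \<Longrightarrow> v \<in> V \<Longrightarrow> u - v \<in> V"
  unfolding form_diff_eq by (intro form_subspace_add form_subspace_scale)

lemma form_scale_diff: "form_scale r u - form_scale r v = form_scale r (u - v)"
  by (intro ext) (simp add: form_scale_def algebra_simps)

lemma cls_mem_iff: "w \<in> cls V W v \<longleftrightarrow> v \<in> V \<and> w \<in> V \<and> v - w \<in> W"
  by (simp add: cls_def quot_rel_def)

lemma cls_eq_iff:
  assumes W: "form_subspace W" and uv: "u \<in> V" "v \<in> V"
  shows "cls V W u = cls V W v \<longleftrightarrow> u - v \<in> W"
proof
  assume "cls V W u = cls V W v"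
  moreover have "v \<in> cls V W v" using uv form_subspace_zero[OF W] by (simp add: cls_mem_iff)
  ultimately have "v \<in> cls V W u" by simp
  then show "u - v \<in> W" by (simp add: cls_mem_iff)
next
  assume d: "u - v \<in> W"
  have "u - w \<in> W \<longleftrightarrow> v - w \<in> W" for w
  proof
    assume "u - w \<in> W"
    then have "(u - w) - (u - v) \<in> W" using d by (rule form_subspace_diff[OF W])
    then show "v - w \<in> W" by simp
  next
    assume "v - w \<in> W"
    with d have "(u - v) + (v - w) \<in> W" by (rule form_subspace_add[OF W])
    then show "u - w \<in> W" by simp
  qed
  then show "cls V W u = cls V W v" using uv by (auto simp: cls_mem_iff set_eq_iff)
qed

lemma quot_eq: "quot V W = cls V W ` V"
  by (auto simp: quot_def cls_def quotient_def)

lemma UN_cls_const: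
  assumes "v \<in> X" "\<And>w. w \<in> X \<Longrightarrow> g w = c" shows "(\<Union>w\<in>X. g w) = c"
  using assms by auto

lemma quot_add_cls:
  assumes V: "form_subspace V" and W: "form_subspace W" and uv: "u \<in> V" "v \<in> V"
  shows "quot_add V W (cls V W u) (cls V W v) = cls V W (u + v)"
proof -
  have m: "x \<in> cls V W x" if "x \<in> V" for x using that form_subspace_zero[OF W] by (simp add: cls_mem_iff)
  have "cls V W (x + y) = cls V W (u + v)" if "x \<in> cls V W u" "y \<in> cls V W v" for x y
  proof -
    have xy: "x \<in> V" "y \<in> V" "u - x \<in> W" "v - y \<in> W" using that by (auto simp: cls_mem_iff)
    have "(u - x) + (v - y) \<in> W" using xy(3,4) by (rule form_subspace_add[OF W])
    moreover have "(u - x) + (v - y) = (u + v) - (x + y)" by (simp add: algebra_simps)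
    ultimately have "(u + v) - (x + y) \<in> W" by (simp only:)
    then have "cls V W (u + v) = cls V W (x + y)"
      using cls_eq_iff[OF W form_subspace_add[OF V uv] form_subspace_add[OF V xy(1,2)]] by blast
    then show ?thesis ..
  qed
  then show ?thesis
    unfolding quot_add_def by (intro UN_cls_const[OF m[OF uv(1)]] UN_cls_const[OF m[OF uv(2)]])
qed

lemma quot_scale_cls:
  assumes V: "form_subspace V" and W: "form_subspace W" and u: "u \<in> V"
  shows "quot_scale V W r (cls V W u) = cls V W (form_scale r u)"
proof -
  have m: "u \<in> cls V W u" using u form_subspace_zero[OF W] by (simp add: cls_mem_iff)
  have "cls V W (form_scale r x) = cls V W (form_scale r u)" if "x \<in> cls V W u" for x
  proof -
    have x: "x \<in> V" "u - x \<in> W" using that by (auto simp: cls_mem_iff)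
    have "form_scale r u - form_scale r x \<in> W" unfolding form_scale_diff by (rule form_subspace_scale[OF W x(2)])
    then have "cls V W (form_scale r u) = cls V W (form_scale r x)"
      using cls_eq_iff[OF W form_subspace_scale[OF V u] form_subspace_scale[OF V x(1)]] by blast
    then show ?thesis ..
  qed
  then show ?thesis unfolding quot_scale_def by (rule UN_cls_const[OF m])
qed

lemma induces_linearI:
  assumes V: "form_subspace V" and W: "form_subspace W" and V': "form_subspace V'" and W': "form_subspace W'"
    and add: "\<And>u v. T (u + v) = T u + T v" and scale: "\<And>r u. T (form_scale r u) = form_scale r (T u)"
    and TV: "\<And>v. v \<in> V \<Longrightarrow> T v \<in> V'" and TW: "\<And>w. w \<in> W \<Longrightarrow> T w \<in> W'"
  shows "induces_linear V W V' W' T"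
    and "(\<And>v. v \<in> V \<Longrightarrow> N' (T v) \<le> C * N v) \<Longrightarrow> (\<And>v. 0 \<le> N' v) \<Longrightarrow> (\<And>v. 0 \<le> N v) \<Longrightarrow> 0 \<le> C \<Longrightarrow> induces_bounded V W N V' W' N' T"
proof -
  have diff: "T (u - v) = T u - T v" for u v unfolding form_diff_eq add scale ..
  have m: "v \<in> cls V W v" if "v \<in> V" for v using that form_subspace_zero[OF W] by (simp add: cls_mem_iff)
  have m': "v \<in> cls V' W' v" if "v \<in> V'" for v using that form_subspace_zero[OF W'] by (simp add: cls_mem_iff)
  \<comment> \<open>The classes of \<open>T v\<close> for \<open>v\<close> in one class coincide, so
    their union is that common class and no representative has to be selected.\<close>
  define F where "F = (\<lambda>X. \<Union>v\<in>X. cls V' W' (T v))"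
  have F: "F (cls V W v) = cls V' W' (T v)" if v: "v \<in> V" for v
    unfolding F_def
  proof (rule UN_cls_const[OF m[OF v]])
    fix w assume "w \<in> cls V W v"
    then have w: "w \<in> V" "v - w \<in> W" by (auto simp: cls_mem_iff)
    have "T v - T w \<in> W'" using TW[OF w(2)] by (simp only: diff)
    then have "cls V' W' (T v) = cls V' W' (T w)" using cls_eq_iff[OF W' TV[OF v] TV[OF w(1)]] by blast
    then show "cls V' W' (T w) = cls V' W' (T v)" ..
  qed
  have lin: "quot_linear V W V' W' F"
    unfolding quot_linear_def quot_eq
  proof (intro conjI ballI allI)
    fix X assume "X \<in> cls V W ` V"
    then obtain u where u: "u \<in> V" "X = cls V W u" by blast
    show "F X \<in> cls V' W' ` V'" using F[OF u(1)] TV[OF u(1)] u(2) by blast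
    show "F (quot_scale V W r X) = quot_scale V' W' r (F X)" for r
      unfolding u(2) quot_scale_cls[OF V W u(1)] F[OF u(1)] F[OF form_subspace_scale[OF V u(1)]]
        quot_scale_cls[OF V' W' TV[OF u(1)]] scale ..
    fix Y assume "Y \<in> cls V W ` V"
    then obtain v where v: "v \<in> V" "Y = cls V W v" by blast
    show "F (quot_add V W X Y) = quot_add V' W' (F X) (F Y)"
      unfolding u(2) v(2) quot_add_cls[OF V W u(1) v(1)] F[OF u(1)] F[OF v(1)] F[OF form_subspace_add[OF V u(1) v(1)]]
        quot_add_cls[OF V' W' TV[OF u(1)] TV[OF v(1)]] add ..
  qed
  show "induces_linear V W V' W' T"
    unfolding induces_linear_def using TV F lin by blast
  assume bd: "\<And>v. v \<in> V \<Longrightarrow> N' (T v) \<le> C * N v" and nn: "\<And>v. 0 \<le> N' v" "\<And>v. 0 \<le> N v" "0 \<le> C"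
  have "quot_norm N' (F X) \<le> C * quot_norm N X" if X: "X \<in> quot V W" for X
  proof -
    obtain u where u: "u \<in> V" "X = cls V W u" using X unfolding quot_eq by blast
    have le: "quot_norm N' (F X) \<le> C * N v" if v: "v \<in> X" for v
    proof -
      have vV: "v \<in> V" "cls V W v = X" using v u cls_eq_iff[OF W u(1)] by (auto simp: cls_mem_iff)
      then have "T v \<in> F X" using F[OF vV(1)] m'[OF TV[OF vV(1)]] by simp
      then have "quot_norm N' (F X) \<le> N' (T v)"
        unfolding quot_norm_def using nn(1) by (intro cINF_lower bdd_belowI[of _ 0]) auto
      also have "\<dots> \<le> C * N v" by (rule bd[OF vV(1)])
      finally show ?thesis .
    qed
    \<comment> \<open>For positive \<open>C\<close> the bound for each representative is divided by
      \<open>C\<close> to pass to the infimum; for \<open>C = 0\<close> a single representative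
      already gives the claim.\<close>
    show ?thesis
    proof (cases "C = 0")
      case True
      then show ?thesis using le[of u] m u by simp
    next
      case False
      then have "C > 0" using nn(3) by simp
      have "quot_norm N' (F X) / C \<le> quot_norm N X"
        unfolding quot_norm_def[of N]
      proof (rule cINF_greatest)
        show "X \<noteq> {}" using m u by blast
        show "quot_norm N' (F X) / C \<le> N v" if "v \<in> X" for v
          using le[OF that] \<open>C > 0\<close> by (simp add: divide_le_eq mult.commute)
      qed
      then show ?thesis using \<open>C > 0\<close> by (simp add: divide_le_eq mult.commute)
    qed
  qed
  then show "induces_bounded V W N V' W' N' T"
    unfolding induces_bounded_def using TV F lin by blast
qed

section \<open>Subspaces of forms and the norm of Omega\<close>

context rmfd
begin

lemma Lp_subspace: "0 \<le> p \<Longrightarrow> form_subspace (Lp_forms M k p)"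
  unfolding form_subspace_def using Lp_forms_zero Lp_forms_add Lp_forms_scale by blast

lemma null_subspace: "form_subspace (null_forms M k)"
  unfolding form_subspace_def
proof (intro conjI ballI allI)
  show "0 \<in> null_forms M k" by (simp add: null_forms_def measurable_form_zero)
  fix u assume u: "u \<in> null_forms M k"
  show "form_scale r u \<in> null_forms M k" for r
  proof -
    have "AE x in riem_vol M. u x = 0" using u by (simp add: null_forms_def)
    then have "AE x in riem_vol M. form_scale r u x = 0" by eventually_elim (simp add: form_scale_def fun_eq_iff)
    then show ?thesis using u by (simp add: null_forms_def measurable_form_scale)
  qed
  fix v assume v: "v \<in> null_forms M k"
  have "AE x in riem_vol M. u x = 0" "AE x in riem_vol M. v x = 0" using u v by (simp_all add: null_forms_def)
  then have "AE x in riem_vol M. (u + v) x = 0" by eventually_elim simp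
  then show "u + v \<in> null_forms M k" using u v by (simp add: null_forms_def measurable_form_add)
qed

lemma Z_subspace: "0 \<le> p \<Longrightarrow> form_subspace (Z_forms M k p)"
  unfolding form_subspace_def Z_forms_def
  using Lp_forms_zero Lp_forms_add Lp_forms_scale weak_d_zero weak_d_add[of k _ 0 _ 0] weak_d_scale[of k _ 0]
  by (auto simp: form_scale_zero)

lemma B_subspace:
  assumes "0 \<le> p" "0 \<le> q" shows "form_subspace (B_forms M k q p)"
  unfolding form_subspace_def
proof (intro conjI ballI allI)
  show "0 \<in> B_forms M k q p" using Lp_forms_zero weak_d_zero by (auto simp: B_forms_def)
  fix u assume "u \<in> B_forms M k q p"
  then obtain \<phi> where \<phi>: "u \<in> Lp_forms M k p" "\<phi> \<in> Lp_forms M (k - 1) q" "weak_d M (k - 1) \<phi> u" by (auto simp: B_forms_def)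
  show "form_scale r u \<in> B_forms M k q p" for r
    using Lp_forms_scale[OF \<phi>(1)] Lp_forms_scale[OF \<phi>(2)] weak_d_scale[OF \<phi>(3)] unfolding B_forms_def by blast
  fix v assume "v \<in> B_forms M k q p"
  then obtain \<psi> where \<psi>: "v \<in> Lp_forms M k p" "\<psi> \<in> Lp_forms M (k - 1) q" "weak_d M (k - 1) \<psi> v" by (auto simp: B_forms_def)
  show "u + v \<in> B_forms M k q p"
    using Lp_forms_add[OF \<phi>(1) \<psi>(1) assms(1)] Lp_forms_add[OF \<phi>(2) \<psi>(2) assms(2)] weak_d_add[OF \<phi>(3) \<psi>(3)]
    unfolding B_forms_def by blast
qed

lemma B_closure_subspace:
  assumes p: "1 \<le> p" "0 \<le> q" shows "form_subspace (B_closure M k q p)"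
proof -
  have B: "form_subspace (B_forms M k q p)" using p by (intro B_subspace) auto
  have BL: "\<beta> \<in> Lp_forms M k p" if "\<beta> \<in> B_forms M k q p" for \<beta> using that by (simp add: B_forms_def)
  have L: "form_subspace (Lp_forms M k p)" using p by (intro Lp_subspace) auto
  show ?thesis
    unfolding form_subspace_def
  proof (intro conjI ballI allI)
    show "0 \<in> B_closure M k q p"
      using form_subspace_zero[OF L] form_subspace_zero[OF B] p
      by (auto simp: B_closure_def Lp_norm_eq[OF measurable_form_zero] Lp_int_def intro!: bexI[of _ 0])
    fix u assume u: "u \<in> B_closure M k q p"
    show "form_scale r u \<in> B_closure M k q p" for r
      unfolding B_closure_def mem_Collect_eq
    proof (intro conjI allI impI)
      show "form_scale r u \<in> Lp_forms M k p" using u form_subspace_scale[OF L] by (simp add: B_closure_def)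
      fix \<epsilon> :: real assume "\<epsilon> > 0"
      \<comment> \<open>The summand 1 covers the factor \<open>r = 0\<close>.\<close>
      then have "\<epsilon> / (\<bar>r\<bar> + 1) > 0" by (simp add: add_nonneg_pos)
      then obtain \<beta> where \<beta>: "\<beta> \<in> B_forms M k q p" "Lp_norm M k p (u - \<beta>) < \<epsilon> / (\<bar>r\<bar> + 1)"
        using u unfolding B_closure_def by blast
      have "u \<in> Lp_forms M k p" using u by (simp add: B_closure_def)
      then have "u - \<beta> \<in> Lp_forms M k p" using BL[OF \<beta>(1)] by (rule form_subspace_diff[OF L])
      then have "Lp_norm M k p (form_scale r u - form_scale r \<beta>) = \<bar>r\<bar> * Lp_norm M k p (u - \<beta>)"
        using p unfolding form_scale_diff by (intro Lp_norm_scale) (auto simp: Lp_forms_iff)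
      also have "\<dots> \<le> (\<bar>r\<bar> + 1) * Lp_norm M k p (u - \<beta>)" using Lp_norm_nonneg by (intro mult_right_mono) auto
      also have "\<dots> < \<epsilon>" using \<beta>(2) by (simp add: less_divide_eq mult.commute add_nonneg_pos split: if_splits)
      finally show "\<exists>\<beta>\<in>B_forms M k q p. Lp_norm M k p (form_scale r u - \<beta>) < \<epsilon>"
        using form_subspace_scale[OF B \<beta>(1)] by blast
    qed
    fix v assume v: "v \<in> B_closure M k q p"
    show "u + v \<in> B_closure M k q p"
      unfolding B_closure_def mem_Collect_eq
    proof (intro conjI allI impI)
      have uv: "u \<in> Lp_forms M k p" "v \<in> Lp_forms M k p" using u v by (auto simp: B_closure_def)
      show "u + v \<in> Lp_forms M k p" by (rule form_subspace_add[OF L uv])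
      fix \<epsilon> :: real assume "\<epsilon> > 0"
      \<comment> \<open>Two errors below \<epsilon> / 8, multiplied by the factor 4 of
        \<open>Lp_norm_add\<close>, stay below \<epsilon>.\<close>
      then have e: "\<epsilon> / 8 > 0" by simp
      obtain \<beta> where \<beta>: "\<beta> \<in> B_forms M k q p" "Lp_norm M k p (u - \<beta>) < \<epsilon> / 8" using u e unfolding B_closure_def by blast
      obtain \<gamma> where \<gamma>: "\<gamma> \<in> B_forms M k q p" "Lp_norm M k p (v - \<gamma>) < \<epsilon> / 8" using v e unfolding B_closure_def by blast
      have "(u + v) - (\<beta> + \<gamma>) = (u - \<beta>) + (v - \<gamma>)" by (simp add: algebra_simps)
      then have "Lp_norm M k p ((u + v) - (\<beta> + \<gamma>)) \<le> 4 * (Lp_norm M k p (u - \<beta>) + Lp_norm M k p (v - \<gamma>))"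
        using Lp_norm_add[OF form_subspace_diff[OF L uv(1) BL[OF \<beta>(1)]] form_subspace_diff[OF L uv(2) BL[OF \<gamma>(1)]] p(1)]
        by (simp only:)
      also have "\<dots> < \<epsilon>" using \<beta>(2) \<gamma>(2) by simp
      finally show "\<exists>\<beta>\<in>B_forms M k q p. Lp_norm M k p (u + v - \<beta>) < \<epsilon>"
        using form_subspace_add[OF B \<beta>(1) \<gamma>(1)] by blast
    qed
  qed
qed

lemma Omega_subspace:
  assumes "0 \<le> p" "0 \<le> q" shows "form_subspace (Omega_forms M j q p)"
  unfolding form_subspace_def
proof (intro conjI ballI allI)
  show "0 \<in> Omega_forms M j q p" using Lp_forms_zero weak_d_zero by (auto simp: Omega_forms_def)
  fix u assume "u \<in> Omega_forms M j q p"
  then obtain \<phi> where \<phi>: "u \<in> Lp_forms M j q" "\<phi> \<in> Lp_forms M (Suc j) p" "weak_d M j u \<phi>" by (auto simp: Omega_forms_def)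
  show "form_scale r u \<in> Omega_forms M j q p" for r
    using Lp_forms_scale[OF \<phi>(1)] Lp_forms_scale[OF \<phi>(2)] weak_d_scale[OF \<phi>(3)] unfolding Omega_forms_def by blast
  fix v assume "v \<in> Omega_forms M j q p"
  then obtain \<psi> where \<psi>: "v \<in> Lp_forms M j q" "\<psi> \<in> Lp_forms M (Suc j) p" "weak_d M j v \<psi>" by (auto simp: Omega_forms_def)
  show "u + v \<in> Omega_forms M j q p"
    using Lp_forms_add[OF \<phi>(1) \<psi>(1) assms(2)] Lp_forms_add[OF \<phi>(2) \<psi>(2) assms(1)] weak_d_add[OF \<phi>(3) \<psi>(3)]
    unfolding Omega_forms_def by blast
qed

text \<open>\<open>Omega_norm\<close> uses a selected weak differential; by
  \<open>weak_d_unique\<close> it differs from \<theta> only on a null set, so any weak differential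
  may be used to compute the norm.\<close>

lemma Omega_norm_eq:
  assumes w: "weak_d M j \<omega> \<theta>" and j: "Suc j \<le> CARD('n)"
  shows "Omega_norm M j q p \<omega> = Lp_norm M j q \<omega> + Lp_norm M (Suc j) p \<theta>"
proof -
  define \<theta>' where "\<theta>' = (SOME \<theta>. weak_d M j \<omega> \<theta>)"
  have w': "weak_d M j \<omega> \<theta>'" unfolding \<theta>'_def by (rule someI[where P = "weak_d M j \<omega>", OF w])
  have "measurable_form M (Suc j) \<theta>'" "measurable_form M (Suc j) \<theta>"
    using w w' by (auto simp: weak_d_def L1loc_form_def)
  then have "Lp_norm M (Suc j) p \<theta>' = Lp_norm M (Suc j) p \<theta>"
    using weak_d_unique[OF w' w j] by (rule Lp_norm_cong_AE)
  then show ?thesis by (simp add: Omega_norm_def \<theta>'_def)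
qed

lemma Omega_norm_nonneg: "0 \<le> Omega_norm M j q p \<omega>"
  by (simp add: Omega_norm_def Lp_norm_nonneg)

end

lemma pullback_add: "pullback M N f (u + v) = pullback M N f u + pullback M N f v"
  by (intro ext) (simp add: pullback_def)

lemma pullback_scale: "pullback M N f (form_scale r u) = form_scale r (pullback M N f u)"
  by (intro ext) (simp add: pullback_def form_scale_def)

lemma pullback_diff: "pullback M N f (u - v) = pullback M N f u - pullback M N f v"
  by (intro ext) (simp add: pullback_def)

lemma pullback_zero: "pullback M N f 0 = 0"
  by (intro ext) (simp add: pullback_def)

context rmfd_pair
begin

lemma pullback_null:
  assumes f: "diffeo M N f" and \<theta>: "\<theta> \<in> null_forms N k" shows "pullback M N f \<theta> \<in> null_forms M k"
proof -
  have "AE z in riem_vol N. \<theta> z = 0" using \<theta> by (simp add: null_forms_def)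
  from AE_transform[OF f this] have "AE x in riem_vol M. pullback M N f \<theta> x = 0"
    by eventually_elim (simp add: pullback_alt fun_eq_iff)
  then show ?thesis using f \<theta> pullback_measurable by (simp add: null_forms_def diffeo_def)
qed

text \<open>Being closed means having weak differential 0, and 0 pulls back to 0, so this is an
  instance of naturality.\<close>

lemma pullback_Z:
  assumes f: "diffeo M N f" and p: "1 \<le> p" and \<theta>: "\<theta> \<in> Z_forms N k pt" and L: "pullback M N f \<theta> \<in> Lp_forms M k p"
  shows "pullback M N f \<theta> \<in> Z_forms M k p"
proof -
  have "weak_d M k (pullback M N f \<theta>) (pullback M N f 0)"
    using \<theta> M.Lp_imp_L1loc[OF L p] M.L1loc_form_zero by (intro weak_d_pullback[OF f]) (auto simp: Z_forms_def pullback_zero)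
  then show ?thesis using L by (simp add: Z_forms_def pullback_zero)
qed

end

section \<open>Assembly of (A), (B) and (C) from the bounds and naturality\<close>

theorem theorem6p1:
  fixes M :: "('a::{t2_space,second_countable_topology}, 'n::{finite,wellorder}) mfd"
    and N :: "('b::{t2_space,second_countable_topology}, 'n) mfd"
    and f :: "'a \<Rightarrow> 'b" and k :: nat and p pt :: real
  assumes "oriented_riemannian_mfd M" and "oriented_riemannian_mfd N"
    and "1 \<le> k" and "k \<le> CARD('n)"
    and "1 \<le> p" and "p \<le> pt"
    and "f \<in> BD M N k pt (if p = pt then \<infinity> else ereal (p / (pt - p)))"
  shows
    "(induces_bounded
        (Lp_forms N k pt) (null_forms N k) (Lp_norm N k pt)
        (Lp_forms M k p) (null_forms M k) (Lp_norm M k p) (pullback M N f) \<and>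
      pullback M N f ` Z_forms N k pt \<subseteq> Z_forms M k p)
   \<and>
     (\<forall>q qt :: real. 1 < qt \<longrightarrow> qt \<le> q \<longrightarrow>
        f \<in> BD M N (CARD('n) - k + 1) (qt / (qt - 1))
              (if q = qt then \<infinity> else ereal (q * (qt - 1) / (q - qt))) \<longrightarrow>
        (\<forall>\<omega>\<in>Z_forms N k pt.
           cohom_cls M k q p (pullback M N f \<omega>) = cohom_cls M k q p 0 \<longrightarrow>
           cohom_cls N k qt pt \<omega> = cohom_cls N k qt pt 0) \<and>
        (cohom M k q p = {cohom_cls M k q p 0} \<longrightarrow>
           cohom N k qt pt = {cohom_cls N k qt pt 0}))
   \<and>
     (\<forall>q qt :: real. 1 \<le> q \<longrightarrow> q \<le> qt \<longrightarrow>
        f \<in> BD M N (k - 1) qt (if q = qt then \<infinity> else ereal (q / (qt - q))) \<longrightarrow>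
        induces_bounded
          (Omega_forms N (k - 1) qt pt) (null_forms N (k - 1)) (Omega_norm N (k - 1) qt pt)
          (Omega_forms M (k - 1) q p) (null_forms M (k - 1)) (Omega_norm M (k - 1) q p)
          (pullback M N f) \<and>
        induces_linear
          (Z_forms N k pt) (B_forms N k qt pt)
          (Z_forms M k p) (B_forms M k q p) (pullback M N f) \<and>
        induces_bounded
          (Z_forms N k pt) (B_closure N k qt pt) (Lp_norm N k pt)
          (Z_forms M k p) (B_closure M k q p) (Lp_norm M k p) (pullback M N f))"
proof -
  interpret rmfd_pair M N using assms(1,2) by (simp add: rmfd_pair_def rmfd_def)
  interpret NM: rmfd_pair N M by unfold_locales
  \<comment> \<open>\<open>weak_d\<close> is indexed by the degree of the primitive, here
    \<open>k - 1\<close>; the third fact turns its \<open>Suc (k - 1)\<close> back into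
    \<open>k\<close>.\<close>
  have k: "1 \<le> k" "k \<le> CARD('n)" "Suc (k - 1) = k" and p: "1 \<le> p" "p \<le> pt" "1 \<le> pt" using assms by auto
  have df: "diffeo M N f" using assms(7) by (rule BD_diffeo)
  let ?T = "pullback M N f"
  obtain C where C: "0 \<le> C" "\<And>\<theta>. \<theta> \<in> Lp_forms N k pt \<Longrightarrow> ?T \<theta> \<in> Lp_forms M k p"
    "\<And>\<theta>. \<theta> \<in> Lp_forms N k pt \<Longrightarrow> Lp_norm M k p (?T \<theta>) \<le> C * Lp_norm N k pt \<theta>"
    using pullback_Lp[OF p(1,2) assms(7)] by blast
  have ZL: "\<theta> \<in> Lp_forms N k pt" if "\<theta> \<in> Z_forms N k pt" for \<theta> using that by (simp add: Z_forms_def)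
  have TZ: "?T \<theta> \<in> Z_forms M k p" if "\<theta> \<in> Z_forms N k pt" for \<theta>
    by (rule pullback_Z[OF df p(1) that C(2)[OF ZL[OF that]]])
  have A: "induces_bounded (Lp_forms N k pt) (null_forms N k) (Lp_norm N k pt)
        (Lp_forms M k p) (null_forms M k) (Lp_norm M k p) ?T"
    by (rule induces_linearI(2)[where C = C])
      (use p C pullback_null[OF df] in \<open>auto simp: pullback_add pullback_scale M.Lp_norm_nonneg N.Lp_norm_nonneg
        intro: M.Lp_subspace N.Lp_subspace M.null_subspace N.null_subspace\<close>)
  have B: "(\<forall>\<omega>\<in>Z_forms N k pt. cohom_cls M k q p (?T \<omega>) = cohom_cls M k q p 0 \<longrightarrow> cohom_cls N k qt pt \<omega> = cohom_cls N k qt pt 0) \<and>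
      (cohom M k q p = {cohom_cls M k q p 0} \<longrightarrow> cohom N k qt pt = {cohom_cls N k qt pt 0})"
    if q: "1 < qt" "qt \<le> q" and bd: "f \<in> BD M N (CARD('n) - k + 1) (qt / (qt - 1)) (if q = qt then \<infinity> else ereal (q * (qt - 1) / (q - qt)))"
    for q qt
  proof -
    have sM: "form_subspace (Z_forms M k p)" "form_subspace (B_forms M k q p)"
      and sN: "form_subspace (Z_forms N k pt)" "form_subspace (B_forms N k qt pt)"
      using p q by (auto intro!: M.Z_subspace N.Z_subspace M.B_subspace N.B_subspace)
    have first: "cohom_cls N k qt pt \<omega> = cohom_cls N k qt pt 0"
      if \<omega>: "\<omega> \<in> Z_forms N k pt" and eq: "cohom_cls M k q p (?T \<omega>) = cohom_cls M k q p 0" for \<omega>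
    proof -
      have "?T \<omega> - 0 \<in> B_forms M k q p"
        using eq cls_eq_iff[OF sM(2) TZ[OF \<omega>] form_subspace_zero[OF sM(1)]] by (simp add: cohom_cls_def)
      then obtain \<phi> where \<phi>: "\<phi> \<in> Lp_forms M (k - 1) q" "weak_d M (k - 1) \<phi> (?T \<omega>)" by (auto simp: B_forms_def)
      \<comment> \<open>\<phi> is a primitive of \<open>?T \<omega>\<close>, whose pullback by the
        inverse is \<omega> itself. Since \<omega> already lies in the required space, only the
        primitive has to be estimated under the inverse map.\<close>
      let ?\<psi> = "pullback N M (inv f) \<phi>"
      have \<psi>: "?\<psi> \<in> Lp_forms N (k - 1) qt" by (rule pullback_inv_Lp[OF q k(1,2) bd \<phi>(1)])
      have inv: "pullback N M (inv f) (?T \<omega>) = \<omega>" by (rule pullback_inv[OF df])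
      have "weak_d N (k - 1) ?\<psi> (pullback N M (inv f) (?T \<omega>))"
      proof (rule NM.weak_d_pullback[OF diffeo_inv[OF df] \<phi>(2)])
        show "L1loc_form N (k - 1) ?\<psi>" using N.Lp_imp_L1loc[OF \<psi>] q by simp
        show "L1loc_form N (Suc (k - 1)) (pullback N M (inv f) (?T \<omega>))"
          unfolding inv k(3) using N.Lp_imp_L1loc[OF ZL[OF \<omega>] p(3)] .
      qed
      then have "\<omega> - 0 \<in> B_forms N k qt pt" using \<psi> ZL[OF \<omega>] unfolding inv by (auto simp: B_forms_def)
      then show ?thesis
        using cls_eq_iff[OF sN(2) \<omega> form_subspace_zero[OF sN(1)]] by (simp add: cohom_cls_def)
    qed
    moreover have "cohom N k qt pt = {cohom_cls N k qt pt 0}" if z: "cohom M k q p = {cohom_cls M k q p 0}"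
    proof -
      have c: "cohom_cls N k qt pt \<omega> = cohom_cls N k qt pt 0" if \<omega>: "\<omega> \<in> Z_forms N k pt" for \<omega>
      proof (rule first[OF \<omega>])
        have "cohom_cls M k q p (?T \<omega>) \<in> cohom M k q p" using TZ[OF \<omega>] by (simp add: cohom_def quot_eq cohom_cls_def)
        then show "cohom_cls M k q p (?T \<omega>) = cohom_cls M k q p 0" unfolding z by simp
      qed
      have "cohom N k qt pt = cohom_cls N k qt pt ` Z_forms N k pt" by (simp add: cohom_def quot_eq cohom_cls_def)
      also have "\<dots> = (\<lambda>_. cohom_cls N k qt pt 0) ` Z_forms N k pt" by (rule image_cong[OF refl c])
      also have "\<dots> = {cohom_cls N k qt pt 0}" using form_subspace_zero[OF sN(1)] by blast
      finally show ?thesis .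
    qed
    ultimately show ?thesis by blast
  qed
  have Cc: "induces_bounded (Omega_forms N (k - 1) qt pt) (null_forms N (k - 1)) (Omega_norm N (k - 1) qt pt)
          (Omega_forms M (k - 1) q p) (null_forms M (k - 1)) (Omega_norm M (k - 1) q p) ?T \<and>
      induces_linear (Z_forms N k pt) (B_forms N k qt pt) (Z_forms M k p) (B_forms M k q p) ?T \<and>
      induces_bounded (Z_forms N k pt) (B_closure N k qt pt) (Lp_norm N k pt) (Z_forms M k p) (B_closure M k q p) (Lp_norm M k p) ?T"
    if q: "1 \<le> q" "q \<le> qt" and bd: "f \<in> BD M N (k - 1) qt (if q = qt then \<infinity> else ereal (q / (qt - q)))" for q qt
  proof -
    obtain D where D: "0 \<le> D" "\<And>\<theta>. \<theta> \<in> Lp_forms N (k - 1) qt \<Longrightarrow> ?T \<theta> \<in> Lp_forms M (k - 1) q"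
      "\<And>\<theta>. \<theta> \<in> Lp_forms N (k - 1) qt \<Longrightarrow> Lp_norm M (k - 1) q (?T \<theta>) \<le> D * Lp_norm N (k - 1) qt \<theta>"
      using pullback_Lp[OF q bd] by blast
    have pw: "weak_d M (k - 1) (?T \<phi>) (?T \<theta>)"
      if "weak_d N (k - 1) \<phi> \<theta>" "\<phi> \<in> Lp_forms N (k - 1) qt" "\<theta> \<in> Lp_forms N k pt" for \<phi> \<theta>
    proof (rule weak_d_pullback[OF df that(1)])
      show "L1loc_form M (k - 1) (?T \<phi>)" by (rule M.Lp_imp_L1loc[OF D(2)[OF that(2)] q(1)])
      show "L1loc_form M (Suc (k - 1)) (?T \<theta>)" unfolding k(3) by (rule M.Lp_imp_L1loc[OF C(2)[OF that(3)] p(1)])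
    qed
    have TB: "?T \<theta> \<in> B_forms M k q p" if "\<theta> \<in> B_forms N k qt pt" for \<theta>
      using that pw C(2) D(2) unfolding B_forms_def by blast
    \<comment> \<open>A bounded linear map that sends \<open>B_forms\<close> into
      \<open>B_forms\<close> sends closures into closures. As \<open>C\<close> may be 0, \<epsilon>
      is divided by \<open>C + 1\<close>.\<close>
    have TBc: "?T \<theta> \<in> B_closure M k q p" if \<theta>: "\<theta> \<in> B_closure N k qt pt" for \<theta>
      unfolding B_closure_def mem_Collect_eq
    proof (intro conjI allI impI)
      have \<theta>L: "\<theta> \<in> Lp_forms N k pt" using \<theta> by (simp add: B_closure_def)
      show "?T \<theta> \<in> Lp_forms M k p" by (rule C(2)[OF \<theta>L])
      fix \<epsilon> :: real assume "\<epsilon> > 0"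
      then have "\<epsilon> / (C + 1) > 0" using C(1) by simp
      then obtain \<beta> where \<beta>: "\<beta> \<in> B_forms N k qt pt" "Lp_norm N k pt (\<theta> - \<beta>) < \<epsilon> / (C + 1)"
        using \<theta> unfolding B_closure_def by blast
      have "\<theta> - \<beta> \<in> Lp_forms N k pt"
        using \<beta>(1) p by (intro form_subspace_diff[OF N.Lp_subspace \<theta>L]) (auto simp: B_forms_def)
      then have "Lp_norm M k p (?T \<theta> - ?T \<beta>) \<le> C * Lp_norm N k pt (\<theta> - \<beta>)"
        using C(3) by (metis pullback_diff)
      also have "\<dots> \<le> (C + 1) * Lp_norm N k pt (\<theta> - \<beta>)" using N.Lp_norm_nonneg by (intro mult_right_mono) auto
      also have "\<dots> < \<epsilon>" using \<beta>(2) C(1) by (simp add: less_divide_eq mult.commute split: if_splits)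
      finally show "\<exists>\<beta>\<in>B_forms M k q p. Lp_norm M k p (?T \<theta> - \<beta>) < \<epsilon>" using TB[OF \<beta>(1)] by blast
    qed
    \<comment> \<open>The pullback of a weak differential is a weak differential of the pullback, so
      the two summands of the norm are bounded separately, by \<open>D\<close> and by
      \<open>C\<close>.\<close>
    have \<Omega>: "?T \<omega> \<in> Omega_forms M (k - 1) q p \<and> Omega_norm M (k - 1) q p (?T \<omega>) \<le> max C D * Omega_norm N (k - 1) qt pt \<omega>"
      if \<omega>: "\<omega> \<in> Omega_forms N (k - 1) qt pt" for \<omega>
    proof -
      obtain \<theta> where \<theta>: "\<omega> \<in> Lp_forms N (k - 1) qt" "\<theta> \<in> Lp_forms N k pt" "weak_d N (k - 1) \<omega> \<theta>"
        using \<omega> k(3) by (auto simp: Omega_forms_def)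
      note w = pw[OF \<theta>(3,1,2)]
      have j: "Suc (k - 1) \<le> CARD('n)" using k by simp
      have "Omega_norm M (k - 1) q p (?T \<omega>) = Lp_norm M (k - 1) q (?T \<omega>) + Lp_norm M k p (?T \<theta>)"
        using M.Omega_norm_eq[OF w j] k(3) by simp
      also have "\<dots> \<le> D * Lp_norm N (k - 1) qt \<omega> + C * Lp_norm N k pt \<theta>"
        by (intro add_mono D(3) C(3) \<theta>)
      also have "\<dots> \<le> max C D * Lp_norm N (k - 1) qt \<omega> + max C D * Lp_norm N k pt \<theta>"
        by (intro add_mono mult_right_mono N.Lp_norm_nonneg) auto
      also have "\<dots> = max C D * Omega_norm N (k - 1) qt pt \<omega>"
        using N.Omega_norm_eq[OF \<theta>(3) j] k(3) by (simp add: distrib_left)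
      finally show ?thesis using D(2)[OF \<theta>(1)] C(2)[OF \<theta>(2)] w k(3) by (auto simp: Omega_forms_def)
    qed
    have s: "form_subspace (Omega_forms N (k - 1) qt pt)" "form_subspace (Omega_forms M (k - 1) q p)"
      "form_subspace (Z_forms N k pt)" "form_subspace (Z_forms M k p)"
      "form_subspace (B_forms N k qt pt)" "form_subspace (B_forms M k q p)"
      "form_subspace (B_closure N k qt pt)" "form_subspace (B_closure M k q p)"
      using p q by (auto intro!: M.Z_subspace N.Z_subspace M.B_subspace N.B_subspace M.Omega_subspace N.Omega_subspace
          M.B_closure_subspace N.B_closure_subspace)
    have 1: "induces_bounded (Omega_forms N (k - 1) qt pt) (null_forms N (k - 1)) (Omega_norm N (k - 1) qt pt)
          (Omega_forms M (k - 1) q p) (null_forms M (k - 1)) (Omega_norm M (k - 1) q p) ?T"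
      by (rule induces_linearI(2)[OF s(1) N.null_subspace s(2) M.null_subspace pullback_add pullback_scale, where C = "max C D"])
        (use \<Omega> C(1) pullback_null[OF df] in \<open>auto simp: M.Omega_norm_nonneg N.Omega_norm_nonneg\<close>)
    have 2: "induces_linear (Z_forms N k pt) (B_forms N k qt pt) (Z_forms M k p) (B_forms M k q p) ?T"
      by (rule induces_linearI(1)[OF s(3,5,4,6) pullback_add pullback_scale TZ TB])
    have 3: "induces_bounded (Z_forms N k pt) (B_closure N k qt pt) (Lp_norm N k pt) (Z_forms M k p) (B_closure M k q p) (Lp_norm M k p) ?T"
      by (rule induces_linearI(2)[OF s(3,7,4,8) pullback_add pullback_scale TZ TBc, where C = C])
        (use C ZL in \<open>auto simp: M.Lp_norm_nonneg N.Lp_norm_nonneg\<close>)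
    show ?thesis using 1 2 3 by blast
  qed
  show ?thesis using A TZ B Cc by (intro conjI allI impI image_subsetI) blast+
qed

end
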